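(* Let $d\ge 1$, $p>1$ and $s\in(0,1)$. Suppose that $f:\mathbb{R}\to\mathbb{R}$ satisfies $f(0)=0$ and $$|f(u)-f(v)|\le C|u-v|\left(e^{\lambda|u|^p}+e^{\lambda|v|^p}\right)\quad\text{for all } u,v\in\mathbb{R},$$ for some constants $C>0$ and $\lambda>0$. Then, for any initial data $u_0\in \exp L^p_0(\mathbb{R}^d)$, there exists a time $T=T(u_0)>0$ such that the Cauchy problem $$\partial_t u+\mathcal{L}u=f(u)\ \ (t>0,\ x\in\mathbb{R}^d),\qquad u(0,x)=u_0(x)\ \ (x\in\mathbb{R}^d)$$ admits a unique mild solution $u\in C([0,T],\exp L^p_0(\mathbb{R}^d))$.
   Context: For $s\in(0,1)$, $\mathcal{L}=-\Delta+(-\Delta)^s$ on $\mathbb{R}^d$, where $(-\Delta)^s v(x)=C_{d,s}\,\mathrm{P.V.}\int_{\mathbb{R}^d}\frac{v(x)-v(y)}{|x-y|^{d+2s}}\,dy$ with $C_{d,s}=\frac{s4^s\Gamma((d+2s)/2)}{\pi^{d/2}\Gamma(1-s)}$. The heat semigroup of $\mathcal{L}$ is $e^{-t\mathcal{L}}\varphi(x)=\int_{\mathbb{R}^d}P_t^s(x-y)\varphi(y)\,dy$ for $t>0$ (and the identity for $t=0$), where $P_t^s(x)=(4\pi t)^{-d/2}\int_{\mathbb{R}^d}e^{-|x-\xi|^2/(4t)}H_t^s(\xi)\,d\xi$ and $H^s_t$ is the heat kernel of $-(-\Delta)^s$ (i.e. the convolution kernel of $e^{-t(-\Delta)^s}$).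 For $1\le p<\infty$, $\exp L^p(\mathbb{R}^d)$ is the space of $u\in L^1_{\mathrm{loc}}(\mathbb{R}^d)$ with $\int_{\mathbb{R}^d}\left(\exp(|u(x)|^p/\mu^p)-1\right)dx<\infty$ for some $\mu>0$, a Banach space under the Luxemburg norm $\|u\|_{\exp L^p}=\inf\{\mu>0:\int_{\mathbb{R}^d}(\exp(|u(x)|^p/\mu^p)-1)\,dx\le 1\}$. The space $\exp L^p_0(\mathbb{R}^d)$ is the closure of $C_0^\infty(\mathbb{R}^d)$ (smooth compactly supported functions) in $\exp L^p(\mathbb{R}^d)$, with the same norm. Mild solution: for $u_0\in\exp L^p_0(\mathbb{R}^d)$ and $T>0$, a function $u\in C([0,T],\exp L^p_0(\mathbb{R}^d))$ is a mild solution of the Cauchy problem if $u(t)=e^{-t\mathcal{L}}u_0+\int_0^t e^{-(t-\tau)\mathcal{L}}f(u(\tau))\,d\tau$ for all $t\in[0,T]$. *)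

theory Defs
  imports "HOL-Analysis.Analysis"
begin

text \<open>
  The space \<open>\<real>\<^sup>d\<close> is an arbitrary type \<open>'a :: euclidean_space\<close> with \<open>d = DIM('a)\<close>; every such
  type has \<open>d \<ge> 1\<close>.  Elements of function spaces are Borel measurable representatives, and
  equality in these spaces is equality almost everywhere with respect to \<open>lborel\<close>.
\<close>

section \<open>The fractional Laplacian and the heat kernels\<close>

definition frac_const :: "nat \<Rightarrow> real \<Rightarrow> real" where
  "frac_const d s =
     s * 4 powr s * Gamma ((real d + 2 * s) / 2) / (pi powr (real d / 2) * Gamma (1 - s))"

text \<open>The limit as \<open>\<epsilon>\<close> tends to 0 from the right is the principal value.\<close>

definition frac_laplacian :: "real \<Rightarrow> ('a::euclidean_space \<Rightarrow> complex) \<Rightarrow> 'a \<Rightarrow> complex" where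
  "frac_laplacian s v x =
     frac_const DIM('a) s *\<^sub>R
       Lim (at_right 0)
         (\<lambda>\<epsilon>. LINT y:{y. \<epsilon> < norm (x - y)}|lborel.
                 (v x - v y) /\<^sub>R (norm (x - y) powr (real DIM('a) + 2 * s)))"

text \<open>
  The operator \<^term>\<open>frac_laplacian s\<close> commutes with translations, so the plane wave
  \<open>x \<mapsto> exp (\<i> \<xi>\<cdot>x)\<close> is an eigenfunction.  Its eigenvalue is the value of the image at
  \<open>x = 0\<close>, where the plane wave equals 1.  This eigenvalue is the Fourier symbol of the operator
  (it equals \<open>|\<xi>| powr (2 * s)\<close>).
\<close>

definition frac_symbol :: "real \<Rightarrow> 'a::euclidean_space \<Rightarrow> complex" where
  "frac_symbol s \<xi> = frac_laplacian s (\<lambda>x. cis (\<xi> \<bullet> x)) 0"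

text \<open>
  The semigroup generated by \<open>- frac_laplacian s\<close> multiplies the Fourier transform by
  \<open>exp (- t * frac_symbol s \<xi>)\<close>; its convolution kernel is the inverse Fourier transform of this
  multiplier.  The kernel is real valued, so taking the real part only changes the type.
\<close>

definition frac_heat_kernel :: "real \<Rightarrow> real \<Rightarrow> 'a::euclidean_space \<Rightarrow> real" where
  "frac_heat_kernel s t x =
     Re (LINT \<xi>|lborel. cis (x \<bullet> \<xi>) * exp (- (of_real t * frac_symbol s \<xi>)))
       / (2 * pi) ^ DIM('a)"

definition mixed_heat_kernel :: "real \<Rightarrow> real \<Rightarrow> 'a::euclidean_space \<Rightarrow> real" where
  "mixed_heat_kernel s t x =
     (4 * pi * t) powr (- (real DIM('a) / 2)) *
       (LINT \<xi>|lborel. exp (- ((norm (x - \<xi>))\<^sup>2 / (4 * t))) * frac_heat_kernel s t \<xi>)"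

definition mixed_semigroup ::
    "real \<Rightarrow> real \<Rightarrow> ('a::euclidean_space \<Rightarrow> real) \<Rightarrow> 'a \<Rightarrow> real" where
  "mixed_semigroup s t \<phi> x =
     (if t = 0 then \<phi> x else LINT y|lborel. mixed_heat_kernel s t (x - y) * \<phi> y)"

section \<open>Orlicz spaces of exponential type\<close>

definition exp_modular :: "real \<Rightarrow> real \<Rightarrow> ('a::euclidean_space \<Rightarrow> real) \<Rightarrow> ennreal" where
  "exp_modular p \<mu> u =
     (\<integral>\<^sup>+ x. ennreal (exp (\<bar>u x\<bar> powr p / \<mu> powr p) - 1) \<partial>lborel)"

definition L1_loc :: "('a::euclidean_space \<Rightarrow> real) set" where
  "L1_loc = {u \<in> borel_measurable lborel. \<forall>K. compact K \<longrightarrow> set_integrable lborel K u}"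

definition expL :: "real \<Rightarrow> ('a::euclidean_space \<Rightarrow> real) set" where
  "expL p = {u \<in> L1_loc. \<exists>\<mu>>0. exp_modular p \<mu> u < \<infinity>}"

definition expL_norm :: "real \<Rightarrow> ('a::euclidean_space \<Rightarrow> real) \<Rightarrow> real" where
  "expL_norm p u = Inf {\<mu>. \<mu> > 0 \<and> exp_modular p \<mu> u \<le> 1}"

primrec Ck :: "nat \<Rightarrow> ('a::euclidean_space \<Rightarrow> real) \<Rightarrow> bool" where
  "Ck 0 g \<longleftrightarrow> continuous_on UNIV g"
| "Ck (Suc k) g \<longleftrightarrow>
     (\<forall>x. g differentiable (at x)) \<and>
     (\<forall>b\<in>Basis. Ck k (\<lambda>x. frechet_derivative g (at x) b))"

definition test_functions :: "('a::euclidean_space \<Rightarrow> real) set" where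
  "test_functions = {\<phi>. (\<forall>k. Ck k \<phi>) \<and> compact (closure {x. \<phi> x \<noteq> 0})}"

definition expL0 :: "real \<Rightarrow> ('a::euclidean_space \<Rightarrow> real) set" where
  "expL0 p =
     {u \<in> expL p. \<forall>\<epsilon>>0. \<exists>\<phi>\<in>test_functions. expL_norm p (\<lambda>x. u x - \<phi> x) < \<epsilon>}"

section \<open>Mild solutions\<close>

definition continuous_into_expL0 ::
    "real \<Rightarrow> real \<Rightarrow> (real \<Rightarrow> 'a::euclidean_space \<Rightarrow> real) \<Rightarrow> bool" where
  "continuous_into_expL0 p T u \<longleftrightarrow>
     (\<forall>t\<in>{0..T}. u t \<in> expL0 p) \<and>
     (\<forall>t\<in>{0..T}. ((\<lambda>r. expL_norm p (\<lambda>x. u r x - u t x)) \<longlongrightarrow> 0) (at t within {0..T}))"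

text \<open>
  The Duhamel integral is taken as a Lebesgue integral in time for almost every \<open>x\<close>; the
  integrability of its integrand is stated explicitly because the integral of a non-integrable
  function is 0 by convention.
\<close>

definition mild_solution ::
    "real \<Rightarrow> real \<Rightarrow> (real \<Rightarrow> real) \<Rightarrow> ('a::euclidean_space \<Rightarrow> real) \<Rightarrow> real
      \<Rightarrow> (real \<Rightarrow> 'a \<Rightarrow> real) \<Rightarrow> bool" where
  "mild_solution p s f u\<^sub>0 T u \<longleftrightarrow>
     continuous_into_expL0 p T u \<and>
     (\<forall>t\<in>{0..T}. AE x in lborel.
        set_integrable lborel {0..t} (\<lambda>\<tau>. mixed_semigroup s (t - \<tau>) (\<lambda>y. f (u \<tau> y)) x) \<and>
        u t x = mixed_semigroup s t u\<^sub>0 x +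
          (LINT \<tau>:{0..t}|lborel. mixed_semigroup s (t - \<tau>) (\<lambda>y. f (u \<tau> y)) x))"

end

theory Submission
  imports Defs "HOL-Probability.Probability"
begin

text \<open>
  Split the initial datum as a test function plus a remainder that is small in \<open>exp L\<^sup>p\<close>.  Near a
  bounded function the map \<open>u \<mapsto> f(u)\<close> is Lipschitz from \<open>exp L\<^sup>p\<close> to \<open>L\<^sup>p \<inter> L\<^sup>q\<close> for a large \<open>q\<close>,
  because the exponential weight of the small remainder is integrable to a high power.  The heat
  kernel is a probability density bounded by the Gaussian value \<open>(4 \<pi> t) powr (- d / 2)\<close>, so the
  semigroup contracts \<open>L\<^sup>p\<close> and maps \<open>L\<^sup>q\<close> to \<open>L\<^sup>\<infinity>\<close> with norm \<open>t powr (- d / (2 q))\<close>, which is integrable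
  at \<open>0\<close> for \<open>q > d / 2\<close>.  Since \<open>L\<^sup>p \<inter> L\<^sup>\<infinity>\<close> embeds into \<open>exp L\<^sup>p\<close>, the Duhamel map is a contraction for
  short times.  Uniqueness follows by applying the same estimate at the last time up to which two
  solutions agree; the semigroup law is never needed.

  Nonnegativity of the kernel comes from truncating the singular integral near the origin: the
  truncated multiplier is, up to a positive constant, the exponential of the Fourier transform of a
  finite measure, and each power of that transform against a Gaussian is a convolution of positive
  objects.
\<close>

section \<open>Gaussian Fourier integrals\<close>

text \<open>The obstacle is that \<open>exp (lam * \<bar>u\<bar> powr p)\<close> minus 1 has
  integrable high powers only if \<open>u\<close> is small in the Luxemburg norm. The splitting
  repairs this because the bounded part costs the exponential no more than a constant factor. The
  admissible radius \<open>\<eta>\<close> depends on \<open>p\<close>, \<open>lam\<close> and the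
  dimension alone; only the Lipschitz constant sees the bounded part. Hence uniqueness can pick a
  fresh test function at any later time and keep the same radius.

  Two Lebesgue exponents occur because the Young function behaves like a \<open>p\<close>-th power
  where a function is small and is controlled by the sup norm where it is large.

  The contraction estimate bounds differences of Picard iterates in the sup norm as well. They
  therefore converge at every point, and Fatou's lemma carries the Luxemburg bounds over to the
  limit.

  Time regularity of the Duhamel integral comes from translating the integration variable, which
  moves the increment from the semigroup onto the source. In the uniqueness proof the sources cancel
  before the time of agreement, so the difference of two solutions is a Duhamel integral that starts
  there.\<close>

lemma lborel_prod_Basis:
  fixes f :: "'a::euclidean_space \<Rightarrow> real \<Rightarrow> complex"
  assumes f: "\<And>b. b \<in> Basis \<Longrightarrow> integrable lborel (f b)"
  shows "integrable lborel (\<lambda>x::'a. \<Prod>b\<in>Basis. f b (x \<bullet> b))"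
    and "(LINT x|lborel. (\<Prod>b\<in>Basis. f b (x \<bullet> b))) = (\<Prod>b\<in>Basis. LINT y|lborel. f b y)"
proof -
  interpret product_sigma_finite "\<lambda>b::'a. (lborel :: real measure)" ..
  have m [measurable]: "\<And>b. b \<in> Basis \<Longrightarrow> f b \<in> borel_measurable borel"
    using borel_measurable_integrable[OF f] by simp
  have eq: "(\<Prod>b\<in>Basis. f b ((\<Sum>c\<in>Basis. y c *\<^sub>R c) \<bullet> b)) = (\<Prod>b\<in>Basis. f b (y b))" for y :: "'a \<Rightarrow> real"
    by (intro prod.cong) auto
  have M: "(\<lambda>f. \<Sum>b\<in>Basis. f b *\<^sub>R b) \<in> (\<Pi>\<^sub>M b\<in>Basis. lborel) \<rightarrow>\<^sub>M (borel :: 'a measure)"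
    by measurable
  have B: "(\<lambda>x::'a. \<Prod>b\<in>Basis. f b (x \<bullet> b)) \<in> borel_measurable borel"
    by measurable
  \<comment> \<open>By definition Lebesgue measure is the image of a product of interval measures;
    \<open>lborel_eq_real\<close> identifies each factor with \<open>lborel\<close> on the
    line.\<close>
  have L: "(lborel :: 'a measure) = distr (\<Pi>\<^sub>M b\<in>Basis. lborel) borel (\<lambda>f. \<Sum>b\<in>Basis. f b *\<^sub>R b)"
    by (subst lborel_def) (simp add: lborel_eq_real)
  show "integrable lborel (\<lambda>x::'a. \<Prod>b\<in>Basis. f b (x \<bullet> b))"
    unfolding L integrable_distr_eq[OF M B] eq
    by (rule product_integrable_prod) (use f in auto)
  show "(LINT x|lborel. (\<Prod>b\<in>Basis. f b (x \<bullet> b))) = (\<Prod>b\<in>Basis. LINT y|lborel. f b y)"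
    unfolding L integral_distr[OF M B] eq
    by (rule product_integral_prod) (use f in auto)
qed

text \<open>Read off from the characteristic function of the standard normal law: with
  \<open>c = sqrt (2 * t)\<close> the substitution \<open>y = c * \<xi>\<close> turns the density
  into \<open>exp (- (t * \<xi>\<^sup>2))\<close> and the frequency \<open>x / c\<close> into
  \<open>x\<close>.\<close>

lemma gaussian_fourier_real:
  fixes x t :: real
  assumes t: "t > 0"
  shows "integrable lborel (\<lambda>\<xi>. cis (x * \<xi>) * exp (- (t * \<xi>\<^sup>2)))"
    and "(LINT \<xi>|lborel. cis (x * \<xi>) * exp (- (t * \<xi>\<^sup>2))) = sqrt (pi / t) * exp (- (x\<^sup>2 / (4 * t)))"
proof -
  define c where "c = sqrt (2 * t)"
  have c: "c > 0" "c\<^sup>2 = 2 * t" using t by (auto simp: c_def)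
  define g where "g = (\<lambda>y. std_normal_density y *\<^sub>R iexp (x / c * y))"
  have "complex_integrable std_normal_distribution (\<lambda>y. iexp (x / c * y))"
    using prob_space.prob_space[OF prob_space_normal_density, of 1 0]
    by (intro finite_measure.integrable_const_bound[where B=1])
      (auto intro!: prob_space.finite_measure prob_space_normal_density)
  then have g: "integrable lborel g"
    unfolding g_def by (subst (asm) integrable_density) auto
  have "(LINT y|lborel. g y) = char std_normal_distribution (x / c)"
    unfolding char_def g_def by (subst integral_density) auto
  also have "\<dots> = exp (- (x\<^sup>2 / (4 * t)))"
    unfolding char_std_normal_distribution by (simp add: power_divide c)
  finally have gi: "(LINT y|lborel. g y) = exp (- (x\<^sup>2 / (4 * t)))" .
  have eq: "g (0 + c * \<xi>) = (1 / sqrt (2 * pi)) *\<^sub>R (cis (x * \<xi>) * exp (- (t * \<xi>\<^sup>2)))" for \<xi>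
    using c(1) unfolding g_def std_normal_density_def
    by (simp add: cis_conv_exp power_mult_distrib c(2) scaleR_conv_of_real mult_ac)
  have "integrable lborel (\<lambda>\<xi>. sqrt (2 * pi) *\<^sub>R g (0 + c * \<xi>))"
    using lborel_integrable_real_affine[OF g, of c 0] c(1)
    by (intro integrable_scaleR_right) auto
  then show I: "integrable lborel (\<lambda>\<xi>. cis (x * \<xi>) * exp (- (t * \<xi>\<^sup>2)))"
    unfolding eq by simp
  have "(LINT y|lborel. g y) = c *\<^sub>R (LINT \<xi>|lborel. g (0 + c * \<xi>))"
    using lborel_integral_real_affine[of c g 0] c(1) by simp
  also have "\<dots> = c *\<^sub>R (1 / sqrt (2 * pi)) *\<^sub>R (LINT \<xi>|lborel. cis (x * \<xi>) * exp (- (t * \<xi>\<^sup>2)))"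
    unfolding eq by simp
  finally have "(LINT \<xi>|lborel. cis (x * \<xi>) * exp (- (t * \<xi>\<^sup>2))) = (sqrt (2 * pi) / c) *\<^sub>R (LINT y|lborel. g y)"
    using c(1) by simp
  also have "sqrt (2 * pi) / c = sqrt (pi / t)"
    unfolding c_def using t by (simp add: real_sqrt_divide[symmetric])
  finally show "(LINT \<xi>|lborel. cis (x * \<xi>) * exp (- (t * \<xi>\<^sup>2))) = sqrt (pi / t) * exp (- (x\<^sup>2 / (4 * t)))"
    unfolding gi by (simp add: scaleR_conv_of_real)
qed

text \<open>Plane wave and Gaussian both factor over the coordinates, so the integral is a product
  of one-dimensional ones.\<close>

lemma gaussian_fourier:
  fixes x :: "'a::euclidean_space" and t :: real
  assumes t: "t > 0"
  shows "integrable lborel (\<lambda>\<xi>. cis (x \<bullet> \<xi>) * exp (- (t * (norm \<xi>)\<^sup>2)))"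
    and "(LINT \<xi>|lborel. cis (x \<bullet> \<xi>) * exp (- (t * (norm \<xi>)\<^sup>2))) =
      sqrt (pi / t) ^ DIM('a) * exp (- ((norm x)\<^sup>2 / (4 * t)))"
proof -
  have cis_sum: "cis (sum h A) = (\<Prod>a\<in>A. cis (h a))" if "finite A" for h and A :: "'a set"
    using that by (induction A) (auto simp: cis_mult[symmetric])
  have nrm: "(norm z)\<^sup>2 = (\<Sum>b\<in>Basis. (z \<bullet> b)\<^sup>2)" for z :: 'a
    by (subst power2_norm_eq_inner, subst euclidean_inner) (simp add: power2_eq_square)
  have eq: "cis (x \<bullet> \<xi>) * exp (- (t * (norm \<xi>)\<^sup>2)) =
      (\<Prod>b\<in>Basis. cis ((x \<bullet> b) * (\<xi> \<bullet> b)) * exp (- (t * (\<xi> \<bullet> b)\<^sup>2)))" for \<xi>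
    unfolding prod.distrib nrm
    by (subst euclidean_inner)
      (simp add: cis_sum exp_sum[symmetric] sum_distrib_left sum_negf of_real_prod[symmetric] del: of_real_prod)
  note I = lborel_prod_Basis[where f="\<lambda>b y. cis ((x \<bullet> b) * y) * exp (- (t * y\<^sup>2))", OF gaussian_fourier_real(1)[OF t]]
  show "integrable lborel (\<lambda>\<xi>. cis (x \<bullet> \<xi>) * exp (- (t * (norm \<xi>)\<^sup>2)))"
    unfolding eq using I(1) by simp
  show "(LINT \<xi>|lborel. cis (x \<bullet> \<xi>) * exp (- (t * (norm \<xi>)\<^sup>2))) =
      sqrt (pi / t) ^ DIM('a) * exp (- ((norm x)\<^sup>2 / (4 * t)))"
    unfolding eq I(2) gaussian_fourier_real(2)[OF t]
    by (simp add: prod.distrib of_real_prod[symmetric] exp_sum[symmetric] nrm sum_divide_distrib sum_negf del: of_real_prod)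
qed

section \<open>The symbol of the fractional Laplacian\<close>

lemma lborel_nn_integral_affine:
  fixes t :: "'a::euclidean_space"
  assumes "c \<noteq> 0" and [measurable]: "f \<in> borel_measurable borel"
  shows "nn_integral lborel f = ennreal (\<bar>c\<bar> ^ DIM('a)) * (\<integral>\<^sup>+x. f (t + c *\<^sub>R x) \<partial>lborel)"
  by (subst lborel_affine[OF assms(1), of t])
    (simp add: nn_integral_density nn_integral_distr nn_integral_cmult)

lemma lborel_integral_affine:
  fixes t :: "'a::euclidean_space" and f :: "'a \<Rightarrow> 'b::{banach, second_countable_topology}"
  assumes "c \<noteq> 0" and [measurable]: "f \<in> borel_measurable borel"
  shows "integral\<^sup>L lborel f = (\<bar>c\<bar> ^ DIM('a)) *\<^sub>R (LINT x|lborel. f (t + c *\<^sub>R x))"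
  by (subst lborel_affine[OF assms(1), of t])
    (simp add: integral_density integral_distr)

lemma lborel_integrable_affine:
  fixes t :: "'a::euclidean_space" and f :: "'a \<Rightarrow> 'b::{banach, second_countable_topology}"
  assumes "c \<noteq> 0" and f: "integrable lborel f"
  shows "integrable lborel (\<lambda>x. f (t + c *\<^sub>R x))"
proof -
  have [measurable]: "f \<in> borel_measurable borel"
    using borel_measurable_integrable[OF f] by simp
  have "integrable (density (distr lborel borel (\<lambda>x. t + c *\<^sub>R x)) (\<lambda>_. \<bar>c\<bar>^DIM('a))) f"
    using f by (subst (asm) lborel_affine[OF assms(1), of t])
  then have "integrable lborel (\<lambda>x. \<bar>c\<bar>^DIM('a) *\<^sub>R f (t + c *\<^sub>R x))"
    by (simp add: integrable_density integrable_distr_eq)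
  from integrable_scaleR_right[OF this, of "inverse (\<bar>c\<bar>^DIM('a))"] show ?thesis
    using assms(1) by simp
qed

lemma dyadic_bracket:
  fixes r :: real
  assumes "1 \<le> r"
  obtains k :: nat where "2 ^ k \<le> r" "r \<le> 2 ^ Suc k"
proof -
  define k where "k = nat \<lfloor>log 2 r\<rfloor>"
  have "0 \<le> log 2 r" using assms by simp
  then have k: "real k \<le> log 2 r" "log 2 r \<le> real k + 1"
    unfolding k_def by linarith+
  from k(1) have "2 powr real k \<le> r" using assms by (subst (asm) le_log_iff) auto
  moreover from k(2) have "r \<le> 2 powr (real k + 1)" using assms by (subst (asm) log_le_iff) auto
  ultimately show ?thesis
    by (intro that[of k]) (auto simp: powr_realpow powr_add mult.commute)
qed

text \<open>On \<open>S\<close> the function lies below the sum of the weights \<open>a k\<close>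
  over the balls of radius \<open>R k\<close>, because one ball that contains \<open>y\<close> and
  dominates \<open>f y\<close> is enough. The \<open>k\<close>-th term integrates to a multiple of
  \<open>a k * R k ^ DIM('a)\<close>.\<close>

lemma nn_integral_dyadic_finite:
  fixes f :: "'a::euclidean_space \<Rightarrow> real" and a R :: "nat \<Rightarrow> real"
  assumes R: "\<And>k. 0 \<le> R k" and a: "\<And>k. 0 \<le> a k"
    and s: "summable (\<lambda>k. a k * R k ^ DIM('a))"
    and le: "\<And>y. y \<in> S \<Longrightarrow> \<exists>k. norm y \<le> R k \<and> f y \<le> a k"
  shows "(\<integral>\<^sup>+y. ennreal (f y) * indicator S y \<partial>lborel) < \<infinity>"
proof -
  let ?V = "unit_ball_vol (real DIM('a))"
  have "(\<integral>\<^sup>+y. ennreal (f y) * indicator S y \<partial>lborel)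
      \<le> (\<integral>\<^sup>+y. (\<Sum>k. ennreal (a k) * indicator (cball 0 (R k)) y) \<partial>(lborel :: 'a measure))"
  proof (rule nn_integral_mono)
    fix y :: 'a
    show "ennreal (f y) * indicator S y \<le> (\<Sum>k. ennreal (a k) * indicator (cball 0 (R k)) y)"
    proof (cases "y \<in> S")
      case True
      then obtain k where k: "norm y \<le> R k" "f y \<le> a k" using le by blast
      then have "ennreal (f y) \<le> ennreal (a k) * indicator (cball 0 (R k)) y"
        using a by (auto simp: indicator_def intro: ennreal_leI)
      also have "\<dots> = sum (\<lambda>k. ennreal (a k) * indicator (cball 0 (R k)) y) {k}"
        by (subst sum.insert) auto
      also have "\<dots> \<le> (\<Sum>k. ennreal (a k) * indicator (cball 0 (R k)) y)"
        by (intro sum_le_suminf) auto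
      finally show ?thesis using True by simp
    qed simp
  qed
  also have "\<dots> = (\<Sum>k. \<integral>\<^sup>+y. ennreal (a k) * indicator (cball 0 (R k)) y \<partial>(lborel :: 'a measure))"
    by (intro nn_integral_suminf borel_measurable_times_ennreal borel_measurable_const borel_measurable_indicator)
      simp
  also have "\<dots> = (\<Sum>k. ennreal (?V * (a k * R k ^ DIM('a))))"
    using R a by (simp add: nn_integral_cmult_indicator emeasure_cball ennreal_mult'[symmetric] mult_ac)
  also have "\<dots> < \<infinity>"
    using R a s by (subst suminf_ennreal_eq[OF _ summable_sums]) (auto intro!: summable_mult)
  finally show ?thesis .
qed

definition levy_weight :: "real \<Rightarrow> 'a::euclidean_space \<Rightarrow> real" where
  "levy_weight s y = inverse (norm y powr (real DIM('a) + 2 * s))"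

lemma levy_weight_measurable [measurable]: "levy_weight s \<in> borel_measurable borel"
  unfolding levy_weight_def by measurable

lemma levy_weight_nonneg [simp]: "0 \<le> levy_weight s y"
  by (simp add: levy_weight_def)

text \<open>The Levy condition. At infinity the dyadic sums are geometric with ratio
  \<open>2 powr (- 2 * s)\<close>, near the origin with ratio \<open>2 powr (- (2 - 2 * s))\<close>;
  the two ends of the range of \<open>s\<close> make them converge.\<close>

lemma levy_weight_integrable:
  assumes s: "0 < s" "s < 1"
  shows "integrable lborel (\<lambda>y::'a::euclidean_space. min 1 ((norm y)\<^sup>2) * levy_weight s y)"
proof (rule integrableI_bounded)
  let ?f = "\<lambda>y::'a. min 1 ((norm y)\<^sup>2) * levy_weight s y"
  let ?d = "real DIM('a)"
  show "?f \<in> borel_measurable lborel" by measurable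
  have out: "(\<integral>\<^sup>+y. ennreal (?f y) * indicator {y. 1 \<le> norm y} y \<partial>lborel) < \<infinity>"
  proof (rule nn_integral_dyadic_finite)
    let ?a = "\<lambda>k::nat. 2 powr (- real k * (?d + 2 * s))"
    let ?R = "\<lambda>k::nat. (2::real) ^ Suc k"
    have "?a k * ?R k ^ DIM('a) = 2 ^ DIM('a) * (2 powr (- 2 * s)) ^ k" for k
    proof -
      have "?R k ^ DIM('a) = 2 powr (?d * (real k + 1))"
        by (simp add: powr_realpow[symmetric] powr_powr powr_add[symmetric] algebra_simps del: power_Suc)
      then have "?a k * ?R k ^ DIM('a) = 2 powr (?d + - 2 * s * real k)"
        by (simp add: powr_add[symmetric] algebra_simps)
      also have "\<dots> = 2 ^ DIM('a) * (2 powr (- 2 * s)) ^ k"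
        by (simp only: powr_realpow[symmetric] powr_powr powr_add powr_gt_zero)
      finally show ?thesis .
    qed
    moreover have "summable (\<lambda>k. 2 ^ DIM('a) * (2 powr (- 2 * s)) ^ k)"
      using s by (intro summable_mult summable_geometric) (auto intro: powr_less_one)
    ultimately show "summable (\<lambda>k. ?a k * ?R k ^ DIM('a))" by (simp only:)
    fix y :: 'a assume "y \<in> {y. 1 \<le> norm y}"
    then have y: "1 \<le> norm y" by simp
    then obtain k where k: "2 ^ k \<le> norm y" "norm y \<le> 2 ^ Suc k" using dyadic_bracket by blast
    have "(2 powr real k) powr (?d + 2 * s) \<le> norm y powr (?d + 2 * s)"
      using k(1) s by (intro powr_mono2) (auto simp: powr_realpow)
    then have "?f y \<le> 1 * ?a k"
      unfolding levy_weight_def using y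
      by (intro mult_mono) (auto simp: powr_minus powr_powr divide_simps)
    then show "\<exists>k. norm y \<le> ?R k \<and> ?f y \<le> ?a k" using k by auto
  qed auto
  have inn: "(\<integral>\<^sup>+y. ennreal (?f y) * indicator {y. norm y \<le> 1} y \<partial>lborel) < \<infinity>"
  proof (rule nn_integral_dyadic_finite)
    \<comment> \<open>On the shell between the radii \<open>2 powr - (real k + 1)\<close> and
      \<open>2 powr - real k\<close>, the growing factor \<open>norm y powr (2 - 2 * s)\<close> is
      taken at the outer radius and the decaying factor \<open>norm y powr - ?d\<close> at the inner
      one, hence \<open>real k + 1\<close>.\<close>
    let ?a = "\<lambda>k::nat. 2 powr (- real k * (2 - 2 * s) + ?d * (real k + 1))"
    let ?R = "\<lambda>k::nat. 1 / (2::real) ^ k"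
    have "?a k * ?R k ^ DIM('a) = 2 ^ DIM('a) * (2 powr (- (2 - 2 * s))) ^ k" for k
    proof -
      have "?R k ^ DIM('a) = 2 powr (- ?d * real k)"
        by (simp add: powr_realpow[symmetric] powr_powr powr_minus mult_ac divide_simps)
      then have "?a k * ?R k ^ DIM('a) = 2 powr (?d + - (2 - 2 * s) * real k)"
        by (simp add: powr_add[symmetric] algebra_simps)
      also have "\<dots> = 2 ^ DIM('a) * (2 powr (- (2 - 2 * s))) ^ k"
        by (simp only: powr_realpow[symmetric] powr_powr powr_add powr_gt_zero)
      finally show ?thesis .
    qed
    moreover have "summable (\<lambda>k. 2 ^ DIM('a) * (2 powr (- (2 - 2 * s))) ^ k)"
      using s by (intro summable_mult summable_geometric) (auto intro: powr_less_one)
    ultimately show "summable (\<lambda>k. ?a k * ?R k ^ DIM('a))" by (simp only:)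
    fix y :: 'a assume "y \<in> {y. norm y \<le> 1}"
    then have y: "norm y \<le> 1" by simp
    show "\<exists>k. norm y \<le> ?R k \<and> ?f y \<le> ?a k"
    proof (cases "y = 0")
      case True then show ?thesis by (auto simp: levy_weight_def)
    next
      case False
      then have "1 \<le> 1 / norm y" using y by simp
      then obtain k where k: "2 ^ k \<le> 1 / norm y" "1 / norm y \<le> 2 ^ Suc k" using dyadic_bracket by blast
      have k1: "norm y \<le> ?R k" using k(1) False by (simp add: field_simps)
      have "2 powr - (real k + 1) = 1 / 2 ^ Suc k"
        using powr_realpow[of 2 "Suc k"] by (simp only: powr_minus_divide of_nat_Suc add.commute)
      then have k2: "2 powr - (real k + 1) \<le> norm y"
        using k(2) False by (simp only:) (simp add: field_simps)
      have "?f y \<le> (norm y)\<^sup>2 * levy_weight s y"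
        by (intro mult_right_mono) auto
      also have "\<dots> = norm y powr (2 - 2 * s) * norm y powr - ?d"
      proof -
        have "norm y powr (2 - 2 * s) * norm y powr - ?d = norm y powr (2 - (?d + 2 * s))"
          unfolding powr_add[symmetric] by (rule arg_cong[where f="\<lambda>e. norm y powr e"]) simp
        also have "\<dots> = (norm y)\<^sup>2 * levy_weight s y"
          using False by (simp add: powr_diff levy_weight_def divide_inverse)
        finally show ?thesis ..
      qed
      also have "\<dots> \<le> (2 powr - real k) powr (2 - 2 * s) * (2 powr - (real k + 1)) powr - ?d"
        using k1 k2 s False
        by (intro mult_mono powr_mono2 powr_mono2') (auto simp: powr_minus powr_realpow divide_simps)
      also have "\<dots> = ?a k"
        by (simp add: powr_powr powr_add[symmetric] algebra_simps)
      finally show ?thesis using k1 by blast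
    qed
  qed auto
  have "(\<integral>\<^sup>+y. ennreal (norm (?f y)) \<partial>lborel) \<le>
      (\<integral>\<^sup>+y. ennreal (?f y) * indicator {y. 1 \<le> norm y} y + ennreal (?f y) * indicator {y. norm y \<le> 1} y \<partial>lborel)"
    by (intro nn_integral_mono) (auto simp: indicator_def)
  also have "\<dots> < \<infinity>"
    using inn out by (subst nn_integral_add) auto
  finally show "(\<integral>\<^sup>+y. ennreal (norm (?f y)) \<partial>lborel) < \<infinity>" .
qed

lemma one_minus_cos_bounds:
  fixes z :: real
  shows "0 \<le> 1 - cos z" "1 - cos z \<le> 2" "1 - cos z \<le> z\<^sup>2 / 2"
proof -
  have "cos z = 1 - 2 * (sin (z / 2))\<^sup>2" using cos_double_sin[of "z/2"] by simp
  moreover have "(sin (z / 2))\<^sup>2 \<le> (z / 2)\<^sup>2"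
    using abs_sin_x_le_abs_x[of "z/2"] by (simp only: abs_le_square_iff)
  ultimately show "1 - cos z \<le> z\<^sup>2 / 2" by (simp add: power_divide)
qed (auto intro: order_trans[OF _ cos_ge_minus_one])

text \<open>Quadratic near the origin, bounded by 2 away from it. The constant is locally bounded in
  \<xi>, which allows a common majorant along convergent sequences of frequencies.\<close>

lemma one_minus_cos_inner_le:
  fixes \<xi> y :: "'a::euclidean_space"
  shows "1 - cos (\<xi> \<bullet> y) \<le> (2 + (norm \<xi>)\<^sup>2) * min 1 ((norm y)\<^sup>2)"
proof (cases "norm y \<le> 1")
  case True
  have "1 - cos (\<xi> \<bullet> y) \<le> (\<xi> \<bullet> y)\<^sup>2 / 2" by (rule one_minus_cos_bounds)
  also have "\<dots> \<le> (\<xi> \<bullet> y)\<^sup>2" by simp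
  also have "\<dots> \<le> (norm \<xi>)\<^sup>2 * (norm y)\<^sup>2"
    using Cauchy_Schwarz_ineq[of \<xi> y] by (simp add: power2_norm_eq_inner)
  also have "\<dots> \<le> (2 + (norm \<xi>)\<^sup>2) * (norm y)\<^sup>2" by (intro mult_right_mono) auto
  also have "(norm y)\<^sup>2 = min 1 ((norm y)\<^sup>2)" using True by (simp add: power_le_one)
  finally show ?thesis .
next
  case False
  then have "min 1 ((norm y)\<^sup>2) = 1" by (simp add: min_def power_le_one)
  then show ?thesis using one_minus_cos_bounds(2)[of "\<xi> \<bullet> y"] by (simp add: add_increasing2)
qed

lemma levy_integrable:
  fixes \<xi> :: "'a::euclidean_space"
  assumes s: "0 < s" "s < 1"
  shows "integrable lborel (\<lambda>y. (1 - cos (\<xi> \<bullet> y)) * levy_weight s y)"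
proof (rule Bochner_Integration.integrable_bound[OF integrable_mult_right[OF levy_weight_integrable[OF s], of "2 + (norm \<xi>)\<^sup>2"]])
  show "AE y in lborel. norm ((1 - cos (\<xi> \<bullet> y)) * levy_weight s y)
      \<le> norm ((2 + (norm \<xi>)\<^sup>2) * (min 1 ((norm y)\<^sup>2) * levy_weight s y))"
    using one_minus_cos_inner_le[of \<xi>] one_minus_cos_bounds(1)
    by (intro AE_I2) (auto simp: abs_mult mult.assoc[symmetric] abs_of_nonneg intro!: mult_right_mono)
qed measurable

text \<open>The Levy-Khintchine form of the symbol. What is used of it is its sign, its limit 0 at
  the origin and a lower bound by a power of the frequency.\<close>

definition levy_exponent :: "real \<Rightarrow> 'a::euclidean_space \<Rightarrow> real" where
  "levy_exponent s \<xi> = frac_const DIM('a) s * (LINT y|lborel. (1 - cos (\<xi> \<bullet> y)) * levy_weight s y)"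

text \<open>With the jumps of size at most \<epsilon> removed, the Levy measure becomes finite: the
  jump measure of a compound Poisson process.\<close>

definition levy_truncated :: "real \<Rightarrow> real \<Rightarrow> 'a::euclidean_space \<Rightarrow> real" where
  "levy_truncated s \<epsilon> y = frac_const DIM('a) s * (indicator {y. \<epsilon> < norm y} y * levy_weight s y)"

lemma frac_const_pos:
  assumes "0 < s" "s < 1"
  shows "frac_const d s > 0"
  unfolding frac_const_def using assms by (intro divide_pos_pos mult_pos_pos Gamma_real_pos) auto

lemma levy_exponent_measurable [measurable]: "levy_exponent s \<in> borel_measurable borel"
  unfolding levy_exponent_def by measurable

lemma levy_exponent_nonneg:
  assumes "0 < s" "s < 1"
  shows "0 \<le> levy_exponent s \<xi>"
  unfolding levy_exponent_def using one_minus_cos_bounds(1) frac_const_pos[OF assms]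
  by (intro mult_nonneg_nonneg Bochner_Integration.integral_nonneg) (auto simp: less_imp_le)

lemma levy_truncated_integrable:
  assumes s: "0 < s" "s < 1" and e: "\<epsilon> > 0"
  shows "integrable lborel (levy_truncated s \<epsilon> :: 'a::euclidean_space \<Rightarrow> real)"
proof -
  let ?m = "min 1 (\<epsilon>\<^sup>2)"
  have "norm (indicator {y. \<epsilon> < norm y} y * levy_weight s y) \<le> norm (1 / ?m * (min 1 ((norm y)\<^sup>2) * levy_weight s y))" for y :: 'a
  proof (cases "\<epsilon> < norm y")
    case True
    then have "\<epsilon>\<^sup>2 \<le> (norm y)\<^sup>2" using e by (intro power_mono) auto
    then have "?m \<le> min 1 ((norm y)\<^sup>2)" by linarith
    moreover have "0 < ?m" using e by simp
    ultimately have "1 \<le> min 1 ((norm y)\<^sup>2) / ?m" by simp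
    then have "1 * levy_weight s y \<le> (min 1 ((norm y)\<^sup>2) / ?m) * levy_weight s y"
      by (intro mult_right_mono) auto
    then show ?thesis using True e by simp
  qed simp
  then have "integrable lborel (\<lambda>y::'a. indicator {y. \<epsilon> < norm y} y * levy_weight s y)"
    by (intro Bochner_Integration.integrable_bound[OF integrable_mult_right[OF levy_weight_integrable[OF s], of "1 / ?m"]])
      auto
  then show ?thesis unfolding levy_truncated_def[abs_def] by simp
qed

lemma borel_measurable_cis [measurable]: "cis \<in> borel_measurable borel"
  by (intro borel_measurable_continuous_onI continuous_intros)

text \<open>Two readings of one truncated integral. Total mass minus Fourier transform gives
  positivity of the semigroup, because its negative exponentiates to a positive constant times the
  exponential of a transform. The cosine form is real with a nonnegative integrand and gives the
  limit as \<epsilon> tends to 0.\<close>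

lemma levy_truncated_fourier:
  fixes \<xi> :: "'a::euclidean_space"
  assumes s: "0 < s" "s < 1" and e: "\<epsilon> > 0"
  shows "frac_const DIM('a) s *\<^sub>R (LINT y:{y. \<epsilon> < norm (0 - y)}|lborel.
                 (cis (\<xi> \<bullet> 0) - cis (\<xi> \<bullet> y)) /\<^sub>R (norm (0 - y) powr (real DIM('a) + 2 * s)))
     = complex_of_real (LINT y|lborel. levy_truncated s \<epsilon> (y::'a)) - (LINT y|lborel. cis (\<xi> \<bullet> y) * levy_truncated s \<epsilon> y)"
    and "frac_const DIM('a) s *\<^sub>R (LINT y:{y. \<epsilon> < norm (0 - y)}|lborel.
                 (cis (\<xi> \<bullet> 0) - cis (\<xi> \<bullet> y)) /\<^sub>R (norm (0 - y) powr (real DIM('a) + 2 * s)))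
     = complex_of_real (LINT y|lborel. (1 - cos (\<xi> \<bullet> y)) * levy_truncated s \<epsilon> y)"
proof -
  let ?w = "levy_truncated s \<epsilon> :: 'a \<Rightarrow> real"
  let ?J = "frac_const DIM('a) s *\<^sub>R (LINT y:{y. \<epsilon> < norm (0 - y)}|lborel.
                 (cis (\<xi> \<bullet> 0) - cis (\<xi> \<bullet> y)) /\<^sub>R (norm (0 - y) powr (real DIM('a) + 2 * s)))"
  note I = levy_truncated_integrable[OF s e, where 'a='a]
  have [measurable]: "?w \<in> borel_measurable borel" using borel_measurable_integrable[OF I] by simp
  have Ic: "integrable lborel (\<lambda>y. cis (\<xi> \<bullet> y) * ?w y)"
    by (rule Bochner_Integration.integrable_bound[OF I]) (auto simp: norm_mult)
  have J: "?J = (LINT y|lborel. (1 - cis (\<xi> \<bullet> y)) * ?w y)"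
    unfolding set_lebesgue_integral_def integral_scaleR_right[symmetric]
    by (intro Bochner_Integration.integral_cong)
      (auto simp: levy_truncated_def levy_weight_def scaleR_conv_of_real indicator_def)
  also have "\<dots> = (LINT y|lborel. ?w y - cis (\<xi> \<bullet> y) * ?w y)"
    by (simp add: algebra_simps)
  also have "\<dots> = complex_of_real (LINT y|lborel. ?w y) - (LINT y|lborel. cis (\<xi> \<bullet> y) * ?w y)"
    using I Ic by (subst Bochner_Integration.integral_diff) auto
  finally show "?J = complex_of_real (LINT y|lborel. ?w y) - (LINT y|lborel. cis (\<xi> \<bullet> y) * ?w y)" .
  have sym: "?w (- y) = ?w y" for y by (simp add: levy_truncated_def levy_weight_def indicator_def)
  have I1: "integrable lborel (\<lambda>y. (1 - cis (\<xi> \<bullet> y)) * ?w y)"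
    using I Ic by (simp add: algebra_simps)
  have I2: "integrable lborel (\<lambda>y. (1 - cis (\<xi> \<bullet> - y)) * ?w (- y))"
    using lborel_integrable_affine[OF _ I1, of "-1" 0] by simp
  \<comment> \<open>Averaging with the reflected integrand removes the sine, since the weight is
    even.\<close>
  have "2 * ?J = (LINT y|lborel. (1 - cis (\<xi> \<bullet> y)) * ?w y) + (LINT y|lborel. (1 - cis (\<xi> \<bullet> - y)) * ?w (- y))"
    unfolding J using lborel_integral_affine[of "-1" "\<lambda>y. (1 - cis (\<xi> \<bullet> y)) * ?w y" 0] by simp
  also have "\<dots> = (LINT y|lborel. (1 - cis (\<xi> \<bullet> y)) * ?w y + (1 - cis (\<xi> \<bullet> - y)) * ?w (- y))"
    by (rule Bochner_Integration.integral_add[symmetric, OF I1 I2])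
  also have "\<dots> = (LINT y|lborel. complex_of_real (2 * ((1 - cos (\<xi> \<bullet> y)) * ?w y)))"
    by (intro Bochner_Integration.integral_cong) (auto simp: sym complex_eq_iff algebra_simps)
  also have "\<dots> = complex_of_real (2 * (LINT y|lborel. (1 - cos (\<xi> \<bullet> y)) * ?w y))"
    by (simp only: integral_complex_of_real integral_mult_right_zero)
  finally show "?J = complex_of_real (LINT y|lborel. (1 - cos (\<xi> \<bullet> y)) * ?w y)"
    by (simp add: complex_eq_iff)
qed

lemma levy_truncated_tendsto:
  fixes \<xi> :: "'a::euclidean_space"
  assumes s: "0 < s" "s < 1"
  shows "((\<lambda>\<epsilon>. LINT y|lborel. (1 - cos (\<xi> \<bullet> y)) * levy_truncated s \<epsilon> y) \<longlongrightarrow> levy_exponent s \<xi>) (at_right 0)"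
proof (rule tendsto_at_right_sequentially[of 0 1])
  fix S :: "nat \<Rightarrow> real"
  assume S: "\<And>n. 0 < S n" "S \<longlonglongrightarrow> 0"
  let ?C = "frac_const DIM('a) s"
  have [measurable]: "levy_truncated s e \<in> borel_measurable borel" for e
    unfolding levy_truncated_def[abs_def] by measurable
  have "(\<lambda>n. LINT y|lborel. (1 - cos (\<xi> \<bullet> y)) * levy_truncated s (S n) y) \<longlonglongrightarrow>
      (LINT y|lborel. ?C * ((1 - cos (\<xi> \<bullet> y)) * levy_weight s y))"
  proof (rule integral_dominated_convergence)
    show "integrable lborel (\<lambda>y. ?C * ((1 - cos (\<xi> \<bullet> y)) * levy_weight s y))"
      by (intro integrable_mult_right levy_integrable[OF s])
    show "AE y in lborel. (\<lambda>n. (1 - cos (\<xi> \<bullet> y)) * levy_truncated s (S n) y) \<longlonglongrightarrow> ?C * ((1 - cos (\<xi> \<bullet> y)) * levy_weight s y)"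
    proof (intro AE_I2)
      fix y :: 'a
      show "(\<lambda>n. (1 - cos (\<xi> \<bullet> y)) * levy_truncated s (S n) y) \<longlonglongrightarrow> ?C * ((1 - cos (\<xi> \<bullet> y)) * levy_weight s y)"
      proof (cases "y = 0")
        case False
        then have "\<forall>\<^sub>F n in sequentially. S n < norm y"
          using order_tendstoD(2)[OF S(2)] by simp
        then have "\<forall>\<^sub>F n in sequentially. (1 - cos (\<xi> \<bullet> y)) * levy_truncated s (S n) y = ?C * ((1 - cos (\<xi> \<bullet> y)) * levy_weight s y)"
          by eventually_elim (simp add: levy_truncated_def)
        then show ?thesis by (rule tendsto_eventually)
      qed simp
    qed
    show "AE y in lborel. norm ((1 - cos (\<xi> \<bullet> y)) * levy_truncated s (S n) y) \<le> ?C * ((1 - cos (\<xi> \<bullet> y)) * levy_weight s y)" for n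
      using frac_const_pos[OF s, of "DIM('a)"] one_minus_cos_bounds(1)
      by (intro AE_I2) (auto simp: levy_truncated_def indicator_def)
  qed measurable
  then show "(\<lambda>n. LINT y|lborel. (1 - cos (\<xi> \<bullet> y)) * levy_truncated s (S n) y) \<longlonglongrightarrow> levy_exponent s \<xi>"
    by (simp add: levy_exponent_def)
qed simp

lemma frac_symbol_eq:
  fixes \<xi> :: "'a::euclidean_space"
  assumes s: "0 < s" "s < 1"
  shows "frac_symbol s \<xi> = complex_of_real (levy_exponent s \<xi>)"
proof -
  let ?C = "frac_const DIM('a) s"
  let ?J = "\<lambda>\<epsilon>. LINT y:{y. \<epsilon> < norm (0 - y)}|lborel.
                 (cis (\<xi> \<bullet> 0) - cis (\<xi> \<bullet> y)) /\<^sub>R (norm (0 - y) powr (real DIM('a) + 2 * s))"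
  have "((\<lambda>\<epsilon>. ?C *\<^sub>R ?J \<epsilon>) \<longlongrightarrow> complex_of_real (levy_exponent s \<xi>)) (at_right 0)"
  proof (rule Lim_transform_eventually[OF tendsto_of_real[OF levy_truncated_tendsto[OF s]]])
    show "\<forall>\<^sub>F \<epsilon> in at_right 0. complex_of_real (LINT y|lborel. (1 - cos (\<xi> \<bullet> y)) * levy_truncated s \<epsilon> y) = ?C *\<^sub>R ?J \<epsilon>"
      using levy_truncated_fourier(2)[OF s, of _ \<xi>] by (auto simp: eventually_at_filter)
  qed
  \<comment> \<open>In \<open>frac_laplacian\<close> the constant stands outside \<open>Lim\<close>,
    so it is cancelled before the limit is identified.\<close>
  then have "((\<lambda>\<epsilon>. inverse ?C *\<^sub>R ?C *\<^sub>R ?J \<epsilon>) \<longlongrightarrow> inverse ?C *\<^sub>R complex_of_real (levy_exponent s \<xi>)) (at_right 0)"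
    by (intro tendsto_intros)
  then have "(?J \<longlongrightarrow> inverse ?C *\<^sub>R complex_of_real (levy_exponent s \<xi>)) (at_right 0)"
    using frac_const_pos[OF s, of "DIM('a)"] by simp
  then have "Lim (at_right 0) ?J = inverse ?C *\<^sub>R complex_of_real (levy_exponent s \<xi>)"
    by (intro tendsto_Lim) auto
  then show ?thesis
    using frac_const_pos[OF s, of "DIM('a)"] unfolding frac_symbol_def frac_laplacian_def by simp
qed

text \<open>The value 0 of the symbol at zero frequency is what makes the heat kernel have mass 1;
  this limit is the form in which that enters.\<close>

lemma levy_exponent_tendsto_0:
  assumes s: "0 < s" "s < 1" and X: "X \<longlonglongrightarrow> (0::'a::euclidean_space)"
  shows "(\<lambda>n. levy_exponent s (X n)) \<longlonglongrightarrow> 0"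
proof -
  obtain B where B: "\<And>n. norm (X n) \<le> B"
    using convergent_imp_Bseq[of X] X unfolding convergent_def Bseq_def by auto
  have "(\<lambda>n. LINT y|lborel. (1 - cos (X n \<bullet> y)) * levy_weight s y) \<longlonglongrightarrow> (LINT y|(lborel::'a measure). 0)"
  proof (rule integral_dominated_convergence)
    show "integrable lborel (\<lambda>y::'a. (2 + B\<^sup>2) * (min 1 ((norm y)\<^sup>2) * levy_weight s y))"
      by (intro integrable_mult_right levy_weight_integrable[OF s])
    show "AE y in lborel. norm ((1 - cos (X n \<bullet> y)) * levy_weight s y) \<le> (2 + B\<^sup>2) * (min 1 ((norm y)\<^sup>2) * levy_weight s y)" for n
    proof (intro AE_I2)
      fix y :: 'a
      have "1 - cos (X n \<bullet> y) \<le> (2 + (norm (X n))\<^sup>2) * min 1 ((norm y)\<^sup>2)" by (rule one_minus_cos_inner_le)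
      also have "\<dots> \<le> (2 + B\<^sup>2) * min 1 ((norm y)\<^sup>2)"
        using B[of n] by (intro mult_right_mono add_left_mono power_mono) auto
      finally show "norm ((1 - cos (X n \<bullet> y)) * levy_weight s y) \<le> (2 + B\<^sup>2) * (min 1 ((norm y)\<^sup>2) * levy_weight s y)"
        using one_minus_cos_bounds(1) by (auto simp: abs_mult mult.assoc[symmetric] intro!: mult_right_mono)
    qed
    show "AE y in lborel. (\<lambda>n. (1 - cos (X n \<bullet> y)) * levy_weight s y) \<longlonglongrightarrow> 0"
      using X by (intro AE_I2) (auto intro!: tendsto_eq_intros)
  qed auto
  then show ?thesis unfolding levy_exponent_def by (auto intro!: tendsto_eq_intros)
qed

text \<open>On the ball of radius \<open>r / 4\<close> around \<open>(r / 2) \<cdot> \<xi> / |\<xi>|\<close> with \<open>r = 1 / |\<xi>|\<close> the phase \<open>\<xi> \<bullet> y\<close>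
  stays in \<open>[1/4, 1]\<close>, so the integrand of the exponent is bounded below there.\<close>

lemma levy_exponent_lower_bound:
  assumes s: "0 < s" "s < 1"
  obtains c where "c > 0" "\<And>\<xi>::'a::euclidean_space. c * norm \<xi> powr (2 * s) \<le> levy_exponent s \<xi>"
proof -
  let ?d = "real DIM('a)" and ?V = "unit_ball_vol (real DIM('a))"
  define k where "k = 1 - cos (1/4::real)"
  have k: "k > 0" using cos_monotone_0_pi[of 0 "1/4"] pi_gt3 by (simp add: k_def)
  define c where "c = frac_const DIM('a) s * (k * (?V * (1/4) ^ DIM('a)))"
  have "c > 0" unfolding c_def using k frac_const_pos[OF s] by (intro mult_pos_pos) auto
  moreover have "c * norm \<xi> powr (2 * s) \<le> levy_exponent s \<xi>" for \<xi> :: 'a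
  proof (cases "\<xi> = 0")
    case True then show ?thesis using levy_exponent_nonneg[OF s] by simp
  next
    case False
    define n where "n = norm \<xi>"
    have n: "n > 0" using False by (simp add: n_def)
    define z where "z = (1 / (2 * n\<^sup>2)) *\<^sub>R \<xi>"
    \<comment> \<open>\<open>w\<close> is the value of the radially decreasing weight at distance
      \<open>1 / n\<close>, hence a lower bound for it on the chosen ball.\<close>
    define w where "w = n powr (?d + 2 * s)"
    have pt: "k * w \<le> (1 - cos (\<xi> \<bullet> y)) * levy_weight s y" if y: "y \<in> cball z (1 / (4 * n))" for y
    proof -
      have nz: "norm z = 1 / (2 * n)" using n by (simp add: z_def n_def[symmetric] power2_eq_square)
      have dy: "norm (y - z) \<le> 1 / (4 * n)" using y by (simp add: dist_norm norm_minus_commute)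
      have "\<bar>\<xi> \<bullet> (y - z)\<bar> \<le> n * norm (y - z)"
        unfolding n_def by (rule Cauchy_Schwarz_ineq2)
      also have "\<dots> \<le> n * (1 / (4 * n))"
        using dy n by (intro mult_left_mono) auto
      also have "\<dots> = 1 / 4" using n by simp
      finally have "\<bar>\<xi> \<bullet> (y - z)\<bar> \<le> 1 / 4" .
      moreover have "\<xi> \<bullet> z = 1 / 2"
        using n by (simp add: z_def n_def dot_square_norm)
      ultimately have ph: "1 / 4 \<le> \<xi> \<bullet> y" "\<xi> \<bullet> y \<le> 1"
        unfolding inner_diff_right by linarith+
      have c1: "k \<le> 1 - cos (\<xi> \<bullet> y)"
        unfolding k_def using ph pi_gt3 by (simp add: cos_monotone_0_pi_le)
      have "norm y \<le> norm z + norm (y - z)" using norm_triangle_ineq[of z "y - z"] by simp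
      also have "\<dots> \<le> 1 / n" using nz dy n by (simp add: field_simps)
      finally have ny: "norm y \<le> 1 / n" .
      have y0: "y \<noteq> 0" using ph by auto
      have "norm y powr (?d + 2 * s) \<le> (1 / n) powr (?d + 2 * s)"
        using ny s by (intro powr_mono2) auto
      also have "\<dots> = inverse w" unfolding w_def using n by (simp add: powr_divide inverse_eq_divide)
      finally have "w \<le> levy_weight s y"
        unfolding levy_weight_def using y0 n by (subst le_imp_inverse_le[of _ "inverse w", simplified]) (auto simp: w_def)
      then show ?thesis using c1 k n by (intro mult_mono) (auto simp: w_def)
    qed
    have "k * (?V * (1/4) ^ DIM('a)) * n powr (2 * s) = k * w * (?V * (1 / (4 * n)) ^ DIM('a))"
      using n by (simp add: w_def powr_add powr_realpow power_divide power_mult_distrib)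
    also have "\<dots> = (LINT y|lborel. k * w * indicator (cball z (1 / (4 * n))) y)"
      using n by (simp add: content_cball)
    also have "\<dots> \<le> (LINT y|lborel. (1 - cos (\<xi> \<bullet> y)) * levy_weight s y)"
    proof (rule integral_mono[OF _ levy_integrable[OF s]])
      show "integrable lborel (\<lambda>y. k * w * indicator (cball z (1 / (4 * n))) y)"
        by (intro integrable_mult_right integrable_real_indicator) (use n in \<open>auto simp: emeasure_cball\<close>)
    qed (use pt one_minus_cos_bounds(1) in \<open>auto simp: indicator_def\<close>)
    finally show ?thesis
      unfolding c_def levy_exponent_def n_def using frac_const_pos[OF s, of "DIM('a)"]
      by (simp add: mult.assoc mult_left_mono)
  qed
  ultimately show ?thesis by (rule that)
qed

section \<open>Positivity of Fourier integrals\<close>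

text \<open>A majorant of product form supplies the hypothesis of Fubini's theorem in all the
  Fourier computations below.\<close>

lemma integrable_lborel_pair_bound:
  fixes h :: "'a::euclidean_space \<times> 'b::euclidean_space \<Rightarrow> complex"
  assumes h [measurable]: "h \<in> borel_measurable (lborel \<Otimes>\<^sub>M lborel)"
    and f: "integrable lborel f" and g: "integrable lborel g"
    and le: "\<And>x y. norm (h (x, y)) \<le> f x * g y"
    and nn: "\<And>x. 0 \<le> f x" "\<And>y. 0 \<le> g y"
  shows "integrable (lborel \<Otimes>\<^sub>M lborel) h"
proof (rule integrableI_bounded[OF h])
  have [measurable]: "f \<in> borel_measurable borel" "g \<in> borel_measurable borel"
    using borel_measurable_integrable[OF f] borel_measurable_integrable[OF g] by auto
  have "(\<integral>\<^sup>+z. ennreal (norm (h z)) \<partial>(lborel \<Otimes>\<^sub>M lborel)) = (\<integral>\<^sup>+x. \<integral>\<^sup>+y. ennreal (norm (h (x, y))) \<partial>lborel \<partial>lborel)"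
    by (rule lborel.nn_integral_fst[symmetric]) measurable
  also have "\<dots> \<le> (\<integral>\<^sup>+x. \<integral>\<^sup>+y. ennreal (f x) * ennreal (g y) \<partial>lborel \<partial>lborel)"
    using le nn by (intro nn_integral_mono) (simp add: ennreal_mult'[symmetric] ennreal_leI)
  also have "\<dots> = (\<integral>\<^sup>+x. ennreal (f x) \<partial>lborel) * (\<integral>\<^sup>+y. ennreal (g y) \<partial>lborel)"
    by (simp add: nn_integral_cmult nn_integral_multc)
  also have "\<dots> < \<infinity>"
    using f g nn by (subst (1 2) nn_integral_eq_integral) (auto simp: ennreal_mult'[symmetric])
  finally show "(\<integral>\<^sup>+z. ennreal (norm (h z)) \<partial>(lborel \<Otimes>\<^sub>M lborel)) < \<infinity>" .
qed

lemma integrable_cis_mult: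
  fixes f :: "'a::euclidean_space \<Rightarrow> complex"
  assumes "integrable lborel f"
  shows "integrable lborel (\<lambda>\<xi>. cis (x \<bullet> \<xi>) * f \<xi>)"
proof (rule Bochner_Integration.integrable_bound[OF assms])
  have [measurable]: "f \<in> borel_measurable borel" using borel_measurable_integrable[OF assms] by simp
  show "(\<lambda>\<xi>. cis (x \<bullet> \<xi>) * f \<xi>) \<in> borel_measurable lborel" by measurable
qed (simp add: norm_mult)

lemma gaussian_integrable:
  assumes "c > 0"
  shows "integrable lborel (\<lambda>\<xi>::'a::euclidean_space. exp (- (c * (norm \<xi>)\<^sup>2)))"
    and "(LINT \<xi>|lborel. exp (- (c * (norm (\<xi>::'a))\<^sup>2))) = sqrt (pi / c) ^ DIM('a)"
proof -
  note I = gaussian_fourier[OF assms, of "0::'a"]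
  have "integrable lborel (\<lambda>\<xi>::'a. Re (cis (0 \<bullet> \<xi>) * exp (- (c * (norm \<xi>)\<^sup>2))))"
    using I(1) by (rule integrable_Re)
  then show "integrable lborel (\<lambda>\<xi>::'a. exp (- (c * (norm \<xi>)\<^sup>2)))" by simp
  from I(2) have "complex_of_real (LINT \<xi>|lborel. exp (- (c * (norm (\<xi>::'a))\<^sup>2))) = of_real (sqrt (pi / c) ^ DIM('a))"
    by (simp add: integral_complex_of_real[symmetric] del: integral_complex_of_real)
  then show "(LINT \<xi>|lborel. exp (- (c * (norm (\<xi>::'a))\<^sup>2))) = sqrt (pi / c) ^ DIM('a)"
    by (simp only: of_real_eq_iff)
qed

lemma fourier_weight:
  fixes w :: "'a::euclidean_space \<Rightarrow> real"
  assumes w: "integrable lborel w" "\<And>y. 0 \<le> w y"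
  shows "(\<lambda>\<xi>. LINT y|lborel. cis (\<xi> \<bullet> y) * w y) \<in> borel_measurable borel"
    and "norm (LINT y|lborel. cis (\<xi> \<bullet> y) * w y) \<le> (LINT y|lborel. w y)"
proof -
  have [measurable]: "w \<in> borel_measurable borel" using borel_measurable_integrable[OF w(1)] by simp
  show "(\<lambda>\<xi>. LINT y|lborel. cis (\<xi> \<bullet> y) * w y) \<in> borel_measurable borel" by measurable
  have "norm (LINT y|lborel. cis (\<xi> \<bullet> y) * w y) \<le> (LINT y|lborel. norm (cis (\<xi> \<bullet> y) * w y))"
    by (rule integral_norm_bound)
  then show "norm (LINT y|lborel. cis (\<xi> \<bullet> y) * w y) \<le> (LINT y|lborel. w y)"
    using w(2) by (simp add: norm_mult)
qed

text \<open>One more factor of the transform of \<open>w\<close> averages the previous integral over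
  translations: the value at \<open>x\<close> becomes the integral of \<open>w y\<close> times the
  value at \<open>x + y\<close>. Positivity is inherited, provided that the induction hypothesis
  holds at every point. Membership in the nonnegative reals also records that the integral is
  real.\<close>

lemma gaussian_fourier_power_nonneg:
  fixes w :: "'a::euclidean_space \<Rightarrow> real"
  assumes w: "integrable lborel w" "\<And>y. 0 \<le> w y" and c: "c > 0"
  shows "(LINT \<xi>|lborel. cis (x \<bullet> \<xi>) * (exp (- (c * (norm \<xi>)\<^sup>2)) * (LINT y|lborel. cis (\<xi> \<bullet> y) * w y) ^ n)) \<in> \<real>\<^sub>\<ge>\<^sub>0"
proof (induction n arbitrary: x)
  case 0
  show ?case using gaussian_fourier(2)[OF c, of x] by (simp add: complex_nonneg_Reals_iff c less_imp_le)
next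
  case (Suc n)
  define W where "W = (\<lambda>\<xi>. LINT y|lborel. cis (\<xi> \<bullet> y) * w y)"
  define G where "G = (\<lambda>\<xi>::'a. exp (- (c * (norm \<xi>)\<^sup>2)))"
  define I where "I = (\<lambda>x. LINT \<xi>|lborel. cis (x \<bullet> \<xi>) * (G \<xi> * W \<xi> ^ n))"
  have wm [measurable]: "w \<in> borel_measurable borel" using borel_measurable_integrable[OF w(1)] by simp
  have Wm [measurable]: "W \<in> borel_measurable borel" unfolding W_def by (rule fourier_weight[OF w])
  have Gm [measurable]: "G \<in> borel_measurable borel" unfolding G_def by measurable
  have Wb: "norm (W \<xi>) \<le> (LINT y|lborel. w y)" for \<xi> unfolding W_def by (rule fourier_weight[OF w])
  have IH: "I x \<in> \<real>\<^sub>\<ge>\<^sub>0" for x using Suc.IH unfolding I_def G_def W_def .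
  let ?h = "\<lambda>\<xi> y. cis (x \<bullet> \<xi>) * (G \<xi> * W \<xi> ^ n) * (cis (\<xi> \<bullet> y) * w y)"
  have int: "integrable (lborel \<Otimes>\<^sub>M lborel) (\<lambda>(\<xi>, y). ?h \<xi> y)"
  proof (rule integrable_lborel_pair_bound[where f="\<lambda>\<xi>. (LINT y|lborel. w y) ^ n * G \<xi>" and g=w])
    show "integrable lborel (\<lambda>\<xi>. (LINT y|lborel. w y) ^ n * G \<xi>)"
      unfolding G_def by (intro integrable_mult_right gaussian_integrable c)
    show "norm (case (\<xi>, y) of (\<xi>, y) \<Rightarrow> ?h \<xi> y) \<le> (LINT y|lborel. w y) ^ n * G \<xi> * w y" for \<xi> y
      using power_mono[OF Wb[of \<xi>], of n] w(2)[of y]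
      by (auto simp: norm_mult norm_power G_def intro!: mult_right_mono)
    show "0 \<le> (LINT y|lborel. w y) ^ n * G \<xi>" for \<xi>
      using w(2) by (auto simp: G_def intro!: mult_nonneg_nonneg zero_le_power Bochner_Integration.integral_nonneg)
  qed (use w in auto)
  have "(LINT \<xi>|lborel. cis (x \<bullet> \<xi>) * (G \<xi> * W \<xi> ^ Suc n)) = (LINT \<xi>|lborel. LINT y|lborel. ?h \<xi> y)"
  proof (intro Bochner_Integration.integral_cong refl)
    fix \<xi>
    have H: "(LINT y|lborel. ?h \<xi> y) = cis (x \<bullet> \<xi>) * (G \<xi> * W \<xi> ^ n) * W \<xi>"
      by (subst integral_mult_right_zero) (simp add: W_def)
    show "cis (x \<bullet> \<xi>) * (G \<xi> * W \<xi> ^ Suc n) = (LINT y|lborel. ?h \<xi> y)"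
      unfolding H by (simp add: mult_ac)
  qed
  also have "\<dots> = (LINT y|lborel. LINT \<xi>|lborel. ?h \<xi> y)"
    by (rule lborel_pair.Fubini_integral[OF int, symmetric])
  also have "\<dots> = (LINT y|lborel. w y * I (x + y))"
  proof (intro Bochner_Integration.integral_cong refl)
    fix y
    have "?h \<xi> y = w y * (cis ((x + y) \<bullet> \<xi>) * (G \<xi> * W \<xi> ^ n))" for \<xi>
      by (simp add: inner_add_left cis_mult[symmetric] inner_commute[of \<xi> y] mult_ac)
    then show "(LINT \<xi>|lborel. ?h \<xi> y) = w y * I (x + y)"
      unfolding I_def by (simp only: integral_mult_right_zero)
  qed
  also have "\<dots> = (LINT y|lborel. complex_of_real (w y * Re (I (x + y))))"
    using IH by (intro Bochner_Integration.integral_cong refl) (auto simp: complex_nonneg_Reals_iff complex_eq_iff)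
  also have "\<dots> = complex_of_real (LINT y|lborel. w y * Re (I (x + y)))"
    by (rule integral_complex_of_real)
  also have "\<dots> \<in> \<real>\<^sub>\<ge>\<^sub>0"
    using IH w(2) by (simp add: complex_nonneg_Reals_iff Bochner_Integration.integral_nonneg)
  finally show ?case unfolding W_def G_def .
qed

text \<open>The exponential series is integrated term by term; the transform is bounded by the mass
  \<open>L\<close> of \<open>w\<close>, so the terms are dominated by \<open>L ^ n / fact n\<close>
  times a Gaussian.\<close>

lemma gaussian_fourier_exp_nonneg:
  fixes w :: "'a::euclidean_space \<Rightarrow> real"
  assumes w: "integrable lborel w" "\<And>y. 0 \<le> w y" and c: "c > 0"
  shows "0 \<le> Re (LINT \<xi>|lborel. cis (x \<bullet> \<xi>) * (exp (- (c * (norm \<xi>)\<^sup>2)) * exp (LINT y|lborel. cis (\<xi> \<bullet> y) * w y)))"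
proof -
  define W where "W = (\<lambda>\<xi>. LINT y|lborel. cis (\<xi> \<bullet> y) * w y)"
  define L where "L = (LINT y|lborel. w y)"
  define G where "G = (\<lambda>\<xi>::'a. exp (- (c * (norm \<xi>)\<^sup>2)))"
  define f where "f = (\<lambda>n \<xi>. inverse (fact n) *\<^sub>R (cis (x \<bullet> \<xi>) * (G \<xi> * W \<xi> ^ n)))"
  have L0: "0 \<le> L" unfolding L_def using w(2) by simp
  have Gi: "integrable lborel G" unfolding G_def by (rule gaussian_integrable[OF c])
  have Wm [measurable]: "W \<in> borel_measurable borel" unfolding W_def by (rule fourier_weight[OF w])
  have Gm [measurable]: "G \<in> borel_measurable borel" unfolding G_def by measurable
  have Wb: "norm (W \<xi>) \<le> L" for \<xi> unfolding W_def L_def by (rule fourier_weight[OF w])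
  have fb: "norm (f n \<xi>) \<le> inverse (fact n) * L ^ n * G \<xi>" for n \<xi>
    using power_mono[OF Wb[of \<xi>], of n]
    by (auto simp: f_def norm_mult norm_power G_def intro!: mult_right_mono mult_left_mono)
  have fi: "integrable lborel (f n)" for n
    by (rule Bochner_Integration.integrable_bound[OF integrable_mult_right[OF Gi, of "inverse (fact n) * L ^ n"]])
      (use fb[of n] L0 in \<open>auto simp: f_def G_def\<close>)
  have sm: "summable (\<lambda>n. inverse (fact n) * L ^ n)"
    using summable_exp_generic[of L] by (simp add: scaleR_conv_of_real divide_inverse)
  have "(\<lambda>n. integral\<^sup>L lborel (f n)) sums (LINT \<xi>|lborel. (\<Sum>n. f n \<xi>))"
  proof (rule sums_integral[OF fi])
    show "AE \<xi> in lborel. summable (\<lambda>n. norm (f n \<xi>))"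
      by (intro AE_I2 summable_comparison_test'[OF summable_mult2[OF sm]]) (use fb in auto)
    show "summable (\<lambda>n. LINT \<xi>|lborel. norm (f n \<xi>))"
    proof (rule summable_comparison_test'[OF summable_mult2[OF sm, of "integral\<^sup>L lborel G"], of 0])
      fix n
      have "(LINT \<xi>|lborel. norm (f n \<xi>)) \<le> (LINT \<xi>|lborel. inverse (fact n) * L ^ n * G \<xi>)"
        by (intro integral_mono integrable_norm fi integrable_mult_right Gi) (rule fb)
      then show "norm (LINT \<xi>|lborel. norm (f n \<xi>)) \<le> inverse (fact n) * L ^ n * integral\<^sup>L lborel G"
        by simp
    qed
  qed
  moreover have "(\<Sum>n. f n \<xi>) = cis (x \<bullet> \<xi>) * (G \<xi> * exp (W \<xi>))" for \<xi>
  proof -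
    have "(\<lambda>n. (cis (x \<bullet> \<xi>) * G \<xi>) * (W \<xi> ^ n /\<^sub>R fact n)) sums ((cis (x \<bullet> \<xi>) * G \<xi>) * exp (W \<xi>))"
      by (intro sums_mult exp_converges)
    then show ?thesis by (simp add: f_def sums_iff mult_ac)
  qed
  ultimately have S: "(\<lambda>n. integral\<^sup>L lborel (f n)) sums (LINT \<xi>|lborel. cis (x \<bullet> \<xi>) * (G \<xi> * exp (W \<xi>)))"
    by simp
  have "0 \<le> Re (integral\<^sup>L lborel (f n))" for n
    using gaussian_fourier_power_nonneg[OF w c, of x n]
    unfolding f_def G_def W_def integral_scaleR_right by (simp add: complex_nonneg_Reals_iff)
  then show ?thesis
    using sums_le[OF _ sums_zero sums_Re[OF S]] unfolding G_def W_def by simp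
qed

definition mixed_symbol :: "real \<Rightarrow> 'a::euclidean_space \<Rightarrow> real" where
  "mixed_symbol s \<xi> = (norm \<xi>)\<^sup>2 + levy_exponent s \<xi>"

lemma mixed_symbol_measurable [measurable]: "mixed_symbol s \<in> borel_measurable borel"
  unfolding mixed_symbol_def by measurable

lemma mixed_symbol_ge:
  assumes "0 < s" "s < 1"
  shows "(norm \<xi>)\<^sup>2 \<le> mixed_symbol s \<xi>"
  unfolding mixed_symbol_def using levy_exponent_nonneg[OF assms] by simp

lemma mixed_symbol_nonneg:
  assumes "0 < s" "s < 1"
  shows "0 \<le> mixed_symbol s \<xi>"
  using mixed_symbol_ge[OF assms, of \<xi>] zero_le_power2[of "norm \<xi>"] by linarith

lemma exp_mixed_symbol_le:
  assumes "0 < s" "s < 1" "0 \<le> a" "a \<le> t"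
  shows "exp (- (t * mixed_symbol s \<xi>)) \<le> exp (- (a * (norm \<xi>)\<^sup>2))"
  using mult_mono[OF assms(4) mixed_symbol_ge[OF assms(1,2), of \<xi>]] assms by simp

lemma exp_mixed_symbol_integrable:
  assumes s: "0 < s" "s < 1" and t: "t > 0"
  shows "integrable lborel (\<lambda>\<xi>::'a::euclidean_space. exp (- (t * mixed_symbol s \<xi>)))"
  by (rule Bochner_Integration.integrable_bound[OF gaussian_integrable(1)[OF t]])
    (use exp_mixed_symbol_le[OF s, of t t] t in \<open>auto simp del: exp_le_cancel_iff\<close>)

text \<open>The Gaussian coming from the Laplacian dominates the multipliers of all truncations at
  once, because the truncated exponents are nonnegative. Hence the truncation can be removed by
  dominated convergence.\<close>

lemma fourier_mixed_nonneg:
  fixes x :: "'a::euclidean_space"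
  assumes s: "0 < s" "s < 1" and t: "t > 0"
  shows "0 \<le> Re (LINT \<xi>|lborel. cis (x \<bullet> \<xi>) * complex_of_real (exp (- (t * mixed_symbol s \<xi>))))"
proof -
  define e where "e = (\<lambda>n. 1 / (real n + 1))"
  have e0: "e n > 0" for n by (simp add: e_def)
  have el: "e \<longlonglongrightarrow> 0" unfolding e_def using LIMSEQ_inverse_real_of_nat by (simp add: inverse_eq_divide add_ac)
  define P where "P = (\<lambda>n \<xi>. LINT y|lborel. (1 - cos (\<xi> \<bullet> y)) * levy_truncated s (e n) (y::'a))"
  define G where "G = (\<lambda>\<xi>::'a. exp (- (t * (norm \<xi>)\<^sup>2)))"
  have ltm [measurable]: "levy_truncated s (e n) \<in> borel_measurable borel" for n
    unfolding levy_truncated_def[abs_def] by measurable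
  have lt0: "0 \<le> levy_truncated s (e n) y" for n and y :: 'a
    using frac_const_pos[OF s, of "DIM('a)"] by (simp add: levy_truncated_def)
  have [measurable]: "P n \<in> borel_measurable borel" for n
    unfolding P_def by measurable
  have [measurable]: "G \<in> borel_measurable borel" unfolding G_def by measurable
  have P0: "0 \<le> P n \<xi>" for n \<xi>
    unfolding P_def using lt0 one_minus_cos_bounds(1) by (intro Bochner_Integration.integral_nonneg mult_nonneg_nonneg) auto
  have Plim: "(\<lambda>n. P n \<xi>) \<longlonglongrightarrow> levy_exponent s \<xi>" for \<xi>
    unfolding P_def using e0 el
    by (intro filterlim_compose[OF levy_truncated_tendsto[OF s]])
      (auto simp: filterlim_at order_less_imp_not_eq2)
  have nn: "0 \<le> Re (LINT \<xi>|lborel. cis (x \<bullet> \<xi>) * complex_of_real (G \<xi> * exp (- (t * P n \<xi>))))" for n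
  proof -
    let ?w = "\<lambda>y::'a. t * levy_truncated s (e n) y"
    let ?l = "LINT y|lborel. levy_truncated s (e n) (y::'a)"
    have wi: "integrable lborel ?w" by (intro integrable_mult_right levy_truncated_integrable[OF s e0])
    have w0: "0 \<le> ?w y" for y using lt0 t by simp
    have Pe: "complex_of_real (P n \<xi>) = ?l - (LINT y|lborel. cis (\<xi> \<bullet> y) * levy_truncated s (e n) y)" for \<xi>
      using levy_truncated_fourier[OF s e0[of n], of \<xi>] unfolding P_def by simp
    have W: "(LINT y|lborel. cis (\<xi> \<bullet> y) * ?w y) = of_real t * (LINT y|lborel. cis (\<xi> \<bullet> y) * levy_truncated s (e n) y)" for \<xi>
      by (subst integral_mult_right_zero[symmetric]) (simp add: mult_ac)
    have E: "complex_of_real (exp (- (t * P n \<xi>))) = exp (- (t * ?l)) *\<^sub>R exp (LINT y|lborel. cis (\<xi> \<bullet> y) * ?w y)" for \<xi>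
    proof -
      have "complex_of_real (exp (- (t * P n \<xi>))) = exp (- (of_real t * complex_of_real (P n \<xi>)))"
        by (simp add: exp_of_real[symmetric])
      also have "\<dots> = exp (of_real (- (t * ?l)) + (LINT y|lborel. cis (\<xi> \<bullet> y) * ?w y))"
        unfolding Pe W by (simp add: algebra_simps)
      also have "\<dots> = exp (- (t * ?l)) *\<^sub>R exp (LINT y|lborel. cis (\<xi> \<bullet> y) * ?w y)"
        by (simp only: exp_add scaleR_conv_of_real exp_of_real)
      finally show ?thesis .
    qed
    have "(LINT \<xi>|lborel. cis (x \<bullet> \<xi>) * complex_of_real (G \<xi> * exp (- (t * P n \<xi>))))
       = exp (- (t * ?l)) *\<^sub>R (LINT \<xi>|lborel. cis (x \<bullet> \<xi>) * (G \<xi> * exp (LINT y|lborel. cis (\<xi> \<bullet> y) * ?w y)))"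
      unfolding integral_scaleR_right[symmetric]
      by (intro Bochner_Integration.integral_cong refl) (simp only: of_real_mult E mult_scaleR_right)
    then show ?thesis
      using gaussian_fourier_exp_nonneg[OF wi w0 t, of x] unfolding G_def by simp
  qed
  have "(\<lambda>n. LINT \<xi>|lborel. cis (x \<bullet> \<xi>) * complex_of_real (G \<xi> * exp (- (t * P n \<xi>))))
     \<longlonglongrightarrow> (LINT \<xi>|lborel. cis (x \<bullet> \<xi>) * complex_of_real (exp (- (t * mixed_symbol s \<xi>))))"
  proof (rule integral_dominated_convergence)
    show "integrable lborel G" unfolding G_def by (rule gaussian_integrable[OF t])
    show "AE \<xi> in lborel. (\<lambda>n. cis (x \<bullet> \<xi>) * complex_of_real (G \<xi> * exp (- (t * P n \<xi>))))
        \<longlonglongrightarrow> cis (x \<bullet> \<xi>) * complex_of_real (exp (- (t * mixed_symbol s \<xi>)))"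
    proof (intro AE_I2)
      fix \<xi> :: 'a
      have "exp (- (t * mixed_symbol s \<xi>)) = G \<xi> * exp (- (t * levy_exponent s \<xi>))"
        unfolding G_def mixed_symbol_def by (simp add: exp_add[symmetric] algebra_simps)
      then show "(\<lambda>n. cis (x \<bullet> \<xi>) * complex_of_real (G \<xi> * exp (- (t * P n \<xi>))))
        \<longlonglongrightarrow> cis (x \<bullet> \<xi>) * complex_of_real (exp (- (t * mixed_symbol s \<xi>)))"
        by (simp only:) (intro tendsto_intros Plim)
    qed
    show "AE \<xi> in lborel. norm (cis (x \<bullet> \<xi>) * complex_of_real (G \<xi> * exp (- (t * P n \<xi>)))) \<le> G \<xi>" for n
      using P0 t by (intro AE_I2) (auto simp: norm_mult G_def abs_mult)
  qed measurable
  from tendsto_Re[OF this] show ?thesis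
    by (rule LIMSEQ_le_const) (use nn in auto)
qed

section \<open>The mixed heat kernel\<close>

text \<open>Makes the Fourier integral in \<open>frac_heat_kernel\<close> absolutely convergent.
  Outside the unit ball an exponential of a power of the frequency decays faster than the
  \<open>N\<close>-th inverse power; the majorant is the already known weight with
  \<open>s = 1/2\<close>, that is, the power \<open>- (d + 1)\<close>.\<close>

lemma exp_levy_exponent_integrable:
  assumes s: "0 < s" "s < 1" and t: "t > 0"
  shows "integrable lborel (\<lambda>\<xi>::'a::euclidean_space. exp (- (t * levy_exponent s \<xi>)))"
proof -
  obtain c where c: "c > 0" "\<And>\<xi>::'a. c * norm \<xi> powr (2 * s) \<le> levy_exponent s \<xi>"
    using levy_exponent_lower_bound[OF s] by blast
  \<comment> \<open>Large enough that \<open>2 * s * N\<close> is at least \<open>d + 1\<close>;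
    \<open>Suc\<close> keeps \<open>N\<close> positive for the division by \<open>N\<close>.\<close>
  define N where "N = Suc (nat \<lceil>(real DIM('a) + 1) / (2 * s)\<rceil>)"
  have "(real DIM('a) + 1) / (2 * s) \<le> real N" unfolding N_def by linarith
  then have N: "real DIM('a) + 1 \<le> 2 * s * real N" "N > 0"
    using s by (auto simp: N_def field_simps)
  define M where "M = (real N / (t * c)) ^ N"
  have M: "M \<ge> 0" unfolding M_def using t c(1) by simp
  let ?g = "\<lambda>\<xi>::'a. indicator (cball 0 1) \<xi> + M * (min 1 ((norm \<xi>)\<^sup>2) * levy_weight (1/2) \<xi>)"
  have le: "exp (- (t * levy_exponent s \<xi>)) \<le> ?g \<xi>" for \<xi> :: 'a
  proof (cases "norm \<xi> \<le> 1")
    case True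
    then show ?thesis using levy_exponent_nonneg[OF s, of \<xi>] t M by (simp add: add_increasing2)
  next
    case False
    define z where "z = t * (c * norm \<xi> powr (2 * s))"
    have z: "z > 0" unfolding z_def using t c(1) False by (intro mult_pos_pos) auto
    have "exp (- (t * levy_exponent s \<xi>)) \<le> exp (- z)"
      unfolding z_def using c(2)[of \<xi>] t by simp
    also have "\<dots> \<le> inverse ((z / N) ^ N)"
    proof -
      have "(z / N) ^ N \<le> (1 + z / N) ^ N" using z by (intro power_mono) auto
      also have "\<dots> \<le> exp z" using z N(2) by (intro exp_ge_one_plus_x_over_n_power_n) auto
      finally show ?thesis unfolding exp_minus using z N(2) by (intro le_imp_inverse_le) auto
    qed
    also have "\<dots> = M * inverse (norm \<xi> powr (2 * s * real N))"
    proof -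
      have "norm \<xi> powr (2 * s * real N) = (norm \<xi> powr (2 * s)) ^ N"
        using False by (subst powr_powr[symmetric], subst powr_realpow) auto
      then show ?thesis unfolding M_def z_def by (simp add: power_divide power_mult_distrib divide_simps)
    qed
    also have "\<dots> \<le> M * inverse (norm \<xi> powr (real DIM('a) + 2 * (1/2)))"
      using N False M by (intro mult_left_mono le_imp_inverse_le powr_mono) auto
    also have "\<dots> = M * (1 * levy_weight (1/2) \<xi>)" by (simp add: levy_weight_def)
    also have "1 = min 1 ((norm \<xi>)\<^sup>2)" using False by (simp add: min_def)
    finally show ?thesis using False by simp
  qed
  have "integrable lborel ?g"
    by (intro Bochner_Integration.integrable_add integrable_real_indicator integrable_mult_right levy_weight_integrable)
      (auto simp: emeasure_cball)
  then show ?thesis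
    by (rule Bochner_Integration.integrable_bound) (use le in \<open>auto intro!: AE_I2 order_trans[OF le abs_ge_self]\<close>)
qed

lemma powr_minus_half_nat:
  fixes z :: real
  assumes "z > 0"
  shows "z powr (- (real n / 2)) = inverse (sqrt z ^ n)"
proof -
  have "sqrt z ^ n = sqrt z powr real n" using assms by (simp add: powr_realpow)
  also have "\<dots> = z powr (real n / 2)" using assms by (simp add: powr_half_sqrt[symmetric] powr_powr)
  finally show ?thesis by (simp add: powr_minus)
qed

text \<open>The convolution theorem: after exchanging the integrals, the inner one is the transform
  of a translated Gaussian and contributes \<open>exp (- (t * (norm \<xi>)\<^sup>2))\<close>, while
  its mass cancels the prefactor. All later facts on the kernel start from this formula.\<close>

lemma mixed_heat_kernel_eq:
  fixes x :: "'a::euclidean_space"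
  assumes s: "0 < s" "s < 1" and t: "t > 0"
  shows "mixed_heat_kernel s t x =
    Re (LINT \<xi>|lborel. cis (x \<bullet> \<xi>) * complex_of_real (exp (- (t * mixed_symbol s \<xi>)))) / (2 * pi) ^ DIM('a)"
proof -
  define E where "E = (\<lambda>\<xi>::'a. exp (- (t * levy_exponent s \<xi>)))"
  define G where "G = (\<lambda>y::'a. exp (- ((norm (x - y))\<^sup>2 / (4 * t))))"
  define H where "H = (\<lambda>y::'a. LINT \<xi>|lborel. cis (y \<bullet> \<xi>) * complex_of_real (E \<xi>))"
  have Ei: "integrable lborel E" unfolding E_def by (rule exp_levy_exponent_integrable[OF s t])
  have Em [measurable]: "E \<in> borel_measurable borel" unfolding E_def by measurable
  have Gm [measurable]: "G \<in> borel_measurable borel" unfolding G_def by measurable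
  have G': "G (x + z) = exp (- (1 / (4 * t) * (norm z)\<^sup>2))" for z by (simp add: G_def)
  have Gi: "integrable lborel G"
  proof -
    have "integrable lborel (\<lambda>z. G (x + z))"
      unfolding G' by (rule gaussian_integrable) (use t in simp)
    from lborel_integrable_affine[OF _ this, of 1 "- x"] show ?thesis by simp
  qed
  let ?h = "\<lambda>y \<xi>. complex_of_real (G y) * (cis (y \<bullet> \<xi>) * complex_of_real (E \<xi>))"
  have int: "integrable (lborel \<Otimes>\<^sub>M lborel) (\<lambda>(y, \<xi>). ?h y \<xi>)"
    by (rule integrable_lborel_pair_bound[OF _ Gi Ei]) (auto simp: norm_mult G_def E_def)
  have Hint: "integrable lborel (\<lambda>y. complex_of_real (G y) * H y)"
    using lborel_pair.integrable_fst[OF int] unfolding H_def by simp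
  have K: "frac_heat_kernel s t y = Re (H y) / (2 * pi) ^ DIM('a)" for y :: 'a
    unfolding frac_heat_kernel_def H_def E_def frac_symbol_eq[OF s]
    by (simp add: exp_of_real[symmetric])
  have in_gauss: "(LINT y|lborel. complex_of_real (G y) * cis (y \<bullet> \<xi>)) =
      complex_of_real (sqrt (4 * pi * t) ^ DIM('a) * exp (- (t * (norm \<xi>)\<^sup>2))) * cis (x \<bullet> \<xi>)" for \<xi>
  proof -
    have "(LINT y|lborel. complex_of_real (G y) * cis (y \<bullet> \<xi>)) =
        (LINT z|lborel. complex_of_real (G (x + z)) * cis ((x + z) \<bullet> \<xi>))"
      using lborel_integral_affine[of 1 "\<lambda>y. complex_of_real (G y) * cis (y \<bullet> \<xi>)" x] by simp
    also have "\<dots> = (LINT z|lborel. cis (x \<bullet> \<xi>) * (cis (\<xi> \<bullet> z) * exp (- (1 / (4 * t) * (norm z)\<^sup>2))))"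
      unfolding G' by (simp add: inner_add_left cis_mult[symmetric] inner_commute[of \<xi>] mult_ac)
    also have "\<dots> = cis (x \<bullet> \<xi>) * (LINT z|lborel. cis (\<xi> \<bullet> z) * exp (- (1 / (4 * t) * (norm z)\<^sup>2)))"
      by (rule integral_mult_right_zero)
    also have "\<dots> = complex_of_real (sqrt (4 * pi * t) ^ DIM('a) * exp (- (t * (norm \<xi>)\<^sup>2))) * cis (x \<bullet> \<xi>)"
      using t by (subst gaussian_fourier(2)) (auto simp: mult_ac)
    finally show ?thesis .
  qed
  have "(LINT y|lborel. complex_of_real (G y) * H y) = (LINT y|lborel. LINT \<xi>|lborel. ?h y \<xi>)"
    unfolding H_def by simp
  also have "\<dots> = (LINT \<xi>|lborel. LINT y|lborel. ?h y \<xi>)"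
    by (rule lborel_pair.Fubini_integral[OF int, symmetric])
  also have "\<dots> = (LINT \<xi>|lborel. complex_of_real (sqrt (4 * pi * t) ^ DIM('a)) * (cis (x \<bullet> \<xi>) * complex_of_real (exp (- (t * mixed_symbol s \<xi>)))))"
  proof (intro Bochner_Integration.integral_cong refl)
    fix \<xi> :: 'a
    have "(LINT y|lborel. ?h y \<xi>) = (LINT y|lborel. complex_of_real (E \<xi>) * (complex_of_real (G y) * cis (y \<bullet> \<xi>)))"
      by (simp only: mult_ac)
    also have "\<dots> = complex_of_real (E \<xi>) * (complex_of_real (sqrt (4 * pi * t) ^ DIM('a) * exp (- (t * (norm \<xi>)\<^sup>2))) * cis (x \<bullet> \<xi>))"
      unfolding in_gauss[symmetric] by (rule integral_mult_right_zero)
    also have "exp (- (t * mixed_symbol s \<xi>)) = exp (- (t * (norm \<xi>)\<^sup>2)) * E \<xi>"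
      unfolding E_def mixed_symbol_def by (simp add: exp_add[symmetric] algebra_simps)
    then have "complex_of_real (E \<xi>) * (complex_of_real (sqrt (4 * pi * t) ^ DIM('a) * exp (- (t * (norm \<xi>)\<^sup>2))) * cis (x \<bullet> \<xi>))
       = complex_of_real (sqrt (4 * pi * t) ^ DIM('a)) * (cis (x \<bullet> \<xi>) * complex_of_real (exp (- (t * mixed_symbol s \<xi>))))"
      by (simp only: of_real_mult mult_ac)
    finally show "(LINT y|lborel. ?h y \<xi>) = complex_of_real (sqrt (4 * pi * t) ^ DIM('a)) * (cis (x \<bullet> \<xi>) * complex_of_real (exp (- (t * mixed_symbol s \<xi>))))" .
  qed
  also have "\<dots> = complex_of_real (sqrt (4 * pi * t) ^ DIM('a)) * (LINT \<xi>|lborel. cis (x \<bullet> \<xi>) * complex_of_real (exp (- (t * mixed_symbol s \<xi>))))"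
    by (rule integral_mult_right_zero)
  finally have F: "(LINT y|lborel. complex_of_real (G y) * H y) = \<dots>" .
  have "(LINT y|lborel. G y * frac_heat_kernel s t y) = (LINT y|lborel. Re (complex_of_real (G y) * H y) / (2 * pi) ^ DIM('a))"
    unfolding K by simp
  also have "\<dots> = Re (LINT y|lborel. complex_of_real (G y) * H y) / (2 * pi) ^ DIM('a)"
    using Hint by (subst integral_divide_zero, subst integral_Re) auto
  finally have "mixed_heat_kernel s t x = (4 * pi * t) powr (- (real DIM('a) / 2)) *
      (Re (LINT y|lborel. complex_of_real (G y) * H y) / (2 * pi) ^ DIM('a))"
    unfolding mixed_heat_kernel_def G_def by simp
  moreover have "(4 * pi * t) powr (- (real DIM('a) / 2)) * sqrt (4 * pi * t) ^ DIM('a) = 1"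
    using t by (simp add: powr_minus_half_nat)
  ultimately show ?thesis
    unfolding F by (simp add: mult.assoc[symmetric])
qed

section \<open>Sign, bounds, continuity and mass of the mixed heat kernel\<close>

context
  fixes s :: real
  assumes s: "0 < s" "s < 1"
begin

lemma mixed_heat_kernel_nonneg:
  "t > 0 \<Longrightarrow> 0 \<le> mixed_heat_kernel s t x"
  unfolding mixed_heat_kernel_eq[OF s] by (intro divide_nonneg_nonneg fourier_mixed_nonneg[OF s]) auto

lemma mixed_fourier_integrable:
  assumes "t > 0"
  shows "integrable lborel (\<lambda>\<xi>. cis (x \<bullet> \<xi>) * complex_of_real (exp (- (t * mixed_symbol s \<xi>))))"
  by (intro integrable_cis_mult integrable_of_real exp_mixed_symbol_integrable[OF s assms])

text \<open>The bound does not depend on \<open>x\<close>: closeness of the multipliers in mean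
  gives uniform closeness of the kernels, and with it uniform time continuity of the semigroup on
  test functions at positive times.\<close>

lemma mixed_heat_kernel_diff_le:
  fixes x :: "'a::euclidean_space"
  assumes "t > 0" "r > 0"
  shows "\<bar>mixed_heat_kernel s t x - mixed_heat_kernel s r x\<bar> \<le>
    (LINT \<xi>|lborel. \<bar>exp (- (t * mixed_symbol s \<xi>)) - exp (- (r * mixed_symbol s (\<xi>::'a)))\<bar>) / (2 * pi) ^ DIM('a)"
proof -
  let ?e = "\<lambda>t (\<xi>::'a). complex_of_real (exp (- (t * mixed_symbol s \<xi>)))"
  have "\<bar>mixed_heat_kernel s t x - mixed_heat_kernel s r x\<bar> =
      \<bar>Re ((LINT \<xi>|lborel. cis (x \<bullet> \<xi>) * ?e t \<xi>) - (LINT \<xi>|lborel. cis (x \<bullet> \<xi>) * ?e r \<xi>))\<bar> / (2 * pi) ^ DIM('a)"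
    using assms by (simp add: mixed_heat_kernel_eq[OF s] diff_divide_distrib[symmetric] abs_divide)
  also have "\<dots> \<le> norm ((LINT \<xi>|lborel. cis (x \<bullet> \<xi>) * ?e t \<xi>) - (LINT \<xi>|lborel. cis (x \<bullet> \<xi>) * ?e r \<xi>)) / (2 * pi) ^ DIM('a)"
    by (intro divide_right_mono abs_Re_le_cmod) simp
  also have "(LINT \<xi>|lborel. cis (x \<bullet> \<xi>) * ?e t \<xi>) - (LINT \<xi>|lborel. cis (x \<bullet> \<xi>) * ?e r \<xi>)
     = (LINT \<xi>|lborel. cis (x \<bullet> \<xi>) * ?e t \<xi> - cis (x \<bullet> \<xi>) * ?e r \<xi>)"
    by (rule Bochner_Integration.integral_diff[symmetric]) (intro mixed_fourier_integrable assms)+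
  also have "norm \<dots> \<le> (LINT \<xi>|lborel. norm (cis (x \<bullet> \<xi>) * ?e t \<xi> - cis (x \<bullet> \<xi>) * ?e r \<xi>))"
    by (rule integral_norm_bound)
  also have "\<dots> = (LINT \<xi>|lborel. \<bar>exp (- (t * mixed_symbol s \<xi>)) - exp (- (r * mixed_symbol s (\<xi>::'a)))\<bar>)"
    by (simp add: right_diff_distrib[symmetric] norm_mult of_real_diff[symmetric] del: of_real_diff)
  finally show ?thesis by (simp add: divide_right_mono)
qed

text \<open>Dropping the nonnegative fractional part of the symbol leaves a Gaussian integral, whose
  value is that of the classical heat kernel at the origin.\<close>

lemma mixed_heat_kernel_le:
  fixes x :: "'a::euclidean_space"
  assumes "t > 0"
  shows "mixed_heat_kernel s t x \<le> (4 * pi * t) powr (- (real DIM('a) / 2))"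
proof -
  let ?e = "\<lambda>\<xi>::'a. complex_of_real (exp (- (t * mixed_symbol s \<xi>)))"
  have "mixed_heat_kernel s t x \<le> norm (LINT \<xi>|lborel. cis (x \<bullet> \<xi>) * ?e \<xi>) / (2 * pi) ^ DIM('a)"
    unfolding mixed_heat_kernel_eq[OF s assms] by (intro divide_right_mono complex_Re_le_cmod) simp
  also have "norm (LINT \<xi>|lborel. cis (x \<bullet> \<xi>) * ?e \<xi>) \<le> (LINT \<xi>|lborel. norm (cis (x \<bullet> \<xi>) * ?e \<xi>))"
    by (rule integral_norm_bound)
  also have "\<dots> = (LINT \<xi>|lborel. exp (- (t * mixed_symbol s (\<xi>::'a))))"
    by (simp add: norm_mult)
  also have "\<dots> \<le> (LINT \<xi>|lborel. exp (- (t * (norm (\<xi>::'a))\<^sup>2)))"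
    using assms by (intro integral_mono exp_mixed_symbol_integrable[OF s] gaussian_integrable(1) exp_mixed_symbol_le[OF s]) auto
  also have "\<dots> = sqrt (pi / t) ^ DIM('a)" using assms by (rule gaussian_integrable)
  also have "sqrt (pi / t) ^ DIM('a) / (2 * pi) ^ DIM('a) = (4 * pi * t) powr (- (real DIM('a) / 2))"
  proof -
    have "sqrt (pi / t) / (2 * pi) = 1 / sqrt (4 * pi * t)"
      using assms by (simp add: real_sqrt_divide real_sqrt_mult field_simps)
    then have "sqrt (pi / t) ^ DIM('a) / (2 * pi) ^ DIM('a) = (1 / sqrt (4 * pi * t)) ^ DIM('a)"
      by (simp only: power_divide[symmetric])
    also have "\<dots> = (4 * pi * t) powr (- (real DIM('a) / 2))"
      using assms by (subst powr_minus_half_nat) (auto simp: power_divide inverse_eq_divide)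
    finally show ?thesis .
  qed
  finally show ?thesis by (simp add: divide_right_mono)
qed

lemma mixed_symbol_diff_tendsto_0:
  assumes r: "r > 0" and t: "t \<longlonglongrightarrow> r" and ge: "\<And>n. t n \<ge> a" "a > 0"
  shows "(\<lambda>n. LINT \<xi>|lborel. \<bar>exp (- (t n * mixed_symbol s \<xi>)) - exp (- (r * mixed_symbol s (\<xi>::'a::euclidean_space)))\<bar>) \<longlonglongrightarrow> 0"
proof -
  have ra: "a \<le> r" using LIMSEQ_le_const[OF t] ge by blast
  have "(\<lambda>n. LINT \<xi>|lborel. \<bar>exp (- (t n * mixed_symbol s \<xi>)) - exp (- (r * mixed_symbol s (\<xi>::'a)))\<bar>) \<longlonglongrightarrow> (LINT \<xi>|(lborel::'a measure). 0)"
  proof (rule integral_dominated_convergence)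
    show "integrable lborel (\<lambda>\<xi>::'a. 2 * exp (- (a * (norm \<xi>)\<^sup>2)))"
      using ge by (intro integrable_mult_right gaussian_integrable)
    show "AE \<xi>::'a in lborel. (\<lambda>n. \<bar>exp (- (t n * mixed_symbol s \<xi>)) - exp (- (r * mixed_symbol s \<xi>))\<bar>) \<longlonglongrightarrow> 0"
      by (intro AE_I2 tendsto_rabs_zero LIM_zero tendsto_intros t)
    show "AE \<xi>::'a in lborel. norm \<bar>exp (- (t n * mixed_symbol s \<xi>)) - exp (- (r * mixed_symbol s \<xi>))\<bar> \<le> 2 * exp (- (a * (norm \<xi>)\<^sup>2))" for n
    proof (intro AE_I2)
      fix \<xi> :: 'a
      have "exp (- (t n * mixed_symbol s \<xi>)) \<le> exp (- (a * (norm \<xi>)\<^sup>2))" "exp (- (r * mixed_symbol s \<xi>)) \<le> exp (- (a * (norm \<xi>)\<^sup>2))"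
        using ge ra by (intro exp_mixed_symbol_le[OF s]; simp)+
      then show "norm \<bar>exp (- (t n * mixed_symbol s \<xi>)) - exp (- (r * mixed_symbol s \<xi>))\<bar> \<le> 2 * exp (- (a * (norm \<xi>)\<^sup>2))"
        using exp_gt_zero[of "- (t n * mixed_symbol s \<xi>)"] exp_gt_zero[of "- (r * mixed_symbol s \<xi>)"]
        unfolding real_norm_def abs_abs by linarith
    qed
  qed measurable
  then show ?thesis by simp
qed

text \<open>The common lower bound \<open>a\<close> on the times provides a single Gaussian majorant
  for all multipliers.\<close>

lemma mixed_heat_kernel_tendsto:
  fixes x :: "nat \<Rightarrow> 'a::euclidean_space"
  assumes r: "r > 0" and t: "t \<longlonglongrightarrow> r" and ge: "\<And>n. t n \<ge> a" "a > 0" and x: "x \<longlonglongrightarrow> y"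
  shows "(\<lambda>n. mixed_heat_kernel s (t n) (x n)) \<longlonglongrightarrow> mixed_heat_kernel s r y"
proof -
  have t0: "t n > 0" for n using ge(1)[of n] ge(2) by linarith
  have "(\<lambda>n. LINT \<xi>|lborel. cis (x n \<bullet> \<xi>) * complex_of_real (exp (- (t n * mixed_symbol s \<xi>))))
      \<longlonglongrightarrow> (LINT \<xi>|lborel. cis (y \<bullet> \<xi>) * complex_of_real (exp (- (r * mixed_symbol s \<xi>))))"
  proof (rule integral_dominated_convergence)
    show "integrable lborel (\<lambda>\<xi>::'a. exp (- (a * (norm \<xi>)\<^sup>2)))"
      using ge by (intro gaussian_integrable)
    show "AE \<xi> in lborel. (\<lambda>n. cis (x n \<bullet> \<xi>) * complex_of_real (exp (- (t n * mixed_symbol s \<xi>))))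
        \<longlonglongrightarrow> cis (y \<bullet> \<xi>) * complex_of_real (exp (- (r * mixed_symbol s \<xi>)))"
      by (intro AE_I2 tendsto_intros t x)
    show "AE \<xi> in lborel. norm (cis (x n \<bullet> \<xi>) * complex_of_real (exp (- (t n * mixed_symbol s \<xi>)))) \<le> exp (- (a * (norm \<xi>)\<^sup>2))" for n
    proof (intro AE_I2)
      fix \<xi> :: 'a
      have "exp (- (t n * mixed_symbol s \<xi>)) \<le> exp (- (a * (norm \<xi>)\<^sup>2))"
        using ge by (intro exp_mixed_symbol_le[OF s]) auto
      then show "norm (cis (x n \<bullet> \<xi>) * complex_of_real (exp (- (t n * mixed_symbol s \<xi>)))) \<le> exp (- (a * (norm \<xi>)\<^sup>2))"
        by (simp add: norm_mult)
    qed
  qed measurable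
  from tendsto_divide[OF tendsto_Re[OF this] tendsto_const[of "(2 * pi) ^ DIM('a)"]] show ?thesis
    using r t0 by (simp add: mixed_heat_kernel_eq[OF s])
qed

lemma mixed_heat_kernel_measurable [measurable]:
  assumes "t > 0"
  shows "mixed_heat_kernel s t \<in> borel_measurable borel"
  unfolding mixed_heat_kernel_eq[OF s assms, abs_def] by measurable

text \<open>The substitution \<open>\<xi> = 2 * sqrt a * \<eta>\<close> makes the limits \<open>a \<rightarrow> 0\<close> (total mass) and
  \<open>t \<rightarrow> 0\<close> (concentration at the origin) two instances of dominated convergence.\<close>

lemma mixed_heat_kernel_gaussian:
  assumes t: "t > 0" and a: "a > 0"
  shows "integrable lborel (\<lambda>x::'a::euclidean_space. exp (- (a * (norm x)\<^sup>2)) * mixed_heat_kernel s t x)"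
    and "(LINT x|lborel. exp (- (a * (norm (x::'a))\<^sup>2)) * mixed_heat_kernel s t x) =
      inverse (sqrt pi ^ DIM('a)) * (LINT \<eta>|lborel. exp (- (norm (\<eta>::'a))\<^sup>2) * exp (- (t * mixed_symbol s ((2 * sqrt a) *\<^sub>R \<eta>))))"
proof -
  define E where "E = (\<lambda>\<xi>::'a. exp (- (t * mixed_symbol s \<xi>)))"
  define G where "G = (\<lambda>x::'a. exp (- (a * (norm x)\<^sup>2)))"
  have Ei: "integrable lborel E" unfolding E_def by (rule exp_mixed_symbol_integrable[OF s t])
  have Gi: "integrable lborel G" unfolding G_def by (rule gaussian_integrable[OF a])
  have Em [measurable]: "E \<in> borel_measurable borel" unfolding E_def by measurable
  have Gm [measurable]: "G \<in> borel_measurable borel" unfolding G_def by measurable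
  let ?h = "\<lambda>x \<xi>. complex_of_real (G x) * (cis (x \<bullet> \<xi>) * complex_of_real (E \<xi>))"
  let ?H = "\<lambda>x. LINT \<xi>|lborel. cis (x \<bullet> \<xi>) * complex_of_real (E \<xi>)"
  have int: "integrable (lborel \<Otimes>\<^sub>M lborel) (\<lambda>(y, \<xi>). ?h y \<xi>)"
    by (rule integrable_lborel_pair_bound[OF _ Gi Ei]) (auto simp: norm_mult G_def E_def)
  have Hint: "integrable lborel (\<lambda>y. complex_of_real (G y) * ?H y)"
    using lborel_pair.integrable_fst[OF int] by simp
  have K: "G x * mixed_heat_kernel s t x = Re (complex_of_real (G x) * ?H x) / (2 * pi) ^ DIM('a)" for x :: 'a
    unfolding mixed_heat_kernel_eq[OF s t] E_def by simp
  show "integrable lborel (\<lambda>x::'a. exp (- (a * (norm x)\<^sup>2)) * mixed_heat_kernel s t x)"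
    unfolding K[unfolded G_def] using integrable_divide[OF integrable_Re[OF Hint], of "(2 * pi) ^ DIM('a)"]
    by (simp add: G_def)
  have g: "(LINT x|lborel. complex_of_real (G x) * cis (x \<bullet> \<xi>)) = complex_of_real (sqrt (pi / a) ^ DIM('a) * exp (- ((norm \<xi>)\<^sup>2 / (4 * a))))" for \<xi>
    using gaussian_fourier(2)[OF a, of \<xi>] by (simp add: G_def mult.commute inner_commute)
  have "(LINT y|lborel. complex_of_real (G y) * ?H y) = (LINT y|lborel. LINT \<xi>|lborel. ?h y \<xi>)"
    by simp
  also have "\<dots> = (LINT \<xi>|lborel. LINT y|lborel. ?h y \<xi>)"
    by (rule lborel_pair.Fubini_integral[OF int, symmetric])
  also have "\<dots> = (LINT \<xi>|lborel. complex_of_real (sqrt (pi / a) ^ DIM('a) * exp (- ((norm \<xi>)\<^sup>2 / (4 * a))) * E \<xi>))"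
  proof (intro Bochner_Integration.integral_cong refl)
    fix \<xi> :: 'a
    have "(LINT y|lborel. ?h y \<xi>) = (LINT y|lborel. complex_of_real (E \<xi>) * (complex_of_real (G y) * cis (y \<bullet> \<xi>)))"
      by (simp only: mult_ac)
    also have "\<dots> = complex_of_real (E \<xi>) * complex_of_real (sqrt (pi / a) ^ DIM('a) * exp (- ((norm \<xi>)\<^sup>2 / (4 * a))))"
      unfolding g[symmetric] by (rule integral_mult_right_zero)
    finally show "(LINT y|lborel. ?h y \<xi>) = complex_of_real (sqrt (pi / a) ^ DIM('a) * exp (- ((norm \<xi>)\<^sup>2 / (4 * a))) * E \<xi>)"
      by (simp only: of_real_mult mult_ac)
  qed
  also have "\<dots> = complex_of_real (LINT \<xi>|lborel. sqrt (pi / a) ^ DIM('a) * (exp (- ((norm \<xi>)\<^sup>2 / (4 * a))) * E \<xi>))"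
    by (simp only: integral_complex_of_real mult.assoc)
  finally have F: "(LINT y|lborel. complex_of_real (G y) * ?H y) =
      complex_of_real (sqrt (pi / a) ^ DIM('a) * (LINT \<xi>|lborel. exp (- ((norm \<xi>)\<^sup>2 / (4 * a))) * E \<xi>))"
    by (simp only: integral_mult_right_zero)
  have "(LINT x|lborel. exp (- (a * (norm (x::'a))\<^sup>2)) * mixed_heat_kernel s t x)
      = (LINT x|lborel. Re (complex_of_real (G x) * ?H x) / (2 * pi) ^ DIM('a))"
    unfolding K[unfolded G_def] by (simp add: G_def)
  also have "\<dots> = Re (LINT x|lborel. complex_of_real (G x) * ?H x) / (2 * pi) ^ DIM('a)"
    using Hint by (subst integral_divide_zero, subst integral_Re) auto
  also have "\<dots> = sqrt (pi / a) ^ DIM('a) * (LINT \<xi>|lborel. exp (- ((norm \<xi>)\<^sup>2 / (4 * a))) * E \<xi>) / (2 * pi) ^ DIM('a)"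
    unfolding F by (simp only: Re_complex_of_real)
  also have "(LINT \<xi>|lborel. exp (- ((norm \<xi>)\<^sup>2 / (4 * a))) * E \<xi>) =
      (2 * sqrt a) ^ DIM('a) * (LINT \<eta>|lborel. exp (- (norm \<eta>)\<^sup>2) * E ((2 * sqrt a) *\<^sub>R \<eta>))"
    using a lborel_integral_affine[of "2 * sqrt a" "\<lambda>\<xi>. exp (- ((norm \<xi>)\<^sup>2 / (4 * a))) * E \<xi>" 0]
    by (simp add: power_mult_distrib)
  also have "sqrt (pi / a) ^ DIM('a) * ((2 * sqrt a) ^ DIM('a) * (LINT \<eta>|lborel. exp (- (norm \<eta>)\<^sup>2) * E ((2 * sqrt a) *\<^sub>R \<eta>))) / (2 * pi) ^ DIM('a)
      = (sqrt (pi / a) * (2 * sqrt a) / (2 * pi)) ^ DIM('a) * (LINT \<eta>|lborel. exp (- (norm \<eta>)\<^sup>2) * E ((2 * sqrt a) *\<^sub>R \<eta>))"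
    by (simp add: power_mult_distrib power_divide)
  also have "sqrt (pi / a) * (2 * sqrt a) / (2 * pi) = inverse (sqrt pi)"
    using a by (simp add: real_sqrt_divide field_simps)
  finally show "(LINT x|lborel. exp (- (a * (norm (x::'a))\<^sup>2)) * mixed_heat_kernel s t x) =
      inverse (sqrt pi ^ DIM('a)) * (LINT \<eta>|lborel. exp (- (norm (\<eta>::'a))\<^sup>2) * exp (- (t * mixed_symbol s ((2 * sqrt a) *\<^sub>R \<eta>))))"
    by (simp add: E_def power_inverse)
qed

lemma mixed_symbol_tendsto_0:
  "X \<longlonglongrightarrow> (0 :: 'a::euclidean_space) \<Longrightarrow> (\<lambda>n. mixed_symbol s (X n)) \<longlonglongrightarrow> 0"
  unfolding mixed_symbol_def using levy_exponent_tendsto_0[OF s, of X] by (auto intro!: tendsto_eq_intros)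

lemma gaussian_mass_tendsto_1:
  fixes t a :: "nat \<Rightarrow> real"
  assumes t: "\<And>n. t n \<ge> 0" and lim: "\<And>\<eta>::'a::euclidean_space. (\<lambda>n. t n * mixed_symbol s ((2 * sqrt (a n)) *\<^sub>R \<eta>)) \<longlonglongrightarrow> 0"
  shows "(\<lambda>n. inverse (sqrt pi ^ DIM('a)) * (LINT \<eta>|lborel. exp (- (norm (\<eta>::'a))\<^sup>2) * exp (- (t n * mixed_symbol s ((2 * sqrt (a n)) *\<^sub>R \<eta>))))) \<longlonglongrightarrow> 1"
proof -
  have "(\<lambda>n. LINT \<eta>|lborel. exp (- (norm (\<eta>::'a))\<^sup>2) * exp (- (t n * mixed_symbol s ((2 * sqrt (a n)) *\<^sub>R \<eta>))))
      \<longlonglongrightarrow> (LINT \<eta>|lborel. exp (- (1 * (norm (\<eta>::'a))\<^sup>2)) * exp (- 0))"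
  proof (rule integral_dominated_convergence)
    show "integrable lborel (\<lambda>\<eta>::'a. exp (- (1 * (norm \<eta>)\<^sup>2)))" by (rule gaussian_integrable) simp
    show "AE \<eta>::'a in lborel. (\<lambda>n. exp (- (norm \<eta>)\<^sup>2) * exp (- (t n * mixed_symbol s ((2 * sqrt (a n)) *\<^sub>R \<eta>)))) \<longlonglongrightarrow> exp (- (1 * (norm \<eta>)\<^sup>2)) * exp (- 0)"
      unfolding mult_1 by (intro AE_I2 tendsto_intros lim)
    show "AE \<eta>::'a in lborel. norm (exp (- (norm \<eta>)\<^sup>2) * exp (- (t n * mixed_symbol s ((2 * sqrt (a n)) *\<^sub>R \<eta>)))) \<le> exp (- (1 * (norm \<eta>)\<^sup>2))" for n
      using t mixed_symbol_nonneg[OF s] by (intro AE_I2) (auto simp: abs_mult intro!: mult_nonneg_nonneg)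
  qed measurable
  also have "(LINT \<eta>|lborel. exp (- (1 * (norm (\<eta>::'a))\<^sup>2)) * exp (- 0)) = sqrt pi ^ DIM('a)"
    using gaussian_integrable(2)[of 1, where 'a='a] by simp
  finally have L: "(\<lambda>n. LINT \<eta>|lborel. exp (- (norm (\<eta>::'a))\<^sup>2) * exp (- (t n * mixed_symbol s ((2 * sqrt (a n)) *\<^sub>R \<eta>)))) \<longlonglongrightarrow> sqrt pi ^ DIM('a)" .
  have "inverse (sqrt pi ^ DIM('a)) * sqrt pi ^ DIM('a) = 1" by simp
  then show ?thesis using tendsto_mult[OF tendsto_const[of "inverse (sqrt pi ^ DIM('a))"] L] by (simp only:)
qed

text \<open>Since the kernel is nonnegative, the Gaussian damping can be removed by monotone
  convergence. The damped masses tend to \<open>exp (- 0) = 1\<close>, which gives integrability and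
  mass together.\<close>

lemma mixed_heat_kernel_mass:
  assumes t: "t > 0"
  shows "integrable lborel (mixed_heat_kernel s t :: 'a::euclidean_space \<Rightarrow> real)"
    and "(LINT x|lborel. mixed_heat_kernel s t (x::'a)) = 1"
proof -
  define a where "a = (\<lambda>n. 1 / (real n + 1))"
  have a0: "a n > 0" for n by (simp add: a_def)
  have al: "a \<longlonglongrightarrow> 0" unfolding a_def using LIMSEQ_inverse_real_of_nat by (simp add: inverse_eq_divide add_ac)
  let ?f = "\<lambda>n x::'a. exp (- (a n * (norm x)\<^sup>2)) * mixed_heat_kernel s t x"
  have m [measurable]: "mixed_heat_kernel s t \<in> borel_measurable (borel :: 'a measure)"
    using t by (rule mixed_heat_kernel_measurable)
  have i: "integrable lborel (?f n)" for n by (rule mixed_heat_kernel_gaussian(1)[OF t a0])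
  have mono: "AE x in lborel. mono (\<lambda>n. ?f n x)"
    by (intro AE_I2 monoI mult_right_mono mixed_heat_kernel_nonneg t) (auto simp: a_def intro!: mult_right_mono divide_left_mono)
  have lim: "AE x in lborel. (\<lambda>n. ?f n x) \<longlonglongrightarrow> mixed_heat_kernel s t x"
    using al by (auto intro!: AE_I2 tendsto_eq_intros)
  have ilim: "(\<lambda>n. integral\<^sup>L lborel (?f n)) \<longlonglongrightarrow> 1"
    unfolding mixed_heat_kernel_gaussian(2)[OF t a0]
  proof (rule gaussian_mass_tendsto_1)
    show "(\<lambda>n. t * mixed_symbol s ((2 * sqrt (a n)) *\<^sub>R \<eta>)) \<longlonglongrightarrow> 0" for \<eta> :: 'a
      using al by (intro tendsto_mult_right_zero mixed_symbol_tendsto_0) (auto intro!: tendsto_eq_intros)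
  qed (use t in auto)
  show "integrable lborel (mixed_heat_kernel s t :: 'a \<Rightarrow> real)"
    by (rule integrable_monotone_convergence[OF i mono lim ilim]) simp
  show "(LINT x|lborel. mixed_heat_kernel s t (x::'a)) = 1"
    by (rule integral_monotone_convergence[OF i mono lim ilim]) simp
qed

text \<open>A Chebyshev argument: where \<open>\<delta> \<le> norm x\<close>, the function
  \<open>1 - exp (- (norm x)\<^sup>2)\<close> is at least \<open>?c\<close>, so the outer mass is at
  most \<open>inverse ?c\<close> times 1 minus the Gaussian mean \<open>?q n\<close>, and that mean
  tends to 1.\<close>

lemma mixed_heat_kernel_concentrates:
  assumes t: "\<And>n. t n > 0" "t \<longlonglongrightarrow> 0" and d: "\<delta> > 0"
  shows "(\<lambda>n. LINT x|lborel. indicator {x. \<delta> \<le> norm x} x * mixed_heat_kernel s (t n) (x::'a::euclidean_space)) \<longlonglongrightarrow> 0"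
proof -
  let ?K = "\<lambda>n. mixed_heat_kernel s (t n) :: 'a \<Rightarrow> real"
  let ?q = "\<lambda>n. LINT x|lborel. exp (- (1 * (norm (x::'a))\<^sup>2)) * ?K n x"
  let ?c = "1 - exp (- \<delta>\<^sup>2)"
  have c: "?c > 0" using d by simp
  have m [measurable]: "?K n \<in> borel_measurable (borel :: 'a measure)" for n
    using t(1) by (rule mixed_heat_kernel_measurable)
  have q: "?q \<longlonglongrightarrow> 1"
    unfolding mixed_heat_kernel_gaussian(2)[OF t(1) zero_less_one]
  proof (rule gaussian_mass_tendsto_1)
    show "(\<lambda>n. t n * mixed_symbol s ((2 * sqrt 1) *\<^sub>R \<eta>)) \<longlonglongrightarrow> 0" for \<eta> :: 'a
      by (intro tendsto_mult_left_zero t)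
  qed (use t in \<open>auto intro: less_imp_le\<close>)
  have le: "(LINT x|lborel. indicator {x. \<delta> \<le> norm x} x * ?K n x) \<le> inverse ?c * (1 - ?q n)" for n
  proof -
    note i1 = mixed_heat_kernel_mass[OF t(1), where 'a='a, of n]
    note i2 = mixed_heat_kernel_gaussian(1)[OF t(1) zero_less_one, where 'a='a, of n]
    have "(LINT x|lborel. indicator {x. \<delta> \<le> norm x} x * ?K n x)
        \<le> (LINT x|lborel. inverse ?c * (?K n x - exp (- (1 * (norm x)\<^sup>2)) * ?K n x))"
    proof (rule integral_mono)
      show "integrable lborel (\<lambda>x. indicator {x. \<delta> \<le> norm x} x * ?K n x)"
        by (rule Bochner_Integration.integrable_bound[OF i1(1)]) (auto simp: indicator_def)
      show "integrable lborel (\<lambda>x. inverse ?c * (?K n x - exp (- (1 * (norm x)\<^sup>2)) * ?K n x))"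
        by (intro integrable_mult_right Bochner_Integration.integrable_diff i1 i2)
      fix x :: 'a
      have K0: "0 \<le> ?K n x" using t by (intro mixed_heat_kernel_nonneg)
      have e: "exp (- (1 * (norm x)\<^sup>2)) \<le> 1" by simp
      show "indicator {x. \<delta> \<le> norm x} x * ?K n x \<le> inverse ?c * (?K n x - exp (- (1 * (norm x)\<^sup>2)) * ?K n x)"
      proof (cases "\<delta> \<le> norm x")
        case True
        then have "\<delta>\<^sup>2 \<le> (norm x)\<^sup>2" using d by (intro power_mono) auto
        then have "?c \<le> 1 - exp (- (1 * (norm x)\<^sup>2))" by simp
        then have "1 \<le> inverse ?c * (1 - exp (- (1 * (norm x)\<^sup>2)))" using c by (simp add: field_simps)
        from mult_right_mono[OF this K0] show ?thesis using True by (simp add: algebra_simps)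
      next
        case False
        have "0 \<le> inverse ?c * ((1 - exp (- (1 * (norm x)\<^sup>2))) * ?K n x)"
          using c e K0 by (intro mult_nonneg_nonneg) auto
        then show ?thesis using False by (simp add: algebra_simps)
      qed
    qed
    also have "\<dots> = inverse ?c * (1 - ?q n)"
      using i1 i2 by (subst integral_mult_right_zero, subst Bochner_Integration.integral_diff) auto
    finally show ?thesis .
  qed
  have "(\<lambda>n. inverse ?c * (1 - ?q n)) \<longlonglongrightarrow> inverse ?c * (1 - 1)"
    by (intro tendsto_intros q)
  then have "(\<lambda>n. inverse ?c * (1 - ?q n)) \<longlonglongrightarrow> 0" by simp
  then show ?thesis
  proof (rule tendsto_sandwich[rotated 3, where f="\<lambda>_. 0"])
    show "\<forall>\<^sub>F n in sequentially. (LINT x|lborel. indicator {x. \<delta> \<le> norm x} x * ?K n x) \<le> inverse ?c * (1 - ?q n)"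
      by (intro always_eventually allI le)
    show "\<forall>\<^sub>F n in sequentially. 0 \<le> (LINT x|lborel. indicator {x. \<delta> \<le> norm x} x * ?K n x)"
      by (intro always_eventually allI Bochner_Integration.integral_nonneg mult_nonneg_nonneg mixed_heat_kernel_nonneg t) auto
  qed simp
qed

end

section \<open>Luxemburg balls\<close>

lemma convex_on_abs_powr:
  assumes "1 \<le> p"
  shows "convex_on UNIV (\<lambda>x::real. \<bar>x\<bar> powr p)"
proof (rule convex_onI)
  fix t x y :: real
  assume t: "0 < t" "t < 1"
  have scale: "(c * z) powr p \<le> c * z powr p" if "0 < c" "c < 1" "0 \<le> z" for c z :: real
  proof -
    have "c powr p \<le> c powr 1" using that assms by (intro powr_mono') auto
    then show ?thesis using that by (simp add: powr_mult mult_right_mono)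
  qed
  have "\<bar>(1 - t) *\<^sub>R x + t *\<^sub>R y\<bar> \<le> (1 - t) * \<bar>x\<bar> + t * \<bar>y\<bar>"
    using t abs_triangle_ineq[of "(1 - t) * x" "t * y"] by (simp add: abs_mult)
  then have "\<bar>(1 - t) *\<^sub>R x + t *\<^sub>R y\<bar> powr p \<le> ((1 - t) * \<bar>x\<bar> + t * \<bar>y\<bar>) powr p"
    using assms by (intro powr_mono2) auto
  also have "\<dots> \<le> (1 - t) * \<bar>x\<bar> powr p + t * \<bar>y\<bar> powr p"
  \<comment> \<open>With one point at 0 the claim reduces to \<open>scale\<close>;
    \<open>powr_convex\<close> treats two nonzero points.\<close>
  proof (cases "x = 0 \<or> y = 0")
    case True
    then show ?thesis using scale[of "1 - t" "\<bar>x\<bar>"] scale[of t "\<bar>y\<bar>"] t assms by auto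
  next
    case False
    then show ?thesis
      using convex_onD[OF powr_convex[OF assms], of t "\<bar>x\<bar>" "\<bar>y\<bar>"] t by simp
  qed
  finally show "\<bar>(1 - t) *\<^sub>R x + t *\<^sub>R y\<bar> powr p \<le> (1 - t) * \<bar>x\<bar> powr p + t * \<bar>y\<bar> powr p" .
qed simp

text \<open>Extended evenly to the whole line, where it stays convex, so that Jensen's inequality
  applies to functions of either sign.\<close>

definition young :: "real \<Rightarrow> real \<Rightarrow> real" where
  "young p z = exp (\<bar>z\<bar> powr p) - 1"

lemma young_nonneg [simp]: "0 \<le> young p z"
  by (simp add: young_def)

lemma young_0 [simp]: "young p 0 = 0"
  by (simp add: young_def)

lemma young_minus [simp]: "young p (- z) = young p z"
  by (simp add: young_def)

lemma young_measurable [measurable]: "young p \<in> borel_measurable borel"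
  unfolding young_def by measurable

lemma young_continuous: "p > 0 \<Longrightarrow> continuous_on UNIV (young p)"
  unfolding young_def by (intro continuous_intros continuous_on_powr') auto

lemma young_mono: "0 \<le> p \<Longrightarrow> \<bar>y\<bar> \<le> \<bar>z\<bar> \<Longrightarrow> young p y \<le> young p z"
  unfolding young_def by (simp add: powr_mono2)

lemma convex_on_young:
  assumes "1 \<le> p"
  shows "convex_on UNIV (young p)"
proof (rule convex_onI)
  fix t x y :: real
  assume t: "0 < t" "t < 1"
  have "exp (\<bar>(1 - t) *\<^sub>R x + t *\<^sub>R y\<bar> powr p) \<le> exp ((1 - t) * \<bar>x\<bar> powr p + t * \<bar>y\<bar> powr p)"
    using convex_onD[OF convex_on_abs_powr[OF assms], of t x y] t by simp
  also have "\<dots> \<le> (1 - t) * exp (\<bar>x\<bar> powr p) + t * exp (\<bar>y\<bar> powr p)"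
    using convex_onD[OF exp_convex, of t "\<bar>x\<bar> powr p" "\<bar>y\<bar> powr p"] t by simp
  finally show "young p ((1 - t) *\<^sub>R x + t *\<^sub>R y) \<le> (1 - t) * young p x + t * young p y"
    by (simp add: young_def algebra_simps)
qed simp

lemma young_scale_le:
  assumes "1 \<le> p" "0 \<le> c" "c \<le> 1"
  shows "young p (c * z) \<le> c * young p z"
  using convex_onD[OF convex_on_young[OF assms(1)], of c 0 z] assms by simp

lemma exp_modular_eq:
  assumes "\<mu> > 0"
  shows "exp_modular p \<mu> u = (\<integral>\<^sup>+x. ennreal (young p (u x / \<mu>)) \<partial>lborel)"
  using assms by (simp add: exp_modular_def young_def abs_divide powr_divide)

text \<open>The condition \<open>expL_norm p u \<le> \<mu>\<close>, in a form that keeps track of measurability and avoids the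
  junk value of the infimum of the empty set.\<close>

definition expL_le :: "real \<Rightarrow> real \<Rightarrow> ('a::euclidean_space \<Rightarrow> real) \<Rightarrow> bool" where
  "expL_le p \<mu> u \<longleftrightarrow> u \<in> borel_measurable borel \<and> \<mu> > 0 \<and> (\<integral>\<^sup>+x. ennreal (young p (u x / \<mu>)) \<partial>lborel) \<le> 1"

lemma expL_leD:
  assumes "expL_le p \<mu> u"
  shows "u \<in> borel_measurable borel" "\<mu> > 0" "(\<integral>\<^sup>+x. ennreal (young p (u x / \<mu>)) \<partial>lborel) \<le> 1"
  using assms by (auto simp: expL_le_def)

lemma expL_le_cong_AE:
  assumes "expL_le p \<mu> u" "v \<in> borel_measurable borel" "AE x in lborel. u x = v x"
  shows "expL_le p \<mu> v"
proof -
  have "(\<integral>\<^sup>+x. ennreal (young p (u x / \<mu>)) \<partial>lborel) = (\<integral>\<^sup>+x. ennreal (young p (v x / \<mu>)) \<partial>lborel)"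
    using assms(3) by (intro nn_integral_cong_AE) auto
  then show ?thesis using assms(1,2) by (simp add: expL_le_def)
qed

lemma expL_le_minus:
  assumes "expL_le p \<mu> u"
  shows "expL_le p \<mu> (\<lambda>x. - u x)"
  using assms by (simp add: expL_le_def)

lemma expL_le_diff_commute:
  "expL_le p \<mu> (\<lambda>x. u x - v x) \<Longrightarrow> expL_le p \<mu> (\<lambda>x. v x - u x)"
  using expL_le_minus by fastforce

lemma expL_le_mono:
  assumes "expL_le p a u" "a \<le> b" "0 \<le> p"
  shows "expL_le p b u"
proof -
  have "(\<integral>\<^sup>+x. ennreal (young p (u x / b)) \<partial>lborel) \<le> (\<integral>\<^sup>+x. ennreal (young p (u x / a)) \<partial>lborel)"
    using expL_leD[OF assms(1)] assms(2,3)
    by (intro nn_integral_mono ennreal_leI young_mono) (auto simp: abs_divide intro!: divide_left_mono)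
  then show ?thesis using assms by (auto simp: expL_le_def)
qed

text \<open>The triangle inequality of the Luxemburg norm: \<open>(u + v) / (a + b)\<close> is the
  convex combination of \<open>u / a\<close> and \<open>v / b\<close> with weight
  \<open>b / (a + b)\<close> on the second.\<close>

lemma expL_le_add:
  assumes "expL_le p a u" "expL_le p b v" "1 \<le> p"
  shows "expL_le p (a + b) (\<lambda>x. u x + v x)"
proof -
  note [measurable] = expL_leD(1)[OF assms(1)] expL_leD(1)[OF assms(2)]
  have ab: "a > 0" "b > 0" using assms by (auto dest: expL_leD)
  define t where "t = b / (a + b)"
  have t: "0 \<le> t" "t \<le> 1" "1 - t = a / (a + b)" using ab by (auto simp: t_def field_simps)
  have "young p ((u x + v x) / (a + b)) \<le> (1 - t) * young p (u x / a) + t * young p (v x / b)" for x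
  proof -
    have "(1 - t) * (u x / a) + t * (v x / b) = (u x + v x) / (a + b)"
      unfolding t(3) unfolding t_def using ab by (simp add: divide_simps)
    then show ?thesis
      using convex_onD[OF convex_on_young[OF assms(3)] t(1,2), of "u x / a" "v x / b"] by simp
  qed
  then have "(\<integral>\<^sup>+x. ennreal (young p ((u x + v x) / (a + b))) \<partial>lborel)
      \<le> (\<integral>\<^sup>+x. ennreal (1 - t) * ennreal (young p (u x / a)) + ennreal t * ennreal (young p (v x / b)) \<partial>lborel)"
    using t(1,2) by (intro nn_integral_mono) (simp add: ennreal_mult'[symmetric] ennreal_plus[symmetric] ennreal_leI del: ennreal_plus)
  also have "\<dots> = ennreal (1 - t) * (\<integral>\<^sup>+x. ennreal (young p (u x / a)) \<partial>lborel) + ennreal t * (\<integral>\<^sup>+x. ennreal (young p (v x / b)) \<partial>lborel)"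
    by (simp add: nn_integral_add nn_integral_cmult)
  also have "\<dots> \<le> ennreal (1 - t) * 1 + ennreal t * 1"
    using expL_leD(3)[OF assms(1)] expL_leD(3)[OF assms(2)] by (intro add_mono mult_left_mono) auto
  also have "\<dots> = 1" using t by (simp add: ennreal_plus[symmetric] del: ennreal_plus)
  finally show ?thesis using ab by (simp add: expL_le_def)
qed

lemma expL_le_diff:
  assumes "expL_le p a u" "expL_le p b v" "1 \<le> p"
  shows "expL_le p (a + b) (\<lambda>x. u x - v x)"
  using expL_le_add[OF assms(1) expL_le_minus[OF assms(2)] assms(3)] by simp

lemma expL_le_triangle:
  assumes "expL_le p a (\<lambda>x. u x - v x)" "expL_le p b (\<lambda>x. v x - w x)" "1 \<le> p"
  shows "expL_le p (a + b) (\<lambda>x. u x - w x)"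
  using expL_le_add[OF assms] by simp

lemma expL_le_0: "p > 0 \<Longrightarrow> \<mu> > 0 \<Longrightarrow> expL_le p \<mu> (\<lambda>x. 0)"
  by (simp add: expL_le_def)

text \<open>Luxemburg balls are closed under pointwise limits; this is how the limit of the Picard
  iterates inherits their bounds. Convergence is asked at every point, so the limit is Borel
  measurable as well.\<close>

lemma expL_le_Fatou:
  assumes u: "\<And>n. expL_le p \<mu> (u n)" and lim: "\<And>x. (\<lambda>n. u n x) \<longlonglongrightarrow> v x" and p: "p > 0"
  shows "expL_le p \<mu> v"
proof -
  have um [measurable]: "u n \<in> borel_measurable borel" for n using u by (rule expL_leD)
  have m: "\<mu> > 0" using u by (rule expL_leD)
  have vm: "v \<in> borel_measurable borel" using um lim by (rule borel_measurable_LIMSEQ_real[rotated])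
  have "(\<lambda>n. ennreal (young p (u n x / \<mu>))) \<longlonglongrightarrow> ennreal (young p (v x / \<mu>))" for x
    using young_continuous[OF p] lim[of x] m
    by (intro tendsto_ennrealI continuous_on_tendsto_compose[where f="young p" and s=UNIV]) (auto intro!: tendsto_intros)
  then have "(\<integral>\<^sup>+x. ennreal (young p (v x / \<mu>)) \<partial>lborel) = (\<integral>\<^sup>+x. liminf (\<lambda>n. ennreal (young p (u n x / \<mu>))) \<partial>lborel)"
    by (intro nn_integral_cong lim_imp_Liminf[symmetric]) auto
  also have "\<dots> \<le> liminf (\<lambda>n. \<integral>\<^sup>+x. ennreal (young p (u n x / \<mu>)) \<partial>lborel)"
    by (rule nn_integral_liminf) measurable
  also have "\<dots> \<le> liminf (\<lambda>n. 1)"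
    by (intro Liminf_mono always_eventually allI expL_leD(3)[OF u])
  also have "\<dots> = 1" by (simp add: Liminf_const)
  finally show ?thesis using vm m by (simp add: expL_le_def)
qed

section \<open>Comparison of Luxemburg balls with powers and with bounded functions\<close>

lemma powr_le_young:
  assumes p: "0 < p" and m: "p \<le> m"
  obtains c where "c > 0" "\<And>z. \<bar>z\<bar> powr m \<le> c * young p z"
proof -
  define N where "N = Suc (nat \<lceil>m / p\<rceil>)"
  have N: "m / p \<le> real N" "N > 0" unfolding N_def by (auto simp: le_nat_iff) linarith
  define c where "c = 1 + real N ^ N"
  have "\<bar>z\<bar> powr m \<le> c * young p z" for z
  proof (cases "z = 0")
    case False
    define X where "X = \<bar>z\<bar> powr p"
    have X: "X > 0" using False by (simp add: X_def)
    have 1: "X \<le> exp X - 1" using exp_ge_add_one_self[of X] by linarith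
    \<comment> \<open>From \<open>1 + (X / N) ^ N \<le> (1 + X / N) ^ N \<le> exp X\<close>.
      Together with \<open>X \<le> exp X - 1\<close> this bounds \<open>X powr (m / p)\<close>, the
      first power covering \<open>X \<le> 1\<close> and the \<open>N\<close>-th power covering
      larger \<open>X\<close>.\<close>
    have 2: "X ^ N \<le> real N ^ N * (exp X - 1)"
    proof -
      have sup: "1 + y ^ k \<le> (1 + y) ^ k" if "0 \<le> y" "0 < k" for y :: real and k
        using that(2,1)
      proof (induction k rule: nat_induct_non_zero)
        case (Suc k)
        have "1 + y ^ Suc k \<le> (1 + y) * (1 + y ^ k)" using Suc.prems by (simp add: algebra_simps)
        also have "\<dots> \<le> (1 + y) * (1 + y) ^ k" using Suc by (intro mult_left_mono) auto
        finally show ?case by simp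
      qed simp
      have "(1 + X / N) ^ N \<le> exp X" using X N by (intro exp_ge_one_plus_x_over_n_power_n) auto
      then have "(X / N) ^ N \<le> exp X - 1" using sup[of "X / N" N] X N by simp
      then show ?thesis using N by (simp add: power_divide field_simps)
    qed
    have "\<bar>z\<bar> powr m = X powr (m / p)" using p by (simp add: X_def powr_powr)
    also have "\<dots> \<le> X + X ^ N"
    proof (cases "X \<le> 1")
      case True
      have "X powr (m / p) \<le> X powr 1" using True X p m by (intro powr_mono') auto
      then show ?thesis using X by (simp add: add_increasing2)
    next
      case False
      have "X powr (m / p) \<le> X powr real N" using False N by (intro powr_mono) auto
      then show ?thesis using X by (simp add: powr_realpow add_increasing)
    qed
    also have "\<dots> \<le> c * (exp X - 1)" unfolding c_def distrib_right mult_1 by (rule add_mono[OF 1 2])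
    finally show ?thesis by (simp add: young_def X_def)
  qed (use p m in auto)
  moreover have "c > 0" unfolding c_def by (simp add: add_pos_nonneg)
  ultimately show ?thesis using that[of c] by blast
qed

lemma young_le_powr:
  assumes "0 < p" "\<bar>z\<bar> \<le> B"
  shows "young p z \<le> exp (B powr p) * \<bar>z\<bar> powr p"
proof -
  have "1 - \<bar>z\<bar> powr p \<le> exp (- (\<bar>z\<bar> powr p))" using exp_ge_add_one_self[of "- (\<bar>z\<bar> powr p)"] by linarith
  then have "exp (\<bar>z\<bar> powr p) * (1 - \<bar>z\<bar> powr p) \<le> 1"
    by (simp add: exp_minus field_simps)
  then have "young p z \<le> exp (\<bar>z\<bar> powr p) * \<bar>z\<bar> powr p" by (simp add: young_def algebra_simps)
  also have "\<dots> \<le> exp (B powr p) * \<bar>z\<bar> powr p"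
    using assms by (intro mult_right_mono) (auto intro: powr_mono2)
  finally show ?thesis .
qed

text \<open>The embedding of the intersection of L^p and L^\<infinity> into exp L^p. On values below
  \<open>B / \<mu>\<close> the Young function is at most \<open>exp ((B / \<mu>) powr p)\<close>
  times a \<open>p\<close>-th power. The smallness condition is left as a hypothesis because each
  use balances \<open>B\<close>, \<open>J\<close> and \<open>\<mu>\<close> differently.\<close>

lemma expL_le_bounded:
  assumes "u \<in> borel_measurable borel" and \<mu>: "\<mu> > 0" and B: "\<And>x. \<bar>u x\<bar> \<le> B"
    and J: "(\<integral>\<^sup>+x. ennreal (\<bar>u x\<bar> powr p) \<partial>lborel) \<le> ennreal J" "0 \<le> J"
    and le: "exp ((B / \<mu>) powr p) * J \<le> \<mu> powr p" and p: "p > 0"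
  shows "expL_le p \<mu> u"
proof -
  have [measurable]: "u \<in> borel_measurable borel" by fact
  let ?c = "exp ((B / \<mu>) powr p) / \<mu> powr p"
  have "young p (u x / \<mu>) \<le> ?c * \<bar>u x\<bar> powr p" for x
    using young_le_powr[OF p, of "u x / \<mu>" "B / \<mu>"] B[of x] \<mu>
    by (simp add: abs_divide divide_right_mono powr_divide)
  then have "(\<integral>\<^sup>+x. ennreal (young p (u x / \<mu>)) \<partial>lborel) \<le> (\<integral>\<^sup>+x. ennreal ?c * ennreal (\<bar>u x\<bar> powr p) \<partial>lborel)"
    by (intro nn_integral_mono) (simp add: ennreal_mult'[symmetric] ennreal_leI)
  also have "\<dots> = ennreal ?c * (\<integral>\<^sup>+x. ennreal (\<bar>u x\<bar> powr p) \<partial>lborel)"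
    by (rule nn_integral_cmult) measurable
  also have "\<dots> \<le> ennreal ?c * ennreal J" using J by (intro mult_left_mono) auto
  also have "\<dots> = ennreal (?c * J)" using \<mu> by (intro ennreal_mult'[symmetric]) auto
  also have "\<dots> \<le> 1" using le \<mu> by (simp add: ennreal_le_1 divide_le_eq)
  finally show ?thesis using \<mu> by (simp add: expL_le_def)
qed

lemma expL_le_powr:
  assumes p: "0 < p" and m: "p \<le> m"
  shows "\<exists>c>0. \<forall>\<mu> u. expL_le p \<mu> (u :: 'a::euclidean_space \<Rightarrow> real) \<longrightarrow>
    (\<integral>\<^sup>+x. ennreal (\<bar>u x\<bar> powr m) \<partial>lborel) \<le> ennreal (c * \<mu> powr m)"
proof -
  obtain c where c: "c > 0" "\<And>z. \<bar>z\<bar> powr m \<le> c * young p z" using powr_le_young[OF p m] by blast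
  have "(\<integral>\<^sup>+x. ennreal (\<bar>u x\<bar> powr m) \<partial>lborel) \<le> ennreal (c * \<mu> powr m)" if u: "expL_le p \<mu> u" for \<mu> and u :: "'a \<Rightarrow> real"
  proof -
    note [measurable] = expL_leD(1)[OF u]
    have \<mu>: "\<mu> > 0" using u by (rule expL_leD)
    have "\<bar>u x\<bar> powr m \<le> (c * \<mu> powr m) * young p (u x / \<mu>)" for x
      using c(2)[of "u x / \<mu>"] \<mu> by (simp add: abs_divide powr_divide field_simps)
    then have "(\<integral>\<^sup>+x. ennreal (\<bar>u x\<bar> powr m) \<partial>lborel) \<le> (\<integral>\<^sup>+x. ennreal (c * \<mu> powr m) * ennreal (young p (u x / \<mu>)) \<partial>lborel)"
      using c by (intro nn_integral_mono) (simp add: ennreal_mult'[symmetric] ennreal_leI)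
    also have "\<dots> = ennreal (c * \<mu> powr m) * (\<integral>\<^sup>+x. ennreal (young p (u x / \<mu>)) \<partial>lborel)"
      by (rule nn_integral_cmult) measurable
    also have "\<dots> \<le> ennreal (c * \<mu> powr m) * 1" using expL_leD(3)[OF u] by (intro mult_left_mono) auto
    finally show ?thesis by simp
  qed
  then show ?thesis using c(1) by blast
qed

lemma expL_le_all_imp_0:
  fixes u :: "'a::euclidean_space \<Rightarrow> real"
  assumes "1 \<le> p" "\<And>\<mu>. \<mu> > 0 \<Longrightarrow> expL_le p \<mu> u"
  shows "AE x in lborel. u x = 0"
proof -
  have [measurable]: "u \<in> borel_measurable borel" using assms(2)[of 1] by (auto dest: expL_leD)
  have p: "0 < p" using assms(1) by simp
  obtain c where c: "c > 0" "\<And>\<mu> u. expL_le p \<mu> (u :: 'a \<Rightarrow> real) \<Longrightarrow> (\<integral>\<^sup>+x. ennreal (\<bar>u x\<bar> powr p) \<partial>lborel) \<le> ennreal (c * \<mu> powr p)"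
    using expL_le_powr[OF p order_refl, where 'a='a] by auto
  have "(\<integral>\<^sup>+x. ennreal (\<bar>u x\<bar> powr p) \<partial>lborel) \<le> 0 + ennreal e" if "e > 0" for e
  proof -
    \<comment> \<open>Solves \<open>c * \<mu> powr p = e\<close>, so that the ball of this radius
      bounds the \<open>p\<close>-th moment by \<open>e\<close>.\<close>
    define \<mu> where "\<mu> = (e / c) powr (1 / p)"
    have "c * \<mu> powr p = e" using c(1) that assms(1) by (simp add: \<mu>_def powr_powr)
    moreover have "\<mu> > 0" using c(1) that by (simp add: \<mu>_def)
    ultimately show ?thesis using c(2)[OF assms(2)[of \<mu>]] by simp
  qed
  then have "(\<integral>\<^sup>+x. ennreal (\<bar>u x\<bar> powr p) \<partial>lborel) \<le> 0"
    by (rule ennreal_le_epsilon)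
  then have "(\<integral>\<^sup>+x. ennreal (\<bar>u x\<bar> powr p) \<partial>lborel) = 0"
    by (simp only: le_zero_eq)
  then have "AE x in lborel. ennreal (\<bar>u x\<bar> powr p) = 0"
    by (subst (asm) nn_integral_0_iff_AE) measurable
  then show ?thesis by eventually_elim (simp add: ennreal_eq_0_iff)
qed

text \<open>Local integrability follows from \<open>\<bar>z\<bar> \<le> 1 + young p z\<close>: the
  constant is integrable over compact sets and the modular is at most 1.\<close>

lemma expL_le_imp_expL:
  assumes u: "expL_le p \<mu> u" and p: "1 \<le> p"
  shows "u \<in> expL p" "expL_norm p u \<le> \<mu>"
proof -
  note [measurable] = expL_leD(1)[OF u]
  have \<mu>: "\<mu> > 0" using u by (rule expL_leD)
  have M: "exp_modular p \<mu> u \<le> 1" using expL_leD(3)[OF u] exp_modular_eq[OF \<mu>, of p u] by simp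
  have "set_integrable lborel K u" if "compact K" for K
    unfolding set_integrable_def
  proof (rule integrableI_bounded)
    have [measurable]: "K \<in> sets borel" using that by (rule borel_compact)
    show "(\<lambda>x. indicat_real K x *\<^sub>R u x) \<in> borel_measurable lborel" by measurable
    have "\<bar>u x\<bar> \<le> \<mu> * (1 + young p (u x / \<mu>))" for x
    proof -
      let ?z = "\<bar>u x / \<mu>\<bar>"
      have "?z \<le> 1 + ?z powr p"
      proof (cases "?z \<le> 1")
        case False
        then have "?z powr 1 \<le> ?z powr p" using p by (intro powr_mono) auto
        then show ?thesis by simp
      qed (simp add: add_increasing2)
      also have "?z powr p \<le> young p (u x / \<mu>)"
        using exp_ge_add_one_self[of "?z powr p"] unfolding young_def by linarith
      finally show ?thesis using \<mu> by (simp add: field_simps abs_divide)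
    qed
    then have "norm (indicat_real K x *\<^sub>R u x) \<le> \<mu> * (indicator K x + young p (u x / \<mu>))" for x
      using \<mu> by (auto simp: indicator_def)
    then have "(\<integral>\<^sup>+x. ennreal (norm (indicat_real K x *\<^sub>R u x)) \<partial>lborel)
        \<le> (\<integral>\<^sup>+x. ennreal \<mu> * (indicator K x + ennreal (young p (u x / \<mu>))) \<partial>lborel)"
      using \<mu> by (intro nn_integral_mono)
        (simp add: ennreal_mult'[symmetric] ennreal_plus[symmetric] ennreal_indicator[symmetric] ennreal_leI del: ennreal_plus)
    also have "\<dots> = ennreal \<mu> * (emeasure lborel K + (\<integral>\<^sup>+x. ennreal (young p (u x / \<mu>)) \<partial>lborel))"
      by (simp add: nn_integral_cmult nn_integral_add)
    also have "\<dots> < \<infinity>"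
    proof -
      have "(\<integral>\<^sup>+x. ennreal (young p (u x / \<mu>)) \<partial>lborel) < top"
        using expL_leD(3)[OF u] by (rule le_less_trans) simp
      then show ?thesis using emeasure_compact_finite[OF that] by (simp add: ennreal_mult_less_top)
    qed
    finally show "(\<integral>\<^sup>+x. ennreal (norm (indicat_real K x *\<^sub>R u x)) \<partial>lborel) < \<infinity>" .
  qed
  then show "u \<in> expL p"
    using M \<mu> by (auto simp: expL_def L1_loc_def intro!: exI[of _ \<mu>] le_less_trans[OF M])
  show "expL_norm p u \<le> \<mu>"
    unfolding expL_norm_def using M \<mu> by (intro cInf_lower bdd_belowI[of _ 0]) auto
qed

lemma expL_norm_less_imp:
  assumes u: "u \<in> expL p" and p: "1 \<le> p" and less: "expL_norm p u < \<mu>"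
  shows "expL_le p \<mu> u"
proof -
  have [measurable]: "u \<in> borel_measurable borel" using u by (auto simp: expL_def L1_loc_def)
  obtain a where a: "a > 0" "exp_modular p a u < \<infinity>" using u by (auto simp: expL_def)
  define I where "I = enn2real (exp_modular p a u)"
  have I: "exp_modular p a u = ennreal I" "I \<ge> 0" unfolding I_def using a by auto
  \<comment> \<open>By convexity, dividing the argument by \<open>k \<ge> 1\<close> divides the
    modular at least by \<open>k\<close>. The scale \<open>k * a\<close> then has modular at most
    \<open>I / k \<le> 1\<close>, so the set in the infimum is nonempty.\<close>
  define k where "k = max 1 I"
  have k: "k \<ge> 1" "k \<ge> I" by (auto simp: k_def)
  have "exp_modular p (k * a) u = (\<integral>\<^sup>+x. ennreal (young p (u x / (k * a))) \<partial>lborel)"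
    using a k by (intro exp_modular_eq) auto
  also have "\<dots> \<le> (\<integral>\<^sup>+x. ennreal (1 / k) * ennreal (young p (u x / a)) \<partial>lborel)"
  proof (rule nn_integral_mono)
    fix x
    have "young p (1 / k * (u x / a)) \<le> 1 / k * young p (u x / a)" using k p by (intro young_scale_le) auto
    then show "ennreal (young p (u x / (k * a))) \<le> ennreal (1 / k) * ennreal (young p (u x / a))"
      using k by (simp add: ennreal_mult'[symmetric] ennreal_leI)
  qed
  also have "\<dots> = ennreal (1 / k) * exp_modular p a u"
    by (simp add: exp_modular_eq[OF a(1)] nn_integral_cmult)
  also have "\<dots> \<le> 1" unfolding I using k I by (simp add: ennreal_mult'[symmetric] ennreal_le_1)
  finally have ne: "k * a \<in> {\<mu>. \<mu> > 0 \<and> exp_modular p \<mu> u \<le> 1}" using a k by simp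
  then obtain b where b: "b > 0" "exp_modular p b u \<le> 1" "b < \<mu>"
    using cInf_lessD[of "{\<mu>. \<mu> > 0 \<and> exp_modular p \<mu> u \<le> 1}" \<mu>] less unfolding expL_norm_def by blast
  then have "expL_le p b u" using exp_modular_eq[of b p u] by (simp add: expL_le_def)
  then show ?thesis using b p by (auto intro: expL_le_mono)
qed

section \<open>Smooth approximation\<close>

lemma Ck_SucI:
  assumes "\<And>x. (f has_derivative D x) (at x)" "\<And>b. b \<in> Basis \<Longrightarrow> Ck k (\<lambda>x. D x b)"
  shows "Ck (Suc k) f"
proof -
  have "frechet_derivative f (at x) = D x" for x
    using frechet_derivative_at[OF assms(1)] by simp
  then show ?thesis using assms by (auto simp: differentiable_def)
qed

lemma Ck_Suc_has_derivative:
  "Ck (Suc k) f \<Longrightarrow> (f has_derivative frechet_derivative f (at x)) (at x)"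
  by (simp add: frechet_derivative_works[symmetric])

lemma Ck_SucD: "Ck (Suc k) f \<Longrightarrow> Ck k f"
proof (induction k arbitrary: f)
  case 0
  then show ?case
    by (auto intro!: continuous_at_imp_continuous_on differentiable_imp_continuous_within)
next
  case (Suc k)
  from Suc.prems have "\<forall>x. f differentiable at x" "\<forall>b\<in>Basis. Ck (Suc k) (\<lambda>x. frechet_derivative f (at x) b)"
    by simp_all
  then show ?case using Suc.IH by simp
qed

lemma Ck_const: "Ck k (\<lambda>x. c)"
proof (induction k arbitrary: c)
  case (Suc k)
  show ?case by (rule Ck_SucI[where D="\<lambda>_ _. 0"]) (auto simp: Suc)
qed simp

lemma Ck_add: "Ck k f \<Longrightarrow> Ck k g \<Longrightarrow> Ck k (\<lambda>x. f x + g x)"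
proof (induction k arbitrary: f g)
  case 0
  then show ?case by (auto intro: continuous_intros)
next
  case (Suc k)
  show ?case
    by (rule Ck_SucI[OF has_derivative_add[OF Ck_Suc_has_derivative[OF Suc.prems(1)] Ck_Suc_has_derivative[OF Suc.prems(2)]]])
      (use Suc in auto)
qed

lemma Ck_mult: "Ck k f \<Longrightarrow> Ck k g \<Longrightarrow> Ck k (\<lambda>x. f x * g x)"
proof (induction k arbitrary: f g)
  case 0
  then show ?case by (auto intro: continuous_intros)
next
  case (Suc k)
  show ?case
  proof (rule Ck_SucI[OF has_derivative_mult[OF Ck_Suc_has_derivative[OF Suc.prems(1)] Ck_Suc_has_derivative[OF Suc.prems(2)]]])
    fix b :: 'a assume "b \<in> Basis"
    then show "Ck k (\<lambda>x. f x * frechet_derivative g (at x) b + frechet_derivative f (at x) b * g x)"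
      using Suc.prems Ck_SucD[OF Suc.prems(1)] Ck_SucD[OF Suc.prems(2)]
      by (intro Ck_add Suc.IH) auto
  qed
qed

lemma Ck_bounded_linear:
  assumes "bounded_linear f"
  shows "Ck k f"
proof (cases k)
  case 0
  then show ?thesis using assms by (simp add: linear_continuous_on)
next
  case (Suc n)
  show ?thesis unfolding Suc
    by (rule Ck_SucI[where D="\<lambda>_. f"]) (auto simp: assms bounded_linear_imp_has_derivative Ck_const)
qed

lemma Ck_real_polynomial_function:
  "real_polynomial_function f \<Longrightarrow> Ck k f"
  by (induction rule: real_polynomial_function.induct) (auto intro: Ck_bounded_linear Ck_const Ck_add Ck_mult)

text \<open>The outer function comes with the whole sequence \<open>H\<close> of its derivatives, so
  each differentiation stays inside the family and the induction on \<open>k\<close> can keep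
  \<open>n\<close> arbitrary.\<close>

lemma Ck_compose:
  fixes H :: "nat \<Rightarrow> real \<Rightarrow> real" and g :: "'a::euclidean_space \<Rightarrow> real"
  assumes H: "\<And>n z. (H n has_real_derivative H (Suc n) z) (at z)" and g: "\<And>k. Ck k g"
  shows "Ck k (\<lambda>x. H n (g x))"
proof (induction k arbitrary: n)
  case 0
  have Hc: "continuous_on UNIV (H n)"
    by (intro continuous_at_imp_continuous_on ballI DERIV_isCont[OF H])
  then have "continuous_on UNIV (\<lambda>x. H n (g x))"
    by (rule continuous_on_compose2) (use g[of 0] in auto)
  then show ?case by simp
next
  case (Suc k)
  have g': "(g has_derivative frechet_derivative g (at x)) (at x)" for x
    by (rule Ck_Suc_has_derivative[OF g])
  show ?case
  proof (rule Ck_SucI)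
    show "((\<lambda>x. H n (g x)) has_derivative (\<lambda>h. frechet_derivative g (at x) h * H (Suc n) (g x))) (at x)" for x
      by (rule DERIV_compose_FDERIV[OF H g'])
    fix b :: 'a assume "b \<in> Basis"
    then show "Ck k (\<lambda>x. frechet_derivative g (at x) b * H (Suc n) (g x))"
      using g[of "Suc k"] by (intro Ck_mult Suc.IH) auto
  qed
qed

text \<open>For \<open>P = 1\<close> this is the classical smooth function that vanishes to infinite
  order at 0. The polynomial parameter makes the family closed under differentiation.\<close>

definition flat :: "real poly \<Rightarrow> real \<Rightarrow> real" where
  "flat P z = (if z \<le> 0 then 0 else poly P (1 / z) * exp (- (1 / z)))"

lemma poly_exp_tendsto_0: "((\<lambda>x::real. poly P x * exp (- x)) \<longlongrightarrow> 0) at_top"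
proof -
  have "((\<lambda>x::real. \<Sum>i\<le>degree P. coeff P i * (x ^ i / exp x)) \<longlongrightarrow> (\<Sum>i\<le>degree P. coeff P i * 0)) at_top"
    by (intro tendsto_sum tendsto_mult tendsto_const tendsto_power_div_exp_0)
  then show ?thesis
    by (simp add: poly_altdef sum_distrib_right exp_minus divide_inverse mult.assoc)
qed

text \<open>Differentiating \<open>P (1/z) * exp (- 1/z)\<close> gives
  \<open>(P - P') (1/z) / z\<^sup>2\<close> times the same exponential, and
  \<open>[:0, 0, 1:]\<close> is the square of the variable \<open>1/z\<close>. At 0 exponential
  decay beats every polynomial in \<open>1/z\<close>.\<close>

lemma flat_has_derivative:
  "(flat P has_real_derivative flat ([:0, 0, 1:] * (P - pderiv P)) z) (at z)"
proof (cases "z = 0")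
  case False
  have pos: "((\<lambda>z. poly P (1 / z) * exp (- (1 / z))) has_real_derivative flat ([:0, 0, 1:] * (P - pderiv P)) z) (at z)" if "z > 0"
    using that unfolding flat_def
    by (auto intro!: derivative_eq_intros DERIV_chain2[OF poly_DERIV] simp: power2_eq_square algebra_simps divide_simps)
  show ?thesis
  proof (cases "z > 0")
    case True
    show ?thesis
      by (rule has_field_derivative_transform_within_open[OF pos[OF True], of "{0<..}"])
        (use True in \<open>auto simp: flat_def\<close>)
  next
    case False
    show ?thesis
      by (rule has_field_derivative_transform_within_open[of "\<lambda>_. 0" _ _ "{..<0}"])
        (use False \<open>z \<noteq> 0\<close> in \<open>auto simp: flat_def\<close>)
  qed
next
  case True
  have "((\<lambda>h. flat P h / h) \<longlongrightarrow> 0) (at 0)"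
    unfolding filterlim_at_split
  proof
    show "((\<lambda>h. flat P h / h) \<longlongrightarrow> 0) (at_left 0)"
      by (rule tendsto_eventually) (auto simp: flat_def eventually_at_filter)
    \<comment> \<open>Dividing by \<open>h\<close> multiplies the polynomial in \<open>1/h\<close>
      by its variable, hence \<open>pCons 0 P\<close>.\<close>
    have "((\<lambda>h. poly (pCons 0 P) (inverse h) * exp (- inverse h)) \<longlongrightarrow> 0) (at_right 0)"
      by (rule filterlim_compose[OF poly_exp_tendsto_0 filterlim_inverse_at_top_right])
    then show "((\<lambda>h. flat P h / h) \<longlongrightarrow> 0) (at_right 0)"
      by (rule Lim_transform_eventually)
        (auto simp: flat_def eventually_at_filter inverse_eq_divide)
  qed
  then show ?thesis unfolding True DERIV_def by (simp add: flat_def)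
qed

primrec flat_poly :: "nat \<Rightarrow> real poly" where
  "flat_poly 0 = 1"
| "flat_poly (Suc n) = [:0, 0, 1:] * (flat_poly n - pderiv (flat_poly n))"

definition bump :: "real \<Rightarrow> 'a::euclidean_space \<Rightarrow> real" where
  "bump R x = flat 1 (R\<^sup>2 - x \<bullet> x)"

lemma Ck_inner_self: "Ck k (\<lambda>x::'a::euclidean_space. x \<bullet> x)"
proof -
  have "real_polynomial_function (\<lambda>x::'a. \<Sum>b\<in>Basis. (x \<bullet> b) * (x \<bullet> b))"
    by (intro real_polynomial_function_sum real_polynomial_function.intros bounded_linear_inner_left) auto
  moreover have "(\<lambda>x::'a. \<Sum>b\<in>Basis. (x \<bullet> b) * (x \<bullet> b)) = (\<lambda>x. x \<bullet> x)"
    by (intro ext) (rule euclidean_inner[symmetric])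
  ultimately show ?thesis using Ck_real_polynomial_function by simp
qed

lemma Ck_bump: "Ck k (bump R)"
proof -
  have "Ck k (\<lambda>x::'a. R\<^sup>2 + (-1) * (x \<bullet> x))" for k
    by (intro Ck_add Ck_mult Ck_const Ck_inner_self)
  then have "Ck k (\<lambda>x::'a. R\<^sup>2 - x \<bullet> x)" for k by simp
  from Ck_compose[where H="\<lambda>n. flat (flat_poly n)" and n=0, OF _ this] show ?thesis
    unfolding bump_def[abs_def] using flat_has_derivative by simp
qed

lemma bump_bounds:
  shows "0 \<le> bump R x" "bump R x \<le> 1"
  by (auto simp: bump_def flat_def)

lemma bump_pos:
  assumes "norm x < R"
  shows "0 < bump R x"
proof -
  have "(norm x)\<^sup>2 < R\<^sup>2" using assms by (intro power_strict_mono) auto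
  then show ?thesis by (simp add: bump_def flat_def power2_norm_eq_inner)
qed

lemma bump_zero:
  assumes "R \<le> norm x" "0 \<le> R"
  shows "bump R x = 0"
proof -
  have "R\<^sup>2 \<le> (norm x)\<^sup>2" using assms by (intro power_mono) auto
  then show ?thesis by (simp add: bump_def flat_def power2_norm_eq_inner)
qed

lemma test_functionsI:
  assumes "\<And>k. Ck k g" "\<And>x. R \<le> norm x \<Longrightarrow> g x = 0"
  shows "g \<in> test_functions"
proof -
  have "closure {x. g x \<noteq> 0} \<subseteq> cball 0 R"
  proof (rule closure_minimal)
    show "{x. g x \<noteq> 0} \<subseteq> cball 0 R"
      using assms(2) by (auto simp: dist_norm) (meson linear)
  qed simp
  then have "compact (closure {x. g x \<noteq> 0})"
    unfolding compact_eq_bounded_closed by (auto intro: bounded_subset[OF bounded_cball])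
  then show ?thesis using assms(1) by (simp add: test_functions_def)
qed

lemma test_function_continuous: "\<phi> \<in> test_functions \<Longrightarrow> continuous_on UNIV \<phi>"
  by (auto simp: test_functions_def dest: spec[of _ 0])

lemma test_function_support:
  assumes "\<phi> \<in> test_functions"
  obtains R B where "0 < R" "0 < B" "\<And>x. R \<le> norm x \<Longrightarrow> \<phi> x = 0" "\<And>x. \<bar>\<phi> x\<bar> \<le> B"
proof -
  let ?S = "closure {x. \<phi> x \<noteq> 0}"
  have c: "compact ?S" using assms by (simp add: test_functions_def)
  obtain R where R: "R > 0" "\<forall>x\<in>?S. norm x \<le> R"
    using compact_imp_bounded[OF c] unfolding bounded_pos by blast
  have "compact (\<phi> ` ?S)"
    using c test_function_continuous[OF assms] continuous_on_subset by (intro compact_continuous_image) auto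
  then have "bounded (\<phi> ` ?S)" by (rule compact_imp_bounded)
  then obtain B where B: "B > 0" "\<forall>y\<in>\<phi> ` ?S. norm y \<le> B" unfolding bounded_pos by blast
  show ?thesis
  proof (rule that[of "R + 1" B])
    have S: "x \<in> ?S" if "\<phi> x \<noteq> 0" for x using that by (intro subsetD[OF closure_subset]) simp
    show "\<phi> x = 0" if "R + 1 \<le> norm x" for x
    proof (rule ccontr)
      assume "\<phi> x \<noteq> 0"
      then have "norm x \<le> R" using S R(2) by simp
      then show False using that by simp
    qed
    show "\<bar>\<phi> x\<bar> \<le> B" for x
    proof (cases "\<phi> x = 0")
      case False
      then show ?thesis using S[of x] B(2) by simp
    qed (use B in simp)
  qed (use R B in auto)
qed

text \<open>\<open>F\<close> is divided by a smooth bump that is positive on its support, the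
  quotient is approximated by a polynomial, and the bump is multiplied back. Bump times polynomial
  is a test function, and since the bump is at most 1 the error does not grow.\<close>

lemma smooth_approximation:
  fixes F :: "'a::euclidean_space \<Rightarrow> real"
  assumes F: "continuous_on UNIV F" and R: "R > 0" "\<And>x. R \<le> norm x \<Longrightarrow> F x = 0" and e: "e > 0"
  obtains g where "g \<in> test_functions" "\<And>x. \<bar>F x - g x\<bar> \<le> e" "\<And>x. R + 1 \<le> norm x \<Longrightarrow> F x - g x = 0"
proof -
  \<comment> \<open>The radius \<open>R + 1\<close> keeps the bump positive on the closed ball of
    radius \<open>R\<close>, where the division takes place.\<close>
  let ?b = "bump (R + 1) :: 'a \<Rightarrow> real"
  have bc: "continuous_on UNIV ?b" using Ck_bump[of 0 "R + 1"] by simp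
  have nz: "?b x \<noteq> 0" if "norm x \<le> R" for x using bump_pos[of x "R + 1"] that by simp
  define G where "G = (\<lambda>x. if norm x \<le> R then F x / ?b x else 0)"
  have "continuous_on ({x. norm x \<le> R} \<union> {x. R \<le> norm x}) G"
    unfolding G_def
  proof (rule continuous_on_cases)
    show "closed {x::'a. norm x \<le> R}" "closed {x::'a. R \<le> norm x}"
      by (intro closed_Collect_le continuous_intros)+
    show "continuous_on {x. norm x \<le> R} (\<lambda>x. F x / ?b x)"
      using R by (intro continuous_intros continuous_on_subset[OF F] continuous_on_subset[OF bc])
        (auto dest: nz)
  qed (use R in auto)
  moreover have "{x. norm x \<le> R} \<union> {x. R \<le> norm x} = (UNIV :: 'a set)" by auto
  ultimately have Gc: "continuous_on UNIV G" by simp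
  have FG: "F x = ?b x * G x" for x
  proof (cases "norm x \<le> R")
    case True
    then have "?b x > 0" by (intro bump_pos) auto
    then show ?thesis using True by (simp add: G_def)
  next
    case False
    then show ?thesis using R(2)[of x] by (simp add: G_def)
  qed
  obtain P where P: "real_polynomial_function P" "\<And>x. x \<in> cball 0 (R + 1) \<Longrightarrow> \<bar>G x - P x\<bar> < e"
    using Stone_Weierstrass_real_polynomial_function[OF compact_cball continuous_on_subset[OF Gc] e] by blast
  have z: "?b x = 0" if "R + 1 \<le> norm x" for x using that R by (intro bump_zero) auto
  show ?thesis
  proof (rule that[of "\<lambda>x. ?b x * P x"])
    show "(\<lambda>x. ?b x * P x) \<in> test_functions"
      by (rule test_functionsI[of _ "R + 1"]) (auto simp: z intro: Ck_mult Ck_bump Ck_real_polynomial_function[OF P(1)])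
    show "\<bar>F x - ?b x * P x\<bar> \<le> e" for x
    proof (cases "norm x \<le> R + 1")
      case True
      then have "\<bar>?b x * (G x - P x)\<bar> \<le> 1 * e"
        unfolding abs_mult using P(2)[of x] bump_bounds[of "R + 1" x] by (intro mult_mono) auto
      then show ?thesis unfolding FG by (simp add: algebra_simps)
    next
      case False
      then show ?thesis unfolding FG using z[of x] e by simp
    qed
    show "F x - ?b x * P x = 0" if "R + 1 \<le> norm x" for x
      unfolding FG using z[OF that] by simp
  qed
qed

section \<open>Membership in the closure of the test functions\<close>

lemma powr_integral_compact_support:
  fixes u :: "'a::euclidean_space \<Rightarrow> real"
  assumes "0 \<le> B" "\<And>x. \<bar>u x\<bar> \<le> B" "\<And>x. R \<le> norm x \<Longrightarrow> u x = 0" "0 \<le> R" "0 < p"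
  shows "(\<integral>\<^sup>+x. ennreal (\<bar>u x\<bar> powr p) \<partial>lborel) \<le> ennreal (B powr p * (unit_ball_vol (real DIM('a)) * R ^ DIM('a)))"
proof -
  have "ennreal (\<bar>u x\<bar> powr p) \<le> ennreal (B powr p) * indicator (cball 0 R) x" for x
  proof (cases "norm x \<le> R")
    case True
    then show ?thesis using assms by (auto intro!: ennreal_leI powr_mono2)
  next
    case False
    then show ?thesis using assms(3)[of x] by simp
  qed
  then have "(\<integral>\<^sup>+x. ennreal (\<bar>u x\<bar> powr p) \<partial>lborel) \<le> (\<integral>\<^sup>+x. ennreal (B powr p) * indicator (cball 0 R) x \<partial>(lborel :: 'a measure))"
    by (intro nn_integral_mono)
  also have "\<dots> = ennreal (B powr p * (unit_ball_vol (real DIM('a)) * R ^ DIM('a)))"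
    using assms by (simp add: nn_integral_cmult_indicator emeasure_cball ennreal_mult'[symmetric])
  finally show ?thesis .
qed

lemma expL_le_small_compact_support:
  fixes R :: real
  assumes "1 \<le> p" "0 \<le> R" "0 < e"
  obtains \<delta> where "\<delta> > 0" "\<And>u. u \<in> borel_measurable borel \<Longrightarrow> (\<And>x::'a::euclidean_space. \<bar>u x\<bar> \<le> \<delta>) \<Longrightarrow> (\<And>x. R \<le> norm x \<Longrightarrow> u x = 0) \<Longrightarrow> expL_le p e u"
proof -
  define V where "V = unit_ball_vol (real DIM('a)) * R ^ DIM('a)"
  have V: "V \<ge> 0" using assms by (simp add: V_def)
  \<comment> \<open>Chosen so that \<open>exp 1 * V * k \<le> 1\<close>. Also
    \<open>k \<le> 1\<close>, which gives \<open>k powr p \<le> k\<close> and bounds the exponential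
    factor by \<open>exp 1\<close>.\<close>
  define k where "k = 1 / (exp 1 * V + 1)"
  have k: "0 < k" "k \<le> 1" "exp 1 * V * k \<le> 1"
    using V by (auto simp: k_def divide_le_eq add_pos_nonneg add_nonneg_pos)
  have "expL_le p e u" if "u \<in> borel_measurable borel" "\<And>x::'a. \<bar>u x\<bar> \<le> e * k" "\<And>x. R \<le> norm x \<Longrightarrow> u x = 0" for u
  proof (rule expL_le_bounded[OF that(1) assms(3) that(2)])
    show "(\<integral>\<^sup>+x. ennreal (\<bar>u x\<bar> powr p) \<partial>lborel) \<le> ennreal ((e * k) powr p * V)"
      unfolding V_def using that assms k by (intro powr_integral_compact_support) auto
    have kp: "k powr p \<le> k" using powr_mono'[of 1 p k] k assms by simp
    have "exp ((e * k / e) powr p) * ((e * k) powr p * V) = e powr p * (exp (k powr p) * (k powr p * V))"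
      using assms k by (simp add: powr_mult)
    also have "\<dots> \<le> e powr p * (exp 1 * (k * V))"
      using kp k V by (intro mult_left_mono mult_mono mult_right_mono) auto
    also have "\<dots> \<le> e powr p * 1"
      using k by (intro mult_left_mono) (auto simp: mult_ac)
    finally show "exp ((e * k / e) powr p) * ((e * k) powr p * V) \<le> e powr p" by simp
  qed (use V assms in auto)
  then show ?thesis using that[of "e * k"] k assms by simp
qed

text \<open>Every test function lies in some Luxemburg ball. Hence all differences that occur lie in
  \<open>expL p\<close>, and \<open>expL_norm_less_imp\<close> and \<open>expL_le_imp_expL\<close>
  translate between the norm and the balls.\<close>

lemma expL0_iff:
  fixes u :: "'a::euclidean_space \<Rightarrow> real"
  assumes p: "1 \<le> p"
  shows "u \<in> expL0 p \<longleftrightarrow> (\<forall>e>0. \<exists>\<phi>\<in>test_functions. expL_le p e (\<lambda>x. u x - \<phi> x))"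
proof -
  have tf: "\<exists>\<mu>. expL_le p \<mu> \<phi>" if tf: "\<phi> \<in> test_functions" for \<phi> :: "'a \<Rightarrow> real"
  proof -
    obtain R B where RB: "0 < R" "0 < B" "\<And>x. R \<le> norm x \<Longrightarrow> \<phi> x = 0" "\<And>x. \<bar>\<phi> x\<bar> \<le> B"
      using test_function_support[OF tf] by blast
    define J where "J = B powr p * (unit_ball_vol (real DIM('a)) * R ^ DIM('a))"
    define \<mu> where "\<mu> = max B (max 1 (exp 1 * J))"
    have \<mu>: "\<mu> \<ge> B" "\<mu> \<ge> 1" "\<mu> \<ge> exp 1 * J" by (auto simp: \<mu>_def)
    have J: "J \<ge> 0" using RB by (simp add: J_def)
    have "expL_le p \<mu> \<phi>"
    proof (rule expL_le_bounded[where J=J and B=B])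
      show "\<phi> \<in> borel_measurable borel" using test_function_continuous[OF tf] by (rule borel_measurable_continuous_onI)
      show "(\<integral>\<^sup>+x. ennreal (\<bar>\<phi> x\<bar> powr p) \<partial>lborel) \<le> ennreal J"
        unfolding J_def using RB p by (intro powr_integral_compact_support) auto
      have "(B / \<mu>) powr p \<le> 1 powr p" using \<mu> RB p by (intro powr_mono2) auto
      then have "exp ((B / \<mu>) powr p) * J \<le> exp 1 * J" using J by (intro mult_right_mono) auto
      also have "\<dots> \<le> \<mu> powr 1" using \<mu> by simp
      also have "\<dots> \<le> \<mu> powr p" using \<mu> p by (intro powr_mono) auto
      finally show "exp ((B / \<mu>) powr p) * J \<le> \<mu> powr p" .
    qed (use RB \<mu> J p in auto)
    then show ?thesis ..
  qed
  show ?thesis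
  proof
    assume u: "u \<in> expL0 p"
    show "\<forall>e>0. \<exists>\<phi>\<in>test_functions. expL_le p e (\<lambda>x. u x - \<phi> x)"
    proof (intro allI impI)
      fix e :: real assume "e > 0"
      then obtain \<phi> where \<phi>: "\<phi> \<in> test_functions" "expL_norm p (\<lambda>x. u x - \<phi> x) < e"
        using u by (auto simp: expL0_def)
      obtain \<mu> where 1: "expL_le p \<mu> \<phi>" using tf[OF \<phi>(1)] by blast
      have uL: "u \<in> expL p" using u by (simp add: expL0_def)
      have "expL_le p (expL_norm p u + 1) u" using expL_norm_less_imp[OF uL p, of "expL_norm p u + 1"] by simp
      from expL_le_diff[OF this 1 p] have "(\<lambda>x. u x - \<phi> x) \<in> expL p" using expL_le_imp_expL p by blast
      from expL_norm_less_imp[OF this p \<phi>(2)] \<phi>(1) show "\<exists>\<phi>\<in>test_functions. expL_le p e (\<lambda>x. u x - \<phi> x)" by blast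
    qed
  next
    assume R: "\<forall>e>0. \<exists>\<phi>\<in>test_functions. expL_le p e (\<lambda>x. u x - \<phi> x)"
    then obtain \<phi> where \<phi>: "\<phi> \<in> test_functions" "expL_le p 1 (\<lambda>x. u x - \<phi> x)" using zero_less_one by blast
    obtain \<mu> where 1: "expL_le p \<mu> \<phi>" using tf[OF \<phi>(1)] by blast
    have "expL_le p (1 + \<mu>) u" using expL_le_add[OF \<phi>(2) 1 p] by simp
    then have "u \<in> expL p" using expL_le_imp_expL p by blast
    moreover have "\<exists>\<phi>\<in>test_functions. expL_norm p (\<lambda>x. u x - \<phi> x) < e" if "e > 0" for e
    proof -
      \<comment> \<open>The ball gives a non-strict bound on the norm while the definition asks for
        a strict one, hence \<open>e/2\<close>.\<close>
      from R that obtain \<phi> where \<phi>: "\<phi> \<in> test_functions" "expL_le p (e/2) (\<lambda>x. u x - \<phi> x)" using half_gt_zero by blast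
      then show ?thesis using expL_le_imp_expL(2)[OF \<phi>(2) p] that by (intro bexI[of _ \<phi>]) auto
    qed
    ultimately show "u \<in> expL0 p" by (simp add: expL0_def)
  qed
qed

lemma expL0_closed:
  fixes u :: "'a::euclidean_space \<Rightarrow> real"
  assumes p: "1 \<le> p" and "\<And>e. e > 0 \<Longrightarrow> \<exists>w\<in>expL0 p. expL_le p e (\<lambda>x. u x - w x)"
  shows "u \<in> expL0 p"
  unfolding expL0_iff[OF p]
proof (intro allI impI)
  fix e :: real assume "e > 0"
  then have e2: "e / 2 > 0" by simp
  from assms(2)[OF this] obtain w where w: "w \<in> expL0 p" "expL_le p (e/2) (\<lambda>x. u x - w x)" by blast
  with e2 obtain \<phi> where "\<phi> \<in> test_functions" "expL_le p (e/2) (\<lambda>x. w x - \<phi> x)" using expL0_iff[OF p] by blast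
  with expL_le_triangle[OF w(2) this(2) p] show "\<exists>\<phi>\<in>test_functions. expL_le p e (\<lambda>x. u x - \<phi> x)" by auto
qed

lemma expL0_exists_bound:
  assumes "1 \<le> p" "u \<in> expL0 p"
  shows "\<exists>\<mu>. expL_le p \<mu> u"
  using assms expL_norm_less_imp[of u p "expL_norm p u + 1"] by (auto simp: expL0_def)

lemma expL0_measurable: "u \<in> expL0 p \<Longrightarrow> u \<in> borel_measurable borel"
  by (simp add: expL0_def expL_def L1_loc_def)

text \<open>Cutting off at radius about \<open>n\<close> leaves a tail whose \<open>p\<close>-th
  moment tends to 0. As the tail is also bounded by \<open>B\<close>, it is small in exp L^p. The
  cut-off function is continuous with compact support and is approximated uniformly by test
  functions.\<close>

lemma expL0_continuous_bounded:
  fixes F :: "'a::euclidean_space \<Rightarrow> real"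
  assumes p: "1 \<le> p" and F: "continuous_on UNIV F" "\<And>x. \<bar>F x\<bar> \<le> B"
    and Fp: "(\<integral>\<^sup>+x. ennreal (\<bar>F x\<bar> powr p) \<partial>lborel) < \<infinity>"
  shows "F \<in> expL0 p"
proof (rule expL0_closed[OF p])
  fix e :: real assume e: "e > 0"
  have [measurable]: "F \<in> borel_measurable borel" using F(1) by (rule borel_measurable_continuous_onI)
  define \<kappa> where "\<kappa> = (\<lambda>n x::'a. max 0 (min 1 (real n + 1 - norm x)))"
  have \<kappa>: "0 \<le> \<kappa> n x" "\<kappa> n x \<le> 1" for n x by (auto simp: \<kappa>_def)
  have \<kappa>1: "\<kappa> n x = 1" if "norm x \<le> n" for n x using that by (auto simp: \<kappa>_def)
  have \<kappa>c: "continuous_on UNIV (\<kappa> n)" for n unfolding \<kappa>_def by (intro continuous_intros)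
  have [measurable]: "\<kappa> n \<in> borel_measurable borel" for n using \<kappa>c by (rule borel_measurable_continuous_onI)
  have le: "\<bar>F x - F x * \<kappa> n x\<bar> \<le> \<bar>F x\<bar>" for n x
  proof -
    have "F x - F x * \<kappa> n x = F x * (1 - \<kappa> n x)" by (simp add: algebra_simps)
    then have "\<bar>F x - F x * \<kappa> n x\<bar> = \<bar>F x\<bar> * (1 - \<kappa> n x)"
      using \<kappa>[of n x] by (simp add: abs_mult)
    also have "\<dots> \<le> \<bar>F x\<bar> * 1" using \<kappa>[of n x] by (intro mult_left_mono) auto
    finally show ?thesis by simp
  qed
  have "(\<lambda>n. \<integral>\<^sup>+x. ennreal (\<bar>F x - F x * \<kappa> n x\<bar> powr p) \<partial>lborel) \<longlonglongrightarrow> (\<integral>\<^sup>+x. 0 \<partial>(lborel :: 'a measure))"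
  proof (rule nn_integral_dominated_convergence)
    show "AE x in lborel. ennreal (\<bar>F x - F x * \<kappa> n x\<bar> powr p) \<le> ennreal (\<bar>F x\<bar> powr p)" for n
      using le p by (intro AE_I2 ennreal_leI powr_mono2) auto
    show "AE x in lborel. (\<lambda>n. ennreal (\<bar>F x - F x * \<kappa> n x\<bar> powr p)) \<longlonglongrightarrow> 0"
    proof (intro AE_I2 tendsto_eventually)
      fix x :: 'a
      obtain N :: nat where "norm x \<le> N" using real_arch_simple by blast
      then have "\<kappa> n x = 1" if "n \<ge> N" for n using that by (intro \<kappa>1) simp
      then show "\<forall>\<^sub>F n in sequentially. ennreal (\<bar>F x - F x * \<kappa> n x\<bar> powr p) = 0"
        by (intro eventually_mono[OF eventually_ge_at_top[of N]]) simp
    qed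
  qed (use Fp in auto)
  \<comment> \<open>The largest \<open>p\<close>-th moment that \<open>expL_le_bounded\<close>
    allows at scale \<open>e\<close> under the sup bound \<open>B\<close>.\<close>
  moreover define j where "j = e powr p / exp ((B / e) powr p)"
  have j: "j > 0" using e by (simp add: j_def)
  ultimately have "\<forall>\<^sub>F n in sequentially. (\<integral>\<^sup>+x. ennreal (\<bar>F x - F x * \<kappa> n x\<bar> powr p) \<partial>lborel) < ennreal j"
    by (intro order_tendstoD(2)) auto
  then obtain n where n: "(\<integral>\<^sup>+x. ennreal (\<bar>F x - F x * \<kappa> n x\<bar> powr p) \<partial>lborel) < ennreal j"
    by (auto simp: eventually_sequentially)
  have "expL_le p e (\<lambda>x. F x - F x * \<kappa> n x)"
  proof (rule expL_le_bounded[where J=j and B=B])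
    show "\<bar>F x - F x * \<kappa> n x\<bar> \<le> B" for x using le[of x n] F(2)[of x] by linarith
    show "exp ((B / e) powr p) * j \<le> e powr p" by (simp add: j_def)
  qed (use n e p j in auto)
  moreover have "(\<lambda>x. F x * \<kappa> n x) \<in> expL0 p"
    unfolding expL0_iff[OF p]
  proof (intro allI impI)
    fix d :: real assume d: "d > 0"
    obtain \<delta> where \<delta>: "\<delta> > 0" "\<And>u. u \<in> borel_measurable borel \<Longrightarrow> (\<And>x::'a. \<bar>u x\<bar> \<le> \<delta>) \<Longrightarrow> (\<And>x. real n + 2 \<le> norm x \<Longrightarrow> u x = 0) \<Longrightarrow> expL_le p d u"
      using expL_le_small_compact_support[OF p _ d, of "real n + 2", where 'a='a] by auto
    have c: "continuous_on UNIV (\<lambda>x. F x * \<kappa> n x)" using F(1) \<kappa>c by (intro continuous_intros)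
    have z: "F x * \<kappa> n x = 0" if "real n + 1 \<le> norm x" for x using that by (simp add: \<kappa>_def)
    have n1: "real n + 1 > 0" by simp
    obtain g where g: "g \<in> test_functions" "\<And>x. \<bar>F x * \<kappa> n x - g x\<bar> \<le> \<delta>" "\<And>x. real n + 1 + 1 \<le> norm x \<Longrightarrow> F x * \<kappa> n x - g x = 0"
      using smooth_approximation[OF c n1 z \<delta>(1)] by blast
    have [measurable]: "g \<in> borel_measurable borel" using test_function_continuous[OF g(1)] by (rule borel_measurable_continuous_onI)
    have "expL_le p d (\<lambda>x. F x * \<kappa> n x - g x)"
      using g by (intro \<delta>(2)) auto
    then show "\<exists>\<phi>\<in>test_functions. expL_le p d (\<lambda>x. F x * \<kappa> n x - \<phi> x)" using g(1) by blast
  qed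
  ultimately show "\<exists>w\<in>expL0 p. expL_le p e (\<lambda>x. F x - w x)"
    by (intro bexI[of _ "\<lambda>x. F x * \<kappa> n x"])
qed

lemma continuous_into_expL0_iff:
  fixes u :: "real \<Rightarrow> 'a::euclidean_space \<Rightarrow> real"
  assumes p: "1 \<le> p"
  shows "continuous_into_expL0 p T u \<longleftrightarrow> (\<forall>t\<in>{0..T}. u t \<in> expL0 p) \<and>
    (\<forall>t\<in>{0..T}. \<forall>e>0. \<exists>d>0. \<forall>r\<in>{0..T}. \<bar>r - t\<bar> < d \<longrightarrow> expL_le p e (\<lambda>x. u r x - u t x))"
proof (cases "\<forall>t\<in>{0..T}. u t \<in> expL0 p")
  case True
  have L: "(\<lambda>x. u r x - u t x) \<in> expL p" if rt: "r \<in> {0..T}" "t \<in> {0..T}" for r t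
  proof -
    obtain a b where "expL_le p a (u r)" "expL_le p b (u t)"
      using expL0_exists_bound[OF p] True rt by blast
    from expL_le_diff[OF this p] show ?thesis using expL_le_imp_expL p by blast
  qed
  \<comment> \<open>A negative infimum would put \<open>v\<close> into a ball of radius 0, but
    \<open>expL_le\<close> demands a positive radius. With this sign an upper bound on the norm is a
    bound on its distance to 0.\<close>
  have nn: "0 \<le> expL_norm p v" if "v \<in> expL p" for v :: "'a \<Rightarrow> real"
  proof (rule ccontr)
    assume "\<not> 0 \<le> expL_norm p v"
    then have "expL_le p 0 v" by (intro expL_norm_less_imp that p) simp
    then show False by (auto dest: expL_leD)
  qed
  have "((\<lambda>r. expL_norm p (\<lambda>x. u r x - u t x)) \<longlongrightarrow> 0) (at t within {0..T}) \<longleftrightarrow>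
     (\<forall>e>0. \<exists>d>0. \<forall>r\<in>{0..T}. \<bar>r - t\<bar> < d \<longrightarrow> expL_le p e (\<lambda>x. u r x - u t x))" if t: "t \<in> {0..T}" for t
  proof
    assume l: "((\<lambda>r. expL_norm p (\<lambda>x. u r x - u t x)) \<longlongrightarrow> 0) (at t within {0..T})"
    show "\<forall>e>0. \<exists>d>0. \<forall>r\<in>{0..T}. \<bar>r - t\<bar> < d \<longrightarrow> expL_le p e (\<lambda>x. u r x - u t x)"
    proof (intro allI impI)
      fix e :: real assume e: "e > 0"
      from order_tendstoD(2)[OF l e] obtain d where d: "d > 0" "\<And>r. r \<in> {0..T} \<Longrightarrow> r \<noteq> t \<Longrightarrow> dist r t < d \<Longrightarrow> expL_norm p (\<lambda>x. u r x - u t x) < e"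
        unfolding eventually_at by blast
      have "expL_le p e (\<lambda>x. u r x - u t x)" if "r \<in> {0..T}" "\<bar>r - t\<bar> < d" for r
      proof (cases "r = t")
        case True
        then show ?thesis using e p by (simp add: expL_le_0)
      next
        case False
        then show ?thesis using d(2)[of r] that t by (intro expL_norm_less_imp L p) (auto simp: dist_real_def)
      qed
      then show "\<exists>d>0. \<forall>r\<in>{0..T}. \<bar>r - t\<bar> < d \<longrightarrow> expL_le p e (\<lambda>x. u r x - u t x)" using d(1) by blast
    qed
  next
    assume R: "\<forall>e>0. \<exists>d>0. \<forall>r\<in>{0..T}. \<bar>r - t\<bar> < d \<longrightarrow> expL_le p e (\<lambda>x. u r x - u t x)"
    show "((\<lambda>r. expL_norm p (\<lambda>x. u r x - u t x)) \<longlongrightarrow> 0) (at t within {0..T})"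
    proof (rule tendstoI)
      fix e :: real assume "e > 0"
      then have "e / 2 > 0" by simp
      with R have "\<exists>d>0. \<forall>r\<in>{0..T}. \<bar>r - t\<bar> < d \<longrightarrow> expL_le p (e/2) (\<lambda>x. u r x - u t x)" by simp
      then obtain d where d: "d > 0" "\<And>r. r \<in> {0..T} \<Longrightarrow> \<bar>r - t\<bar> < d \<Longrightarrow> expL_le p (e/2) (\<lambda>x. u r x - u t x)"
        by auto
      show "\<forall>\<^sub>F r in at t within {0..T}. dist (expL_norm p (\<lambda>x. u r x - u t x)) 0 < e"
        unfolding eventually_at
      proof (intro exI[of _ d] conjI ballI impI)
        fix r assume r: "r \<in> {0..T}" "r \<noteq> t \<and> dist r t < d"
        then have "expL_norm p (\<lambda>x. u r x - u t x) \<le> e / 2"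
          using d(2)[of r] by (intro expL_le_imp_expL p) (auto simp: dist_real_def)
        then show "dist (expL_norm p (\<lambda>x. u r x - u t x)) 0 < e"
          using nn[OF L[OF r(1) t]] \<open>e > 0\<close> by (simp add: dist_real_def)
      qed (rule d)
    qed
  qed
  then show ?thesis using True by (simp add: continuous_into_expL0_def)
next
  case False
  then show ?thesis by (auto simp: continuous_into_expL0_def)
qed

section \<open>Convolution with a bounded density\<close>

text \<open>Without integrability of \<open>q (X x)\<close> the right-hand side is infinite, so this
  form has no side condition on the composition.\<close>

lemma (in prob_space) nn_jensens_inequality:
  fixes q :: "real \<Rightarrow> real"
  assumes X: "integrable M X" and q: "convex_on UNIV q" "\<And>z. 0 \<le> q z" "q \<in> borel_measurable borel"
  shows "ennreal (q (expectation X)) \<le> (\<integral>\<^sup>+x. ennreal (q (X x)) \<partial>M)"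
proof (cases "integrable M (\<lambda>x. q (X x))")
  case True
  have "q (expectation X) \<le> expectation (\<lambda>x. q (X x))"
    by (rule jensens_inequality[where I=UNIV and q=q]) (use X True q(1) in auto)
  then show ?thesis using True q(2) by (simp add: nn_integral_eq_integral ennreal_leI)
next
  case False
  have "(\<lambda>x. q (X x)) \<in> borel_measurable M"
    using q(3) borel_measurable_integrable[OF X] by simp
  then have "(\<integral>\<^sup>+x. ennreal (q (X x)) \<partial>M) = \<infinity>"
    using False q(2) unfolding integrable_iff_bounded by (simp add: less_top[symmetric])
  then show ?thesis by simp
qed

text \<open>Serves for two averages: over space against the heat kernel, and over time against the
  uniform density of an interval.\<close>

lemma jensen_density:
  fixes w g :: "'a \<Rightarrow> real" and q :: "real \<Rightarrow> real"
  assumes w: "integrable M w" "\<And>y. 0 \<le> w y" "(LINT y|M. w y) = 1"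
    and g: "g \<in> borel_measurable M" "integrable M (\<lambda>y. w y * g y)"
    and q: "convex_on UNIV q" "\<And>z. 0 \<le> q z" "q \<in> borel_measurable borel"
  shows "ennreal (q (LINT y|M. w y * g y)) \<le> (\<integral>\<^sup>+y. ennreal (w y) * ennreal (q (g y)) \<partial>M)"
proof -
  have [measurable]: "w \<in> borel_measurable M" "g \<in> borel_measurable M" "q \<in> borel_measurable borel"
    using borel_measurable_integrable[OF w(1)] g(1) q(3) by auto
  let ?D = "density M (\<lambda>y. ennreal (w y))"
  interpret D: prob_space ?D
  proof
    have "emeasure ?D (space ?D) = (\<integral>\<^sup>+y. ennreal (w y) \<partial>M)"
      by (simp add: emeasure_density)
    also have "\<dots> = 1" using w by (subst nn_integral_eq_integral) auto
    finally show "emeasure ?D (space ?D) = 1" .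
  qed
  have "integrable ?D g" using w(2) g by (subst integrable_density) auto
  from D.nn_jensens_inequality[OF this q]
  have "ennreal (q (D.expectation g)) \<le> (\<integral>\<^sup>+y. ennreal (q (g y)) \<partial>?D)" .
  also have "D.expectation g = (LINT y|M. w y * g y)" using w(2) g by (subst integral_density) auto
  also have "(\<integral>\<^sup>+y. ennreal (q (g y)) \<partial>?D) = (\<integral>\<^sup>+y. ennreal (w y) * ennreal (q (g y)) \<partial>M)"
    by (rule nn_integral_density) measurable
  finally show ?thesis .
qed

text \<open>Dominated convergence with moving majorants whose integrals converge. Clipping
  \<open>f n\<close> to the range of \<open>\<plusminus> g'\<close> leaves a fixed majorant; the
  clipping error is at most \<open>g n - min (g n) g'\<close>, whose integral tends to 0. It fits
  translated heat kernels at varying times, all of which have mass 1.\<close>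

lemma integral_pratt:
  fixes f :: "nat \<Rightarrow> 'a \<Rightarrow> real"
  assumes f: "\<And>n. f n \<in> borel_measurable M" "\<And>x. (\<lambda>n. f n x) \<longlonglongrightarrow> f' x"
    and g: "\<And>n. integrable M (g n)" "integrable M g'" "\<And>x. (\<lambda>n. g n x) \<longlonglongrightarrow> g' x"
    and le: "\<And>n x. \<bar>f n x\<bar> \<le> g n x"
    and lim: "(\<lambda>n. LINT x|M. g n x) \<longlonglongrightarrow> (LINT x|M. g' x)"
  shows "(\<lambda>n. LINT x|M. f n x) \<longlonglongrightarrow> (LINT x|M. f' x)"
proof -
  have [measurable]: "f n \<in> borel_measurable M" "g n \<in> borel_measurable M" "g' \<in> borel_measurable M" for n
    using f(1) borel_measurable_integrable[OF g(1)] borel_measurable_integrable[OF g(2)] by auto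
  have [measurable]: "f' \<in> borel_measurable M" using f by (rule borel_measurable_LIMSEQ_real[rotated])
  have g0: "0 \<le> g n x" for n x using le[of n x] by linarith
  have g'0: "0 \<le> g' x" for x using g(3)[of x] by (rule LIMSEQ_le_const) (use g0 in auto)
  have f'le: "\<bar>f' x\<bar> \<le> g' x" for x
    by (rule LIMSEQ_le[OF tendsto_rabs[OF f(2)] g(3)]) (use le in auto)
  have fi: "integrable M (f n)" for n
    by (rule Bochner_Integration.integrable_bound[OF g(1)[of n]]) (use le g0 in auto)
  have mi: "integrable M (\<lambda>x. min (g n x) (g' x))" for n
    by (rule Bochner_Integration.integrable_bound[OF g(2)]) (use g0 g'0 in auto)
  define h where "h = (\<lambda>n x. max (- g' x) (min (g' x) (f n x)))"
  have [measurable]: "h n \<in> borel_measurable M" for n unfolding h_def by measurable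
  have hle: "\<bar>h n x\<bar> \<le> g' x" for n x using g'0[of x] unfolding h_def by (auto simp: abs_le_iff)
  have hi: "integrable M (h n)" for n
    by (rule Bochner_Integration.integrable_bound[OF g(2)]) (use hle g'0 in auto)
  have 1: "(\<lambda>n. LINT x|M. h n x) \<longlonglongrightarrow> (LINT x|M. f' x)"
  proof (rule integral_dominated_convergence[OF _ _ g(2)])
    show "AE x in M. (\<lambda>n. h n x) \<longlonglongrightarrow> f' x"
    proof (rule AE_I2)
      fix x
      have "(\<lambda>n. h n x) \<longlonglongrightarrow> max (- g' x) (min (g' x) (f' x))"
        unfolding h_def by (intro tendsto_max tendsto_min tendsto_const f(2))
      also have "max (- g' x) (min (g' x) (f' x)) = f' x" using f'le[of x] by auto
      finally show "(\<lambda>n. h n x) \<longlonglongrightarrow> f' x" .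
    qed
  qed (use hle in auto)
  have 2: "(\<lambda>n. LINT x|M. min (g n x) (g' x)) \<longlonglongrightarrow> (LINT x|M. g' x)"
  proof (rule integral_dominated_convergence[OF _ _ g(2)])
    show "AE x in M. (\<lambda>n. min (g n x) (g' x)) \<longlonglongrightarrow> g' x"
    proof (rule AE_I2)
      fix x
      show "(\<lambda>n. min (g n x) (g' x)) \<longlonglongrightarrow> g' x"
        using tendsto_min[OF g(3)[of x] tendsto_const[of "g' x"]] by simp
    qed
  qed (use g0 g'0 in auto)
  have pt: "\<bar>f n x - h n x\<bar> \<le> g n x - min (g n x) (g' x)" for n x
  proof -
    have "f n x \<le> g n x" "- g n x \<le> f n x" using le[of n x] by linarith+
    then show ?thesis using g'0[of x] unfolding h_def by (auto simp: max_def min_def abs_le_iff)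
  qed
  have "\<bar>(LINT x|M. f n x) - (LINT x|M. h n x)\<bar> \<le> (LINT x|M. g n x) - (LINT x|M. min (g n x) (g' x))" for n
  proof -
    have "\<bar>(LINT x|M. f n x) - (LINT x|M. h n x)\<bar> = \<bar>LINT x|M. f n x - h n x\<bar>"
      by (simp add: fi hi)
    also have "\<dots> \<le> (LINT x|M. \<bar>f n x - h n x\<bar>)" by (rule integral_abs_bound)
    also have "\<dots> \<le> (LINT x|M. g n x - min (g n x) (g' x))"
      by (intro integral_mono integrable_abs Bochner_Integration.integrable_diff fi hi mi g pt)
    also have "\<dots> = (LINT x|M. g n x) - (LINT x|M. min (g n x) (g' x))"
      by (simp add: g mi)
    finally show ?thesis .
  qed
  moreover have "(\<lambda>n. (LINT x|M. g n x) - (LINT x|M. min (g n x) (g' x))) \<longlonglongrightarrow> 0"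
    using tendsto_diff[OF lim 2] by simp
  ultimately have "(\<lambda>n. (LINT x|M. f n x) - (LINT x|M. h n x)) \<longlonglongrightarrow> 0"
    unfolding real_norm_def[symmetric] by (rule Lim_null_comparison[OF always_eventually, OF allI])
  from tendsto_add[OF this 1] show ?thesis by simp
qed

section \<open>Convolution estimates in Lebesgue and Orlicz spaces\<close>

definition Lp_le :: "real \<Rightarrow> real \<Rightarrow> ('a::euclidean_space \<Rightarrow> real) \<Rightarrow> bool" where
  "Lp_le m A g \<longleftrightarrow> g \<in> borel_measurable borel \<and> 0 \<le> A \<and> (\<integral>\<^sup>+x. ennreal (\<bar>g x\<bar> powr m) \<partial>lborel) \<le> ennreal (A powr m)"

lemma Lp_leD:
  assumes "Lp_le m A g"
  shows "g \<in> borel_measurable borel" "0 \<le> A" "(\<integral>\<^sup>+x. ennreal (\<bar>g x\<bar> powr m) \<partial>lborel) \<le> ennreal (A powr m)"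
  using assms by (auto simp: Lp_le_def)

lemma Lp_le_integrable:
  assumes "Lp_le m A g"
  shows "integrable lborel (\<lambda>x. \<bar>g x\<bar> powr m)"
proof (rule integrableI_bounded)
  have [measurable]: "g \<in> borel_measurable borel" using assms by (rule Lp_leD)
  show "(\<lambda>x. \<bar>g x\<bar> powr m) \<in> borel_measurable lborel" by measurable
  show "(\<integral>\<^sup>+x. ennreal (norm (\<bar>g x\<bar> powr m)) \<partial>lborel) < \<infinity>"
    using Lp_leD(3)[OF assms] by (simp add: le_less_trans)
qed

lemma Lp_le_mono: "Lp_le m A g \<Longrightarrow> A \<le> B \<Longrightarrow> 0 \<le> m \<Longrightarrow> Lp_le m B g"
  unfolding Lp_le_def by (auto intro: order_trans ennreal_leI powr_mono2)

lemma abs_le_one_plus_powr: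
  assumes "1 \<le> (m::real)"
  shows "\<bar>z\<bar> \<le> 1 + \<bar>z\<bar> powr m"
proof (cases "\<bar>z\<bar> \<le> 1")
  case False
  then have "\<bar>z\<bar> powr 1 \<le> \<bar>z\<bar> powr m" using assms by (intro powr_mono) auto
  then show ?thesis using False by simp
qed (simp add: add_increasing2)

definition kernel_conv :: "('a::euclidean_space \<Rightarrow> real) \<Rightarrow> ('a \<Rightarrow> real) \<Rightarrow> 'a \<Rightarrow> real" where
  "kernel_conv k g x = (LINT y|lborel. k (x - y) * g y)"

text \<open>The smoothing estimates use a bounded probability density and nothing further about the
  heat kernel. \<open>M\<close> may be any upper bound, so that kernels at different times can share
  one.\<close>

locale heat_density =
  fixes k :: "'a::euclidean_space \<Rightarrow> real" and M :: real
  assumes k_int: "integrable lborel k" and k_nonneg: "\<And>x. 0 \<le> k x" and k_mass: "(LINT x|lborel. k x) = 1"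
    and k_le: "\<And>x. k x \<le> M"
begin

lemma k_measurable [measurable]: "k \<in> borel_measurable borel"
  using borel_measurable_integrable[OF k_int] by simp

lemma M_nonneg: "0 \<le> M"
  using k_nonneg[of undefined] k_le[of undefined] by linarith

lemma k_shift: "integrable lborel (\<lambda>y. k (x - y))" "(LINT y|lborel. k (x - y)) = 1"
  using lborel_integrable_affine[OF _ k_int, of "-1" x] lborel_integral_affine[of "-1" k x] k_mass by auto

lemma k_nn_shift: "(\<integral>\<^sup>+x. ennreal (k (x - y)) \<partial>lborel) = 1"
proof -
  have "(\<integral>\<^sup>+x. ennreal (k x) \<partial>lborel) = (\<integral>\<^sup>+x. ennreal (k (- y + x)) \<partial>lborel)"
    using lborel_nn_integral_affine[of 1 "\<lambda>x. ennreal (k x)" "- y"] by simp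
  moreover have "(\<integral>\<^sup>+x. ennreal (k x) \<partial>lborel) = 1"
    using k_int k_nonneg k_mass by (subst nn_integral_eq_integral) auto
  ultimately show ?thesis by (simp add: algebra_simps)
qed

abbreviation conv :: "('a \<Rightarrow> real) \<Rightarrow> 'a \<Rightarrow> real" where
  "conv \<equiv> kernel_conv k"

lemma conv_measurable [measurable]:
  assumes [measurable]: "g \<in> borel_measurable borel"
  shows "conv g \<in> borel_measurable borel"
  unfolding kernel_conv_def[abs_def] by measurable

text \<open>From \<open>\<bar>g y\<bar> \<le> 1 + \<bar>g y\<bar> powr m\<close>: the first term is
  paid by the mass of the kernel, the second by its sup bound.\<close>

lemma conv_integrable:
  assumes g: "Lp_le m A g" and m: "1 \<le> m"
  shows "integrable lborel (\<lambda>y. k (x - y) * g y)"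
proof (rule Bochner_Integration.integrable_bound)
  have [measurable]: "g \<in> borel_measurable borel" using g by (rule Lp_leD)
  show "integrable lborel (\<lambda>y. k (x - y) + M * \<bar>g y\<bar> powr m)"
    by (intro Bochner_Integration.integrable_add integrable_mult_right k_shift Lp_le_integrable[OF g])
  show "(\<lambda>y. k (x - y) * g y) \<in> borel_measurable lborel" by measurable
  show "AE y in lborel. norm (k (x - y) * g y) \<le> norm (k (x - y) + M * \<bar>g y\<bar> powr m)"
  proof (rule AE_I2)
    fix y
    have "norm (k (x - y) * g y) = k (x - y) * \<bar>g y\<bar>" using k_nonneg by (simp add: abs_mult)
    also have "\<dots> \<le> k (x - y) * (1 + \<bar>g y\<bar> powr m)"
      by (intro mult_left_mono abs_le_one_plus_powr m k_nonneg)
    also have "\<dots> \<le> k (x - y) + M * \<bar>g y\<bar> powr m"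
      using k_le[of "x - y"] by (simp add: distrib_left mult_right_mono)
    finally show "norm (k (x - y) * g y) \<le> norm (k (x - y) + M * \<bar>g y\<bar> powr m)" by simp
  qed
qed

lemma conv_diff:
  assumes "Lp_le m A g" "Lp_le n B h" "1 \<le> m" "1 \<le> n"
  shows "conv (\<lambda>y. g y - h y) x = conv g x - conv h x"
  unfolding kernel_conv_def right_diff_distrib
  by (intro Bochner_Integration.integral_diff conv_integrable[OF assms(1,3)] conv_integrable[OF assms(2,4)])

lemma conv_add:
  assumes "Lp_le m A g" "Lp_le n B h" "1 \<le> m" "1 \<le> n"
  shows "conv (\<lambda>y. g y + h y) x = conv g x + conv h x"
  unfolding kernel_conv_def distrib_left
  by (intro Bochner_Integration.integral_add conv_integrable[OF assms(1,3)] conv_integrable[OF assms(2,4)])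

lemma conv_jensen:
  assumes g: "Lp_le m A g" "1 \<le> m" and q: "convex_on UNIV q" "\<And>z. 0 \<le> q z" "q \<in> borel_measurable borel"
  shows "ennreal (q (conv g x)) \<le> (\<integral>\<^sup>+y. ennreal (k (x - y)) * ennreal (q (g y)) \<partial>lborel)"
  unfolding kernel_conv_def
  by (rule jensen_density[OF _ _ _ _ _ q]) (use k_shift k_nonneg conv_integrable[OF g] Lp_leD(1)[OF g(1)] in auto)

text \<open>Jensen's inequality at each point, then Tonelli and mass 1. A general convex
  \<open>q\<close> covers powers and the Young function at once.\<close>

lemma conv_contraction:
  assumes g: "Lp_le m A g" "1 \<le> m" and q: "convex_on UNIV q" "\<And>z. 0 \<le> q z" "q \<in> borel_measurable borel"
  shows "(\<integral>\<^sup>+x. ennreal (q (conv g x)) \<partial>lborel) \<le> (\<integral>\<^sup>+x. ennreal (q (g x)) \<partial>lborel)"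
proof -
  have [measurable]: "g \<in> borel_measurable borel" using g by (auto dest: Lp_leD)
  note [measurable] = q(3)
  have "(\<integral>\<^sup>+x. ennreal (q (conv g x)) \<partial>lborel) \<le> (\<integral>\<^sup>+x. \<integral>\<^sup>+y. ennreal (k (x - y)) * ennreal (q (g y)) \<partial>lborel \<partial>lborel)"
    by (intro nn_integral_mono conv_jensen[OF g q])
  also have "\<dots> = (\<integral>\<^sup>+y. \<integral>\<^sup>+x. ennreal (k (x - y)) * ennreal (q (g y)) \<partial>lborel \<partial>lborel)"
    by (rule lborel_pair.Fubini') measurable
  also have "\<dots> = (\<integral>\<^sup>+y. ennreal (q (g y)) \<partial>lborel)"
    by (subst nn_integral_multc) (auto simp: k_nn_shift)
  finally show ?thesis .
qed

lemma conv_Lp_le: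
  assumes g: "Lp_le m A g" "1 \<le> m"
  shows "Lp_le m A (conv g)"
proof -
  have "(\<integral>\<^sup>+x. ennreal (\<bar>conv g x\<bar> powr m) \<partial>lborel) \<le> (\<integral>\<^sup>+x. ennreal (\<bar>g x\<bar> powr m) \<partial>lborel)"
    by (rule conv_contraction[OF g convex_on_abs_powr[OF g(2)]]) auto
  then show ?thesis using Lp_leD[OF g(1)] unfolding Lp_le_def by (auto intro: order_trans)
qed

lemma conv_expL_le:
  assumes g: "expL_le p \<mu> g" and p: "1 \<le> p"
  shows "expL_le p \<mu> (conv g)"
proof -
  have \<mu>: "\<mu> > 0" using g by (rule expL_leD)
  obtain c where c: "c > 0" "\<forall>\<mu> u. expL_le p \<mu> (u :: 'a \<Rightarrow> real) \<longrightarrow> (\<integral>\<^sup>+x. ennreal (\<bar>u x\<bar> powr p) \<partial>lborel) \<le> ennreal (c * \<mu> powr p)"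
    using expL_le_powr[of p p, where 'a='a] p by auto
  have [measurable]: "g \<in> borel_measurable borel" using g by (rule expL_leD)
  \<comment> \<open>Any finite bound would do: it guarantees that the convolution integral
    converges, and the constant does not reach the conclusion.\<close>
  define A where "A = (c * \<mu> powr p) powr (1 / p)"
  have "A powr p = c * \<mu> powr p" using c(1) p by (simp add: A_def powr_powr)
  then have L: "Lp_le p A g" using c(2) g by (simp add: Lp_le_def A_def)
  have q: "convex_on UNIV (\<lambda>z. young p (z / \<mu>))"
  proof (rule convex_onI)
    fix t x y :: real assume "0 < t" "t < 1"
    then show "young p (((1 - t) *\<^sub>R x + t *\<^sub>R y) / \<mu>) \<le> (1 - t) * young p (x / \<mu>) + t * young p (y / \<mu>)"
      using convex_onD[OF convex_on_young[OF p], of t "x / \<mu>" "y / \<mu>"] by (simp add: add_divide_distrib)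
  qed simp
  have "(\<integral>\<^sup>+x. ennreal (young p (conv g x / \<mu>)) \<partial>lborel) \<le> (\<integral>\<^sup>+x. ennreal (young p (g x / \<mu>)) \<partial>lborel)"
    by (rule conv_contraction[OF L p q]) auto
  also have "\<dots> \<le> 1" using g by (rule expL_leD)
  finally show ?thesis using \<mu> by (simp add: expL_le_def)
qed

text \<open>Jensen followed by \<open>k \<le> M\<close> bounds the \<open>m\<close>-th power by
  \<open>M * A powr m\<close>; the root is the source of the time singularity
  \<open>t powr (- d / (2 * m))\<close>.\<close>

lemma conv_bound:
  assumes g: "Lp_le m A g" "1 \<le> m"
  shows "\<bar>conv g x\<bar> \<le> M powr (1 / m) * A"
proof -
  have [measurable]: "g \<in> borel_measurable borel" using g by (auto dest: Lp_leD)
  have A: "0 \<le> A" using g by (auto dest: Lp_leD)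
  have "ennreal (\<bar>conv g x\<bar> powr m) \<le> (\<integral>\<^sup>+y. ennreal (k (x - y)) * ennreal (\<bar>g y\<bar> powr m) \<partial>lborel)"
    by (rule conv_jensen[OF g convex_on_abs_powr[OF g(2)]]) auto
  also have "\<dots> \<le> (\<integral>\<^sup>+y. ennreal M * ennreal (\<bar>g y\<bar> powr m) \<partial>lborel)"
    by (intro nn_integral_mono mult_right_mono ennreal_leI k_le) simp
  also have "\<dots> = ennreal M * (\<integral>\<^sup>+y. ennreal (\<bar>g y\<bar> powr m) \<partial>lborel)"
    by (rule nn_integral_cmult) measurable
  also have "\<dots> \<le> ennreal M * ennreal (A powr m)" using Lp_leD(3)[OF g(1)] by (rule mult_left_mono) simp
  also have "\<dots> = ennreal (M * A powr m)" by (rule ennreal_mult'[symmetric, OF M_nonneg])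
  finally have "\<bar>conv g x\<bar> powr m \<le> M * A powr m" using M_nonneg by (simp add: ennreal_le_iff)
  then have "(\<bar>conv g x\<bar> powr m) powr (1 / m) \<le> (M * A powr m) powr (1 / m)"
    using g(2) by (intro powr_mono2) auto
  then show ?thesis using g(2) A M_nonneg by (simp add: powr_powr powr_mult)
qed

end

section \<open>The mixed heat semigroup\<close>

lemma expL_le_imp_Lp_le:
  assumes p: "0 < p" and m: "p \<le> m"
  shows "\<exists>c>0. \<forall>\<mu> u. expL_le p \<mu> (u :: 'a::euclidean_space \<Rightarrow> real) \<longrightarrow> Lp_le m (c * \<mu>) u"
proof -
  obtain c where c: "c > 0" "\<forall>\<mu> u. expL_le p \<mu> (u :: 'a \<Rightarrow> real) \<longrightarrow> (\<integral>\<^sup>+x. ennreal (\<bar>u x\<bar> powr m) \<partial>lborel) \<le> ennreal (c * \<mu> powr m)"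
    using expL_le_powr[OF p m, where 'a='a] by auto
  have "Lp_le m (c powr (1 / m) * \<mu>) u" if u: "expL_le p \<mu> u" for \<mu> and u :: "'a \<Rightarrow> real"
  proof -
    have \<mu>: "\<mu> > 0" using u by (rule expL_leD)
    have "(c powr (1 / m) * \<mu>) powr m = c * \<mu> powr m"
      using c(1) \<mu> p m by (simp add: powr_mult powr_powr)
    then show ?thesis using c u \<mu> expL_leD(1)[OF u] by (simp add: Lp_le_def)
  qed
  then show ?thesis using c(1) by (intro exI[of _ "c powr (1 / m)"]) auto
qed

context
  fixes s :: real
  assumes s: "0 < s" "s < 1"
begin

lemma mixed_heat_density:
  assumes "t > 0"
  shows "heat_density (mixed_heat_kernel s t :: 'a::euclidean_space \<Rightarrow> real) ((4 * pi * t) powr (- (real DIM('a) / 2)))"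
  by unfold_locales
    (use mixed_heat_kernel_mass[OF s assms] mixed_heat_kernel_nonneg[OF s assms] mixed_heat_kernel_le[OF s assms] in auto)

lemma mixed_semigroup_conv:
  "t > 0 \<Longrightarrow> mixed_semigroup s t g = kernel_conv (mixed_heat_kernel s t) g"
  by (intro ext) (simp add: mixed_semigroup_def kernel_conv_def)

lemma mixed_semigroup_0 [simp]: "mixed_semigroup s 0 g = g"
  by (intro ext) (simp add: mixed_semigroup_def)

lemma mixed_semigroup_diff:
  assumes t: "0 \<le> t" and gh: "Lp_le m A g" "Lp_le n B h" "1 \<le> m" "1 \<le> n"
  shows "mixed_semigroup s t (\<lambda>y. g y - h y) x = mixed_semigroup s t g x - mixed_semigroup s t h x"
proof (cases "t = 0")
  case False
  then interpret heat_density "mixed_heat_kernel s t :: 'a \<Rightarrow> real" "(4 * pi * t) powr (- (real DIM('a) / 2))"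
    using assms by (intro mixed_heat_density) auto
  show ?thesis using False assms conv_diff[OF gh] by (simp add: mixed_semigroup_conv)
qed simp

lemma mixed_semigroup_Lp_le:
  assumes t: "0 \<le> t" and g: "Lp_le m A g" "1 \<le> m"
  shows "Lp_le m A (mixed_semigroup s t g)"
proof (cases "t = 0")
  case False
  then interpret heat_density "mixed_heat_kernel s t :: 'a \<Rightarrow> real" "(4 * pi * t) powr (- (real DIM('a) / 2))"
    using assms by (intro mixed_heat_density) auto
  show ?thesis using False t conv_Lp_le[OF g] by (simp add: mixed_semigroup_conv)
qed (use g in simp)

lemma mixed_semigroup_expL_le:
  assumes t: "0 \<le> t" and g: "expL_le p \<mu> g" "1 \<le> p"
  shows "expL_le p \<mu> (mixed_semigroup s t g)"
proof (cases "t = 0")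
  case False
  then interpret heat_density "mixed_heat_kernel s t :: 'a \<Rightarrow> real" "(4 * pi * t) powr (- (real DIM('a) / 2))"
    using assms by (intro mixed_heat_density) auto
  show ?thesis using False t conv_expL_le[OF g] by (simp add: mixed_semigroup_conv)
qed (use g in simp)

lemma mixed_semigroup_bound:
  assumes t: "0 < t" and g: "Lp_le m A g" "1 \<le> m"
  shows "\<bar>mixed_semigroup s t g (x::'a::euclidean_space)\<bar> \<le> (4 * pi * t) powr (- (real DIM('a) / (2 * m))) * A"
proof -
  interpret heat_density "mixed_heat_kernel s t :: 'a \<Rightarrow> real" "(4 * pi * t) powr (- (real DIM('a) / 2))"
    using t by (rule mixed_heat_density)
  show ?thesis using t conv_bound[OF g, of x] by (simp add: mixed_semigroup_conv powr_powr)
qed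

text \<open>Joint continuity in time, data and position away from time 0. The change of the data is
  controlled by \<open>conv_bound\<close>. For fixed data \<open>h\<close>, the majorants kernel
  plus \<open>?M * \<bar>h\<bar> powr m\<close> all have the same integral, because every kernel has
  mass 1, so \<open>integral_pratt\<close> applies.\<close>

lemma mixed_semigroup_tendsto:
  fixes x :: "nat \<Rightarrow> 'a::euclidean_space"
  assumes t: "t \<longlonglongrightarrow> r" "\<And>n. t n \<ge> a" "a > 0" and x: "x \<longlonglongrightarrow> y"
    and h: "Lp_le m A h" and g: "\<And>n. Lp_le m (B n) (\<lambda>y. g n y - h y)" "B \<longlonglongrightarrow> 0" and m: "1 \<le> m"
  shows "(\<lambda>n. mixed_semigroup s (t n) (g n) (x n)) \<longlonglongrightarrow> mixed_semigroup s r h y"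
proof -
  let ?K = "\<lambda>t. mixed_heat_kernel s t :: 'a \<Rightarrow> real"
  let ?M = "(4 * pi * a) powr (- (real DIM('a) / 2))"
  have t0: "t n > 0" for n using t(2)[of n] t(3) by linarith
  have ra: "a \<le> r" using LIMSEQ_le_const[OF t(1)] t(2) by blast
  have r0: "r > 0" using ra t(3) by linarith
  \<comment> \<open>All times at least \<open>a\<close> share the sup bound at time
    \<open>a\<close>.\<close>
  have D: "heat_density (?K u) ?M" if "u \<ge> a" for u
  proof -
    have u: "u > 0" using that t(3) by linarith
    interpret heat_density "?K u" "(4 * pi * u) powr (- (real DIM('a) / 2))" using u by (rule mixed_heat_density)
    have "(4 * pi * u) powr (- (real DIM('a) / 2)) \<le> ?M"
      using that t(3) by (intro powr_mono2') auto
    then show ?thesis using k_int k_nonneg k_mass k_le by unfold_locales (auto intro: order_trans)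
  qed
  have hm [measurable]: "h \<in> borel_measurable borel" using h by (rule Lp_leD)
  have split: "mixed_semigroup s (t n) (g n) (x n) = kernel_conv (?K (t n)) (\<lambda>y. g n y - h y) (x n) + kernel_conv (?K (t n)) h (x n)" for n
  proof -
    interpret heat_density "?K (t n)" ?M by (rule D[OF t(2)])
    show ?thesis using conv_add[OF g(1) h m m, of n "x n"] t0 by (simp add: mixed_semigroup_conv)
  qed
  have 1: "(\<lambda>n. kernel_conv (?K (t n)) (\<lambda>y. g n y - h y) (x n)) \<longlonglongrightarrow> 0"
  proof (rule Lim_null_comparison)
    show "\<forall>\<^sub>F n in sequentially. norm (kernel_conv (?K (t n)) (\<lambda>y. g n y - h y) (x n)) \<le> ?M powr (1 / m) * B n"
    proof (rule always_eventually, rule allI)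
      fix n
      interpret heat_density "?K (t n)" ?M by (rule D[OF t(2)])
      show "norm (kernel_conv (?K (t n)) (\<lambda>y. g n y - h y) (x n)) \<le> ?M powr (1 / m) * B n"
        using conv_bound[OF g(1) m] by simp
    qed
    show "(\<lambda>n. ?M powr (1 / m) * B n) \<longlonglongrightarrow> 0" using tendsto_mult[OF tendsto_const g(2)] by simp
  qed
  have 2: "(\<lambda>n. kernel_conv (?K (t n)) h (x n)) \<longlonglongrightarrow> kernel_conv (?K r) h y"
    unfolding kernel_conv_def
  proof (rule integral_pratt[where g="\<lambda>n z. ?K (t n) (x n - z) + ?M * \<bar>h z\<bar> powr m" and g'="\<lambda>z. ?K r (y - z) + ?M * \<bar>h z\<bar> powr m"])
    have hi: "integrable lborel (\<lambda>z. ?M * \<bar>h z\<bar> powr m)" by (intro integrable_mult_right Lp_le_integrable[OF h])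
    have Klim: "(\<lambda>n. ?K (t n) (x n - z)) \<longlonglongrightarrow> ?K r (y - z)" for z
      by (intro mixed_heat_kernel_tendsto[OF s r0 t] tendsto_diff x tendsto_const)
    show "(\<lambda>n. ?K (t n) (x n - z) * h z) \<longlonglongrightarrow> ?K r (y - z) * h z" for z
      by (intro tendsto_mult Klim tendsto_const)
    show "(\<lambda>n. ?K (t n) (x n - z) + ?M * \<bar>h z\<bar> powr m) \<longlonglongrightarrow> ?K r (y - z) + ?M * \<bar>h z\<bar> powr m" for z
      by (intro tendsto_add Klim tendsto_const)
    have F: "integrable lborel (\<lambda>z. ?K u (v - z) + ?M * \<bar>h z\<bar> powr m) \<and>
       (LINT z|lborel. ?K u (v - z) + ?M * \<bar>h z\<bar> powr m) = 1 + (LINT z|lborel. ?M * \<bar>h z\<bar> powr m)" if "u \<ge> a" for u v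
    proof -
      interpret heat_density "?K u" ?M by (rule D[OF that])
      show ?thesis using hi k_shift[of v] by (simp add: Bochner_Integration.integral_add del: integral_mult_right_zero)
    qed
    show "integrable lborel (\<lambda>z. ?K (t n) (x n - z) + ?M * \<bar>h z\<bar> powr m)" for n using F[OF t(2)] by blast
    show "integrable lborel (\<lambda>z. ?K r (y - z) + ?M * \<bar>h z\<bar> powr m)" using F[OF ra] by blast
    show "(\<lambda>n. LINT z|lborel. ?K (t n) (x n - z) + ?M * \<bar>h z\<bar> powr m) \<longlonglongrightarrow> (LINT z|lborel. ?K r (y - z) + ?M * \<bar>h z\<bar> powr m)"
      using F[OF t(2)] F[OF ra] by simp
    fix n
    interpret heat_density "?K (t n)" ?M by (rule D[OF t(2)])
    show "(\<lambda>z. ?K (t n) (x n - z) * h z) \<in> borel_measurable lborel" by measurable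
    fix z
    have "\<bar>?K (t n) (x n - z) * h z\<bar> = ?K (t n) (x n - z) * \<bar>h z\<bar>" using k_nonneg by (simp add: abs_mult)
    also have "\<dots> \<le> ?K (t n) (x n - z) * (1 + \<bar>h z\<bar> powr m)"
      by (intro mult_left_mono abs_le_one_plus_powr m k_nonneg)
    also have "\<dots> \<le> ?K (t n) (x n - z) + ?M * \<bar>h z\<bar> powr m"
      using k_le[of "x n - z"] by (simp add: distrib_left mult_right_mono)
    finally show "\<bar>?K (t n) (x n - z) * h z\<bar> \<le> ?K (t n) (x n - z) + ?M * \<bar>h z\<bar> powr m" .
  qed
  show ?thesis
    unfolding split using tendsto_add[OF 1 2] r0 by (simp add: mixed_semigroup_conv)
qed

lemma mixed_semigroup_continuous:
  fixes g :: "'a::euclidean_space \<Rightarrow> real"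
  assumes t: "t > 0" and g: "Lp_le m A g" "1 \<le> m"
  shows "continuous_on UNIV (mixed_semigroup s t g)"
proof (rule continuous_on_sequentiallyI)
  fix u :: "nat \<Rightarrow> 'a" and a assume "u \<longlonglongrightarrow> a"
  then show "(\<lambda>n. mixed_semigroup s t g (u n)) \<longlonglongrightarrow> mixed_semigroup s t g a"
    by (intro mixed_semigroup_tendsto[where t="\<lambda>_. t" and a=t and g="\<lambda>_. g" and B="\<lambda>_. 0" and h=g and m=m and A=A])
      (use t g in \<open>auto simp: Lp_le_def\<close>)
qed

text \<open>At positive times the evolution is continuous, bounded and of finite \<open>p\<close>-th
  moment, which places it in the closure of the test functions.\<close>

lemma mixed_semigroup_expL0_of_Lp:
  fixes g :: "'a::euclidean_space \<Rightarrow> real"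
  assumes t: "t > 0" and g: "Lp_le p A g" and p: "1 \<le> p"
  shows "mixed_semigroup s t g \<in> expL0 p"
proof (rule expL0_continuous_bounded[OF p])
  show "continuous_on UNIV (mixed_semigroup s t g)" by (rule mixed_semigroup_continuous[OF t g p])
  show "\<bar>mixed_semigroup s t g x\<bar> \<le> (4 * pi * t) powr (- (real DIM('a) / (2 * p))) * A" for x
    by (rule mixed_semigroup_bound[OF t g p])
  show "(\<integral>\<^sup>+x. ennreal (\<bar>mixed_semigroup s t g x\<bar> powr p) \<partial>lborel) < \<infinity>"
    using Lp_leD(3)[OF mixed_semigroup_Lp_le[OF less_imp_le[OF t] g p]] by (simp add: le_less_trans)
qed

lemma mixed_semigroup_expL0:
  fixes g :: "'a::euclidean_space \<Rightarrow> real"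
  assumes t: "t \<ge> 0" and g: "g \<in> expL0 p" and p: "1 \<le> p"
  shows "mixed_semigroup s t g \<in> expL0 p"
proof (cases "t = 0")
  case False
  obtain \<mu> where \<mu>: "expL_le p \<mu> g" using expL0_exists_bound[OF p g] by blast
  obtain c where c: "c > 0" "\<forall>\<mu> u. expL_le p \<mu> (u :: 'a \<Rightarrow> real) \<longrightarrow> Lp_le p (c * \<mu>) u"
    using expL_le_imp_Lp_le[of p p, where 'a='a] p by auto
  from c(2) \<mu> have "Lp_le p (c * \<mu>) g" by blast
  then show ?thesis using False t p by (intro mixed_semigroup_expL0_of_Lp) auto
qed (use g in simp)

lemma test_function_uniformly_close:
  fixes \<phi> :: "'a::euclidean_space \<Rightarrow> real"
  assumes \<phi>: "\<phi> \<in> test_functions" and e: "e > 0"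
  obtains d where "d > 0" "\<And>x y. norm (x - y) < d \<Longrightarrow> \<bar>\<phi> x - \<phi> y\<bar> \<le> e"
proof -
  obtain R B where RB: "0 < R" "0 < B" "\<And>x. R \<le> norm x \<Longrightarrow> \<phi> x = 0" "\<And>x. \<bar>\<phi> x\<bar> \<le> B"
    using test_function_support[OF \<phi>] by blast
  have "uniformly_continuous_on (cball 0 (R + 1)) \<phi>"
    by (intro compact_uniformly_continuous continuous_on_subset[OF test_function_continuous[OF \<phi>]]) auto
  from this[unfolded uniformly_continuous_on_def, rule_format, OF e]
  obtain d where d: "d > 0" "\<And>x y. x \<in> cball 0 (R + 1) \<Longrightarrow> y \<in> cball 0 (R + 1) \<Longrightarrow> dist y x < d \<Longrightarrow> dist (\<phi> y) (\<phi> x) < e"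
    by blast
  show ?thesis
  \<comment> \<open>If one of two points at distance below 1 leaves the ball of radius
    \<open>R + 1\<close>, both lie outside the ball of radius \<open>R\<close>, where the function
    vanishes.\<close>
  proof (rule that[of "min d 1"])
    fix x y :: 'a assume xy: "norm (x - y) < min d 1"
    have tri: "norm x \<le> norm y + norm (x - y)" "norm y \<le> norm x + norm (x - y)"
      using norm_triangle_sub[of x y] norm_triangle_sub[of y x] by (simp_all add: norm_minus_commute)
    show "\<bar>\<phi> x - \<phi> y\<bar> \<le> e"
    proof (cases "norm x \<le> R + 1 \<and> norm y \<le> R + 1")
      case True
      then have "dist (\<phi> x) (\<phi> y) < e" using xy by (intro d(2)) (auto simp: dist_norm)
      then show ?thesis by (simp add: dist_real_def)
    next
      case False
      then have "R \<le> norm x" "R \<le> norm y" using tri xy by auto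
      then show ?thesis using RB(3) e by simp
    qed
  qed (use d in simp)
qed

text \<open>At \<open>t > 0\<close> the kernels themselves converge uniformly, by convergence of
  their multipliers in mean. At \<open>t = 0\<close> the kernels are an approximate identity: nearby
  mass meets the uniform continuity of \<open>\<phi>\<close>, and the mass beyond distance
  \<open>d\<close> tends to 0.\<close>

lemma mixed_semigroup_test_uniform:
  fixes \<phi> :: "'a::euclidean_space \<Rightarrow> real"
  assumes \<phi>: "\<phi> \<in> test_functions" and r: "\<And>n. r n \<ge> 0" "r \<longlonglongrightarrow> t" "\<And>n. r n \<noteq> t" and t: "t \<ge> 0" and e: "e > 0"
  shows "\<forall>\<^sub>F n in sequentially. \<forall>x. \<bar>mixed_semigroup s (r n) \<phi> x - mixed_semigroup s t \<phi> x\<bar> \<le> e"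
proof -
  obtain R B where RB: "0 < R" "0 < B" "\<And>x. R \<le> norm x \<Longrightarrow> \<phi> x = 0" "\<And>x. \<bar>\<phi> x\<bar> \<le> B"
    using test_function_support[OF \<phi>] by blast
  have [measurable]: "\<phi> \<in> borel_measurable borel" using test_function_continuous[OF \<phi>] by (rule borel_measurable_continuous_onI)
  let ?K = "\<lambda>t. mixed_heat_kernel s t :: 'a \<Rightarrow> real"
  have \<phi>i: "integrable lborel \<phi>"
  proof (rule Bochner_Integration.integrable_bound)
    show "integrable lborel (\<lambda>x::'a. B * indicator (cball 0 R) x)"
      by (intro integrable_mult_right integrable_real_indicator) (use RB in \<open>auto simp: emeasure_cball\<close>)
    show "AE x in lborel. norm (\<phi> x) \<le> norm (B * indicator (cball 0 R) x)"
    proof (rule AE_I2)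
      fix x show "norm (\<phi> x) \<le> norm (B * indicator (cball 0 R) x)"
        using RB(3)[of x] RB(4)[of x] RB(2) by (cases "norm x \<le> R") auto
    qed
  qed measurable
  have prod_i: "integrable lborel (\<lambda>y. ?K u (x - y) * \<phi> y)" if "u > 0" for u x
  proof -
    interpret heat_density "?K u" "(4 * pi * u) powr (- (real DIM('a) / 2))" using that by (rule mixed_heat_density)
    show ?thesis
      by (rule Bochner_Integration.integrable_bound[OF integrable_mult_right[OF \<phi>i, of "(4 * pi * u) powr (- (real DIM('a) / 2))"]])
        (auto simp: abs_mult k_nonneg k_le intro!: AE_I2 mult_right_mono)
  qed
  show ?thesis
  proof (cases "t = 0")
    case False
    with t have t0: "t > 0" by simp
    define L where "L = (LINT y|lborel. \<bar>\<phi> y\<bar>)"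
    have L: "L \<ge> 0" by (simp add: L_def)
    let ?D = "\<lambda>n. (LINT \<xi>|lborel. \<bar>exp (- (r n * mixed_symbol s \<xi>)) - exp (- (t * mixed_symbol s (\<xi>::'a)))\<bar>)"
    \<comment> \<open>The convergence of the multipliers needs a positive lower bound for all times;
      it holds from index \<open>N\<close> on, so the shifted sequence is used.\<close>
    obtain N where N: "\<And>n. n \<ge> N \<Longrightarrow> r n > t / 2"
      using order_tendstoD(1)[OF r(2), of "t/2"] t0 by (auto simp: eventually_sequentially)
    have "(\<lambda>n. ?D (n + N)) \<longlonglongrightarrow> 0"
      by (rule mixed_symbol_diff_tendsto_0[OF s t0, where a="t/2"])
        (use N t0 LIMSEQ_ignore_initial_segment[OF r(2), of N] in \<open>auto intro: less_imp_le\<close>)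
    then have "?D \<longlonglongrightarrow> 0" by (rule LIMSEQ_offset)
    then have "(\<lambda>n. ?D n / (2 * pi) ^ DIM('a) * L) \<longlonglongrightarrow> 0 / (2 * pi) ^ DIM('a) * L"
      by (intro tendsto_mult tendsto_divide tendsto_const) auto
    then have "\<forall>\<^sub>F n in sequentially. ?D n / (2 * pi) ^ DIM('a) * L < e"
      using e by (intro order_tendstoD(2)) auto
    then show ?thesis using eventually_ge_at_top[of N]
    proof eventually_elim
      case (elim n)
      have rn: "r n > 0" using N[OF elim(2)] t0 by linarith
      show ?case
      proof
        fix x
        have "mixed_semigroup s (r n) \<phi> x - mixed_semigroup s t \<phi> x = (LINT y|lborel. ?K (r n) (x - y) * \<phi> y - ?K t (x - y) * \<phi> y)"
          using rn t0 prod_i by (simp add: mixed_semigroup_conv kernel_conv_def)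
        also have "\<bar>\<dots>\<bar> \<le> (LINT y|lborel. \<bar>?K (r n) (x - y) * \<phi> y - ?K t (x - y) * \<phi> y\<bar>)"
          by (rule integral_abs_bound)
        also have "\<dots> \<le> (LINT y|lborel. ?D n / (2 * pi) ^ DIM('a) * \<bar>\<phi> y\<bar>)"
        proof (rule integral_mono)
          show "integrable lborel (\<lambda>y. \<bar>?K (r n) (x - y) * \<phi> y - ?K t (x - y) * \<phi> y\<bar>)"
            using rn t0 prod_i by (intro integrable_abs Bochner_Integration.integrable_diff) auto
          show "integrable lborel (\<lambda>y. ?D n / (2 * pi) ^ DIM('a) * \<bar>\<phi> y\<bar>)"
            by (intro integrable_mult_right integrable_abs \<phi>i)
          show "\<bar>?K (r n) (x - y) * \<phi> y - ?K t (x - y) * \<phi> y\<bar> \<le> ?D n / (2 * pi) ^ DIM('a) * \<bar>\<phi> y\<bar>" for y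
            unfolding left_diff_distrib[symmetric] abs_mult
            by (intro mult_right_mono mixed_heat_kernel_diff_le[OF s rn t0]) simp
        qed
        also have "\<dots> = ?D n / (2 * pi) ^ DIM('a) * L" by (simp add: L_def)
        finally show "\<bar>mixed_semigroup s (r n) \<phi> x - mixed_semigroup s t \<phi> x\<bar> \<le> e" using elim(1) by linarith
      qed
    qed
  next
    case True
    \<comment> \<open>The assumption \<open>r n \<noteq> t\<close> excludes time 0, where the
      semigroup is the identity instead of a convolution.\<close>
    have rn: "r n > 0" for n using r(1)[of n] r(3)[of n] True by simp
    obtain d where d: "d > 0" "\<And>x y. norm (x - y) < d \<Longrightarrow> \<bar>\<phi> x - \<phi> y\<bar> \<le> e / 2"
      using test_function_uniformly_close[OF \<phi>, of "e / 2"] e by auto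
    let ?I = "\<lambda>n. LINT z|lborel. indicator {z. d \<le> norm z} z * ?K (r n) z"
    have "?I \<longlonglongrightarrow> 0" using r(2) True by (intro mixed_heat_kernel_concentrates[OF s rn _ d(1)]) simp
    then have "(\<lambda>n. 2 * B * ?I n) \<longlonglongrightarrow> 2 * B * 0" by (intro tendsto_mult tendsto_const)
    then have "\<forall>\<^sub>F n in sequentially. 2 * B * ?I n < e / 2" using e by (intro order_tendstoD(2)) auto
    then show ?thesis
    proof eventually_elim
      case (elim n)
      interpret heat_density "?K (r n)" "(4 * pi * r n) powr (- (real DIM('a) / 2))" using rn by (rule mixed_heat_density)
      show ?case
      proof
        fix x
        have ki: "integrable lborel (\<lambda>z. indicator {z. d \<le> norm z} z * ?K (r n) z)"
          by (rule Bochner_Integration.integrable_bound[OF k_int]) (auto simp: indicator_def)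
        have ki': "integrable lborel (\<lambda>y. indicator {z. d \<le> norm z} (x - y) * ?K (r n) (x - y))"
          using lborel_integrable_affine[OF _ ki, of "-1" x] by simp
        have I': "(LINT y|lborel. indicator {z. d \<le> norm z} (x - y) * ?K (r n) (x - y)) = ?I n"
          using lborel_integral_affine[of "-1" "\<lambda>z. indicator {z. d \<le> norm z} z * ?K (r n) z" x] by simp
        have "mixed_semigroup s (r n) \<phi> x - mixed_semigroup s t \<phi> x = (LINT y|lborel. ?K (r n) (x - y) * \<phi> y) - (LINT y|lborel. ?K (r n) (x - y) * \<phi> x)"
          using rn[of n] True k_shift(2)[of x] by (simp add: mixed_semigroup_conv kernel_conv_def)
        also have "\<dots> = (LINT y|lborel. ?K (r n) (x - y) * \<phi> y - ?K (r n) (x - y) * \<phi> x)"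
          using prod_i[OF rn] k_shift(1) by simp
        also have "\<bar>\<dots>\<bar> \<le> (LINT y|lborel. \<bar>?K (r n) (x - y) * \<phi> y - ?K (r n) (x - y) * \<phi> x\<bar>)"
          by (rule integral_abs_bound)
        also have "\<dots> \<le> (LINT y|lborel. e / 2 * ?K (r n) (x - y) + 2 * B * (indicator {z. d \<le> norm z} (x - y) * ?K (r n) (x - y)))"
        proof (rule integral_mono)
          show "integrable lborel (\<lambda>y. \<bar>?K (r n) (x - y) * \<phi> y - ?K (r n) (x - y) * \<phi> x\<bar>)"
            using prod_i[OF rn] k_shift(1) by (intro integrable_abs Bochner_Integration.integrable_diff integrable_mult_left) auto
          show "integrable lborel (\<lambda>y. e / 2 * ?K (r n) (x - y) + 2 * B * (indicator {z. d \<le> norm z} (x - y) * ?K (r n) (x - y)))"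
            by (intro Bochner_Integration.integrable_add integrable_mult_right k_shift ki')
          fix y
          have "\<bar>\<phi> y - \<phi> x\<bar> \<le> e / 2 + 2 * B * indicator {z. d \<le> norm z} (x - y)"
          proof (cases "d \<le> norm (x - y)")
            case True
            then show ?thesis using RB(4)[of x] RB(4)[of y] e by (auto simp: abs_le_iff)
          next
            case False
            then show ?thesis using d(2)[of x y] by (auto simp: abs_minus_commute)
          qed
          from mult_left_mono[OF this k_nonneg[of "x - y"]]
          show "\<bar>?K (r n) (x - y) * \<phi> y - ?K (r n) (x - y) * \<phi> x\<bar> \<le> e / 2 * ?K (r n) (x - y) + 2 * B * (indicator {z. d \<le> norm z} (x - y) * ?K (r n) (x - y))"
            unfolding right_diff_distrib[symmetric] abs_mult using k_nonneg[of "x - y"] by (simp add: algebra_simps)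
        qed
        also have "\<dots> = e / 2 * (LINT y|lborel. ?K (r n) (x - y)) + 2 * B * (LINT y|lborel. indicator {z. d \<le> norm z} (x - y) * ?K (r n) (x - y))"
          by (subst Bochner_Integration.integral_add)
            (intro integrable_mult_right k_shift ki', intro integrable_mult_right k_shift ki', simp only: integral_mult_right_zero)
        also have "\<dots> = e / 2 + 2 * B * ?I n" unfolding I' using k_shift(2)[of x] by simp
        finally show "\<bar>mixed_semigroup s (r n) \<phi> x - mixed_semigroup s t \<phi> x\<bar> \<le> e" using elim by linarith
      qed
    qed
  qed
qed

end

section \<open>Exponential nonlinearities\<close>

text \<open>A three-term argument through a test function \<open>\<phi>\<close> near
  \<open>u\<^sub>0\<close>. The two outer terms are controlled by contraction in exp L^p. For the
  middle term \<open>z\<close>, a uniform bound \<open>\<eta>\<close> and two integral bounds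
  \<open>L\<close> give \<open>\<bar>z\<bar> powr p \<le> \<eta> powr (p - 1) *
  \<bar>z\<bar>\<close>, which is small because \<open>p > 1\<close>.\<close>

lemma mixed_semigroup_expL_continuous:
  fixes u\<^sub>0 :: "'a::euclidean_space \<Rightarrow> real"
  assumes s: "0 < s" "s < 1" and p: "1 < p" and u0: "u\<^sub>0 \<in> expL0 p" and t: "t \<ge> 0" and e: "e > 0"
  shows "\<exists>d>0. \<forall>r\<ge>0. \<bar>r - t\<bar> < d \<longrightarrow> expL_le p e (\<lambda>x. mixed_semigroup s r u\<^sub>0 x - mixed_semigroup s t u\<^sub>0 x)"
proof (rule ccontr)
  let ?S = "mixed_semigroup s"
  define P where "P = (\<lambda>r. expL_le p e (\<lambda>x. ?S r u\<^sub>0 x - ?S t u\<^sub>0 x))"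
  have p1: "1 \<le> p" using p by simp
  assume "\<not> (\<exists>d>0. \<forall>r\<ge>0. \<bar>r - t\<bar> < d \<longrightarrow> expL_le p e (\<lambda>x. ?S r u\<^sub>0 x - ?S t u\<^sub>0 x))"
  then have neg: "\<exists>r\<ge>0. \<bar>r - t\<bar> < d \<and> \<not> P r" if "d > 0" for d
    using that unfolding P_def by blast
  have "\<exists>r\<ge>0. \<bar>r - t\<bar> < 1 / (real n + 1) \<and> \<not> P r" for n by (rule neg) simp
  then obtain r where r: "\<And>n. r n \<ge> 0" "\<And>n. \<bar>r n - t\<bar> < 1 / (real n + 1)" "\<And>n. \<not> P (r n)"
    by metis
  have "(\<lambda>n. r n - t) \<longlonglongrightarrow> 0"
  proof (rule Lim_null_comparison)
    show "\<forall>\<^sub>F n in sequentially. norm (r n - t) \<le> 1 / (real n + 1)"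
      using r(2) by (intro always_eventually allI) (simp add: less_imp_le)
    show "(\<lambda>n. 1 / (real n + 1)) \<longlonglongrightarrow> 0"
      using LIMSEQ_inverse_real_of_nat by (simp add: inverse_eq_divide add_ac)
  qed
  then have rl: "r \<longlonglongrightarrow> t" by (rule LIM_zero_cancel)
  have rn: "r n \<noteq> t" for n using r(3)[of n] e p by (auto simp: P_def expL_le_0)
  define \<mu> where "\<mu> = e / 3"
  have \<mu>: "\<mu> > 0" using e by (simp add: \<mu>_def)
  obtain \<phi> where \<phi>: "\<phi> \<in> test_functions" "expL_le p \<mu> (\<lambda>x. u\<^sub>0 x - \<phi> x)"
    using u0 \<mu> unfolding expL0_iff[OF p1] by blast
  obtain R B where RB: "0 < R" "0 < B" "\<And>x. R \<le> norm x \<Longrightarrow> \<phi> x = 0" "\<And>x. \<bar>\<phi> x\<bar> \<le> B"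
    using test_function_support[OF \<phi>(1)] by blast
  have [measurable]: "\<phi> \<in> borel_measurable borel" using test_function_continuous[OF \<phi>(1)] by (rule borel_measurable_continuous_onI)
  define L where "L = B powr 1 * (unit_ball_vol (real DIM('a)) * R ^ DIM('a))"
  have L: "L \<ge> 0" using RB by (simp add: L_def)
  have L1: "Lp_le 1 L \<phi>"
    using powr_integral_compact_support[of B \<phi> R 1] RB L by (simp add: Lp_le_def L_def)
  \<comment> \<open>The minimum with \<open>\<mu>\<close> bounds the exponential factor by
    \<open>exp 1\<close>; the other entry solves
    \<open>\<eta> powr (p - 1) * (exp 1 * (2 * L) + 1) = \<mu> powr p\<close>, with
    \<open>+ 1\<close> keeping the denominator positive.\<close>
  define \<eta> where "\<eta> = min \<mu> ((\<mu> powr p / (exp 1 * (2 * L) + 1)) powr (1 / (p - 1)))"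
  have den: "exp 1 * (2 * L) + 1 > 0" using L by (simp add: add_nonneg_pos)
  have \<eta>: "\<eta> > 0" "\<eta> \<le> \<mu>" using \<mu> den by (auto simp: \<eta>_def)
  have "\<eta> powr (p - 1) \<le> ((\<mu> powr p / (exp 1 * (2 * L) + 1)) powr (1 / (p - 1))) powr (p - 1)"
    using \<eta>(1) p by (intro powr_mono2) (auto simp: \<eta>_def)
  also have "\<dots> = \<mu> powr p / (exp 1 * (2 * L) + 1)" using p den by (simp add: powr_powr)
  finally have \<eta>p: "\<eta> powr (p - 1) * (exp 1 * (2 * L) + 1) \<le> \<mu> powr p" using den by (simp add: pos_le_divide_eq)
  obtain n where n: "\<And>x. \<bar>?S (r n) \<phi> x - ?S t \<phi> x\<bar> \<le> \<eta>"
    using mixed_semigroup_test_uniform[OF s \<phi>(1) r(1) rl rn t \<eta>(1)] by (auto simp: eventually_sequentially)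
  have \<phi>L: "Lp_le 1 L (?S u \<phi>)" if "u \<ge> 0" for u using that L1 by (rule mixed_semigroup_Lp_le[OF s]) simp
  have mid: "expL_le p \<mu> (\<lambda>x. ?S (r n) \<phi> x - ?S t \<phi> x)"
  proof (rule expL_le_bounded[where B=\<eta> and J="\<eta> powr (p - 1) * (2 * L)"])
    have [measurable]: "?S (r n) \<phi> \<in> borel_measurable borel" "?S t \<phi> \<in> borel_measurable borel"
      using \<phi>L[OF r(1)] \<phi>L[OF t] by (auto dest: Lp_leD)
    show "(\<lambda>x. ?S (r n) \<phi> x - ?S t \<phi> x) \<in> borel_measurable borel" by measurable
    have "\<bar>?S (r n) \<phi> x - ?S t \<phi> x\<bar> powr p \<le> \<eta> powr (p - 1) * (\<bar>?S (r n) \<phi> x\<bar> + \<bar>?S t \<phi> x\<bar>)" for x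
    proof -
      let ?z = "\<bar>?S (r n) \<phi> x - ?S t \<phi> x\<bar>"
      have "?z powr p = ?z powr (p - 1) * ?z" using powr_add[of ?z "p - 1" 1] by simp
      also have "\<dots> \<le> \<eta> powr (p - 1) * (\<bar>?S (r n) \<phi> x\<bar> + \<bar>?S t \<phi> x\<bar>)"
        using n p by (intro mult_mono powr_mono2) auto
      finally show ?thesis .
    qed
    then have "(\<integral>\<^sup>+x. ennreal (\<bar>?S (r n) \<phi> x - ?S t \<phi> x\<bar> powr p) \<partial>lborel) \<le>
        (\<integral>\<^sup>+x. ennreal (\<eta> powr (p - 1)) * (ennreal (\<bar>?S (r n) \<phi> x\<bar> powr 1) + ennreal (\<bar>?S t \<phi> x\<bar> powr 1)) \<partial>lborel)"
      by (intro nn_integral_mono) (simp add: ennreal_mult'[symmetric] ennreal_plus[symmetric] ennreal_leI del: ennreal_plus)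
    also have "\<dots> = ennreal (\<eta> powr (p - 1)) * ((\<integral>\<^sup>+x. ennreal (\<bar>?S (r n) \<phi> x\<bar> powr 1) \<partial>lborel) + (\<integral>\<^sup>+x. ennreal (\<bar>?S t \<phi> x\<bar> powr 1) \<partial>lborel))"
      by (subst nn_integral_cmult, measurable, subst nn_integral_add, measurable)
    also have "\<dots> \<le> ennreal (\<eta> powr (p - 1)) * (ennreal (L powr 1) + ennreal (L powr 1))"
      by (intro mult_left_mono add_mono Lp_leD(3) \<phi>L r t) simp
    also have "\<dots> = ennreal (\<eta> powr (p - 1) * (2 * L))"
      using L by (simp add: ennreal_plus[symmetric] ennreal_mult'[symmetric] del: ennreal_plus)
    finally show "(\<integral>\<^sup>+x. ennreal (\<bar>?S (r n) \<phi> x - ?S t \<phi> x\<bar> powr p) \<partial>lborel) \<le> ennreal (\<eta> powr (p - 1) * (2 * L))" .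
    have "(\<eta> / \<mu>) powr p \<le> 1 powr p" using \<eta> \<mu> p by (intro powr_mono2) auto
    then have "exp ((\<eta> / \<mu>) powr p) * (\<eta> powr (p - 1) * (2 * L)) \<le> exp 1 * (\<eta> powr (p - 1) * (2 * L))"
      using L by (intro mult_right_mono) auto
    also have "\<dots> \<le> \<eta> powr (p - 1) * (exp 1 * (2 * L) + 1)" by (simp add: algebra_simps)
    also note \<eta>p
    finally show "exp ((\<eta> / \<mu>) powr p) * (\<eta> powr (p - 1) * (2 * L)) \<le> \<mu> powr p" .
  qed (use n \<mu> L p in auto)
  obtain \<nu> where \<nu>: "expL_le p \<nu> u\<^sub>0" using expL0_exists_bound[OF p1 u0] by blast
  obtain c where c: "c > 0" "\<forall>\<mu> u. expL_le p \<mu> (u :: 'a \<Rightarrow> real) \<longrightarrow> Lp_le p (c * \<mu>) u"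
    using expL_le_imp_Lp_le[of p p, where 'a='a] p by auto
  have u0L: "Lp_le p (c * \<nu>) u\<^sub>0" using c(2) \<nu> by blast
  have side: "expL_le p \<mu> (\<lambda>x. ?S u u\<^sub>0 x - ?S u \<phi> x)" if "u \<ge> 0" for u
    using mixed_semigroup_expL_le[OF s that \<phi>(2) p1]
    unfolding mixed_semigroup_diff[OF s that u0L L1 p1 order_refl] by (simp add: eta_contract_eq)
  have "expL_le p (\<mu> + (\<mu> + \<mu>)) (\<lambda>x. ?S (r n) u\<^sub>0 x - ?S t u\<^sub>0 x)"
    by (intro expL_le_triangle[OF side[OF r(1)] expL_le_triangle[OF mid expL_le_diff_commute[OF side[OF t]] p1] p1])
  then show False using r(3)[of n] by (simp add: \<mu>_def P_def)
qed

text \<open>With \<open>X = m * lam * \<bar>w\<bar> powr p\<close> and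
  \<open>y = \<bar>z\<bar> / D\<close>, write \<open>exp X\<close> as 1 plus
  \<open>exp X - 1\<close> and separate the product by the inequality between a product and squares.
  This leaves \<open>y powr m\<close>, \<open>y powr (2 * m)\<close> and
  \<open>exp (2 * X) - 1\<close>. The condition on \<open>\<eta>\<close> says that
  \<open>2 * X\<close> is at most \<open>\<bar>w / \<eta>\<bar> powr p\<close>, so the last term is
  part of the modular of \<open>w\<close>.\<close>

lemma exp_weight_Lp_le:
  fixes p m c lam \<eta> :: real
  assumes p: "0 < p" "p \<le> m" and c: "0 < c" and lam: "0 \<le> lam" and \<eta>: "0 < \<eta>" "2 * m * lam * \<eta> powr p \<le> 1"
  shows "\<exists>L>0. \<forall>D (g :: 'a::euclidean_space \<Rightarrow> real) z w\<^sub>1 w\<^sub>2. g \<in> borel_measurable borel \<longrightarrow> expL_le p D z \<longrightarrow>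
     expL_le p \<eta> w\<^sub>1 \<longrightarrow> expL_le p \<eta> w\<^sub>2 \<longrightarrow>
     (\<forall>x. \<bar>g x\<bar> \<le> c * \<bar>z x\<bar> * (exp (lam * \<bar>w\<^sub>1 x\<bar> powr p) + exp (lam * \<bar>w\<^sub>2 x\<bar> powr p))) \<longrightarrow> Lp_le m (L * D) g"
proof -
  have m: "m > 0" using p by simp
  obtain c1 where c1: "c1 > 0" "\<And>z. \<bar>z\<bar> powr m \<le> c1 * young p z" using powr_le_young[OF p] by blast
  obtain c2 where c2: "c2 > 0" "\<And>z. \<bar>z\<bar> powr (2 * m) \<le> c2 * young p z" using powr_le_young[of p "2 * m"] p by auto
  \<comment> \<open>Each of the two weights contributes \<open>c1 + c2\<close> from the powers of
    \<open>z\<close> and 1 from its own modular.\<close>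
  define k where "k = 2 * c1 + 2 * c2 + 2"
  have k: "k > 0" using c1 c2 by (simp add: k_def)
  define L where "L = 2 * c * k powr (1 / m)"
  have L: "L > 0" using c k by (simp add: L_def)
  have "Lp_le m (L * D) g" if gm: "g \<in> borel_measurable borel" and z: "expL_le p D z" and w: "expL_le p \<eta> w\<^sub>1" "expL_le p \<eta> w\<^sub>2"
    and le: "\<forall>x. \<bar>g x\<bar> \<le> c * \<bar>z x\<bar> * (exp (lam * \<bar>w\<^sub>1 x\<bar> powr p) + exp (lam * \<bar>w\<^sub>2 x\<bar> powr p))"
    for D and g z w\<^sub>1 w\<^sub>2 :: "'a \<Rightarrow> real"
  proof -
    have D: "D > 0" using z by (rule expL_leD)
    note [measurable] = gm expL_leD(1)[OF z] expL_leD(1)[OF w(1)] expL_leD(1)[OF w(2)]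
    have ex: "y powr m * exp (m * (lam * \<bar>v\<bar> powr p)) \<le> y powr m + y powr (2 * m) + young p (v / \<eta>)" if "y \<ge> 0" for y v :: real
    proof -
      define X where "X = m * (lam * \<bar>v\<bar> powr p)"
      have X: "X \<ge> 0" using m lam by (simp add: X_def)
      let ?a = "y powr m" and ?b = "exp X - 1"
      have b: "?b \<ge> 0" using X by simp
      have "0 \<le> (?a - ?b)\<^sup>2" by simp
      then have "?a * ?b \<le> (?a\<^sup>2 + ?b\<^sup>2) / 2" by (simp add: power2_eq_square algebra_simps)
      also have "\<dots> \<le> ?a\<^sup>2 + ?b\<^sup>2" by simp
      also have "?a\<^sup>2 = y powr (2 * m)" by (simp add: power2_eq_square powr_add[symmetric])
      also have "?b\<^sup>2 \<le> exp (2 * X) - 1"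
      proof -
        have "exp (2 * X) = exp X * exp X" by (simp add: mult_exp_exp)
        then show ?thesis using X by (simp add: power2_eq_square algebra_simps)
      qed
      also have "exp (2 * X) \<le> exp (\<bar>v / \<eta>\<bar> powr p)"
      proof -
        have "2 * X = (2 * m * lam * \<eta> powr p) * (\<bar>v\<bar> powr p / \<eta> powr p)"
          using \<eta>(1) by (simp add: X_def)
        also have "\<dots> \<le> 1 * (\<bar>v\<bar> powr p / \<eta> powr p)" using \<eta>(2) by (intro mult_right_mono) auto
        also have "\<dots> = \<bar>v / \<eta>\<bar> powr p" using \<eta>(1) by (simp add: abs_divide powr_divide)
        finally show ?thesis by simp
      qed
      finally have "?a * ?b \<le> y powr (2 * m) + young p (v / \<eta>)" by (simp add: young_def)
      then show ?thesis unfolding X_def[symmetric] by (simp add: algebra_simps)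
    qed
    have pt: "\<bar>g x\<bar> powr m \<le> (2 * c * D) powr m * ((2 * c1 + 2 * c2) * young p (z x / D) + young p (w\<^sub>1 x / \<eta>) + young p (w\<^sub>2 x / \<eta>))" for x
    proof -
      let ?e1 = "exp (lam * \<bar>w\<^sub>1 x\<bar> powr p)" and ?e2 = "exp (lam * \<bar>w\<^sub>2 x\<bar> powr p)" and ?y = "\<bar>z x\<bar> / D"
      have y: "?y \<ge> 0" using D by simp
      have "?e1 + ?e2 \<le> 2 * max ?e1 ?e2" by simp
      then have "c * \<bar>z x\<bar> * (?e1 + ?e2) \<le> c * \<bar>z x\<bar> * (2 * max ?e1 ?e2)" using c by (intro mult_left_mono) auto
      also have "\<dots> = 2 * c * D * ?y * max ?e1 ?e2" using D by simp
      finally have "\<bar>g x\<bar> \<le> 2 * c * D * ?y * max ?e1 ?e2" using le by (meson order_trans)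
      then have "\<bar>g x\<bar> powr m \<le> (2 * c * D * ?y * max ?e1 ?e2) powr m" using m by (intro powr_mono2) auto
      also have "\<dots> = (2 * c * D) powr m * (?y powr m * max ?e1 ?e2 powr m)"
        by (subst powr_mult[of "2 * c * D * ?y"], subst powr_mult[of "2 * c * D" ?y], rule mult.assoc)
      also have "max ?e1 ?e2 powr m \<le> ?e1 powr m + ?e2 powr m" by (simp add: max_def)
      also have "?e1 powr m + ?e2 powr m = exp (m * (lam * \<bar>w\<^sub>1 x\<bar> powr p)) + exp (m * (lam * \<bar>w\<^sub>2 x\<bar> powr p))"
        by (simp add: exp_powr_real mult_ac)
      also have "?y powr m * (exp (m * (lam * \<bar>w\<^sub>1 x\<bar> powr p)) + exp (m * (lam * \<bar>w\<^sub>2 x\<bar> powr p)))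
          \<le> (?y powr m + ?y powr (2 * m) + young p (w\<^sub>1 x / \<eta>)) + (?y powr m + ?y powr (2 * m) + young p (w\<^sub>2 x / \<eta>))"
        unfolding distrib_left by (intro add_mono ex y)
      also have "\<dots> \<le> (2 * c1 + 2 * c2) * young p (z x / D) + young p (w\<^sub>1 x / \<eta>) + young p (w\<^sub>2 x / \<eta>)"
        using c1(2)[of "z x / D"] c2(2)[of "z x / D"] D by (simp add: abs_divide algebra_simps)
      finally show ?thesis by (simp add: mult_left_mono)
    qed
    have "(\<integral>\<^sup>+x. ennreal (\<bar>g x\<bar> powr m) \<partial>lborel) \<le>
        (\<integral>\<^sup>+x. ennreal ((2 * c * D) powr m) * (ennreal (2 * c1 + 2 * c2) * ennreal (young p (z x / D)) + ennreal (young p (w\<^sub>1 x / \<eta>)) + ennreal (young p (w\<^sub>2 x / \<eta>))) \<partial>lborel)"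
      using c1(1) c2(1)
      by (intro nn_integral_mono order_trans[OF ennreal_leI[OF pt]])
        (simp add: ennreal_mult'[symmetric] ennreal_plus[symmetric] del: ennreal_plus)
    also have "\<dots> = ennreal ((2 * c * D) powr m) * (ennreal (2 * c1 + 2 * c2) * (\<integral>\<^sup>+x. ennreal (young p (z x / D)) \<partial>lborel)
        + (\<integral>\<^sup>+x. ennreal (young p (w\<^sub>1 x / \<eta>)) \<partial>lborel) + (\<integral>\<^sup>+x. ennreal (young p (w\<^sub>2 x / \<eta>)) \<partial>lborel))"
      by (simp add: nn_integral_cmult nn_integral_add)
    also have "\<dots> \<le> ennreal ((2 * c * D) powr m) * (ennreal (2 * c1 + 2 * c2) * 1 + 1 + 1)"
      by (intro mult_left_mono add_mono expL_leD(3) z w) auto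
    also have "ennreal (2 * c1 + 2 * c2) * 1 + 1 + 1 = ennreal k"
    proof -
      have "k = 2 * c1 + 2 * c2 + 1 + 1" by (simp add: k_def)
      then have "ennreal k = ennreal (2 * c1 + 2 * c2) + ennreal 1 + ennreal 1"
        using c1(1) c2(1) by (simp only: ennreal_plus add_nonneg_nonneg mult_nonneg_nonneg less_imp_le zero_le_one zero_le_numeral)
      then show ?thesis by simp
    qed
    also have "ennreal ((2 * c * D) powr m) * ennreal k = ennreal ((2 * c * D) powr m * k)"
      by (rule ennreal_mult'[symmetric]) simp
    also have "(2 * c * D) powr m * k = (L * D) powr m"
      using c D k m by (simp add: L_def powr_mult powr_powr)
    finally show ?thesis using gm L D by (simp add: Lp_le_def)
  qed
  then show ?thesis using L by blast
qed

locale exp_nonlinearity =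
  fixes p C lam :: real and f :: "real \<Rightarrow> real"
  assumes p: "1 < p" and f0: "f 0 = 0" and C: "0 < C" and lam: "0 < lam"
    and f: "\<And>a b. \<bar>f a - f b\<bar> \<le> C * \<bar>a - b\<bar> * (exp (lam * \<bar>a\<bar> powr p) + exp (lam * \<bar>b\<bar> powr p))"
begin

lemma f_continuous: "continuous_on UNIV f"
proof (rule continuous_on_sequentiallyI)
  fix u :: "nat \<Rightarrow> real" and a assume u: "u \<longlonglongrightarrow> a"
  have "(\<lambda>n. f (u n) - f a) \<longlonglongrightarrow> 0"
  proof (rule Lim_null_comparison)
    let ?b = "\<lambda>z. C * \<bar>z - a\<bar> * (exp (lam * \<bar>z\<bar> powr p) + exp (lam * \<bar>a\<bar> powr p))"
    show "\<forall>\<^sub>F n in sequentially. norm (f (u n) - f a) \<le> ?b (u n)"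
      using f by (intro always_eventually) simp
    have "continuous_on UNIV ?b" using p by (intro continuous_intros continuous_on_powr') auto
    then have "(\<lambda>n. ?b (u n)) \<longlonglongrightarrow> ?b a" by (rule continuous_on_tendsto_compose) (use u in auto)
    then show "(\<lambda>n. ?b (u n)) \<longlonglongrightarrow> 0" by simp
  qed
  then show "(\<lambda>n. f (u n)) \<longlonglongrightarrow> f a" by (rule LIM_zero_cancel)
qed

lemma f_measurable [measurable]: "f \<in> borel_measurable borel"
  using f_continuous by (rule borel_measurable_continuous_onI)

text \<open>From \<open>\<bar>a\<bar> \<le> 2 * max \<bar>b\<bar> \<bar>a - b\<bar>\<close>, where
  the \<open>p\<close>-th power of the maximum is at most the sum of the powers. Here the factor
  \<open>2 powr p\<close> enters the smallness condition.\<close>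

lemma exp_powr_split:
  assumes "\<bar>b\<bar> \<le> M"
  shows "exp (lam * \<bar>a\<bar> powr p) \<le> exp (lam * 2 powr p * M powr p) * exp (lam * 2 powr p * \<bar>a - b\<bar> powr p)"
proof -
  let ?m = "max \<bar>b\<bar> \<bar>a - b\<bar>"
  have "\<bar>a\<bar> \<le> \<bar>b\<bar> + \<bar>a - b\<bar>" by linarith
  also have "\<dots> \<le> 2 * ?m" by (simp add: max_def)
  finally have "\<bar>a\<bar> \<le> 2 * ?m" .
  then have "\<bar>a\<bar> powr p \<le> (2 * ?m) powr p" using p by (intro powr_mono2) auto
  also have "\<dots> = 2 powr p * ?m powr p" by (rule powr_mult)
  also have "?m powr p \<le> \<bar>b\<bar> powr p + \<bar>a - b\<bar> powr p" by (simp add: max_def)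
  also have "\<bar>b\<bar> powr p \<le> M powr p" using assms p by (intro powr_mono2) auto
  finally have "\<bar>a\<bar> powr p \<le> 2 powr p * (M powr p + \<bar>a - b\<bar> powr p)" by simp
  then have "lam * \<bar>a\<bar> powr p \<le> lam * (2 powr p * (M powr p + \<bar>a - b\<bar> powr p))" using lam by (intro mult_left_mono) auto
  then show ?thesis by (simp add: exp_add[symmetric] algebra_simps)
qed

text \<open>For \<open>u, v\<close> in the \<open>\<eta>\<close>-ball around a bounded function, composition with \<open>f\<close> is Lipschitz from
  the Orlicz space into \<open>L\<^sup>m\<close>: smallness of \<open>\<eta>\<close> absorbs the exponential growth.\<close>

lemma f_local_Lipschitz:
  assumes m: "p \<le> m" and \<eta>: "0 < \<eta>" "2 * m * (lam * 2 powr p) * \<eta> powr p \<le> 1"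
  shows "\<exists>L>0. \<forall>(\<phi> :: 'a::euclidean_space \<Rightarrow> real) u v D. (\<forall>x. \<bar>\<phi> x\<bar> \<le> M) \<longrightarrow>
     expL_le p \<eta> (\<lambda>x. u x - \<phi> x) \<longrightarrow> u \<in> borel_measurable borel \<longrightarrow>
     (expL_le p D u \<longrightarrow> Lp_le m (L * D) (\<lambda>x. f (u x))) \<and>
     (expL_le p \<eta> (\<lambda>x. v x - \<phi> x) \<longrightarrow> v \<in> borel_measurable borel \<longrightarrow>
        expL_le p D (\<lambda>x. u x - v x) \<longrightarrow> Lp_le m (L * D) (\<lambda>x. f (u x) - f (v x)))"
proof -
  define E where "E = exp (lam * 2 powr p * M powr p)"
  have E: "E \<ge> 1" using lam by (simp add: E_def)
  have p0: "0 < p" using p by simp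
  have lam2: "0 \<le> lam * 2 powr p" using lam by simp
  have CE: "0 < C * E" using C E by simp
  from exp_weight_Lp_le[OF p0 m CE lam2 \<eta>, where 'a='a]
  obtain L where L: "L > 0" "\<And>D (g :: 'a \<Rightarrow> real) z w\<^sub>1 w\<^sub>2. g \<in> borel_measurable borel \<Longrightarrow> expL_le p D z \<Longrightarrow>
     expL_le p \<eta> w\<^sub>1 \<Longrightarrow> expL_le p \<eta> w\<^sub>2 \<Longrightarrow>
     (\<forall>x. \<bar>g x\<bar> \<le> C * E * \<bar>z x\<bar> * (exp (lam * 2 powr p * \<bar>w\<^sub>1 x\<bar> powr p) + exp (lam * 2 powr p * \<bar>w\<^sub>2 x\<bar> powr p))) \<Longrightarrow> Lp_le m (L * D) g"
    by auto
  have A: "Lp_le m (L * D) (\<lambda>x. f (u x))"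
    if \<phi>: "\<forall>x. \<bar>\<phi> x\<bar> \<le> M" and u: "expL_le p \<eta> (\<lambda>x. u x - \<phi> x)" "u \<in> borel_measurable borel" "expL_le p D u"
    for \<phi> u :: "'a \<Rightarrow> real" and D
  proof (rule L(2)[OF _ u(3,1,1)])
    have [measurable]: "u \<in> borel_measurable borel" by (rule u)
    show "(\<lambda>x. f (u x)) \<in> borel_measurable borel" by measurable
    show "\<forall>x. \<bar>f (u x)\<bar> \<le> C * E * \<bar>u x\<bar> * (exp (lam * 2 powr p * \<bar>u x - \<phi> x\<bar> powr p) + exp (lam * 2 powr p * \<bar>u x - \<phi> x\<bar> powr p))"
    proof
      fix x
      let ?e = "exp (lam * 2 powr p * \<bar>u x - \<phi> x\<bar> powr p)"
      have e1: "?e \<ge> 1" using lam by simp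
      \<comment> \<open>Comparing with \<open>f 0 = 0\<close> produces the weight of 0, which is 1;
        it is absorbed into a second copy of \<open>E * ?e\<close>.\<close>
      have "1 * 1 \<le> E * ?e" using E e1 by (intro mult_mono) auto
      moreover have "exp (lam * \<bar>u x\<bar> powr p) \<le> E * ?e" unfolding E_def using \<phi> by (intro exp_powr_split) simp
      ultimately have "exp (lam * \<bar>u x\<bar> powr p) + 1 \<le> E * ?e + E * ?e" by simp
      then have "C * \<bar>u x\<bar> * (exp (lam * \<bar>u x\<bar> powr p) + 1) \<le> C * \<bar>u x\<bar> * (E * ?e + E * ?e)"
        using C by (intro mult_left_mono) auto
      then show "\<bar>f (u x)\<bar> \<le> C * E * \<bar>u x\<bar> * (?e + ?e)"
        using f[of "u x" 0] f0 p by (simp add: algebra_simps)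
    qed
  qed
  have B: "Lp_le m (L * D) (\<lambda>x. f (u x) - f (v x))"
    if \<phi>: "\<forall>x. \<bar>\<phi> x\<bar> \<le> M" and u: "expL_le p \<eta> (\<lambda>x. u x - \<phi> x)" "u \<in> borel_measurable borel"
      and v: "expL_le p \<eta> (\<lambda>x. v x - \<phi> x)" "v \<in> borel_measurable borel" and uv: "expL_le p D (\<lambda>x. u x - v x)"
    for \<phi> u v :: "'a \<Rightarrow> real" and D
  proof (rule L(2)[OF _ uv u(1) v(1)])
    have [measurable]: "u \<in> borel_measurable borel" "v \<in> borel_measurable borel" by (rule u v)+
    show "(\<lambda>x. f (u x) - f (v x)) \<in> borel_measurable borel" by measurable
    show "\<forall>x. \<bar>f (u x) - f (v x)\<bar> \<le> C * E * \<bar>u x - v x\<bar> * (exp (lam * 2 powr p * \<bar>u x - \<phi> x\<bar> powr p) + exp (lam * 2 powr p * \<bar>v x - \<phi> x\<bar> powr p))"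
    proof
      fix x
      let ?e = "\<lambda>u. exp (lam * 2 powr p * \<bar>u x - \<phi> x\<bar> powr p)"
      have "exp (lam * \<bar>u x\<bar> powr p) \<le> E * ?e u" "exp (lam * \<bar>v x\<bar> powr p) \<le> E * ?e v"
        unfolding E_def using \<phi> by (intro exp_powr_split; simp)+
      then have "C * \<bar>u x - v x\<bar> * (exp (lam * \<bar>u x\<bar> powr p) + exp (lam * \<bar>v x\<bar> powr p)) \<le> C * \<bar>u x - v x\<bar> * (E * ?e u + E * ?e v)"
        using C by (intro mult_left_mono add_mono) auto
      then show "\<bar>f (u x) - f (v x)\<bar> \<le> C * E * \<bar>u x - v x\<bar> * (?e u + ?e v)"
        using f[of "u x" "v x"] by (simp add: algebra_simps)
    qed
  qed
  show ?thesis using L(1) A B by (intro exI[of _ L]) blast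
qed

end

section \<open>The Duhamel integral\<close>

text \<open>The least bound is the norm itself. It turns smallness for every \<open>e\<close>
  eventually into one numerical sequence tending to 0, the form asked for by
  \<open>mixed_semigroup_tendsto\<close>.\<close>

lemma Lp_le_sharp:
  assumes g: "Lp_le m A g" and m: "0 < m"
  shows "\<exists>B. Lp_le m B g \<and> (\<forall>e. Lp_le m e g \<longrightarrow> B \<le> e)"
proof -
  let ?I = "\<integral>\<^sup>+x. ennreal (\<bar>g x\<bar> powr m) \<partial>lborel"
  have fin: "?I < top" using Lp_leD(3)[OF g] by (rule le_less_trans) simp
  define B where "B = enn2real ?I powr (1 / m)"
  have Bm: "B powr m = enn2real ?I" using m by (simp add: B_def powr_powr)
  have "Lp_le m B g" using Lp_leD(1)[OF g] fin unfolding Lp_le_def Bm by (simp add: B_def)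
  moreover have "B \<le> e" if "Lp_le m e g" for e
  proof -
    have e: "0 \<le> e" using that by (rule Lp_leD)
    have "enn2real ?I \<le> e powr m" using Lp_leD(3)[OF that] by (simp add: enn2real_leI)
    then have "B \<le> (e powr m) powr (1 / m)" unfolding B_def using m by (intro powr_mono2) auto
    then show ?thesis using m e by (simp add: powr_powr)
  qed
  ultimately show ?thesis by blast
qed

text \<open>The constant is not sharp, which spares Minkowski's inequality.\<close>

lemma Lp_le_diff:
  assumes g: "Lp_le m A g" and h: "Lp_le m B h" and m: "1 \<le> m"
  shows "Lp_le m (4 * (A + B)) (\<lambda>x. g x - h x)"
proof -
  have AB: "0 \<le> A" "0 \<le> B" using g h by (auto dest: Lp_leD)
  note [measurable] = Lp_leD(1)[OF g] Lp_leD(1)[OF h]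
  have "\<bar>a - b\<bar> powr m \<le> 2 powr m * (\<bar>a\<bar> powr m + \<bar>b\<bar> powr m)" for a b :: real
  proof -
    have "\<bar>a - b\<bar> \<le> \<bar>a\<bar> + \<bar>b\<bar>" by linarith
    also have "\<dots> \<le> 2 * max \<bar>a\<bar> \<bar>b\<bar>" by (simp add: max_def)
    finally have "\<bar>a - b\<bar> powr m \<le> (2 * max \<bar>a\<bar> \<bar>b\<bar>) powr m" using m by (intro powr_mono2) auto
    also have "\<dots> = 2 powr m * max \<bar>a\<bar> \<bar>b\<bar> powr m" by (rule powr_mult)
    also have "\<dots> \<le> 2 powr m * (\<bar>a\<bar> powr m + \<bar>b\<bar> powr m)" by (intro mult_left_mono) (auto simp: max_def)
    finally show ?thesis .
  qed
  then have "(\<integral>\<^sup>+x. ennreal (\<bar>g x - h x\<bar> powr m) \<partial>lborel) \<le> (\<integral>\<^sup>+x. ennreal (2 powr m) * (ennreal (\<bar>g x\<bar> powr m) + ennreal (\<bar>h x\<bar> powr m)) \<partial>lborel)"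
    by (intro nn_integral_mono) (simp add: ennreal_mult'[symmetric] ennreal_plus[symmetric] ennreal_leI del: ennreal_plus)
  also have "\<dots> = ennreal (2 powr m) * ((\<integral>\<^sup>+x. ennreal (\<bar>g x\<bar> powr m) \<partial>lborel) + (\<integral>\<^sup>+x. ennreal (\<bar>h x\<bar> powr m) \<partial>lborel))"
    by (subst nn_integral_cmult, measurable, subst nn_integral_add, measurable)
  also have "\<dots> \<le> ennreal (2 powr m) * (ennreal (A powr m) + ennreal (B powr m))"
    by (intro mult_left_mono add_mono Lp_leD(3) g h) simp
  also have "\<dots> = ennreal (2 powr m * (A powr m + B powr m))"
    by (simp add: ennreal_mult'[symmetric] ennreal_plus[symmetric] del: ennreal_plus)
  also have "\<dots> \<le> ennreal ((4 * (A + B)) powr m)"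
  proof (rule ennreal_leI)
    have "A powr m \<le> (A + B) powr m" "B powr m \<le> (A + B) powr m" using AB m by (auto intro!: powr_mono2)
    moreover have "2 \<le> (2::real) powr m" using powr_mono[of 1 m 2] m by simp
    ultimately have "A powr m + B powr m \<le> 2 powr m * (A + B) powr m"
      using mult_right_mono[of 2 "2 powr m" "(A + B) powr m"] by simp
    then have "2 powr m * (A powr m + B powr m) \<le> 2 powr m * (2 powr m * (A + B) powr m)" by (intro mult_left_mono) auto
    also have "\<dots> = (4 * (A + B)) powr m" by (simp add: powr_mult[symmetric] mult.assoc[symmetric])
    finally show "2 powr m * (A powr m + B powr m) \<le> (4 * (A + B)) powr m" .
  qed
  finally show ?thesis using AB by (simp add: Lp_le_def)
qed

section \<open>The singular time weight and Duhamel integrals of curves\<close>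

lemma nn_integral_powr_singular:
  assumes \<alpha>: "0 \<le> \<alpha>" "\<alpha> < 1" and ab: "a \<le> b"
  shows "(\<integral>\<^sup>+\<tau>. ennreal (indicator {a..b} \<tau> * (b - \<tau>) powr - \<alpha>) \<partial>lborel) = ennreal ((b - a) powr (1 - \<alpha>) / (1 - \<alpha>))"
proof -
  have "(\<integral>\<^sup>+\<tau>. ennreal (indicator {a..b} \<tau> * (b - \<tau>) powr - \<alpha>) \<partial>lborel) =
      (\<integral>\<^sup>+r. ennreal (indicator {a..b} (b - r) * (b - (b - r)) powr - \<alpha>) \<partial>lborel)"
    by (subst lborel_nn_integral_affine[of "-1" _ b]) auto
  also have "\<dots> = (\<integral>\<^sup>+r. ennreal (indicator {0..b - a} r * r powr - \<alpha>) \<partial>lborel)"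
    by (intro nn_integral_cong) (auto simp: indicator_def)
  also have "\<dots> = ennreal ((b - a) powr (- \<alpha> + 1) / (- \<alpha> + 1))"
    by (rule nn_integral_has_integral_lebesgue[OF _ has_integral_powr_from_0]) (use \<alpha> ab in auto)
  finally show ?thesis by (simp add: add.commute)
qed

lemma powr_singular_integrable:
  fixes \<alpha> a b :: real
  assumes \<alpha>: "0 \<le> \<alpha>" "\<alpha> < 1" and ab: "a \<le> b"
  shows "integrable lborel (\<lambda>\<tau>. indicator {a..b} \<tau> * (b - \<tau>) powr - \<alpha>)"
    and "(LINT \<tau>|lborel. indicator {a..b} \<tau> * (b - \<tau>) powr - \<alpha>) = (b - a) powr (1 - \<alpha>) / (1 - \<alpha>)"
proof -
  show "integrable lborel (\<lambda>\<tau>. indicator {a..b} \<tau> * (b - \<tau>) powr - \<alpha>)"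
    by (rule integrableI_nonneg) (auto simp: nn_integral_powr_singular[OF assms])
  show "(LINT \<tau>|lborel. indicator {a..b} \<tau> * (b - \<tau>) powr - \<alpha>) = (b - a) powr (1 - \<alpha>) / (1 - \<alpha>)"
    using \<alpha> ab by (subst integral_eq_nn_integral) (auto simp: nn_integral_powr_singular[OF assms])
qed

text \<open>The \<open>q\<close> side gives the sup bound and, through continuity in time, a jointly
  continuous integrand; the \<open>p\<close> side gives the \<open>p\<close>-th moment of the
  Duhamel integral.\<close>

definition Lpq_curve :: "real \<Rightarrow> real \<Rightarrow> real \<Rightarrow> real \<Rightarrow> real \<Rightarrow> (real \<Rightarrow> 'a::euclidean_space \<Rightarrow> real) \<Rightarrow> bool" where
  "Lpq_curve p q A a b g \<longleftrightarrow> (\<forall>\<tau>\<in>{a..b}. Lp_le p A (g \<tau>) \<and> Lp_le q A (g \<tau>)) \<and>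
    (\<forall>\<tau>\<in>{a..b}. \<forall>e>0. \<exists>d>0. \<forall>\<sigma>\<in>{a..b}. \<bar>\<sigma> - \<tau>\<bar> < d \<longrightarrow> Lp_le q e (\<lambda>x. g \<sigma> x - g \<tau> x))"

text \<open>The integration interval and the evolution time \<open>t\<close> are separate
  parameters, since the splitting of an integral produces pieces that end before
  \<open>t\<close>.\<close>

definition duhamel :: "real \<Rightarrow> real \<Rightarrow> real \<Rightarrow> real \<Rightarrow> (real \<Rightarrow> 'a::euclidean_space \<Rightarrow> real) \<Rightarrow> 'a \<Rightarrow> real" where
  "duhamel s a b t g x = (LINT \<tau>:{a..b}|lborel. mixed_semigroup s (t - \<tau>) (g \<tau>) x)"

context
  fixes s p q :: real
  assumes s: "0 < s" "s < 1" and p: "1 \<le> p" and q: "1 \<le> q"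
begin

lemma mixed_semigroup_tendsto_eventually:
  fixes x :: "nat \<Rightarrow> 'a::euclidean_space"
  assumes t: "t \<longlonglongrightarrow> r" "r > 0" and x: "x \<longlonglongrightarrow> y"
    and h: "Lp_le q A h" and g: "\<And>e. e > 0 \<Longrightarrow> \<forall>\<^sub>F n in sequentially. Lp_le q e (\<lambda>y. g n y - h y)"
  shows "(\<lambda>n. mixed_semigroup s (t n) (g n) (x n)) \<longlonglongrightarrow> mixed_semigroup s r h y"
proof -
  have "\<forall>\<^sub>F n in sequentially. r / 2 < t n" using t by (intro order_tendstoD(1)) auto
  with g[OF zero_less_one] have "\<forall>\<^sub>F n in sequentially. Lp_le q 1 (\<lambda>y. g n y - h y) \<and> r / 2 < t n"
    by (rule eventually_conj)
  then obtain N where N: "\<And>n. n \<ge> N \<Longrightarrow> Lp_le q 1 (\<lambda>y. g n y - h y)" "\<And>n. n \<ge> N \<Longrightarrow> r / 2 < t n"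
    by (auto simp: eventually_sequentially)
  have "\<exists>B. Lp_le q B (\<lambda>y. g (n + N) y - h y) \<and> (\<forall>e. Lp_le q e (\<lambda>y. g (n + N) y - h y) \<longrightarrow> B \<le> e)" for n
    using q by (intro Lp_le_sharp[OF N(1)]) auto
  then obtain B where B: "\<And>n. Lp_le q (B n) (\<lambda>y. g (n + N) y - h y)" "\<And>n e. Lp_le q e (\<lambda>y. g (n + N) y - h y) \<Longrightarrow> B n \<le> e"
    by metis
  have B0: "0 \<le> B n" for n using B(1) by (rule Lp_leD)
  have "B \<longlonglongrightarrow> 0"
  proof (rule tendstoI)
    fix e :: real assume e: "e > 0"
    then have "\<forall>\<^sub>F n in sequentially. Lp_le q (e/2) (\<lambda>y. g n y - h y)" by (intro g) simp
    then have "\<forall>\<^sub>F n in sequentially. Lp_le q (e/2) (\<lambda>y. g (n + N) y - h y)" by (auto simp: eventually_sequentially intro: trans_le_add1)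
    then show "\<forall>\<^sub>F n in sequentially. dist (B n) 0 < e"
      by eventually_elim (use B(2) B0 e in \<open>fastforce simp: dist_real_def\<close>)
  qed
  then have "(\<lambda>n. mixed_semigroup s (t (n + N)) (g (n + N)) (x (n + N))) \<longlonglongrightarrow> mixed_semigroup s r h y"
    by (intro mixed_semigroup_tendsto[OF s LIMSEQ_ignore_initial_segment[OF t(1), of N] _ _ LIMSEQ_ignore_initial_segment[OF x, of N] h B(1) _ q, where a="r / 2"])
      (use N t in \<open>auto intro: less_imp_le\<close>)
  then show ?thesis by (rule LIMSEQ_offset)
qed

context
  fixes \<alpha> A a b t :: real and g :: "real \<Rightarrow> 'a::euclidean_space \<Rightarrow> real"
  assumes \<alpha>: "\<alpha> = real DIM('a) / (2 * q)" "\<alpha> < 1" and g: "Lpq_curve p q A a b g" and ab: "a \<le> b" "b \<le> t" and A: "0 \<le> A"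
begin

lemma \<alpha>_nonneg: "0 \<le> \<alpha>"
  using \<alpha> q by simp

lemma curve_Lp: "\<tau> \<in> {a..b} \<Longrightarrow> Lp_le p A (g \<tau>)" "\<tau> \<in> {a..b} \<Longrightarrow> Lp_le q A (g \<tau>)"
  using g by (auto simp: Lpq_curve_def)

lemma duhamel_integrand_continuous:
  "continuous_on (({a..b} \<inter> {..<t}) \<times> UNIV) (\<lambda>z. mixed_semigroup s (t - fst z) (g (fst z)) (snd z))"
proof (rule continuous_on_sequentiallyI)
  fix u :: "nat \<Rightarrow> real \<times> 'a" and z
  assume u: "\<forall>n. u n \<in> ({a..b} \<inter> {..<t}) \<times> UNIV" "z \<in> ({a..b} \<inter> {..<t}) \<times> UNIV" "u \<longlonglongrightarrow> z"
  have f: "(\<lambda>n. fst (u n)) \<longlonglongrightarrow> fst z" using u(3) by (rule tendsto_fst)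
  have u1: "fst (u n) \<in> {a..b}" for n using spec[OF u(1), of n] by (simp add: mem_Times_iff)
  have z1: "fst z \<in> {a..b}" "fst z < t" using u(2) by auto
  show "(\<lambda>n. mixed_semigroup s (t - fst (u n)) (g (fst (u n))) (snd (u n))) \<longlonglongrightarrow> mixed_semigroup s (t - fst z) (g (fst z)) (snd z)"
  proof (rule mixed_semigroup_tendsto_eventually[OF _ _ tendsto_snd[OF u(3)] curve_Lp(2)[OF z1(1)]])
    show "(\<lambda>n. t - fst (u n)) \<longlonglongrightarrow> t - fst z" by (intro tendsto_intros f)
    show "0 < t - fst z" using z1 by simp
    fix e :: real assume "e > 0"
    then obtain d where d: "d > 0" "\<And>\<sigma>. \<sigma> \<in> {a..b} \<Longrightarrow> \<bar>\<sigma> - fst z\<bar> < d \<Longrightarrow> Lp_le q e (\<lambda>x. g \<sigma> x - g (fst z) x)"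
      using g z1(1) unfolding Lpq_curve_def by meson
    have "\<forall>\<^sub>F n in sequentially. dist (fst (u n)) (fst z) < d" using f d(1) by (rule tendstoD)
    then show "\<forall>\<^sub>F n in sequentially. Lp_le q e (\<lambda>y. g (fst (u n)) y - g (fst z) y)"
      by eventually_elim (intro d(2) u1, simp add: dist_real_def)
  qed
qed

text \<open>The singular weight is measured from \<open>b\<close> and not from \<open>t\<close>,
  which makes the bound uniform over all evolution times \<open>t \<ge> b\<close>.\<close>

lemma duhamel_integrand_bound:
  assumes "\<tau> \<in> {a..b}" "\<tau> < b"
  shows "\<bar>mixed_semigroup s (t - \<tau>) (g \<tau>) x\<bar> \<le> A * (b - \<tau>) powr - \<alpha>"
proof -
  have "\<bar>mixed_semigroup s (t - \<tau>) (g \<tau>) x\<bar> \<le> (4 * pi * (t - \<tau>)) powr (- (real DIM('a) / (2 * q))) * A"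
    using assms ab by (intro mixed_semigroup_bound[OF s _ curve_Lp(2) q]) auto
  also have "\<dots> \<le> (b - \<tau>) powr - \<alpha> * A"
  proof (rule mult_right_mono[OF _ A])
    have "1 * (t - \<tau>) \<le> (4 * pi) * (t - \<tau>)" using pi_ge_two ab assms by (intro mult_right_mono) auto
    then have "b - \<tau> \<le> 4 * pi * (t - \<tau>)" using ab by simp
    then show "(4 * pi * (t - \<tau>)) powr (- (real DIM('a) / (2 * q))) \<le> (b - \<tau>) powr - \<alpha>"
      unfolding \<alpha>(1)[symmetric] using assms \<alpha>_nonneg by (intro powr_mono2') auto
  qed
  finally show ?thesis by (simp add: mult.commute)
qed

text \<open>The integrand of the Duhamel integral with the (null) time \<open>\<tau> = b\<close> removed, where it need not be continuous.\<close>

definition "W0 \<tau> x = indicator ({a..b} \<inter> {..<b}) \<tau> * mixed_semigroup s (t - \<tau>) (g \<tau>) x"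

text \<open>Joint measurability, needed for Tonelli's theorem in \<open>duhamel_Lp_le\<close>, comes
  from joint continuity on the half-open strip.\<close>

lemma W0_measurable: "(\<lambda>z. W0 (fst z) (snd z)) \<in> borel_measurable borel"
proof -
  let ?A = "({a..b} \<inter> {..<b}) \<times> (UNIV :: 'a set)"
  have "?A \<in> sets (borel \<Otimes>\<^sub>M borel)" by (intro pair_measureI) auto
  then have "?A \<in> sets borel" unfolding borel_prod .
  moreover have "continuous_on ?A (\<lambda>z. mixed_semigroup s (t - fst z) (g (fst z)) (snd z))"
    by (rule continuous_on_subset[OF duhamel_integrand_continuous]) (use ab in auto)
  ultimately have "(\<lambda>z. indicator ?A z *\<^sub>R mixed_semigroup s (t - fst z) (g (fst z)) (snd z)) \<in> borel_measurable borel"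
    by (rule borel_measurable_continuous_on_indicator)
  also have "(\<lambda>z. indicator ?A z *\<^sub>R mixed_semigroup s (t - fst z) (g (fst z)) (snd z)) = (\<lambda>z. W0 (fst z) (snd z))"
    unfolding W0_def by (intro ext) (auto simp: indicator_def)
  finally show ?thesis .
qed

lemma W0_measurable_pair [measurable]: "(\<lambda>(\<tau>, x). W0 \<tau> x) \<in> borel_measurable (lborel \<Otimes>\<^sub>M lborel)"
  using W0_measurable unfolding lborel_prod by (simp add: case_prod_beta')

lemma W0_measurable_time [measurable]: "(\<lambda>\<tau>. W0 \<tau> x) \<in> borel_measurable borel"
  using measurable_compose[OF _ W0_measurable, of "\<lambda>\<tau>. (\<tau>, x)" borel] by simp

text \<open>At \<open>\<tau> = b\<close> the right-hand side is 0, because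
  \<open>0 powr - \<alpha>\<close> is 0 by convention. The bound survives there since
  \<open>W0\<close> is cut off at that time.\<close>

lemma W0_bound: "\<bar>W0 \<tau> x\<bar> \<le> A * (indicator {a..b} \<tau> * (b - \<tau>) powr - \<alpha>)"
  using duhamel_integrand_bound[of \<tau> x] A by (auto simp: W0_def indicator_def)

lemma W0_integrable: "integrable lborel (\<lambda>\<tau>. W0 \<tau> x)"
  by (rule Bochner_Integration.integrable_bound[OF integrable_mult_right[OF powr_singular_integrable(1)[OF \<alpha>_nonneg \<alpha>(2) ab(1)], of A]])
    (use W0_bound A in \<open>auto intro!: AE_I2 order_trans[OF W0_bound]\<close>)

lemma W0_AE: "AE \<tau> in lborel. indicator {a..b} \<tau> *\<^sub>R mixed_semigroup s (t - \<tau>) (g \<tau>) x = W0 \<tau> x"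
  using AE_lborel_singleton[of b] by eventually_elim (auto simp: W0_def indicator_def)

lemma duhamel_integrand_measurable:
  "(\<lambda>\<tau>. indicator {a..b} \<tau> *\<^sub>R mixed_semigroup s (t - \<tau>) (g \<tau>) x) \<in> borel_measurable borel"
proof -
  have "(\<lambda>\<tau>. W0 \<tau> x + indicator {b} \<tau> * (mixed_semigroup s (t - b) (g b) x)) \<in> borel_measurable borel" by measurable
  also have "(\<lambda>\<tau>. W0 \<tau> x + indicator {b} \<tau> * (mixed_semigroup s (t - b) (g b) x)) = (\<lambda>\<tau>. indicator {a..b} \<tau> *\<^sub>R mixed_semigroup s (t - \<tau>) (g \<tau>) x)"
    unfolding W0_def using ab by (intro ext) (auto simp: indicator_def)
  finally show ?thesis .
qed

lemma duhamel_set_integrable: "set_integrable lborel {a..b} (\<lambda>\<tau>. mixed_semigroup s (t - \<tau>) (g \<tau>) x)"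
  unfolding set_integrable_def
  using W0_integrable[of x] W0_AE[of x] duhamel_integrand_measurable[of x]
  by (subst integrable_cong_AE[where g="\<lambda>\<tau>. W0 \<tau> x"]) auto

lemma duhamel_eq_W0: "duhamel s a b t g x = (LINT \<tau>|lborel. W0 \<tau> x)"
  unfolding duhamel_def set_lebesgue_integral_def
  using W0_AE[of x] duhamel_integrand_measurable[of x] by (intro integral_cong_AE) auto

lemma duhamel_bound: "\<bar>duhamel s a b t g x\<bar> \<le> A * ((b - a) powr (1 - \<alpha>) / (1 - \<alpha>))"
proof -
  have "\<bar>duhamel s a b t g x\<bar> \<le> (LINT \<tau>|lborel. \<bar>W0 \<tau> x\<bar>)" unfolding duhamel_eq_W0 by (rule integral_abs_bound)
  also have "\<dots> \<le> (LINT \<tau>|lborel. A * (indicator {a..b} \<tau> * (b - \<tau>) powr - \<alpha>))"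
    by (intro integral_mono integrable_abs W0_integrable integrable_mult_right powr_singular_integrable(1) \<alpha>_nonneg \<alpha> ab W0_bound)
  also have "\<dots> = A * ((b - a) powr (1 - \<alpha>) / (1 - \<alpha>))"
    by (simp add: powr_singular_integrable(2)[OF \<alpha>_nonneg \<alpha>(2) ab(1)])
  finally show ?thesis .
qed

lemma duhamel_continuous: "continuous_on UNIV (duhamel s a b t g)"
proof (rule continuous_on_sequentiallyI)
  fix u :: "nat \<Rightarrow> 'a" and y assume u: "u \<longlonglongrightarrow> y"
  show "(\<lambda>n. duhamel s a b t g (u n)) \<longlonglongrightarrow> duhamel s a b t g y"
    unfolding duhamel_eq_W0
  proof (rule integral_dominated_convergence)
    show "integrable lborel (\<lambda>\<tau>. A * (indicator {a..b} \<tau> * (b - \<tau>) powr - \<alpha>))"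
      by (intro integrable_mult_right powr_singular_integrable(1) \<alpha>_nonneg \<alpha> ab)
    show "AE \<tau> in lborel. norm (W0 \<tau> (u n)) \<le> A * (indicator {a..b} \<tau> * (b - \<tau>) powr - \<alpha>)" for n
      using W0_bound by simp
    show "AE \<tau> in lborel. (\<lambda>n. W0 \<tau> (u n)) \<longlonglongrightarrow> W0 \<tau> y"
    proof (rule AE_I2)
      fix \<tau>
      show "(\<lambda>n. W0 \<tau> (u n)) \<longlonglongrightarrow> W0 \<tau> y"
      proof (cases "\<tau> \<in> {a..b} \<inter> {..<b}")
        case True
        then have \<tau>: "\<tau> \<in> {a..b}" "t - \<tau> > 0" using ab by auto
        have "continuous_on UNIV (mixed_semigroup s (t - \<tau>) (g \<tau>))"
          by (rule mixed_semigroup_continuous[OF s \<tau>(2) curve_Lp(2)[OF \<tau>(1)] q])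
        then have "(\<lambda>n. mixed_semigroup s (t - \<tau>) (g \<tau>) (u n)) \<longlonglongrightarrow> mixed_semigroup s (t - \<tau>) (g \<tau>) y"
          by (rule continuous_on_tendsto_compose) (use u in auto)
        then show ?thesis unfolding W0_def by (intro tendsto_mult tendsto_const)
      qed (auto simp: W0_def)
    qed
  qed measurable
qed

text \<open>Jensen's inequality for the uniform probability density on \<open>{a..b}\<close> moves
  the \<open>p\<close>-th power inside the time integral; then Tonelli and the contraction in L^p at
  each time apply.\<close>

lemma duhamel_Lp_le:
  assumes "a < b"
  shows "Lp_le p (A * (b - a)) (duhamel s a b t g)"
proof -
  let ?h = "b - a"
  define w where "w = (\<lambda>\<tau>. indicator {a..b} \<tau> / ?h :: real)"
  have h: "?h > 0" using assms by simp
  have w0: "0 \<le> w \<tau>" for \<tau> using h by (simp add: w_def)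
  have [measurable]: "w \<in> borel_measurable borel" unfolding w_def by measurable
  have wi: "integrable lborel w" unfolding w_def using assms by (intro integrable_divide integrable_real_indicator) auto
  have w1: "(LINT \<tau>|lborel. w \<tau>) = 1" unfolding w_def using assms by simp
  have wW: "w \<tau> * W0 \<tau> x = W0 \<tau> x / ?h" for \<tau> x by (auto simp: w_def W0_def indicator_def)
  have wWi: "integrable lborel (\<lambda>\<tau>. w \<tau> * W0 \<tau> x)" for x unfolding wW by (intro integrable_divide W0_integrable)
  have D: "duhamel s a b t g x = ?h * (LINT \<tau>|lborel. w \<tau> * W0 \<tau> x)" for x
    unfolding duhamel_eq_W0 wW using h by simp
  have pt: "ennreal (\<bar>duhamel s a b t g x\<bar> powr p) \<le> ennreal (?h powr p) * (\<integral>\<^sup>+\<tau>. ennreal (w \<tau>) * ennreal (\<bar>W0 \<tau> x\<bar> powr p) \<partial>lborel)" for x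
  proof -
    have "ennreal (\<bar>LINT \<tau>|lborel. w \<tau> * W0 \<tau> x\<bar> powr p) \<le> (\<integral>\<^sup>+\<tau>. ennreal (w \<tau>) * ennreal (\<bar>W0 \<tau> x\<bar> powr p) \<partial>lborel)"
      by (rule jensen_density[OF wi w0 w1 _ wWi convex_on_abs_powr[OF p]]) auto
    from mult_left_mono[OF this, of "ennreal (?h powr p)"] show ?thesis
      unfolding D using h by (simp add: abs_mult powr_mult ennreal_mult')
  qed
  have "(\<integral>\<^sup>+x. ennreal (\<bar>duhamel s a b t g x\<bar> powr p) \<partial>lborel) \<le>
      (\<integral>\<^sup>+x. ennreal (?h powr p) * (\<integral>\<^sup>+\<tau>. ennreal (w \<tau>) * ennreal (\<bar>W0 \<tau> x\<bar> powr p) \<partial>lborel) \<partial>lborel)"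
    by (intro nn_integral_mono pt)
  also have "\<dots> = ennreal (?h powr p) * (\<integral>\<^sup>+x. \<integral>\<^sup>+\<tau>. ennreal (w \<tau>) * ennreal (\<bar>W0 \<tau> x\<bar> powr p) \<partial>lborel \<partial>lborel)"
    by (rule nn_integral_cmult) measurable
  also have "(\<integral>\<^sup>+x. \<integral>\<^sup>+\<tau>. ennreal (w \<tau>) * ennreal (\<bar>W0 \<tau> x\<bar> powr p) \<partial>lborel \<partial>lborel)
      = (\<integral>\<^sup>+\<tau>. \<integral>\<^sup>+x. ennreal (w \<tau>) * ennreal (\<bar>W0 \<tau> x\<bar> powr p) \<partial>lborel \<partial>lborel)"
    by (rule lborel_pair.Fubini') measurable
  also have "\<dots> \<le> (\<integral>\<^sup>+\<tau>. ennreal (w \<tau>) * ennreal (A powr p) \<partial>lborel)"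
  proof (rule nn_integral_mono)
    fix \<tau>
    have [measurable]: "(\<lambda>x. W0 \<tau> x) \<in> borel_measurable borel"
      using measurable_compose[OF _ W0_measurable, of "\<lambda>x. (\<tau>, x)" borel] by simp
    have "(\<integral>\<^sup>+x. ennreal (\<bar>W0 \<tau> x\<bar> powr p) \<partial>lborel) \<le> ennreal (A powr p)"
    proof (cases "\<tau> \<in> {a..b} \<inter> {..<b}")
      case True
      then have "Lp_le p A (mixed_semigroup s (t - \<tau>) (g \<tau>))"
        using ab by (intro mixed_semigroup_Lp_le[OF s _ curve_Lp(1) p]) auto
      then show ?thesis using True by (simp add: W0_def Lp_le_def)
    qed (use p in \<open>simp add: W0_def\<close>)
    from mult_left_mono[OF this, of "ennreal (w \<tau>)"]
    show "(\<integral>\<^sup>+x. ennreal (w \<tau>) * ennreal (\<bar>W0 \<tau> x\<bar> powr p) \<partial>lborel) \<le> ennreal (w \<tau>) * ennreal (A powr p)"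
      by (simp add: nn_integral_cmult)
  qed
  also have "\<dots> = ennreal (A powr p)"
    using wi w0 w1 by (simp add: nn_integral_multc nn_integral_eq_integral)
  also have "ennreal (?h powr p) * ennreal (A powr p) = ennreal ((A * ?h) powr p)"
    using h A by (simp add: ennreal_mult'[symmetric] powr_mult mult.commute)
  finally have "(\<integral>\<^sup>+x. ennreal (\<bar>duhamel s a b t g x\<bar> powr p) \<partial>lborel) \<le> ennreal ((A * ?h) powr p)"
    by (simp add: mult_left_mono)
  moreover have "duhamel s a b t g \<in> borel_measurable borel" using duhamel_continuous by (rule borel_measurable_continuous_onI)
  ultimately show ?thesis using A h by (simp add: Lp_le_def)
qed

lemma duhamel_expL0:
  assumes "a < b"
  shows "duhamel s a b t g \<in> expL0 p"
proof (rule expL0_continuous_bounded[OF p duhamel_continuous duhamel_bound])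
  show "(\<integral>\<^sup>+x. ennreal (\<bar>duhamel s a b t g x\<bar> powr p) \<partial>lborel) < \<infinity>"
    using Lp_leD(3)[OF duhamel_Lp_le[OF assms]] by (simp add: le_less_trans)
qed

text \<open>The sup bound and the \<open>p\<close>-th moment bound are fed into
  \<open>expL_le_bounded\<close>. In the constant, \<open>1 / (1 - \<alpha>)\<close> makes the sup
  bound at most the radius, so that the exponential factor is at most \<open>exp 1\<close>, and the
  summand \<open>exp 1\<close> absorbs that factor. As \<open>b - a \<le> 1\<close>, the power
  \<open>1 - \<alpha>\<close> also dominates the length.\<close>

lemma duhamel_expL_le:
  assumes h: "a < b" "b - a \<le> 1" and A0: "0 < A"
  shows "expL_le p (A * (exp 1 + 1 / (1 - \<alpha>)) * (b - a) powr (1 - \<alpha>)) (duhamel s a b t g)"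
proof -
  let ?h = "b - a"
  define K where "K = exp 1 + 1 / (1 - \<alpha>)"
  define \<mu> where "\<mu> = A * K * ?h powr (1 - \<alpha>)"
  have \<alpha>1: "1 - \<alpha> > 0" using \<alpha> by simp
  have K: "K > 0" "exp 1 \<le> K" "1 / (1 - \<alpha>) \<le> K" using \<alpha>1 by (auto simp: K_def add_pos_pos)
  have \<mu>: "\<mu> > 0" unfolding \<mu>_def using A0 K h by simp
  have "expL_le p \<mu> (duhamel s a b t g)"
  proof (rule expL_le_bounded[OF _ \<mu> duhamel_bound])
    show "duhamel s a b t g \<in> borel_measurable borel" using duhamel_continuous by (rule borel_measurable_continuous_onI)
    show "(\<integral>\<^sup>+x. ennreal (\<bar>duhamel s a b t g x\<bar> powr p) \<partial>lborel) \<le> ennreal ((A * ?h) powr p)"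
      by (rule Lp_leD(3)[OF duhamel_Lp_le[OF h(1)]])
    have "A * (?h powr (1 - \<alpha>) / (1 - \<alpha>)) / \<mu> = 1 / (1 - \<alpha>) / K"
      unfolding \<mu>_def using A0 h by simp
    also have "\<dots> \<le> 1" using K by (subst divide_le_eq_1_pos) auto
    finally have "(A * (?h powr (1 - \<alpha>) / (1 - \<alpha>)) / \<mu>) powr p \<le> 1 powr p"
      using A0 \<alpha>1 \<mu> p by (intro powr_mono2) auto
    then have "exp ((A * (?h powr (1 - \<alpha>) / (1 - \<alpha>)) / \<mu>) powr p) * (A * ?h) powr p \<le> exp 1 * (A * ?h) powr p"
      by (intro mult_right_mono) auto
    also have "\<dots> \<le> exp 1 powr p * (A * ?h) powr p"
      using p powr_mono[of 1 p "exp 1"] by (intro mult_right_mono) auto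
    also have "\<dots> = (exp 1 * (A * ?h)) powr p" by (rule powr_mult[symmetric])
    also have "\<dots> \<le> \<mu> powr p"
    proof (rule powr_mono2)
      have "?h powr 1 \<le> ?h powr (1 - \<alpha>)" using h \<alpha>_nonneg by (intro powr_mono') auto
      then have "exp 1 * (A * ?h) \<le> K * (A * ?h powr (1 - \<alpha>))"
        using K A0 h by (intro mult_mono mult_left_mono) auto
      then show "exp 1 * (A * ?h) \<le> \<mu>" by (simp add: \<mu>_def mult_ac)
    qed (use p A0 h in auto)
    finally show "exp ((A * (?h powr (1 - \<alpha>) / (1 - \<alpha>)) / \<mu>) powr p) * (A * ?h) powr p \<le> \<mu> powr p" .
  qed (use p in auto)
  then show ?thesis by (simp add: \<mu>_def K_def)
qed

end

lemma Lpq_curve_subset: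
  "Lpq_curve p q A a b g \<Longrightarrow> a \<le> a' \<Longrightarrow> b' \<le> b \<Longrightarrow> Lpq_curve p q A a' b' g"
  unfolding Lpq_curve_def by (meson atLeastAtMost_iff order_trans)

text \<open>Substituting \<open>\<tau> \<mapsto> \<tau> - h\<close> compares two values of the Duhamel integral without using the
  semigroup law.\<close>

lemma duhamel_shift:
  fixes g :: "real \<Rightarrow> 'a::euclidean_space \<Rightarrow> real"
  assumes g: "Lpq_curve p q A 0 T g" and \<alpha>: "real DIM('a) / (2 * q) < 1" and t: "0 \<le> t" "0 \<le> h" "t + h \<le> T" and A: "0 \<le> A"
  shows "duhamel s 0 (t + h) (t + h) g x - duhamel s 0 t t g x =
    duhamel s 0 h (t + h) g x + duhamel s h (t + h) (t + h) (\<lambda>\<tau> x. g \<tau> x - g (\<tau> - h) x) x"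
proof -
  let ?S = "mixed_semigroup s"
  have c: "Lpq_curve p q A a b g" if "0 \<le> a" "b \<le> t + h" for a b
    using Lpq_curve_subset[OF g, of a b] that t by auto
  have i1: "set_integrable lborel {0..h} (\<lambda>\<tau>. ?S (t + h - \<tau>) (g \<tau>) x)"
    using t by (intro duhamel_set_integrable[OF refl \<alpha> c _ _ A]) auto
  have i2: "set_integrable lborel {h..t + h} (\<lambda>\<tau>. ?S (t + h - \<tau>) (g \<tau>) x)"
    using t by (intro duhamel_set_integrable[OF refl \<alpha> c _ _ A]) auto
  have i3: "set_integrable lborel {0..t} (\<lambda>\<tau>. ?S (t - \<tau>) (g \<tau>) x)"
    using t by (intro duhamel_set_integrable[OF refl \<alpha> c _ _ A]) auto
  have eq: "indicator {0..t} (- h + 1 *\<^sub>R \<tau>) *\<^sub>R ?S (t - (- h + 1 *\<^sub>R \<tau>)) (g (- h + 1 *\<^sub>R \<tau>)) x =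
      indicator {h..t + h} \<tau> *\<^sub>R ?S (t + h - \<tau>) (g (\<tau> - h)) x" for \<tau>
    by (auto simp: indicator_def algebra_simps)
  have i4: "set_integrable lborel {h..t + h} (\<lambda>\<tau>. ?S (t + h - \<tau>) (g (\<tau> - h)) x)"
    using lborel_integrable_affine[OF _ i3[unfolded set_integrable_def], of 1 "- h"] unfolding set_integrable_def eq by simp
  have e4: "duhamel s 0 t t g x = (LINT \<tau>:{h..t + h}|lborel. ?S (t + h - \<tau>) (g (\<tau> - h)) x)"
    using lborel_integral_affine[of 1 "\<lambda>\<tau>. indicator {0..t} \<tau> *\<^sub>R ?S (t - \<tau>) (g \<tau>) x" "- h"]
      borel_measurable_integrable[OF i3[unfolded set_integrable_def]]
    unfolding duhamel_def set_lebesgue_integral_def eq by simp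
  have "duhamel s 0 (t + h) (t + h) g x = (LINT \<tau>:{0..h} \<union> {h..t + h}|lborel. ?S (t + h - \<tau>) (g \<tau>) x)"
    unfolding duhamel_def using t by (simp add: ivl_disj_un_two_touch(4))
  also have "\<dots> = duhamel s 0 h (t + h) g x + (LINT \<tau>:{h..t + h}|lborel. ?S (t + h - \<tau>) (g \<tau>) x)"
    unfolding duhamel_def
  proof (rule set_integral_Un_AE[OF _ _ _ i1 i2])
    show "AE \<tau> in lborel. \<not> (\<tau> \<in> {0..h} \<and> \<tau> \<in> {h..t + h})"
      using AE_lborel_singleton[of h] by eventually_elim auto
  qed auto
  finally have "duhamel s 0 (t + h) (t + h) g x - duhamel s 0 t t g x = duhamel s 0 h (t + h) g x
      + ((LINT \<tau>:{h..t + h}|lborel. ?S (t + h - \<tau>) (g \<tau>) x) - (LINT \<tau>:{h..t + h}|lborel. ?S (t + h - \<tau>) (g (\<tau> - h)) x))"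
    unfolding e4 by simp
  also have "(LINT \<tau>:{h..t + h}|lborel. ?S (t + h - \<tau>) (g \<tau>) x) - (LINT \<tau>:{h..t + h}|lborel. ?S (t + h - \<tau>) (g (\<tau> - h)) x)
     = (LINT \<tau>:{h..t + h}|lborel. ?S (t + h - \<tau>) (g \<tau>) x - ?S (t + h - \<tau>) (g (\<tau> - h)) x)"
    by (rule set_integral_diff(2)[OF i2 i4, symmetric])
  also have "\<dots> = duhamel s h (t + h) (t + h) (\<lambda>\<tau> x. g \<tau> x - g (\<tau> - h) x) x"
    unfolding duhamel_def
  proof (rule set_lebesgue_integral_cong)
    show "\<forall>\<tau>. \<tau> \<in> {h..t + h} \<longrightarrow> ?S (t + h - \<tau>) (g \<tau>) x - ?S (t + h - \<tau>) (g (\<tau> - h)) x = ?S (t + h - \<tau>) (\<lambda>x. g \<tau> x - g (\<tau> - h) x) x"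
    proof (intro allI impI)
      fix \<tau> assume "\<tau> \<in> {h..t + h}"
      then have "Lp_le p A (g \<tau>)" "Lp_le p A (g (\<tau> - h))" "0 \<le> t + h - \<tau>" using g t by (auto simp: Lpq_curve_def)
      then show "?S (t + h - \<tau>) (g \<tau>) x - ?S (t + h - \<tau>) (g (\<tau> - h)) x = ?S (t + h - \<tau>) (\<lambda>x. g \<tau> x - g (\<tau> - h) x) x"
        by (intro mixed_semigroup_diff[OF s _ _ _ p p, symmetric])
    qed
  qed simp
  finally show ?thesis .
qed

text \<open>By \<open>duhamel_shift\<close> an increment of length \<open>h\<close> is an integral
  over a slab of length \<open>h\<close>, small because the slab is short, plus the Duhamel integral
  of \<open>g \<tau> - g (\<tau> - h)\<close>, small because the curve is uniformly
  continuous.\<close>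

lemma duhamel_uniform_modulus:
  fixes g :: "real \<Rightarrow> 'a::euclidean_space \<Rightarrow> real"
  assumes g: "Lpq_curve p q A 0 T g" and \<alpha>: "real DIM('a) / (2 * q) < 1" and A: "0 < A" and T: "T \<le> 1"
    and unif: "\<And>e. e > 0 \<Longrightarrow> \<exists>d>0. \<forall>\<sigma>\<in>{0..T}. \<forall>\<tau>\<in>{0..T}. \<bar>\<sigma> - \<tau>\<bar> < d \<longrightarrow>
      Lp_le p e (\<lambda>x. g \<sigma> x - g \<tau> x) \<and> Lp_le q e (\<lambda>x. g \<sigma> x - g \<tau> x)"
    and e: "e > 0"
  shows "\<exists>d>0. \<forall>\<sigma>\<in>{0..T}. \<forall>\<tau>\<in>{0..T}. \<bar>\<sigma> - \<tau>\<bar> < d \<longrightarrow> expL_le p e (\<lambda>x. duhamel s 0 \<sigma> \<sigma> g x - duhamel s 0 \<tau> \<tau> g x)"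
proof -
  define \<alpha>' where "\<alpha>' = real DIM('a) / (2 * q)"
  have \<alpha>': "\<alpha>' = real DIM('a) / (2 * q)" "\<alpha>' < 1" using \<alpha> by (auto simp: \<alpha>'_def)
  have \<alpha>0: "0 \<le> \<alpha>'" using q by (simp add: \<alpha>'_def)
  define K where "K = exp 1 + 1 / (1 - \<alpha>')"
  have K: "K > 0" using \<alpha>' by (simp add: K_def add_pos_pos)
  define \<epsilon> where "\<epsilon> = e / (2 * K)"
  have \<epsilon>: "\<epsilon> > 0" using e K by (simp add: \<epsilon>_def)
  obtain d1 where d1: "d1 > 0" "\<And>\<sigma> \<tau>. \<sigma> \<in> {0..T} \<Longrightarrow> \<tau> \<in> {0..T} \<Longrightarrow> \<bar>\<sigma> - \<tau>\<bar> < d1 \<Longrightarrow>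
      Lp_le p \<epsilon> (\<lambda>x. g \<sigma> x - g \<tau> x) \<and> Lp_le q \<epsilon> (\<lambda>x. g \<sigma> x - g \<tau> x)"
    using unif[OF \<epsilon>] by blast
  \<comment> \<open>Solves \<open>A * K * d2 powr (1 - \<alpha>') = e / 2\<close>.\<close>
  define d2 where "d2 = (e / (2 * A * K)) powr (1 / (1 - \<alpha>'))"
  have d2: "d2 > 0" using e A K by (simp add: d2_def)
  define d where "d = min d1 d2"
  have d: "d > 0" using d1 d2 by (simp add: d_def)
  have step: "expL_le p e (\<lambda>x. duhamel s 0 (t + h) (t + h) g x - duhamel s 0 t t g x)"
    if th: "0 \<le> t" "0 < h" "t + h \<le> T" "h < d" for t h
  proof -
    have h1: "h \<le> 1" using th T by linarith
    have c0: "Lpq_curve p q A 0 h g" using Lpq_curve_subset[OF g, of 0 h] th by auto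
    have "expL_le p (A * K * (h - 0) powr (1 - \<alpha>')) (duhamel s 0 h (t + h) g)"
      unfolding K_def using th h1 A by (intro duhamel_expL_le[OF \<alpha>' c0]) auto
    moreover have "A * K * (h - 0) powr (1 - \<alpha>') \<le> e / 2"
    proof -
      have "h powr (1 - \<alpha>') \<le> d2 powr (1 - \<alpha>')" using th \<alpha>' by (intro powr_mono2) (auto simp: d_def)
      also have "\<dots> = e / (2 * A * K)" using \<alpha>'(2) e A K by (simp add: d2_def powr_powr)
      finally show ?thesis using A K by (simp add: field_simps)
    qed
    ultimately have 1: "expL_le p (e / 2) (duhamel s 0 h (t + h) g)" by (rule expL_le_mono) (use p in simp)
    have 2: "expL_le p (e / 2) (duhamel s h (t + h) (t + h) (\<lambda>\<tau> x. g \<tau> x - g (\<tau> - h) x))"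
    \<comment> \<open>The second integral then runs over a single point, while the Luxemburg
      estimate requires an interval of positive length.\<close>
    proof (cases "t = 0")
      case True
      have "set_lebesgue_integral lborel {h..h} F = 0" for F :: "real \<Rightarrow> real"
      proof -
        have "(LINT \<tau>|lborel. indicator {h..h} \<tau> *\<^sub>R F \<tau>) = (LINT \<tau>|lborel. indicator {h} \<tau> *\<^sub>R F h)"
          by (intro Bochner_Integration.integral_cong) (auto simp: indicator_def)
        then show ?thesis unfolding set_lebesgue_integral_def by simp
      qed
      then have "duhamel s h (t + h) (t + h) (\<lambda>\<tau> x. g \<tau> x - g (\<tau> - h) x) = (\<lambda>x. 0)"
        unfolding duhamel_def True by simp
      then show ?thesis using e p by (simp add: expL_le_0)
    next
      case False
      have c2: "Lpq_curve p q \<epsilon> h (t + h) (\<lambda>\<tau> x. g \<tau> x - g (\<tau> - h) x)"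
        unfolding Lpq_curve_def
      proof (intro conjI ballI allI impI)
        fix \<tau> assume "\<tau> \<in> {h..t + h}"
        then show "Lp_le p \<epsilon> (\<lambda>x. g \<tau> x - g (\<tau> - h) x)" "Lp_le q \<epsilon> (\<lambda>x. g \<tau> x - g (\<tau> - h) x)"
          using d1(2)[of \<tau> "\<tau> - h"] th by (auto simp: d_def)
      next
        fix \<tau> \<delta> :: real assume \<tau>: "\<tau> \<in> {h..t + h}" and \<delta>: "\<delta> > 0"
        then obtain d3 where d3: "d3 > 0" "\<And>\<sigma> \<tau>. \<sigma> \<in> {0..T} \<Longrightarrow> \<tau> \<in> {0..T} \<Longrightarrow> \<bar>\<sigma> - \<tau>\<bar> < d3 \<Longrightarrow> Lp_le q (\<delta>/8) (\<lambda>x. g \<sigma> x - g \<tau> x)"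
          using unif[of "\<delta>/8"] by auto
        show "\<exists>d>0. \<forall>\<sigma>\<in>{h..t + h}. \<bar>\<sigma> - \<tau>\<bar> < d \<longrightarrow> Lp_le q \<delta> (\<lambda>x. g \<sigma> x - g (\<sigma> - h) x - (g \<tau> x - g (\<tau> - h) x))"
        proof (intro exI[of _ d3] conjI ballI impI d3(1))
          fix \<sigma> assume \<sigma>: "\<sigma> \<in> {h..t + h}" "\<bar>\<sigma> - \<tau>\<bar> < d3"
          \<comment> \<open>The differences are regrouped by time shift, and the factor 4 lost in
            \<open>Lp_le_diff\<close> explains \<open>\<delta>/8\<close>.\<close>
          have "Lp_le q (4 * (\<delta>/8 + \<delta>/8)) (\<lambda>x. (g \<sigma> x - g \<tau> x) - (g (\<sigma> - h) x - g (\<tau> - h) x))"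
            using \<sigma> \<tau> th by (intro Lp_le_diff d3 q) auto
          then show "Lp_le q \<delta> (\<lambda>x. g \<sigma> x - g (\<sigma> - h) x - (g \<tau> x - g (\<tau> - h) x))" by (simp add: algebra_simps)
        qed
      qed
      have "expL_le p (\<epsilon> * K * (t + h - h) powr (1 - \<alpha>')) (duhamel s h (t + h) (t + h) (\<lambda>\<tau> x. g \<tau> x - g (\<tau> - h) x))"
        unfolding K_def using th T \<epsilon> False by (intro duhamel_expL_le[OF \<alpha>' c2]) auto
      moreover have "\<epsilon> * K * (t + h - h) powr (1 - \<alpha>') \<le> e / 2"
      proof -
        have "t powr (1 - \<alpha>') \<le> 1 powr (1 - \<alpha>')" using th T \<alpha>' by (intro powr_mono2) auto
        then have "\<epsilon> * K * t powr (1 - \<alpha>') \<le> \<epsilon> * K * 1" using \<epsilon> K by (intro mult_left_mono) auto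
        then show ?thesis using K by (simp add: \<epsilon>_def)
      qed
      ultimately show ?thesis by (rule expL_le_mono) (use p in simp)
    qed
    have "expL_le p (e / 2 + e / 2) (\<lambda>x. duhamel s 0 h (t + h) g x + duhamel s h (t + h) (t + h) (\<lambda>\<tau> x. g \<tau> x - g (\<tau> - h) x) x)"
      by (rule expL_le_add[OF 1 2 p])
    then show ?thesis using duhamel_shift[OF g \<alpha>, of t h] th A by simp
  qed
  show ?thesis
  proof (intro exI[of _ d] conjI ballI impI d)
    fix \<sigma> \<tau> assume st: "\<sigma> \<in> {0..T}" "\<tau> \<in> {0..T}" "\<bar>\<sigma> - \<tau>\<bar> < d"
    consider "\<sigma> = \<tau>" | "\<tau> < \<sigma>" | "\<sigma> < \<tau>" by linarith
    then show "expL_le p e (\<lambda>x. duhamel s 0 \<sigma> \<sigma> g x - duhamel s 0 \<tau> \<tau> g x)"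
    proof cases
      case 1
      then show ?thesis using e p by (simp add: expL_le_0)
    next
      case 2
      then show ?thesis using step[of \<tau> "\<sigma> - \<tau>"] st by simp
    next
      case 3
      then have "expL_le p e (\<lambda>x. duhamel s 0 \<tau> \<tau> g x - duhamel s 0 \<sigma> \<sigma> g x)"
        using step[of \<sigma> "\<tau> - \<sigma>"] st by simp
      then show ?thesis by (rule expL_le_diff_commute)
    qed
  qed
qed

end

section \<open>Nonlinear estimates near a test function\<close>

lemma test_functions_add:
  assumes "\<phi> \<in> test_functions" "\<psi> \<in> test_functions"
  shows "(\<lambda>x. \<phi> x + \<psi> x) \<in> test_functions"
proof -
  obtain R B where R: "0 < R" "0 < B" "\<And>x. R \<le> norm x \<Longrightarrow> \<phi> x = 0" "\<And>x. \<bar>\<phi> x\<bar> \<le> B"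
    using test_function_support[OF assms(1)] by blast
  obtain R' B' where R': "0 < R'" "0 < B'" "\<And>x. R' \<le> norm x \<Longrightarrow> \<psi> x = 0" "\<And>x. \<bar>\<psi> x\<bar> \<le> B'"
    using test_function_support[OF assms(2)] by blast
  show ?thesis
    by (rule test_functionsI[where R="max R R'"])
      (use assms R(3) R'(3) in \<open>auto simp: test_functions_def intro: Ck_add\<close>)
qed

lemma expL0_add:
  fixes u v :: "'a::euclidean_space \<Rightarrow> real"
  assumes p: "1 \<le> p" and u: "u \<in> expL0 p" and v: "v \<in> expL0 p"
  shows "(\<lambda>x. u x + v x) \<in> expL0 p"
  unfolding expL0_iff[OF p]
proof (intro allI impI)
  fix e :: real assume e: "e > 0"
  then have e2: "e / 2 > 0" by simp
  obtain \<phi> where \<phi>: "\<phi> \<in> test_functions" "expL_le p (e / 2) (\<lambda>x. u x - \<phi> x)"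
    using u e2 unfolding expL0_iff[OF p] by blast
  obtain \<psi> where \<psi>: "\<psi> \<in> test_functions" "expL_le p (e / 2) (\<lambda>x. v x - \<psi> x)"
    using v e2 unfolding expL0_iff[OF p] by blast
  have "expL_le p (e / 2 + e / 2) (\<lambda>x. (u x - \<phi> x) + (v x - \<psi> x))" by (rule expL_le_add[OF \<phi>(2) \<psi>(2) p])
  then have "expL_le p e (\<lambda>x. u x + v x - (\<phi> x + \<psi> x))" by (simp add: algebra_simps)
  then show "\<exists>\<theta>\<in>test_functions. expL_le p e (\<lambda>x. u x + v x - \<theta> x)"
    by (intro bexI[of _ "\<lambda>x. \<phi> x + \<psi> x"] test_functions_add \<phi> \<psi>)
qed

definition expL_continuous_on :: "real \<Rightarrow> real set \<Rightarrow> (real \<Rightarrow> 'a::euclidean_space \<Rightarrow> real) \<Rightarrow> bool" where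
  "expL_continuous_on p I u \<longleftrightarrow>
     (\<forall>t\<in>I. \<forall>e>0. \<exists>d>0. \<forall>r\<in>I. \<bar>r - t\<bar> < d \<longrightarrow> expL_le p e (\<lambda>x. u r x - u t x))"

lemma expL_continuous_onD:
  assumes "expL_continuous_on p I u" "t \<in> I" "e > 0"
  obtains d where "d > 0" "\<And>r. r \<in> I \<Longrightarrow> \<bar>r - t\<bar> < d \<Longrightarrow> expL_le p e (\<lambda>x. u r x - u t x)"
  using assms unfolding expL_continuous_on_def by meson

lemma expL_continuous_on_subset: "expL_continuous_on p I u \<Longrightarrow> J \<subseteq> I \<Longrightarrow> expL_continuous_on p J u"
  unfolding expL_continuous_on_def by (meson subsetD)

lemma continuous_into_expL0_eq:
  assumes "1 \<le> p"
  shows "continuous_into_expL0 p T u \<longleftrightarrow> (\<forall>t\<in>{0..T}. u t \<in> expL0 p) \<and> expL_continuous_on p {0..T} u"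
  unfolding expL_continuous_on_def by (rule continuous_into_expL0_iff[OF assms])

text \<open>Continuity is expressed by a predicate rather than a metric, so the compactness argument
  is carried out directly with a Lebesgue number of the cover by half-tolerance balls.\<close>

lemma expL_uniformly_continuous:
  assumes u: "expL_continuous_on p I u" and I: "compact I" and p: "1 \<le> p" and e: "e > 0"
  shows "\<exists>d>0. \<forall>\<sigma>\<in>I. \<forall>\<tau>\<in>I. \<bar>\<sigma> - \<tau>\<bar> < d \<longrightarrow> expL_le p e (\<lambda>x. u \<sigma> x - u \<tau> x)"
proof -
  have e2: "e / 2 > 0" using e by simp
  have "\<forall>t\<in>I. \<exists>d>0. \<forall>r\<in>I. \<bar>r - t\<bar> < d \<longrightarrow> expL_le p (e / 2) (\<lambda>x. u r x - u t x)"
    using u e2 unfolding expL_continuous_on_def by simp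
  then obtain \<delta> where \<delta>: "\<And>t. t \<in> I \<Longrightarrow> \<delta> t > 0" "\<And>t r. t \<in> I \<Longrightarrow> r \<in> I \<Longrightarrow> \<bar>r - t\<bar> < \<delta> t \<Longrightarrow> expL_le p (e / 2) (\<lambda>x. u r x - u t x)"
    by metis
  obtain d where d: "0 < d" "\<And>x. x \<in> I \<Longrightarrow> \<exists>G\<in>(\<lambda>t. ball t (\<delta> t)) ` I. ball x d \<subseteq> G"
  proof (rule Heine_Borel_lemma[OF I])
    show "I \<subseteq> \<Union> ((\<lambda>t. ball t (\<delta> t)) ` I)" using \<delta>(1) by force
  qed auto
  show ?thesis
  proof (intro exI[of _ d] conjI ballI impI d(1))
    fix \<sigma> \<tau> assume st: "\<sigma> \<in> I" "\<tau> \<in> I" "\<bar>\<sigma> - \<tau>\<bar> < d"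
    obtain t where t: "t \<in> I" "ball \<sigma> d \<subseteq> ball t (\<delta> t)" using d(2)[OF st(1)] by blast
    have "\<sigma> \<in> ball \<sigma> d" "\<tau> \<in> ball \<sigma> d" using d st by (auto simp: dist_real_def)
    with t(2) have "\<bar>\<sigma> - t\<bar> < \<delta> t" "\<bar>\<tau> - t\<bar> < \<delta> t" by (auto simp: dist_real_def subset_eq abs_minus_commute)
    then have "expL_le p (e / 2 + e / 2) (\<lambda>x. u \<sigma> x - u \<tau> x)"
      using st t by (intro expL_le_triangle[OF \<delta>(2) expL_le_diff_commute[OF \<delta>(2)] p]) auto
    then show "expL_le p e (\<lambda>x. u \<sigma> x - u \<tau> x)" by simp
  qed
qed

lemma duhamel_same: "duhamel s a a t g x = 0"
proof -
  have "(LINT \<tau>|lborel. indicator {a..a} \<tau> *\<^sub>R mixed_semigroup s (t - \<tau>) (g \<tau>) x) = (LINT \<tau>|lborel. indicator {a} \<tau> *\<^sub>R mixed_semigroup s (t - a) (g a) x)"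
    by (intro Bochner_Integration.integral_cong) (auto simp: indicator_def)
  then show ?thesis unfolding duhamel_def set_lebesgue_integral_def by simp
qed

lemma duhamel_diff:
  fixes g h :: "real \<Rightarrow> 'a::euclidean_space \<Rightarrow> real"
  assumes s: "0 < s" "s < 1" and p: "1 \<le> p" and q: "1 \<le> q" "real DIM('a) / (2 * q) < 1"
    and g: "Lpq_curve p q A a b g" "0 \<le> A" and h: "Lpq_curve p q B a b h" "0 \<le> B" and ab: "a \<le> b" "b \<le> t"
  shows "duhamel s a b t g x - duhamel s a b t h x = duhamel s a b t (\<lambda>\<tau> x. g \<tau> x - h \<tau> x) x"
proof -
  let ?S = "mixed_semigroup s"
  have "duhamel s a b t g x - duhamel s a b t h x = (LINT \<tau>:{a..b}|lborel. ?S (t - \<tau>) (g \<tau>) x - ?S (t - \<tau>) (h \<tau>) x)"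
    unfolding duhamel_def
    by (rule set_integral_diff(2)[symmetric])
      (intro duhamel_set_integrable[OF s p q(1) refl q(2) g(1) ab g(2)] duhamel_set_integrable[OF s p q(1) refl q(2) h(1) ab h(2)])+
  also have "\<dots> = duhamel s a b t (\<lambda>\<tau> x. g \<tau> x - h \<tau> x) x"
    unfolding duhamel_def
  proof (rule set_lebesgue_integral_cong)
    show "\<forall>\<tau>. \<tau> \<in> {a..b} \<longrightarrow> ?S (t - \<tau>) (g \<tau>) x - ?S (t - \<tau>) (h \<tau>) x = ?S (t - \<tau>) (\<lambda>x. g \<tau> x - h \<tau> x) x"
    proof (intro allI impI)
      fix \<tau> assume "\<tau> \<in> {a..b}"
      then have "Lp_le p A (g \<tau>)" "Lp_le p B (h \<tau>)" "0 \<le> t - \<tau>" using g h ab by (auto simp: Lpq_curve_def)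
      then show "?S (t - \<tau>) (g \<tau>) x - ?S (t - \<tau>) (h \<tau>) x = ?S (t - \<tau>) (\<lambda>x. g \<tau> x - h \<tau> x) x"
        by (intro mixed_semigroup_diff[OF s _ _ _ p p, symmetric])
    qed
  qed simp
  finally show ?thesis .
qed

text \<open>All that the fixed point and local uniqueness arguments see of the nonlinearity:
  Lipschitz bounds into both Lebesgue spaces on the \<eta>-ball around \<open>\<phi>\<close>, with
  \<open>q\<close> so large that the time singularity is integrable.\<close>

locale lipschitz_ball =
  fixes p q \<eta> L :: real and f :: "real \<Rightarrow> real" and \<phi> :: "'a::euclidean_space \<Rightarrow> real"
  assumes p1: "1 \<le> p" and pq: "p \<le> q" and dim_q: "real DIM('a) / (2 * q) < 1" and L: "0 < L"
    and f_Lp: "\<And>u D. u \<in> borel_measurable borel \<Longrightarrow> expL_le p \<eta> (\<lambda>x. u x - \<phi> x) \<Longrightarrow> expL_le p D u \<Longrightarrow>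
      Lp_le p (L * D) (\<lambda>x. f (u x)) \<and> Lp_le q (L * D) (\<lambda>x. f (u x))"
    and f_Lip: "\<And>u v D. u \<in> borel_measurable borel \<Longrightarrow> v \<in> borel_measurable borel \<Longrightarrow>
      expL_le p \<eta> (\<lambda>x. u x - \<phi> x) \<Longrightarrow> expL_le p \<eta> (\<lambda>x. v x - \<phi> x) \<Longrightarrow> expL_le p D (\<lambda>x. u x - v x) \<Longrightarrow>
      Lp_le p (L * D) (\<lambda>x. f (u x) - f (v x)) \<and> Lp_le q (L * D) (\<lambda>x. f (u x) - f (v x))"
begin

lemma q1: "1 \<le> q"
  using p1 pq by simp

definition in_ball :: "real set \<Rightarrow> (real \<Rightarrow> 'a \<Rightarrow> real) \<Rightarrow> bool" where
  "in_ball I u \<longleftrightarrow> (\<forall>t\<in>I. u t \<in> borel_measurable borel \<and> expL_le p \<eta> (\<lambda>x. u t x - \<phi> x)) \<and> expL_continuous_on p I u"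

lemma in_ball_subset: "in_ball I u \<Longrightarrow> J \<subseteq> I \<Longrightarrow> in_ball J u"
  unfolding in_ball_def using expL_continuous_on_subset by blast

lemma f_continuous_step:
  assumes u: "in_ball I u" and st: "\<sigma> \<in> I" "\<tau> \<in> I" and e: "expL_le p e (\<lambda>x. u \<sigma> x - u \<tau> x)"
  shows "Lp_le p (L * e) (\<lambda>x. f (u \<sigma> x) - f (u \<tau> x))" "Lp_le q (L * e) (\<lambda>x. f (u \<sigma> x) - f (u \<tau> x))"
  using f_Lip[of "u \<sigma>" "u \<tau>" e] u st e by (auto simp: in_ball_def)

lemma f_curve:
  assumes u: "in_ball {a..b} u" and D: "\<And>t. t \<in> {a..b} \<Longrightarrow> expL_le p D (u t)"
  shows "Lpq_curve p q (L * D) a b (\<lambda>\<tau> x. f (u \<tau> x))"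
  unfolding Lpq_curve_def
proof (intro conjI ballI allI impI)
  fix \<tau> assume "\<tau> \<in> {a..b}"
  then show "Lp_le p (L * D) (\<lambda>x. f (u \<tau> x))" "Lp_le q (L * D) (\<lambda>x. f (u \<tau> x))"
    using f_Lp[of "u \<tau>" D] D u by (auto simp: in_ball_def)
next
  fix \<tau> e :: real assume \<tau>: "\<tau> \<in> {a..b}" and e: "e > 0"
  have c: "expL_continuous_on p {a..b} u" using u by (simp add: in_ball_def)
  have "e / L > 0" using e L by simp
  from expL_continuous_onD[OF c \<tau> this] obtain d where d: "d > 0" "\<And>r. r \<in> {a..b} \<Longrightarrow> \<bar>r - \<tau>\<bar> < d \<Longrightarrow> expL_le p (e / L) (\<lambda>x. u r x - u \<tau> x)"
    by blast
  show "\<exists>d>0. \<forall>\<sigma>\<in>{a..b}. \<bar>\<sigma> - \<tau>\<bar> < d \<longrightarrow> Lp_le q e (\<lambda>x. f (u \<sigma> x) - f (u \<tau> x))"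
  proof (intro exI[of _ d] conjI ballI impI d(1))
    fix \<sigma> assume "\<sigma> \<in> {a..b}" "\<bar>\<sigma> - \<tau>\<bar> < d"
    then show "Lp_le q e (\<lambda>x. f (u \<sigma> x) - f (u \<tau> x))"
      using f_continuous_step(2)[OF u _ \<tau> d(2), of \<sigma>] L by simp
  qed
qed

lemma f_diff_curve:
  assumes u: "in_ball {a..b} u" and v: "in_ball {a..b} v" and D: "\<And>t. t \<in> {a..b} \<Longrightarrow> expL_le p D (\<lambda>x. u t x - v t x)"
  shows "Lpq_curve p q (L * D) a b (\<lambda>\<tau> x. f (u \<tau> x) - f (v \<tau> x))"
  unfolding Lpq_curve_def
proof (intro conjI ballI allI impI)
  fix \<tau> assume "\<tau> \<in> {a..b}"
  then show "Lp_le p (L * D) (\<lambda>x. f (u \<tau> x) - f (v \<tau> x))" "Lp_le q (L * D) (\<lambda>x. f (u \<tau> x) - f (v \<tau> x))"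
    using f_Lip[of "u \<tau>" "v \<tau>" D] D u v by (auto simp: in_ball_def)
next
  fix \<tau> e :: real assume \<tau>: "\<tau> \<in> {a..b}" and e: "e > 0"
  have c: "expL_continuous_on p {a..b} u" "expL_continuous_on p {a..b} v" using u v by (simp_all add: in_ball_def)
  \<comment> \<open>\<open>L\<close> pays for passing through \<open>f\<close>, and 8 for the factor
    4 of \<open>Lp_le_diff\<close> applied to two terms.\<close>
  have e8: "e / (8 * L) > 0" using e L by simp
  obtain d where d: "d > 0" "\<And>r. r \<in> {a..b} \<Longrightarrow> \<bar>r - \<tau>\<bar> < d \<Longrightarrow> expL_le p (e / (8 * L)) (\<lambda>x. u r x - u \<tau> x)"
    using expL_continuous_onD[OF c(1) \<tau> e8] by blast
  obtain d' where d': "d' > 0" "\<And>r. r \<in> {a..b} \<Longrightarrow> \<bar>r - \<tau>\<bar> < d' \<Longrightarrow> expL_le p (e / (8 * L)) (\<lambda>x. v r x - v \<tau> x)"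
    using expL_continuous_onD[OF c(2) \<tau> e8] by blast
  show "\<exists>d>0. \<forall>\<sigma>\<in>{a..b}. \<bar>\<sigma> - \<tau>\<bar> < d \<longrightarrow> Lp_le q e (\<lambda>x. f (u \<sigma> x) - f (v \<sigma> x) - (f (u \<tau> x) - f (v \<tau> x)))"
  proof (intro exI[of _ "min d d'"] conjI ballI impI)
    fix \<sigma> assume \<sigma>: "\<sigma> \<in> {a..b}" "\<bar>\<sigma> - \<tau>\<bar> < min d d'"
    have "Lp_le q (L * (e / (8 * L))) (\<lambda>x. f (u \<sigma> x) - f (u \<tau> x))"
      using \<sigma> by (intro f_continuous_step(2)[OF u _ \<tau> d(2)]) auto
    moreover have "Lp_le q (L * (e / (8 * L))) (\<lambda>x. f (v \<sigma> x) - f (v \<tau> x))"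
      using \<sigma> by (intro f_continuous_step(2)[OF v _ \<tau> d'(2)]) auto
    ultimately have "Lp_le q (4 * (L * (e / (8 * L)) + L * (e / (8 * L)))) (\<lambda>x. f (u \<sigma> x) - f (u \<tau> x) - (f (v \<sigma> x) - f (v \<tau> x)))"
      by (rule Lp_le_diff[OF _ _ q1])
    then show "Lp_le q e (\<lambda>x. f (u \<sigma> x) - f (v \<sigma> x) - (f (u \<tau> x) - f (v \<tau> x)))"
      using L by (simp add: algebra_simps)
  qed (use d d' in simp)
qed

lemma f_uniform:
  assumes u: "in_ball {a..b} u" and e: "e > 0"
  shows "\<exists>d>0. \<forall>\<sigma>\<in>{a..b}. \<forall>\<tau>\<in>{a..b}. \<bar>\<sigma> - \<tau>\<bar> < d \<longrightarrow>
      Lp_le p e (\<lambda>x. f (u \<sigma> x) - f (u \<tau> x)) \<and> Lp_le q e (\<lambda>x. f (u \<sigma> x) - f (u \<tau> x))"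
proof -
  have c: "expL_continuous_on p {a..b} u" using u by (simp add: in_ball_def)
  have eL: "e / L > 0" using e L by simp
  obtain d where d: "d > 0" "\<forall>\<sigma>\<in>{a..b}. \<forall>\<tau>\<in>{a..b}. \<bar>\<sigma> - \<tau>\<bar> < d \<longrightarrow> expL_le p (e / L) (\<lambda>x. u \<sigma> x - u \<tau> x)"
    using expL_uniformly_continuous[OF c compact_Icc p1 eL] by blast
  show ?thesis
  proof (intro exI[of _ d] conjI d(1) ballI impI)
    fix \<sigma> \<tau> assume st: "\<sigma> \<in> {a..b}" "\<tau> \<in> {a..b}" "\<bar>\<sigma> - \<tau>\<bar> < d"
    then have "expL_le p (e / L) (\<lambda>x. u \<sigma> x - u \<tau> x)" using d by blast
    from f_continuous_step[OF u st(1,2) this] L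
    show "Lp_le p e (\<lambda>x. f (u \<sigma> x) - f (u \<tau> x))" "Lp_le q e (\<lambda>x. f (u \<sigma> x) - f (u \<tau> x))" by simp_all
  qed
qed

end

context exp_nonlinearity
begin

text \<open>The order of quantifiers matters: \<open>q\<close> and \<eta> are fixed before
  \<open>\<phi>\<close>, whose bound affects \<open>L\<close> alone. A test function can thus be
  chosen \<eta>-close to given data afterwards.\<close>

lemma lipschitz_ball_exists:
  obtains q \<eta> where "\<eta> > 0" "\<And>\<phi> :: 'a::euclidean_space \<Rightarrow> real. \<phi> \<in> test_functions \<Longrightarrow> \<exists>L. lipschitz_ball p q \<eta> L f \<phi>"
proof -
  \<comment> \<open>Ensures \<open>p \<le> q\<close> and \<open>DIM('a) / (2 * q) < 1\<close>
    together.\<close>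
  define q where "q = p + real DIM('a)"
  \<comment> \<open>Solves the smallness condition of \<open>f_local_Lipschitz\<close> with equality
    for \<open>m = q\<close>; it then holds for the smaller \<open>m = p\<close> too.\<close>
  define \<eta> where "\<eta> = (1 / (2 * q * (lam * 2 powr p))) powr (1 / p)"
  have q: "p \<le> q" "q > 0" using p by (auto simp: q_def)
  have den: "2 * q * (lam * 2 powr p) > 0" using q lam by simp
  have \<eta>: "\<eta> > 0" using q(2) lam by (simp add: \<eta>_def)
  have \<eta>p: "\<eta> powr p = 1 / (2 * q * (lam * 2 powr p))" using p q(2) lam by (simp add: \<eta>_def powr_powr)
  have \<eta>q: "2 * q * (lam * 2 powr p) * \<eta> powr p \<le> 1" unfolding \<eta>p using q(2) lam by simp
  have "2 * p * (lam * 2 powr p) * \<eta> powr p \<le> 2 * q * (lam * 2 powr p) * \<eta> powr p"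
    using q lam by (intro mult_right_mono) auto
  with \<eta>q have \<eta>p': "2 * p * (lam * 2 powr p) * \<eta> powr p \<le> 1" by linarith
  have "\<exists>L. lipschitz_ball p q \<eta> L f \<phi>" if \<phi>: "\<phi> \<in> test_functions" for \<phi> :: "'a \<Rightarrow> real"
  proof -
    obtain R M where M: "0 < R" "0 < M" "\<And>x. R \<le> norm x \<Longrightarrow> \<phi> x = 0" "\<And>x. \<bar>\<phi> x\<bar> \<le> M"
      using test_function_support[OF \<phi>] by blast
    note Lp = f_local_Lipschitz[OF order_refl \<eta> \<eta>p', where 'a='a and M=M]
    note Lq = f_local_Lipschitz[OF q(1) \<eta> \<eta>q, where 'a='a and M=M]
    have \<phi>M: "\<forall>x. \<bar>\<phi> x\<bar> \<le> M" using M(4) by blast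
    obtain L1 where L1: "L1 > 0"
      "\<And>u v D. expL_le p \<eta> (\<lambda>x. u x - \<phi> x) \<Longrightarrow> u \<in> borel_measurable borel \<Longrightarrow>
       (expL_le p D u \<longrightarrow> Lp_le p (L1 * D) (\<lambda>x. f (u x))) \<and>
       (expL_le p \<eta> (\<lambda>x. v x - \<phi> x) \<longrightarrow> v \<in> borel_measurable borel \<longrightarrow>
        expL_le p D (\<lambda>x. u x - v x) \<longrightarrow> Lp_le p (L1 * D) (\<lambda>x. f (u x) - f (v x)))"
      using Lp \<phi>M by meson
    obtain L2 where L2: "L2 > 0"
      "\<And>u v D. expL_le p \<eta> (\<lambda>x. u x - \<phi> x) \<Longrightarrow> u \<in> borel_measurable borel \<Longrightarrow>
       (expL_le p D u \<longrightarrow> Lp_le q (L2 * D) (\<lambda>x. f (u x))) \<and>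
       (expL_le p \<eta> (\<lambda>x. v x - \<phi> x) \<longrightarrow> v \<in> borel_measurable borel \<longrightarrow>
        expL_le p D (\<lambda>x. u x - v x) \<longrightarrow> Lp_le q (L2 * D) (\<lambda>x. f (u x) - f (v x)))"
      using Lq \<phi>M by meson
    define L where "L = max L1 L2"
    have L: "L > 0" "L1 \<le> L" "L2 \<le> L" using L1 by (auto simp: L_def)
    have up: "Lp_le m (L * D) g" if "Lp_le m (l * D) g" "l \<le> L" "0 \<le> m" "D > 0" for m l D and g :: "'a \<Rightarrow> real"
      using that by (intro Lp_le_mono[OF that(1)] mult_right_mono) auto
    have "lipschitz_ball p q \<eta> L f \<phi>"
    proof
      show "real DIM('a) / (2 * q) < 1" using p by (simp add: q_def field_simps)
      fix u v :: "'a \<Rightarrow> real" and D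
      assume u: "u \<in> borel_measurable borel" "expL_le p \<eta> (\<lambda>x. u x - \<phi> x)"
      {
        assume "expL_le p D u"
        then show "Lp_le p (L * D) (\<lambda>x. f (u x)) \<and> Lp_le q (L * D) (\<lambda>x. f (u x))"
          using L1(2)[OF u(2,1), of D] L2(2)[OF u(2,1), of D] L p q
          by (intro conjI; intro up[where l=L1] up[where l=L2]; auto dest: expL_leD)
      }
      assume v: "v \<in> borel_measurable borel" "expL_le p \<eta> (\<lambda>x. v x - \<phi> x)" "expL_le p D (\<lambda>x. u x - v x)"
      have D: "D > 0" using v(3) by (rule expL_leD)
      have "Lp_le p (L1 * D) (\<lambda>x. f (u x) - f (v x))" using L1(2)[OF u(2,1), of D v] v by blast
      moreover have "Lp_le q (L2 * D) (\<lambda>x. f (u x) - f (v x))" using L2(2)[OF u(2,1), of D v] v by blast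
      ultimately show "Lp_le p (L * D) (\<lambda>x. f (u x) - f (v x)) \<and> Lp_le q (L * D) (\<lambda>x. f (u x) - f (v x))"
        using up[OF _ L(2) _ D] up[OF _ L(3) _ D] p q by auto
    qed (use p q L in auto)
    then show ?thesis ..
  qed
  then show ?thesis using that[OF \<eta>] by blast
qed

end

section \<open>Existence\<close>

context lipschitz_ball
begin

definition "\<alpha> = real DIM('a) / (2 * q)"

definition "K = exp 1 + 1 / (1 - \<alpha>)"

lemma \<alpha>_less: "\<alpha> < 1"
  using dim_q by (simp add: \<alpha>_def)

lemma K_pos: "K > 0"
  unfolding K_def using \<alpha>_less by (intro add_pos_pos) auto

text \<open>The gain \<open>(b - a) powr (1 - \<alpha>)\<close> makes the Duhamel map a contraction on short time intervals.\<close>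

lemma duhamel_diff_contraction:
  assumes s: "0 < s" "s < 1"
    and u: "in_ball {a..b} u" and v: "in_ball {a..b} v" and ab: "a < b" "b - a \<le> 1"
    and D: "\<And>t. t \<in> {a..b} \<Longrightarrow> expL_le p D (\<lambda>x. u t x - v t x)" and D0: "0 < D"
  shows "expL_le p (L * D * K * (b - a) powr (1 - \<alpha>)) (duhamel s a b b (\<lambda>\<tau> x. f (u \<tau> x) - f (v \<tau> x)))"
    and "\<bar>duhamel s a b b (\<lambda>\<tau> x. f (u \<tau> x) - f (v \<tau> x)) x\<bar> \<le> L * D / (1 - \<alpha>)"
proof -
  have c: "Lpq_curve p q (L * D) a b (\<lambda>\<tau> x. f (u \<tau> x) - f (v \<tau> x))" by (rule f_diff_curve[OF u v D])
  have LD: "0 < L * D" using L D0 by simp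
  show "expL_le p (L * D * K * (b - a) powr (1 - \<alpha>)) (duhamel s a b b (\<lambda>\<tau> x. f (u \<tau> x) - f (v \<tau> x)))"
    unfolding K_def using ab LD
    by (intro duhamel_expL_le[OF s p1 q1 \<alpha>_def \<alpha>_less c]) auto
  have "\<bar>duhamel s a b b (\<lambda>\<tau> x. f (u \<tau> x) - f (v \<tau> x)) x\<bar> \<le> L * D * ((b - a) powr (1 - \<alpha>) / (1 - \<alpha>))"
    using ab LD by (intro duhamel_bound[OF s p1 q1 \<alpha>_def \<alpha>_less c]) auto
  also have "\<dots> \<le> L * D * (1 / (1 - \<alpha>))"
  proof -
    have "(b - a) powr (1 - \<alpha>) \<le> 1 powr (1 - \<alpha>)" using ab \<alpha>_less by (intro powr_mono2) auto
    then show ?thesis using \<alpha>_less LD by (intro mult_left_mono divide_right_mono) auto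
  qed
  finally show "\<bar>duhamel s a b b (\<lambda>\<tau> x. f (u \<tau> x) - f (v \<tau> x)) x\<bar> \<le> L * D / (1 - \<alpha>)" by simp
qed

lemma short_time_exists:
  assumes c: "0 < c"
  obtains h where "0 < h" "h \<le> 1" "\<And>t. 0 \<le> t \<Longrightarrow> t \<le> h \<Longrightarrow> t powr (1 - \<alpha>) \<le> c"
proof
  let ?h = "min 1 (c powr (1 / (1 - \<alpha>)))"
  show "0 < ?h" "?h \<le> 1" using c by auto
  fix t assume t: "0 \<le> t" "t \<le> ?h"
  have "t powr (1 - \<alpha>) \<le> (c powr (1 / (1 - \<alpha>))) powr (1 - \<alpha>)" using t \<alpha>_less by (intro powr_mono2) auto
  then show "t powr (1 - \<alpha>) \<le> c" using \<alpha>_less c by (simp add: powr_powr)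
qed

text \<open>Picard iteration among the curves within \<open>\<eta> / 4\<close> of the free
  evolution. The centre moves with time, so at time 0 the Duhamel term alone has to be
  small.\<close>

lemma mild_solution_exists:
  assumes s: "0 < s" "s < 1" and p: "1 < p" and \<eta>: "0 < \<eta>"
    and u0: "u\<^sub>0 \<in> expL0 p" and near: "expL_le p (\<eta> / 2) (\<lambda>x. u\<^sub>0 x - \<phi> x)"
  shows "\<exists>T>0. \<exists>u. mild_solution p s f u\<^sub>0 T u"
proof -
  let ?S = "mixed_semigroup s"
  obtain D1 where D1: "expL_le p D1 u\<^sub>0" using expL0_exists_bound[OF p1 u0] by blast
  have D1': "D1 > 0" using D1 by (rule expL_leD)
  \<comment> \<open>Bounds every curve of \<open>X\<close>: the free evolution stays within
    \<open>D1\<close>, and the deviation from it within \<open>\<eta> / 4\<close>.\<close>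
  define D0 where "D0 = D1 + \<eta>"
  have D0: "D0 > 0" using D1' \<eta> by (simp add: D0_def)
  have \<eta>4: "\<eta> / 4 > 0" using \<eta> by simp
  have S0: "?S 0 u\<^sub>0 = u\<^sub>0" by (intro ext) (simp add: mixed_semigroup_def)
  obtain d0 where d0_pos: "d0 > 0" and "\<forall>r\<ge>0. \<bar>r - 0\<bar> < d0 \<longrightarrow> expL_le p (\<eta> / 4) (\<lambda>x. ?S r u\<^sub>0 x - ?S 0 u\<^sub>0 x)"
    using mixed_semigroup_expL_continuous[OF s p u0 order_refl \<eta>4] by blast
  then have d0: "expL_le p (\<eta> / 4) (\<lambda>x. ?S r u\<^sub>0 x - u\<^sub>0 x)" if "r \<ge> 0" "r < d0" for r
    using that by (simp add: S0)
  \<comment> \<open>The first entry keeps the Duhamel term below \<open>\<eta> / 8\<close>, so the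
    map preserves \<open>X\<close>; the second makes it a contraction with factor
    \<open>1 / 2\<close>.\<close>
  define \<kappa> where "\<kappa> = min (\<eta> / (8 * (L * D0 * K))) (1 / (2 * (L * K)))"
  have LDK: "0 < L * D0 * K" "0 < L * K" using L D0 K_pos by auto
  have "0 < \<kappa>" unfolding \<kappa>_def using LDK \<eta> by simp
  then obtain h where h: "0 < h" "h \<le> 1" "\<And>t. 0 \<le> t \<Longrightarrow> t \<le> h \<Longrightarrow> t powr (1 - \<alpha>) \<le> \<kappa>"
    using short_time_exists by blast
  define T where "T = min h (d0 / 2)"
  have T: "0 < T" "T \<le> 1" "T < d0" "T \<le> h" using h d0_pos by (auto simp: T_def)
  have small: "L * D0 * K * t powr (1 - \<alpha>) \<le> \<eta> / 8" "L * K * t powr (1 - \<alpha>) \<le> 1 / 2" if "t \<in> {0..T}" for t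
  proof -
    have t: "t powr (1 - \<alpha>) \<le> \<kappa>" using that T by (intro h(3)) auto
    have "L * D0 * K * t powr (1 - \<alpha>) \<le> L * D0 * K * (\<eta> / (8 * (L * D0 * K)))"
      using t LDK by (intro mult_left_mono) (auto simp: \<kappa>_def)
    then show "L * D0 * K * t powr (1 - \<alpha>) \<le> \<eta> / 8" using L D0 K_pos by simp
    have "L * K * t powr (1 - \<alpha>) \<le> L * K * (1 / (2 * (L * K)))"
      using t LDK by (intro mult_left_mono) (auto simp: \<kappa>_def)
    then show "L * K * t powr (1 - \<alpha>) \<le> 1 / 2" using L K_pos by simp
  qed
  \<comment> \<open>The distances to the free evolution, from there to the datum and from the datum
    to \<open>\<phi>\<close> add up to \<open>\<eta> / 4 + \<eta> / 4 + \<eta> / 2 = \<eta>\<close>,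
    the radius on which \<open>f\<close> is Lipschitz.\<close>
  define X where "X = (\<lambda>u. (\<forall>t\<in>{0..T}. u t \<in> expL0 p) \<and> expL_continuous_on p {0..T} u \<and>
    (\<forall>t\<in>{0..T}. expL_le p (\<eta> / 4) (\<lambda>x. u t x - ?S t u\<^sub>0 x)))"
  define \<Phi> where "\<Phi> = (\<lambda>u t x. ?S t u\<^sub>0 x + duhamel s 0 t t (\<lambda>\<tau> x. f (u \<tau> x)) x)"
  have X_ball: "in_ball {0..T} u" if u: "X u" for u
    unfolding in_ball_def
  proof (intro conjI ballI)
    fix t assume t: "t \<in> {0..T}"
    show "u t \<in> borel_measurable borel" using u t by (auto simp: X_def intro: expL0_measurable)
    have "expL_le p (\<eta> / 4) (\<lambda>x. u t x - ?S t u\<^sub>0 x)" using u t by (simp add: X_def)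
    moreover have "expL_le p (\<eta> / 4) (\<lambda>x. ?S t u\<^sub>0 x - u\<^sub>0 x)" using t T by (intro d0) auto
    ultimately have "expL_le p (\<eta> / 4 + (\<eta> / 4 + \<eta> / 2)) (\<lambda>x. u t x - \<phi> x)"
      by (rule expL_le_triangle[OF _ expL_le_triangle[OF _ near p1] p1])
    then show "expL_le p \<eta> (\<lambda>x. u t x - \<phi> x)" by simp
  qed (use u in \<open>simp add: X_def\<close>)
  have X_bound: "expL_le p D0 (u t)" if u: "X u" and t: "t \<in> {0..T}" for u t
  proof -
    have "expL_le p (\<eta> / 4) (\<lambda>x. u t x - ?S t u\<^sub>0 x)" using u t by (simp add: X_def)
    moreover have "expL_le p D1 (?S t u\<^sub>0)" using t D1 by (intro mixed_semigroup_expL_le[OF s _ _ p1]) auto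
    ultimately have "expL_le p (\<eta> / 4 + D1) (\<lambda>x. u t x - ?S t u\<^sub>0 x + ?S t u\<^sub>0 x)" by (rule expL_le_add[OF _ _ p1])
    then have "expL_le p (\<eta> / 4 + D1) (u t)" by simp
    then show ?thesis by (rule expL_le_mono) (use \<eta> p in \<open>auto simp: D0_def\<close>)
  qed
  have X_curve: "Lpq_curve p q (L * D0) 0 T (\<lambda>\<tau> x. f (u \<tau> x))" if "X u" for u
    by (rule f_curve[OF X_ball[OF that] X_bound[OF that]])
  have X_curve': "Lpq_curve p q (L * D0) 0 t (\<lambda>\<tau> x. f (u \<tau> x))" if "X u" "t \<in> {0..T}" for u t
    using that by (intro Lpq_curve_subset[OF s p1 q1 X_curve]) auto
  have LD0: "0 < L * D0" using L D0 by simp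
  have S_cont: "expL_continuous_on p {0..T} (\<lambda>t. ?S t u\<^sub>0)"
    unfolding expL_continuous_on_def
  proof (intro ballI allI impI)
    fix t e :: real assume "t \<in> {0..T}" "e > 0"
    then obtain d where "d > 0" "\<forall>r\<ge>0. \<bar>r - t\<bar> < d \<longrightarrow> expL_le p e (\<lambda>x. ?S r u\<^sub>0 x - ?S t u\<^sub>0 x)"
      using mixed_semigroup_expL_continuous[OF s p u0, of t e] by auto
    then show "\<exists>d>0. \<forall>r\<in>{0..T}. \<bar>r - t\<bar> < d \<longrightarrow> expL_le p e (\<lambda>x. ?S r u\<^sub>0 x - ?S t u\<^sub>0 x)"
      by (intro exI[of _ d]) auto
  qed
  have X0: "X (\<lambda>t. ?S t u\<^sub>0)"
    unfolding X_def using S_cont u0 \<eta> p by (auto intro!: mixed_semigroup_expL0[OF s] simp: expL_le_0)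
  have X\<Phi>: "X (\<Phi> u)" if u: "X u" for u
  proof -
    let ?g = "\<lambda>\<tau> x. f (u \<tau> x)"
    have "\<Phi> u t \<in> expL0 p" if t: "t \<in> {0..T}" for t
    proof (cases "t = 0")
      case True
      then show ?thesis using u0 by (simp add: \<Phi>_def duhamel_same S0)
    next
      case False
      have "duhamel s 0 t t ?g \<in> expL0 p"
        using False t LD0 by (intro duhamel_expL0[OF s p1 q1 \<alpha>_def \<alpha>_less X_curve'[OF u t]]) auto
      moreover have "?S t u\<^sub>0 \<in> expL0 p" using t u0 by (intro mixed_semigroup_expL0[OF s _ _ p1]) auto
      ultimately show ?thesis unfolding \<Phi>_def by (intro expL0_add[OF p1])
    qed
    moreover have "expL_continuous_on p {0..T} (\<Phi> u)"
      unfolding expL_continuous_on_def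
    proof (intro ballI allI impI)
      fix t e :: real assume t: "t \<in> {0..T}" and e: "e > 0"
      then have e2: "e / 2 > 0" by simp
      obtain d where d: "d > 0" "\<And>r. r \<in> {0..T} \<Longrightarrow> \<bar>r - t\<bar> < d \<Longrightarrow> expL_le p (e / 2) (\<lambda>x. ?S r u\<^sub>0 x - ?S t u\<^sub>0 x)"
        using expL_continuous_onD[OF S_cont t e2] by blast
      obtain d' where d': "d' > 0" "\<forall>\<sigma>\<in>{0..T}. \<forall>\<tau>\<in>{0..T}. \<bar>\<sigma> - \<tau>\<bar> < d' \<longrightarrow> expL_le p (e / 2) (\<lambda>x. duhamel s 0 \<sigma> \<sigma> ?g x - duhamel s 0 \<tau> \<tau> ?g x)"
        using duhamel_uniform_modulus[OF s p1 q1 X_curve[OF u] dim_q LD0 T(2) f_uniform[OF X_ball[OF u]] e2] by blast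
      show "\<exists>d>0. \<forall>r\<in>{0..T}. \<bar>r - t\<bar> < d \<longrightarrow> expL_le p e (\<lambda>x. \<Phi> u r x - \<Phi> u t x)"
      proof (intro exI[of _ "min d d'"] conjI ballI impI)
        fix r assume r: "r \<in> {0..T}" "\<bar>r - t\<bar> < min d d'"
        have "expL_le p (e / 2) (\<lambda>x. ?S r u\<^sub>0 x - ?S t u\<^sub>0 x)" using r by (intro d(2)) auto
        moreover have "expL_le p (e / 2) (\<lambda>x. duhamel s 0 r r ?g x - duhamel s 0 t t ?g x)" using d'(2) r t by simp
        ultimately have "expL_le p (e / 2 + e / 2) (\<lambda>x. (?S r u\<^sub>0 x - ?S t u\<^sub>0 x) + (duhamel s 0 r r ?g x - duhamel s 0 t t ?g x))"
          by (rule expL_le_add[OF _ _ p1])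
        then show "expL_le p e (\<lambda>x. \<Phi> u r x - \<Phi> u t x)" by (simp add: \<Phi>_def algebra_simps)
      qed (use d d' in simp)
    qed
    moreover have "expL_le p (\<eta> / 4) (\<lambda>x. \<Phi> u t x - ?S t u\<^sub>0 x)" if t: "t \<in> {0..T}" for t
    proof (cases "t = 0")
      case True
      then show ?thesis using \<eta> p by (simp add: \<Phi>_def duhamel_same expL_le_0)
    next
      case False
      have "expL_le p (L * D0 * K * (t - 0) powr (1 - \<alpha>)) (duhamel s 0 t t ?g)"
        unfolding K_def using False t T LD0
        by (intro duhamel_expL_le[OF s p1 q1 \<alpha>_def \<alpha>_less X_curve'[OF u t]]) auto
      then have "expL_le p (\<eta> / 4) (duhamel s 0 t t ?g)"
        by (rule expL_le_mono) (use small(1)[OF t] \<eta> p in auto)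
      then show ?thesis by (simp add: \<Phi>_def)
    qed
    ultimately show ?thesis by (simp add: X_def)
  qed
  \<comment> \<open>The Luxemburg bound drives the iteration; the pointwise bound turns it into
    convergence at every \<open>x\<close>, without exceptional null sets that vary with the
    time.\<close>
  have contr: "expL_le p (\<delta> / 2) (\<lambda>x. \<Phi> u t x - \<Phi> v t x)" "\<bar>\<Phi> u t x - \<Phi> v t x\<bar> \<le> L * \<delta> / (1 - \<alpha>)"
    if u: "X u" and v: "X v" and \<delta>: "\<delta> > 0" and uv: "\<And>t. t \<in> {0..T} \<Longrightarrow> expL_le p \<delta> (\<lambda>x. u t x - v t x)" and t: "t \<in> {0..T}"
    for u v \<delta> t x
  proof -
    have diff: "\<Phi> u t x - \<Phi> v t x = duhamel s 0 t t (\<lambda>\<tau> x. f (u \<tau> x) - f (v \<tau> x)) x" for x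
      unfolding \<Phi>_def using t LD0 duhamel_diff[OF s p1 q1 dim_q X_curve'[OF u t] _ X_curve'[OF v t], of t x] by simp
    have "expL_le p (\<delta> / 2) (\<lambda>x. \<Phi> u t x - \<Phi> v t x) \<and> \<bar>\<Phi> u t x - \<Phi> v t x\<bar> \<le> L * \<delta> / (1 - \<alpha>)"
    proof (cases "t = 0")
      case True
      then show ?thesis using \<delta> p L \<alpha>_less unfolding diff by (simp add: duhamel_same expL_le_0)
    next
      case False
      have sub: "{0..t} \<subseteq> {0..T}" using t by auto
      have b: "in_ball {0..t} u" "in_ball {0..t} v" using in_ball_subset[OF X_ball sub] u v by auto
      have h: "0 < t" "t - 0 \<le> 1" using False t T by auto
      have D: "expL_le p \<delta> (\<lambda>x. u r x - v r x)" if "r \<in> {0..t}" for r using that sub by (intro uv) auto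
      note R = duhamel_diff_contraction[OF s b h D \<delta>]
      have "L * \<delta> * K * (t - 0) powr (1 - \<alpha>) \<le> \<delta> / 2"
        using mult_left_mono[OF small(2)[OF t], of \<delta>] \<delta> by (simp add: mult_ac)
      from expL_le_mono[OF R(1) this] R(2)[of x] show ?thesis unfolding diff using p by simp
    qed
    then show "expL_le p (\<delta> / 2) (\<lambda>x. \<Phi> u t x - \<Phi> v t x)" "\<bar>\<Phi> u t x - \<Phi> v t x\<bar> \<le> L * \<delta> / (1 - \<alpha>)" by auto
  qed
  define U where "U = (\<lambda>n. (\<Phi> ^^ n) (\<lambda>t. ?S t u\<^sub>0))"
  have U0: "U 0 = (\<lambda>t. ?S t u\<^sub>0)" and US: "U (Suc n) = \<Phi> (U n)" for n by (simp_all add: U_def)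
  have XU: "X (U n)" for n by (induction n) (auto simp: U0 US X0 X\<Phi>)
  have step: "expL_le p (\<eta> / 4 * (1/2) ^ n) (\<lambda>x. U (Suc n) t x - U n t x)" if "t \<in> {0..T}" for n t
    using that
  proof (induction n arbitrary: t)
    case 0
    then show ?case using XU[of 1] by (simp add: X_def U0)
  next
    case (Suc n)
    have "expL_le p (\<eta> / 4 * (1/2) ^ n / 2) (\<lambda>x. \<Phi> (U (Suc n)) t x - \<Phi> (U n) t x)"
      using \<eta> by (intro contr(1)[OF XU XU _ Suc.IH Suc.prems]) auto
    then show ?case unfolding US[symmetric] by (simp add: mult.assoc)
  qed
  have conv: "convergent (\<lambda>n. U n t x)" if t: "t \<in> {0..T}" for t x
  proof -
    \<comment> \<open>A pointwise bound exists only after one more application of the map to a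
      Luxemburg bound, hence the start at the second increment.\<close>
    have B: "\<bar>U (Suc (Suc n)) t x - U (Suc n) t x\<bar> \<le> L * (\<eta> / 4) / (1 - \<alpha>) * (1/2) ^ n" for n
      using contr(2)[of "U (Suc n)" "U n" "\<eta> / 4 * (1/2) ^ n" t x, OF XU XU _ step t] \<eta> unfolding US[symmetric] by (simp add: mult_ac)
    have "summable (\<lambda>n. L * (\<eta> / 4) / (1 - \<alpha>) * (1/2) ^ n)" by (intro summable_mult summable_geometric) simp
    then have "summable (\<lambda>n. U (Suc (Suc n)) t x - U (Suc n) t x)"
      by (rule summable_comparison_test'[where N=0]) (use B in simp)
    then have "(\<lambda>n. \<Sum>i<n. U (Suc (Suc i)) t x - U (Suc i) t x) \<longlonglongrightarrow> (\<Sum>i. U (Suc (Suc i)) t x - U (Suc i) t x)"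
      by (rule summable_LIMSEQ)
    then have "(\<lambda>n. U (Suc n) t x - U (Suc 0) t x) \<longlonglongrightarrow> (\<Sum>i. U (Suc (Suc i)) t x - U (Suc i) t x)"
      by (simp only: sum_lessThan_telescope[of "\<lambda>i. U (Suc i) t x"])
    from tendsto_add[OF this tendsto_const[of "U (Suc 0) t x"]]
    have "convergent (\<lambda>n. U (Suc n) t x)" by (auto simp: convergent_def)
    then show ?thesis using convergent_Suc_iff[of "\<lambda>n. U n t x"] by simp
  qed
  define u where "u = (\<lambda>t x. lim (\<lambda>n. U n t x))"
  have lim: "(\<lambda>n. U n t x) \<longlonglongrightarrow> u t x" if "t \<in> {0..T}" for t x
    using conv[OF that, of x] by (simp add: u_def convergent_LIMSEQ_iff)
  \<comment> \<open>The tail from \<open>n\<close> on of the geometric series with terms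
    \<open>\<eta> / 4 * (1/2) ^ k\<close>.\<close>
  define \<delta> where "\<delta> = (\<lambda>n::nat. \<eta> / 2 * (1/2) ^ n)"
  have \<delta>: "\<delta> n > 0" for n using \<eta> by (simp add: \<delta>_def)
  have \<delta>lim: "\<delta> \<longlonglongrightarrow> 0"
    unfolding \<delta>_def using tendsto_mult[OF tendsto_const LIMSEQ_power_zero[of "1/2::real"]] by force
  have close: "expL_le p (\<delta> n) (\<lambda>x. u t x - U n t x)" if t: "t \<in> {0..T}" for n t
  proof (rule expL_le_Fatou)
    fix k :: nat
    have "expL_le p (\<eta> / 2 * ((1/2) ^ n - (1/2) ^ (k + Suc n))) (\<lambda>x. U (k + Suc n) t x - U n t x)"
    proof (induction k)
      case 0
      then show ?case using step[OF t, of n] by simp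
    next
      case (Suc k)
      have "expL_le p (\<eta> / 4 * (1/2) ^ (k + Suc n) + \<eta> / 2 * ((1/2) ^ n - (1/2) ^ (k + Suc n))) (\<lambda>x. U (Suc k + Suc n) t x - U n t x)"
        using step[OF t, of "k + Suc n"] by (intro expL_le_triangle[OF _ Suc p1]) simp
      then show ?case by (simp add: algebra_simps)
    qed
    then show "expL_le p (\<delta> n) (\<lambda>x. U (k + Suc n) t x - U n t x)"
      by (rule expL_le_mono) (use \<eta> p in \<open>auto simp: \<delta>_def\<close>)
    show "(\<lambda>k. U (k + Suc n) t x - U n t x) \<longlonglongrightarrow> u t x - U n t x" for x
      by (intro tendsto_diff tendsto_const LIMSEQ_ignore_initial_segment lim t)
  qed (use p in simp)
  have small_\<delta>: "\<exists>n. \<delta> n < e" if "e > 0" for e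
    using order_tendstoD(2)[OF \<delta>lim that] by (auto simp: eventually_sequentially)
  have Xu: "X u"
    unfolding X_def
  proof (intro conjI ballI)
    fix t assume t: "t \<in> {0..T}"
    show "u t \<in> expL0 p"
    proof (rule expL0_closed[OF p1])
      fix e :: real assume "e > 0"
      then obtain n where n: "\<delta> n < e" using small_\<delta> by blast
      have "expL_le p e (\<lambda>x. u t x - U n t x)" by (rule expL_le_mono[OF close[OF t]]) (use n p in auto)
      moreover have "U n t \<in> expL0 p" using XU[of n] t by (simp add: X_def)
      ultimately show "\<exists>w\<in>expL0 p. expL_le p e (\<lambda>x. u t x - w x)" by (intro bexI[of _ "U n t"])
    qed
    show "expL_le p (\<eta> / 4) (\<lambda>x. u t x - ?S t u\<^sub>0 x)"
    proof (rule expL_le_Fatou)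
      show "expL_le p (\<eta> / 4) (\<lambda>x. U n t x - ?S t u\<^sub>0 x)" for n using XU[of n] t by (simp add: X_def)
      show "(\<lambda>n. U n t x - ?S t u\<^sub>0 x) \<longlonglongrightarrow> u t x - ?S t u\<^sub>0 x" for x
        by (intro tendsto_diff tendsto_const lim t)
    qed (use p in simp)
  next
    show "expL_continuous_on p {0..T} u"
      unfolding expL_continuous_on_def
    proof (intro ballI allI impI)
      fix t e :: real assume t: "t \<in> {0..T}" and e: "e > 0"
      then have e3: "e / 3 > 0" by simp
      then obtain n where n: "\<delta> n < e / 3" using small_\<delta> by blast
      have c: "expL_le p (e / 3) (\<lambda>x. u r x - U n r x)" if "r \<in> {0..T}" for r
        by (rule expL_le_mono[OF close[OF that]]) (use n p in auto)
      have Uc: "expL_continuous_on p {0..T} (U n)" using XU[of n] by (simp add: X_def)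
      obtain d where d: "d > 0" "\<And>r. r \<in> {0..T} \<Longrightarrow> \<bar>r - t\<bar> < d \<Longrightarrow> expL_le p (e / 3) (\<lambda>x. U n r x - U n t x)"
        using expL_continuous_onD[OF Uc t e3] by blast
      show "\<exists>d>0. \<forall>r\<in>{0..T}. \<bar>r - t\<bar> < d \<longrightarrow> expL_le p e (\<lambda>x. u r x - u t x)"
      proof (intro exI[of _ d] conjI ballI impI d(1))
        fix r assume r: "r \<in> {0..T}" "\<bar>r - t\<bar> < d"
        have "expL_le p (e / 3 + (e / 3 + e / 3)) (\<lambda>x. u r x - u t x)"
          by (rule expL_le_triangle[OF c[OF r(1)] expL_le_triangle[OF d(2)[OF r] expL_le_diff_commute[OF c[OF t]] p1] p1])
        then show "expL_le p e (\<lambda>x. u r x - u t x)" by simp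
      qed
    qed
  qed
  \<comment> \<open>The limit \<open>u\<close> and its image are both within
    \<open>\<delta> n / 2\<close> of \<open>U (Suc n)\<close>. Membership of their difference in all
    balls gives equality almost everywhere, as the integral equation demands.\<close>
  have fix_pt: "AE x in lborel. u t x = \<Phi> u t x" if t: "t \<in> {0..T}" for t
  proof -
    have "expL_le p e (\<lambda>x. u t x - \<Phi> u t x)" if e: "e > 0" for e
    proof -
      have "e / 2 > 0" using e by simp
      then obtain n where n: "\<delta> n < e / 2" using small_\<delta> by blast
      have "\<delta> (Suc n) = \<delta> n / 2" by (simp add: \<delta>_def)
      with close[OF t, of "Suc n"] have 1: "expL_le p (\<delta> n / 2) (\<lambda>x. u t x - \<Phi> (U n) t x)" by (simp add: US)
      have 2: "expL_le p (\<delta> n / 2) (\<lambda>x. \<Phi> u t x - \<Phi> (U n) t x)" by (rule contr(1)[OF Xu XU \<delta> close t])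
      have "expL_le p (\<delta> n / 2 + \<delta> n / 2) (\<lambda>x. u t x - \<Phi> u t x)"
        by (rule expL_le_triangle[OF 1 expL_le_diff_commute[OF 2] p1])
      then show ?thesis by (rule expL_le_mono) (use n \<delta>[of n] p in auto)
    qed
    then have "AE x in lborel. u t x - \<Phi> u t x = 0" by (rule expL_le_all_imp_0[OF p1])
    then show ?thesis by simp
  qed
  have "mild_solution p s f u\<^sub>0 T u"
    unfolding mild_solution_def
  proof (intro conjI ballI)
    show "continuous_into_expL0 p T u" unfolding continuous_into_expL0_eq[OF p1] using Xu by (simp add: X_def)
    fix t assume t: "t \<in> {0..T}"
    have I: "set_integrable lborel {0..t} (\<lambda>\<tau>. ?S (t - \<tau>) (\<lambda>y. f (u \<tau> y)) x)" for x
      using t LD0 by (intro duhamel_set_integrable[OF s p1 q1 \<alpha>_def \<alpha>_less X_curve'[OF Xu t]]) auto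
    from fix_pt[OF t] show "AE x in lborel. set_integrable lborel {0..t} (\<lambda>\<tau>. ?S (t - \<tau>) (\<lambda>y. f (u \<tau> y)) x) \<and>
        u t x = ?S t u\<^sub>0 x + (LINT \<tau>:{0..t}|lborel. ?S (t - \<tau>) (\<lambda>y. f (u \<tau> y)) x)"
      by eventually_elim (use I in \<open>simp add: \<Phi>_def duhamel_def\<close>)
  qed
  then show ?thesis using T(1) by blast
qed

end

section \<open>Uniqueness\<close>

lemma expL_le_AE_0:
  assumes "u \<in> borel_measurable borel" "AE x in lborel. u x = 0" "0 < p" "0 < e"
  shows "expL_le p e u"
  by (rule expL_le_cong_AE[OF expL_le_0[OF assms(3,4)] assms(1)]) (use assms(2) in auto)

text \<open>Away from time 0 a convolution does not see null sets, so the conclusion holds at every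
  \<open>x\<close>. This permits deleting the part of a time integral on which two solutions
  agree.\<close>

lemma mixed_semigroup_AE_0:
  assumes "t \<noteq> 0" "AE y in lborel. g y = 0"
  shows "mixed_semigroup s t g x = 0"
  using assms by (auto simp: mixed_semigroup_def intro!: integral_eq_zero_AE)

context lipschitz_ball
begin

text \<open>Both curves lie in the \<eta>-ball, so they differ by at most \<open>2 * \<eta>\<close>;
  inserting this into the equation for the difference halves the bound, uniformly in time, and
  iteration takes it below every \<open>e\<close>. \<open>expL_le_cong_AE\<close> transfers the
  estimate through an equation that holds almost everywhere.\<close>

lemma duhamel_local_uniqueness:
  assumes s: "0 < s" "s < 1" and \<eta>: "0 < \<eta>"
    and u: "in_ball {a..b} u" and v: "in_ball {a..b} v" and ab: "b - a \<le> 1" "L * K * (b - a) powr (1 - \<alpha>) \<le> 1 / 2"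
    and eq: "\<And>t. t \<in> {a..b} \<Longrightarrow> AE x in lborel. u t x - v t x = duhamel s a t t (\<lambda>\<tau> x. f (u \<tau> x) - f (v \<tau> x)) x"
    and t: "t \<in> {a..b}" and e: "0 < e"
  shows "expL_le p e (\<lambda>x. u t x - v t x)"
proof -
  have m: "u t \<in> borel_measurable borel" "v t \<in> borel_measurable borel" if "t \<in> {a..b}" for t
    using u v that by (auto simp: in_ball_def)
  have dm: "(\<lambda>x. u t x - v t x) \<in> borel_measurable borel" if "t \<in> {a..b}" for t
    using m[OF that] by measurable
  have "expL_le p (2 * \<eta> * (1/2) ^ n) (\<lambda>x. u t x - v t x)" if "t \<in> {a..b}" for n t
    using that
  proof (induction n arbitrary: t)
    case 0
    have "expL_le p (\<eta> + \<eta>) (\<lambda>x. u t x - v t x)"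
      using u v 0 by (intro expL_le_triangle[OF _ expL_le_diff_commute p1, where v=\<phi>]) (auto simp: in_ball_def)
    then show ?case by simp
  next
    case (Suc n)
    let ?D = "2 * \<eta> * (1/2) ^ n"
    show ?case
    proof (cases "t = a")
      case True
      have "AE x in lborel. u t x - v t x = 0" using eq[OF Suc.prems] unfolding True duhamel_same .
      then show ?thesis using \<eta> p1 by (intro expL_le_AE_0 dm Suc.prems) auto
    next
      case False
      have sub: "{a..t} \<subseteq> {a..b}" using Suc.prems by auto
      have t: "a < t" "t - a \<le> 1" using False Suc.prems ab by auto
      have D: "expL_le p ?D (\<lambda>x. u r x - v r x)" if "r \<in> {a..t}" for r using that sub by (intro Suc.IH) auto
      have D0: "?D > 0" using \<eta> by simp
      have "expL_le p (L * ?D * K * (t - a) powr (1 - \<alpha>)) (duhamel s a t t (\<lambda>\<tau> x. f (u \<tau> x) - f (v \<tau> x)))"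
        by (rule duhamel_diff_contraction(1)[OF s in_ball_subset[OF u sub] in_ball_subset[OF v sub] t D D0])
      moreover have "L * ?D * K * (t - a) powr (1 - \<alpha>) \<le> 2 * \<eta> * (1/2) ^ Suc n"
      proof -
        have "(t - a) powr (1 - \<alpha>) \<le> (b - a) powr (1 - \<alpha>)" using t Suc.prems \<alpha>_less by (intro powr_mono2) auto
        then have "L * K * (t - a) powr (1 - \<alpha>) \<le> L * K * (b - a) powr (1 - \<alpha>)" using L K_pos by (intro mult_left_mono) auto
        with ab(2) have "L * K * (t - a) powr (1 - \<alpha>) \<le> 1 / 2" by linarith
        from mult_left_mono[OF this, of ?D] D0 show ?thesis by (simp add: mult_ac)
      qed
      ultimately have "expL_le p (2 * \<eta> * (1/2) ^ Suc n) (duhamel s a t t (\<lambda>\<tau> x. f (u \<tau> x) - f (v \<tau> x)))"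
        by (rule expL_le_mono) (use p1 in simp)
      then show ?thesis
        by (rule expL_le_cong_AE[OF _ dm[OF Suc.prems]]) (use eq[OF Suc.prems] in auto)
    qed
  qed
  note bound = this[OF t]
  have "(\<lambda>n. 2 * \<eta> * (1/2) ^ n) \<longlonglongrightarrow> 2 * \<eta> * 0"
    by (intro tendsto_mult tendsto_const LIMSEQ_power_zero) simp
  then have "\<forall>\<^sub>F n in sequentially. 2 * \<eta> * (1/2) ^ n < e" using e by (intro order_tendstoD(2)) auto
  then obtain n where "2 * \<eta> * (1/2) ^ n < e" by (auto simp: eventually_sequentially)
  with bound[of n] show ?thesis using p1 by (auto intro: expL_le_mono)
qed

end

context exp_nonlinearity
begin

lemma mild_solution_unique:
  fixes u v :: "real \<Rightarrow> 'a::euclidean_space \<Rightarrow> real"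
  assumes s: "0 < s" "s < 1" and u: "mild_solution p s f u\<^sub>0 T u" and v: "mild_solution p s f u\<^sub>0 T v"
    and t1: "t\<^sub>1 \<in> {0..T}"
  shows "AE x in lborel. u t\<^sub>1 x = v t\<^sub>1 x"
proof -
  let ?S = "mixed_semigroup s"
  have p1: "1 \<le> p" using p by simp
  have u0: "u t \<in> expL0 p" and v0: "v t \<in> expL0 p" if "t \<in> {0..T}" for t
    using u v that by (auto simp: mild_solution_def continuous_into_expL0_eq[OF p1])
  have uc: "expL_continuous_on p {0..T} u" and vc: "expL_continuous_on p {0..T} v"
    using u v by (auto simp: mild_solution_def continuous_into_expL0_eq[OF p1])
  have um: "u t \<in> borel_measurable borel" and vm: "v t \<in> borel_measurable borel" if "t \<in> {0..T}" for t
    using u0[OF that] v0[OF that] by (auto intro: expL0_measurable)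
  obtain q \<eta> where \<eta>: "\<eta> > 0" and ball: "\<And>\<phi> :: 'a \<Rightarrow> real. \<phi> \<in> test_functions \<Longrightarrow> \<exists>L. lipschitz_ball p q \<eta> L f \<phi>"
    using lipschitz_ball_exists by blast
  \<comment> \<open>For elements of arbitrary size: each has its own test function within \<eta>.
    The bounds justify subtracting the two sources inside the semigroup before any common ball is
    available.\<close>
  have f_Lp: "\<exists>A. Lp_le p A (\<lambda>x. f (w x))" if w: "w \<in> expL0 p" for w :: "'a \<Rightarrow> real"
  proof -
    obtain \<phi> where \<phi>: "\<phi> \<in> test_functions" "expL_le p \<eta> (\<lambda>x. w x - \<phi> x)"
      using w \<eta> unfolding expL0_iff[OF p1] by blast
    obtain L where "lipschitz_ball p q \<eta> L f \<phi>" using ball[OF \<phi>(1)] by blast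
    then interpret lipschitz_ball p q \<eta> L f \<phi> .
    obtain D where "expL_le p D w" using expL0_exists_bound[OF p1 w] by blast
    then show ?thesis using f_Lp[OF expL0_measurable[OF w] \<phi>(2)] by blast
  qed
  define agree where "agree = (\<lambda>t. \<forall>e>0. expL_le p e (\<lambda>x. u t x - v t x))"
  have agree_AE: "AE x in lborel. u t x = v t x" if "agree t" for t
  proof -
    have "AE x in lborel. u t x - v t x = 0" by (rule expL_le_all_imp_0[OF p1]) (use that in \<open>simp add: agree_def\<close>)
    then show ?thesis by simp
  qed
  \<comment> \<open>Subtracting the two integral equations cancels the free evolution, and the
    integrand vanishes before \<open>t\<^sub>0\<close>. What remains is an equation that starts at
    \<open>t\<^sub>0\<close> with zero initial difference.\<close>
  have duh: "AE x in lborel. u t x - v t x = duhamel s t\<^sub>0 t t (\<lambda>\<tau> x. f (u \<tau> x) - f (v \<tau> x)) x"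
    if t: "t \<in> {t\<^sub>0..T}" and t0: "0 \<le> t\<^sub>0" and ag: "\<And>r. 0 \<le> r \<Longrightarrow> r < t\<^sub>0 \<Longrightarrow> agree r" for t t\<^sub>0
  proof -
    have tT: "t \<in> {0..T}" using t t0 by auto
    have pt: "indicator {0..t} \<tau> *\<^sub>R (?S (t - \<tau>) (\<lambda>y. f (u \<tau> y)) x - ?S (t - \<tau>) (\<lambda>y. f (v \<tau> y)) x) =
        indicator {t\<^sub>0..t} \<tau> *\<^sub>R ?S (t - \<tau>) (\<lambda>y. f (u \<tau> y) - f (v \<tau> y)) x" for \<tau> x
    proof (cases "\<tau> \<in> {0..t}")
      case True
      then have \<tau>: "\<tau> \<in> {0..T}" using tT by auto
      obtain A B where AB: "Lp_le p A (\<lambda>x. f (u \<tau> x))" "Lp_le p B (\<lambda>x. f (v \<tau> x))"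
        using f_Lp[OF u0[OF \<tau>]] f_Lp[OF v0[OF \<tau>]] by blast
      have diff: "?S (t - \<tau>) (\<lambda>y. f (u \<tau> y)) x - ?S (t - \<tau>) (\<lambda>y. f (v \<tau> y)) x = ?S (t - \<tau>) (\<lambda>y. f (u \<tau> y) - f (v \<tau> y)) x"
        using True by (intro mixed_semigroup_diff[OF s _ AB p1 p1, symmetric]) auto
      show ?thesis
      proof (cases "\<tau> < t\<^sub>0")
        case before: True
        have "AE y in lborel. f (u \<tau> y) - f (v \<tau> y) = 0"
          using agree_AE[OF ag[OF _ before]] True by auto
        then have "?S (t - \<tau>) (\<lambda>y. f (u \<tau> y) - f (v \<tau> y)) x = 0"
          using before t by (intro mixed_semigroup_AE_0) auto
        then show ?thesis unfolding diff by simp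
      next
        case False
        then show ?thesis using True unfolding diff by simp
      qed
    next
      case False
      then show ?thesis using t0 by auto
    qed
    have "AE x in lborel. set_integrable lborel {0..t} (\<lambda>\<tau>. ?S (t - \<tau>) (\<lambda>y. f (u \<tau> y)) x) \<and>
        u t x = ?S t u\<^sub>0 x + (LINT \<tau>:{0..t}|lborel. ?S (t - \<tau>) (\<lambda>y. f (u \<tau> y)) x)"
      using u tT by (simp add: mild_solution_def)
    moreover have "AE x in lborel. set_integrable lborel {0..t} (\<lambda>\<tau>. ?S (t - \<tau>) (\<lambda>y. f (v \<tau> y)) x) \<and>
        v t x = ?S t u\<^sub>0 x + (LINT \<tau>:{0..t}|lborel. ?S (t - \<tau>) (\<lambda>y. f (v \<tau> y)) x)"
      using v tT by (simp add: mild_solution_def)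
    ultimately show ?thesis
    proof eventually_elim
      case (elim x)
      have "u t x - v t x = (LINT \<tau>:{0..t}|lborel. ?S (t - \<tau>) (\<lambda>y. f (u \<tau> y)) x - ?S (t - \<tau>) (\<lambda>y. f (v \<tau> y)) x)"
        using elim by (simp add: set_integral_diff(2))
      then show ?case unfolding duhamel_def set_lebesgue_integral_def pt .
    qed
  qed
  have "agree t\<^sub>1"
  proof (rule ccontr)
    assume neg: "\<not> agree t\<^sub>1"
    \<comment> \<open>Agreement is required on the whole initial interval, so that all times before
      the supremum are times of agreement.\<close>
    define A where "A = {t \<in> {0..T}. \<forall>r\<in>{0..t}. agree r}"
    have T: "0 \<in> {0..T}" using t1 by auto
    have "AE x in lborel. u 0 x - v 0 x = 0" using duh[of 0 0] T unfolding duhamel_same by auto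
    then have "agree 0" unfolding agree_def using um[OF T] vm[OF T] p by (auto intro!: expL_le_AE_0)
    then have A0: "0 \<in> A" using T by (auto simp: A_def)
    have Alt: "t < t\<^sub>1" if "t \<in> A" for t
    proof (rule ccontr)
      assume "\<not> t < t\<^sub>1"
      then have "t\<^sub>1 \<in> {0..t}" using t1 by auto
      then show False using that neg by (auto simp: A_def)
    qed
    have bdd: "bdd_above A" using Alt by (intro bdd_aboveI[of _ t\<^sub>1]) (simp add: less_imp_le)
    define t\<^sub>0 where "t\<^sub>0 = Sup A"
    have t0: "0 \<le> t\<^sub>0" "t\<^sub>0 \<le> t\<^sub>1"
      unfolding t\<^sub>0_def using A0 Alt bdd by (auto intro: cSup_upper cSup_least less_imp_le)
    then have t0T: "t\<^sub>0 \<in> {0..T}" using t1 by auto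
    have before: "agree r" if r: "0 \<le> r" "r < t\<^sub>0" for r
    proof -
      obtain t where "t \<in> A" "r < t" using r(2) less_cSup_iff[OF _ bdd, of r] A0 unfolding t\<^sub>0_def by blast
      then show ?thesis using r by (auto simp: A_def)
    qed
    have ag0: "agree t\<^sub>0"
    proof (cases "t\<^sub>0 = 0")
      case False
      show ?thesis
        unfolding agree_def
      proof (intro allI impI)
        fix e :: real assume "e > 0"
        then have e3: "e / 3 > 0" by simp
        obtain d where d: "d > 0" "\<And>r. r \<in> {0..T} \<Longrightarrow> \<bar>r - t\<^sub>0\<bar> < d \<Longrightarrow> expL_le p (e / 3) (\<lambda>x. u r x - u t\<^sub>0 x)"
          using expL_continuous_onD[OF uc t0T e3] by blast
        obtain d' where d': "d' > 0" "\<And>r. r \<in> {0..T} \<Longrightarrow> \<bar>r - t\<^sub>0\<bar> < d' \<Longrightarrow> expL_le p (e / 3) (\<lambda>x. v r x - v t\<^sub>0 x)"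
          using expL_continuous_onD[OF vc t0T e3] by blast
        \<comment> \<open>A time strictly before \<open>t\<^sub>0\<close> within both moduli of
          continuity; \<open>max 0\<close> keeps it admissible, and it is strictly smaller because
          \<open>t\<^sub>0\<close> is nonzero here.\<close>
        define r where "r = max 0 (t\<^sub>0 - min d d' / 2)"
        have r: "0 \<le> r" "r < t\<^sub>0" "r \<in> {0..T}" "\<bar>r - t\<^sub>0\<bar> < d" "\<bar>r - t\<^sub>0\<bar> < d'"
          using d(1) d'(1) t0 False t0T by (auto simp: r_def max_def)
        have "expL_le p (e / 3) (\<lambda>x. u r x - v r x)" using before[OF r(1,2)] e3 by (simp add: agree_def)
        then have "expL_le p (e / 3 + (e / 3 + e / 3)) (\<lambda>x. u t\<^sub>0 x - v t\<^sub>0 x)"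
          by (rule expL_le_triangle[OF expL_le_diff_commute[OF d(2)[OF r(3,4)]] expL_le_triangle[OF _ d'(2)[OF r(3,5)] p1] p1])
        then show "expL_le p e (\<lambda>x. u t\<^sub>0 x - v t\<^sub>0 x)" by simp
      qed
    qed (use \<open>agree 0\<close> in simp)
    have lt: "t\<^sub>0 < t\<^sub>1" using t0(2) neg ag0 by (cases "t\<^sub>0 = t\<^sub>1") auto
    \<comment> \<open>Quarters leave room for \<open>v\<close>, which reaches \<open>\<phi>\<close>
      in three steps: to its value at \<open>t\<^sub>0\<close>, across to \<open>u\<close> there,
      and on to \<open>\<phi>\<close>.\<close>
    have \<eta>4: "\<eta> / 4 > 0" using \<eta> by simp
    obtain \<phi> where \<phi>: "\<phi> \<in> test_functions" "expL_le p (\<eta> / 4) (\<lambda>x. u t\<^sub>0 x - \<phi> x)"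
      using u0[OF t0T] \<eta>4 unfolding expL0_iff[OF p1] by blast
    obtain L where "lipschitz_ball p q \<eta> L f \<phi>" using ball[OF \<phi>(1)] by blast
    then interpret lipschitz_ball p q \<eta> L f \<phi> .
    obtain d where d: "d > 0" "\<And>r. r \<in> {0..T} \<Longrightarrow> \<bar>r - t\<^sub>0\<bar> < d \<Longrightarrow> expL_le p (\<eta> / 4) (\<lambda>x. u r x - u t\<^sub>0 x)"
      using expL_continuous_onD[OF uc t0T \<eta>4] by blast
    obtain d' where d': "d' > 0" "\<And>r. r \<in> {0..T} \<Longrightarrow> \<bar>r - t\<^sub>0\<bar> < d' \<Longrightarrow> expL_le p (\<eta> / 4) (\<lambda>x. v r x - v t\<^sub>0 x)"
      using expL_continuous_onD[OF vc t0T \<eta>4] by blast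
    have LK: "0 < 1 / (2 * (L * K))" using L K_pos by simp
    obtain h0 where h0: "0 < h0" "h0 \<le> 1" "\<And>t. 0 \<le> t \<Longrightarrow> t \<le> h0 \<Longrightarrow> t powr (1 - \<alpha>) \<le> 1 / (2 * (L * K))"
      using short_time_exists[OF LK] by blast
    \<comment> \<open>The entry \<open>t\<^sub>1 - t\<^sub>0\<close> keeps the interval inside
      \<open>{0..T}\<close>; halving the moduli makes the inequalities strict.\<close>
    define h where "h = min h0 (min (min d d' / 2) (t\<^sub>1 - t\<^sub>0))"
    have h: "0 < h" "h \<le> h0" "h < d" "h < d'" "t\<^sub>0 + h \<le> T"
      using h0 d(1) d'(1) lt t1 by (auto simp: h_def min_def)
    have sub: "{t\<^sub>0..t\<^sub>0 + h} \<subseteq> {0..T}" using t0 h by auto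
    have vu0: "expL_le p (\<eta> / 4) (\<lambda>x. v t\<^sub>0 x - u t\<^sub>0 x)"
      using ag0 \<eta>4 by (intro expL_le_diff_commute[of p "\<eta> / 4" "u t\<^sub>0"]) (simp add: agree_def)
    have bu: "in_ball {t\<^sub>0..t\<^sub>0 + h} u"
      unfolding in_ball_def
    proof (intro conjI ballI)
      fix t assume t: "t \<in> {t\<^sub>0..t\<^sub>0 + h}"
      then have tT: "t \<in> {0..T}" "\<bar>t - t\<^sub>0\<bar> < d" using sub h by auto
      show "u t \<in> borel_measurable borel" by (rule um[OF tT(1)])
      have "expL_le p (\<eta> / 4 + \<eta> / 4) (\<lambda>x. u t x - \<phi> x)" by (rule expL_le_triangle[OF d(2)[OF tT] \<phi>(2) p1])
      then show "expL_le p \<eta> (\<lambda>x. u t x - \<phi> x)" by (rule expL_le_mono) (use \<eta> p in auto)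
    qed (rule expL_continuous_on_subset[OF uc sub])
    have bv: "in_ball {t\<^sub>0..t\<^sub>0 + h} v"
      unfolding in_ball_def
    proof (intro conjI ballI)
      fix t assume t: "t \<in> {t\<^sub>0..t\<^sub>0 + h}"
      then have tT: "t \<in> {0..T}" "\<bar>t - t\<^sub>0\<bar> < d'" using sub h by auto
      show "v t \<in> borel_measurable borel" by (rule vm[OF tT(1)])
      have "expL_le p (\<eta> / 4 + (\<eta> / 4 + \<eta> / 4)) (\<lambda>x. v t x - \<phi> x)"
        by (rule expL_le_triangle[OF d'(2)[OF tT] expL_le_triangle[OF vu0 \<phi>(2) p1] p1])
      then show "expL_le p \<eta> (\<lambda>x. v t x - \<phi> x)" by (rule expL_le_mono) (use \<eta> p in auto)
    qed (rule expL_continuous_on_subset[OF vc sub])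
    have LKh: "L * K * (t\<^sub>0 + h - t\<^sub>0) powr (1 - \<alpha>) \<le> 1 / 2"
    proof -
      have "L * K * h powr (1 - \<alpha>) \<le> L * K * (1 / (2 * (L * K)))"
        using L K_pos h by (intro mult_left_mono h0(3)) auto
      then show ?thesis using L K_pos by simp
    qed
    have after: "agree t" if t: "t \<in> {t\<^sub>0..t\<^sub>0 + h}" for t
      unfolding agree_def
    proof (intro allI impI)
      fix e :: real assume e: "e > 0"
      show "expL_le p e (\<lambda>x. u t x - v t x)"
      proof (rule duhamel_local_uniqueness[OF s \<eta> bu bv _ LKh _ t e])
        show "t\<^sub>0 + h - t\<^sub>0 \<le> 1" using h h0 by simp
        fix r assume "r \<in> {t\<^sub>0..t\<^sub>0 + h}"
        then show "AE x in lborel. u r x - v r x = duhamel s t\<^sub>0 r r (\<lambda>\<tau> x. f (u \<tau> x) - f (v \<tau> x)) x"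
          using h t0 before by (intro duh) auto
      qed
    qed
    \<comment> \<open>Agreement before \<open>t\<^sub>0\<close> and on the new interval puts
      \<open>t\<^sub>0 + h\<close> into \<open>A\<close>, above its supremum.\<close>
    have "agree r" if "r \<in> {0..t\<^sub>0 + h}" for r
      using before[of r] after[of r] that by (cases "r < t\<^sub>0") auto
    then have "t\<^sub>0 + h \<in> A" using t0 h by (auto simp: A_def)
    then have "t\<^sub>0 + h \<le> t\<^sub>0" unfolding t\<^sub>0_def using bdd by (rule cSup_upper)
    then show False using h by simp
  qed
  then show ?thesis by (rule agree_AE)
qed

end

theorem theorem1p3:
  fixes p s C lam :: real
    and f :: "real \<Rightarrow> real"
    and u\<^sub>0 :: "'a::euclidean_space \<Rightarrow> real"
  assumes "p > 1"
    and "0 < s" and "s < 1"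
    and "f 0 = 0"
    and "C > 0" and "lam > 0"
    and "\<And>a b. \<bar>f a - f b\<bar> \<le>
           C * \<bar>a - b\<bar> * (exp (lam * \<bar>a\<bar> powr p) + exp (lam * \<bar>b\<bar> powr p))"
    and "u\<^sub>0 \<in> expL0 p"
  shows "\<exists>T>0. (\<exists>u. mild_solution p s f u\<^sub>0 T u) \<and>
           (\<forall>u v. mild_solution p s f u\<^sub>0 T u \<and> mild_solution p s f u\<^sub>0 T v \<longrightarrow>
              (\<forall>t\<in>{0..T}. AE x in lborel. u t x = v t x))"
proof -
  interpret exp_nonlinearity p C lam f
    by unfold_locales (use assms in auto)
  have p1: "1 \<le> p" using assms(1) by simp
  obtain q \<eta> where \<eta>: "\<eta> > 0" and ball: "\<And>\<phi> :: 'a \<Rightarrow> real. \<phi> \<in> test_functions \<Longrightarrow> \<exists>L. lipschitz_ball p q \<eta> L f \<phi>"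
    using lipschitz_ball_exists by blast
  then have "\<eta> / 2 > 0" by simp
  then obtain \<phi> where \<phi>: "\<phi> \<in> test_functions" "expL_le p (\<eta> / 2) (\<lambda>x. u\<^sub>0 x - \<phi> x)"
    using assms(8) unfolding expL0_iff[OF p1] by blast
  obtain L where L: "lipschitz_ball p q \<eta> L f \<phi>" using ball[OF \<phi>(1)] by blast
  obtain T where T: "T > 0" "\<exists>u. mild_solution p s f u\<^sub>0 T u"
    using lipschitz_ball.mild_solution_exists[OF L assms(2,3,1) \<eta> assms(8) \<phi>(2)] by blast
  show ?thesis
    by (intro exI[of _ T] conjI T allI impI ballI)
      (blast intro: mild_solution_unique[OF assms(2,3)])
qed

end
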